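(* Let $\gamma>0$, $\Omega=(-1,1)\times(0,1)$ and $\omega=(a,b)\times(0,1)$ with $0<a<b<1$. Consider the system $$\partial_t g-\partial_x^2 g-|x|^{2\gamma}\partial_y^2 g=0\ \text{in }(0,T)\times\Omega,\qquad g=0\ \text{on }(0,T)\times\partial\Omega,\qquad g(0,\cdot)=g_0\in L^2(\Omega).$$ Then: (1) if $\gamma\in(0,1)$, the system is observable in $\omega$ in any time $T>0$; (2) if $\gamma=1$, there exists $T^*>0$ such that the system is observable in $\omega$ in time $T$ for every $T>T^*$ and is not observable in $\omega$ in time $T$ for every $T<T^*$; (3) if $\gamma>1$, the system is not observable in $\omega$ in any time $T>0$.
   Context: Let $H=L^2(\Omega)$, $V$ the completion of $C_c^\infty(\Omega)$ for the norm $\big(\int_\Omega (f_x^2+|x|^{2\gamma}f_y^2)\big)^{1/2}$, and $A$ the self-adjoint operator on $H$ associated with the form $a(f,g)=-\int_\Omega(f_xg_x+|x|^{2\gamma}f_yg_y)$ on $V$ (so $Af=\partial_x^2f+|x|^{2\gamma}\partial_y^2f$); $A$ generates an analytic contraction semigroup $S(t)$, and the solution of the system is $g(t)=S(t)g_0$. The system is observable in $\omega$ in time $T$ if there exists $C>0$ such that for every $g_0\in L^2(\Omega)$ the solution satisfies $\int_\Omega|g(T,x,y)|^2dxdy\le C\int_0^T\int_\omega|g(t,x,y)|^2dxdydt$. *)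

theory Defs
  imports "HOL-Analysis.Analysis"
begin

definition Omega :: "(real \<times> real) set" where
  "Omega = {-1<..<1} \<times> {0<..<1}"

definition omega :: "real \<Rightarrow> real \<Rightarrow> (real \<times> real) set" where
  "omega a b = {a<..<b} \<times> {0<..<1}"

definition pdx :: "(real \<times> real \<Rightarrow> real) \<Rightarrow> real \<times> real \<Rightarrow> real" where
  "pdx f = (\<lambda>(x,y). deriv (\<lambda>s. f (s, y)) x)"

definition pdy :: "(real \<times> real \<Rightarrow> real) \<Rightarrow> real \<times> real \<Rightarrow> real" where
  "pdy f = (\<lambda>(x,y). deriv (\<lambda>s. f (x, s)) y)"

fun Ck :: "nat \<Rightarrow> (real \<times> real \<Rightarrow> real) \<Rightarrow> bool" where
  "Ck 0 f = continuous_on UNIV f"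
| "Ck (Suc n) f = (continuous_on UNIV f \<and>
     (\<forall>x y. (\<lambda>s. f (s, y)) differentiable (at x)) \<and>
     (\<forall>x y. (\<lambda>s. f (x, s)) differentiable (at y)) \<and>
     Ck n (pdx f) \<and> Ck n (pdy f))"

definition smooth2 :: "(real \<times> real \<Rightarrow> real) \<Rightarrow> bool" where
  "smooth2 f = (\<forall>n. Ck n f)"

definition test_fun :: "(real \<times> real \<Rightarrow> real) \<Rightarrow> bool" where
  "test_fun f = (smooth2 f \<and> (\<exists>K. compact K \<and> K \<subseteq> Omega \<and> (\<forall>z. z \<notin> K \<longrightarrow> f z = 0)))"

definition L2 :: "(real \<times> real \<Rightarrow> real) \<Rightarrow> bool" where
  "L2 f = ((\<lambda>z. indicator Omega z * f z) \<in> borel_measurable lborel \<and>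
           integrable lborel (\<lambda>z. indicator Omega z * (f z)\<^sup>2))"

definition L2inner :: "(real \<times> real \<Rightarrow> real) \<Rightarrow> (real \<times> real \<Rightarrow> real) \<Rightarrow> real" where
  "L2inner f g = (LINT z:Omega|lborel. f z * g z)"

definition L2dist2 :: "(real \<times> real \<Rightarrow> real) \<Rightarrow> (real \<times> real \<Rightarrow> real) \<Rightarrow> real" where
  "L2dist2 f g = (LINT z:Omega|lborel. (f z - g z)\<^sup>2)"

text \<open>The Grushin form on smooth functions, with the sign convention of the paper
  (a(f,g) = - int (f_x g_x + |x|^(2 gamma) f_y g_y)), and the associated squared norm.\<close>
definition aform :: "real \<Rightarrow> (real \<times> real \<Rightarrow> real) \<Rightarrow> (real \<times> real \<Rightarrow> real) \<Rightarrow> real" where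
  "aform \<gamma> f g = - (LINT z:Omega|lborel.
      pdx f z * pdx g z + \<bar>fst z\<bar> powr (2 * \<gamma>) * pdy f z * pdy g z)"

definition Vnorm2 :: "real \<Rightarrow> (real \<times> real \<Rightarrow> real) \<Rightarrow> real" where
  "Vnorm2 \<gamma> f = (LINT z:Omega|lborel. (pdx f z)\<^sup>2 + \<bar>fst z\<bar> powr (2 * \<gamma>) * (pdy f z)\<^sup>2)"

text \<open>A sequence of test functions approximating f: Cauchy for the V-norm and
  converging to f in L^2(Omega). V (the completion of C_c^infinity(Omega) for the V-norm)
  is realised inside L^2(Omega) as the set of such limits.\<close>
definition approx_seq :: "real \<Rightarrow> (nat \<Rightarrow> real \<times> real \<Rightarrow> real) \<Rightarrow> (real \<times> real \<Rightarrow> real) \<Rightarrow> bool" where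
  "approx_seq \<gamma> \<phi> f = ((\<forall>k. test_fun (\<phi> k)) \<and>
     (\<forall>e>0. \<exists>N. \<forall>m\<ge>N. \<forall>n\<ge>N. Vnorm2 \<gamma> (\<lambda>z. \<phi> m z - \<phi> n z) < e) \<and>
     (\<lambda>k. L2dist2 (\<phi> k) f) \<longlonglongrightarrow> 0)"

definition Vspace :: "real \<Rightarrow> (real \<times> real \<Rightarrow> real) set" where
  "Vspace \<gamma> = {f. L2 f \<and> (\<exists>\<phi>. approx_seq \<gamma> \<phi> f)}"

definition aV :: "real \<Rightarrow> (real \<times> real \<Rightarrow> real) \<Rightarrow> (real \<times> real \<Rightarrow> real) \<Rightarrow> real" where
  "aV \<gamma> f g = (THE c. \<forall>\<phi> \<psi>. approx_seq \<gamma> \<phi> f \<longrightarrow> approx_seq \<gamma> \<psi> g \<longrightarrow>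
                   (\<lambda>k. aform \<gamma> (\<phi> k) (\<psi> k)) \<longlonglongrightarrow> c)"

definition A_op :: "real \<Rightarrow> (real \<times> real \<Rightarrow> real) \<Rightarrow> (real \<times> real \<Rightarrow> real) \<Rightarrow> bool" where
  "A_op \<gamma> f h = (f \<in> Vspace \<gamma> \<and> L2 h \<and> (\<forall>v\<in>Vspace \<gamma>. aV \<gamma> f v = L2inner h v))"

text \<open>g(t) = S(t) g0: the (unique) trajectory which is continuous in L^2 on [0,oo),
  starts at g0, lies in D(A) for t > 0 and is differentiable in L^2 there with g' = A g.\<close>
definition is_solution :: "real \<Rightarrow> (real \<times> real \<Rightarrow> real) \<Rightarrow> (real \<Rightarrow> real \<times> real \<Rightarrow> real) \<Rightarrow> bool" where
  "is_solution \<gamma> g0 g = ((\<forall>t\<ge>0. L2 (g t)) \<and> L2dist2 (g 0) g0 = 0 \<and>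
     (\<forall>t\<ge>0. ((\<lambda>s. L2dist2 (g s) (g t)) \<longlongrightarrow> 0) (at t within {0..})) \<and>
     (\<forall>t>0. \<exists>h. A_op \<gamma> (g t) h \<and>
        ((\<lambda>s. L2dist2 (\<lambda>z. (g s z - g t z) / (s - t)) h) \<longlongrightarrow> 0) (at t within {0<..})))"

definition observable :: "real \<Rightarrow> real \<Rightarrow> real \<Rightarrow> real \<Rightarrow> bool" where
  "observable \<gamma> a b T = (\<exists>C>0. \<forall>g0 g. L2 g0 \<longrightarrow> is_solution \<gamma> g0 g \<longrightarrow>
      (LINT z:Omega|lborel. (g T z)\<^sup>2) \<le>
        C * (LINT t:{0..T}|lborel. (LINT z:omega a b|lborel. (g t z)\<^sup>2)))"

end

theory Submission
  imports Defs "HOL-Complex_Analysis.Cauchy_Integral_Formula"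
begin

text \<open>Expanding in the sines $\sqrt 2 \sin(n\pi y)$ reduces the system to the one-dimensional equations
  $u_t = u_{xx} - N^2 |x|^{2\gamma} u$ with $N = n\pi$.

  Non-observability for $\gamma \ge 1$: the ground state of $-\partial_x^2 + N^2|x|^{2\gamma}$, obtained by shooting,
  has eigenvalue $O(N^{2/(1+\gamma)})$, while on $(a,b)$ it is exponentially small in $N$.

  Observability for $\gamma \le 1$: let $\psi$ be a Gevrey cutoff in time and
  $F_m(p) = \int_0^T \psi^{(m)}(t) \langle u(t), p\rangle dt$. Integration by parts gives
  $F_m(p'' - N^2|x|^{2\gamma}p) = - F_{m+1}(p)$. Solving $Q_{m+1}'' = N^2|x|^{2\gamma} Q_{m+1} + Q_m$, $Q_0 = \theta$, from an
  endpoint and cutting off inside $(a,b)$ expresses $F_0(\theta)$ by the values of $u$ on $(a,b)$ alone, at the cost $e^{CN}$: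
  the factor $1/(2m)!$ gained in $Q_m$ beats the growth of $\psi^{(m)}$. Since the semigroup is symmetric,
  $\langle u(t), u(T)\rangle = \|u((t+T)/2)\|^2 \ge \|u(T)\|^2$, so $\theta = u(T)$ bounds $\|u(T)\|$. The cost $e^{CN}$ is
  absorbed by the dissipation rate $c N^{2/(1+\gamma)}$, in any positive time if $\gamma < 1$ and in large time if $\gamma = 1$.\<close>


section \<open>Square-integrable functions\<close>

text \<open>Gevrey order 2 is borderline for the flatness argument. Derivatives of e^(-M/t) grow
  like (m!)^2, that is (2m)!/4^m up to a polynomial factor, and the chain \<open>Q\<close> gains
  4^m/(2m)! because the interval has length 2. The factorials cancel, so the Gevrey ratio alone
  decides convergence. M = 288 makes it 1/32 whatever T is: a short T only lowers the mean of the
  cutoff and leaves the exponent of the cost e^(CN) unchanged. This is why every T > 0 is reached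
  when gamma < 1. A chain started at one endpoint does not vanish at the other. So theta is split as
  zeta theta + (1 - zeta) theta, and each piece uses the chain started at the endpoint where its
  cutoff equals 1. The mode of u(T) is known only in L^2, so modes of test functions converging to
  u(T) take the place of theta, and the limit is taken after the estimate. For gamma = 1 the
  threshold is the infimum of the observable times. Contraction in L^2 makes these times upward
  closed; the two estimates keep the infimum positive and finite.\<close>

definition sqi :: "'a measure \<Rightarrow> ('a \<Rightarrow> real) \<Rightarrow> bool" where
  "sqi M f \<longleftrightarrow> f \<in> borel_measurable M \<and> integrable M (\<lambda>x. (f x)\<^sup>2)"

lemma sqi_measurable[measurable_dest]: "sqi M f \<Longrightarrow> f \<in> borel_measurable M"
  by (simp add: sqi_def)

lemma sqi_integrable_sq: "sqi M f \<Longrightarrow> integrable M (\<lambda>x. (f x)\<^sup>2)"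
  by (simp add: sqi_def)

lemma sqi_integrable_mult:
  assumes "sqi M f" "sqi M g" shows "integrable M (\<lambda>x. f x * g x)"
proof (rule Bochner_Integration.integrable_bound)
  show "integrable M (\<lambda>x. (f x)\<^sup>2 + (g x)\<^sup>2)" using assms by (auto simp: sqi_def)
  show "(\<lambda>x. f x * g x) \<in> borel_measurable M" using assms by (auto simp: sqi_def)
  have "\<bar>a * b\<bar> \<le> \<bar>a\<^sup>2 + b\<^sup>2\<bar>" for a b :: real
  proof -
    have "0 \<le> (\<bar>a\<bar> - \<bar>b\<bar>)\<^sup>2" by simp
    then have "2 * (\<bar>a\<bar> * \<bar>b\<bar>) \<le> a\<^sup>2 + b\<^sup>2" by (simp add: power2_diff)
    moreover have "0 \<le> \<bar>a\<bar> * \<bar>b\<bar>" by simp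
    ultimately have "\<bar>a\<bar> * \<bar>b\<bar> \<le> a\<^sup>2 + b\<^sup>2" by linarith
    then show ?thesis by (simp add: abs_mult)
  qed
  then show "AE x in M. norm (f x * g x) \<le> norm ((f x)\<^sup>2 + (g x)\<^sup>2)" by auto
qed

lemma sqi_cmult: "sqi M f \<Longrightarrow> sqi M (\<lambda>x. c * f x)"
  by (auto simp: sqi_def power_mult_distrib)

lemma sqi_add: assumes "sqi M f" "sqi M g" shows "sqi M (\<lambda>x. f x + g x)"
  using assms sqi_integrable_mult[OF assms]
  by (auto simp: sqi_def power2_sum mult.assoc)

lemma sqi_diff: assumes "sqi M f" "sqi M g" shows "sqi M (\<lambda>x. f x - g x)"
  using sqi_add[OF assms(1) sqi_cmult[OF assms(2), of "-1"]] by simp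

lemma sqi_sum: "finite I \<Longrightarrow> (\<And>i. i \<in> I \<Longrightarrow> sqi M (f i)) \<Longrightarrow> sqi M (\<lambda>x. \<Sum>i\<in>I. f i x)"
proof (induction I rule: finite_induct)
  case empty then show ?case by (simp add: sqi_def)
next
  case (insert i I) then show ?case using sqi_add[of M "f i" "\<lambda>x. \<Sum>i\<in>I. f i x"] by simp
qed

lemma sqi_integrable: assumes "finite_measure M" "sqi M f" shows "integrable M f"
proof -
  interpret finite_measure M by fact
  have "sqi M (\<lambda>x. 1::real)" by (simp add: sqi_def)
  from sqi_integrable_mult[OF assms(2) this] show ?thesis by simp
qed

lemma sqi_bounded:
  assumes "finite_measure M" "f \<in> borel_measurable M" "\<And>x. x \<in> space M \<Longrightarrow> \<bar>f x\<bar> \<le> (B::real)"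
  shows "sqi M f"
proof -
  interpret finite_measure M by fact
  have "integrable M (\<lambda>x. (f x)\<^sup>2)"
  proof (rule integrable_const_bound)
    show "AE x in M. norm ((f x)\<^sup>2) \<le> B\<^sup>2"
    proof (rule AE_I2)
      fix x assume "x \<in> space M" from assms(3)[OF this] show "norm ((f x)\<^sup>2) \<le> B\<^sup>2"
        by (metis abs_ge_zero norm_power power_mono real_norm_def)
    qed
  qed (use assms in auto)
  then show ?thesis using assms by (simp add: sqi_def)
qed

text \<open>Cauchy-Schwarz for a semidefinite form, read off from its quadratic. It serves the L^2
  product, the Grushin form and the abstract forms \<open>bbil\<close>; none of them is assumed
  definite, so \<open>C = 0\<close> is a genuine case.\<close>

lemma nonneg_quadratic_discriminant:
  fixes A B C :: real
  assumes "\<And>t. 0 \<le> A + 2 * t * B + t\<^sup>2 * C" shows "\<bar>B\<bar> \<le> sqrt A * sqrt C"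
proof -
  have A: "0 \<le> A" using assms[of 0] by simp
  have C: "0 \<le> C"
  proof (rule ccontr)
    assume "\<not> 0 \<le> C"
    then have n: "C < 0" by simp
    \<comment> \<open>With this t one has t^2 C = -(A+1); adding the hypothesis at t and at -t
      removes B and leaves 0 <= -2.\<close>
    define t where "t = sqrt ((A + 1) / (- C))"
    have "0 \<le> (A + 1) / (- C)" using n A by (intro divide_nonneg_pos) auto
    then have "t\<^sup>2 = (A + 1) / (- C)" by (simp add: t_def)
    then have "t\<^sup>2 * C = - (A + 1)" using n by (simp add: field_simps)
    then show False using assms[of t] assms[of "- t"] by simp
  qed
  have "B\<^sup>2 \<le> A * C"
  proof (cases "C = 0")
    case True
    have "B = 0"
    proof (rule ccontr)
      assume "B \<noteq> 0"
      then show False using assms[of "-(A+1)/(2*B)"] True by (simp add: field_simps)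
    qed
    then show ?thesis using True by simp
  next
    case False
    then have "C > 0" using C by simp
    have "0 \<le> A + 2 * (- B / C) * B + (- B / C)\<^sup>2 * C" by (rule assms)
    also have "\<dots> = A - B\<^sup>2 / C" using \<open>C > 0\<close> by (simp add: field_simps power2_eq_square)
    finally show ?thesis using \<open>C > 0\<close> by (simp add: field_simps)
  qed
  then have "sqrt (B\<^sup>2) \<le> sqrt (A * C)" by (rule real_sqrt_le_mono)
  then show ?thesis by (simp add: real_sqrt_mult)
qed

definition n2 :: "'a measure \<Rightarrow> ('a \<Rightarrow> real) \<Rightarrow> real" where
  "n2 M f = sqrt (\<integral>x. (f x)\<^sup>2 \<partial>M)"

lemma n2_nonneg[simp]: "0 \<le> n2 M f" by (simp add: n2_def)

lemma n2_sq: "(n2 M f)\<^sup>2 = (\<integral>x. (f x)\<^sup>2 \<partial>M)" by (simp add: n2_def)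

lemma integral_sq_expand:
  assumes "sqi M f" "sqi M g"
  shows "(\<integral>x. (f x + t * g x)\<^sup>2 \<partial>M) = (\<integral>x. (f x)\<^sup>2 \<partial>M) + 2 * t * (\<integral>x. f x * g x \<partial>M) + t\<^sup>2 * (\<integral>x. (g x)\<^sup>2 \<partial>M)"
proof -
  have "(\<integral>x. (f x + t * g x)\<^sup>2 \<partial>M) = (\<integral>x. (f x)\<^sup>2 + 2 * t * (f x * g x) + t\<^sup>2 * (g x)\<^sup>2 \<partial>M)"
    by (intro Bochner_Integration.integral_cong refl) (simp add: power2_sum power_mult_distrib algebra_simps)
  then show ?thesis
    using sqi_integrable_sq[OF assms(1)] sqi_integrable_sq[OF assms(2)] sqi_integrable_mult[OF assms] by simp
qed

lemma cauchy_schwarz_integral: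
  assumes "sqi M f" "sqi M g" shows "\<bar>\<integral>x. f x * g x \<partial>M\<bar> \<le> n2 M f * n2 M g"
  unfolding n2_def
proof (rule nonneg_quadratic_discriminant)
  fix t show "0 \<le> (\<integral>x. (f x)\<^sup>2 \<partial>M) + 2 * t * (\<integral>x. f x * g x \<partial>M) + t\<^sup>2 * (\<integral>x. (g x)\<^sup>2 \<partial>M)"
    unfolding integral_sq_expand[OF assms, symmetric] by simp
qed

lemma n2_triangle:
  assumes "sqi M f" "sqi M g" shows "n2 M (\<lambda>x. f x + g x) \<le> n2 M f + n2 M g"
proof (rule power2_le_imp_le)
  have "(n2 M (\<lambda>x. f x + g x))\<^sup>2 = (n2 M f)\<^sup>2 + 2 * (\<integral>x. f x * g x \<partial>M) + (n2 M g)\<^sup>2"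
    using integral_sq_expand[OF assms, of 1] by (simp add: n2_sq)
  also have "\<dots> \<le> (n2 M f)\<^sup>2 + 2 * (n2 M f * n2 M g) + (n2 M g)\<^sup>2"
    using cauchy_schwarz_integral[OF assms] by simp
  also have "\<dots> = (n2 M f + n2 M g)\<^sup>2" by (simp add: power2_sum)
  finally show "(n2 M (\<lambda>x. f x + g x))\<^sup>2 \<le> (n2 M f + n2 M g)\<^sup>2" .
qed simp

lemma n2_cmult: "n2 M (\<lambda>x. c * f x) = \<bar>c\<bar> * n2 M f"
  by (simp add: n2_def power_mult_distrib real_sqrt_mult)

section \<open>Lebesgue measure on the two intervals and on the rectangle\<close>

definition MX :: "real measure" where "MX = restrict_space lborel {-1<..<1}"
definition MY :: "real measure" where "MY = restrict_space lborel {0<..<1}"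
definition MO :: "(real \<times> real) measure" where "MO = restrict_space lborel Omega"

lemma space_MX[simp]: "space MX = {-1<..<1}" and space_MY[simp]: "space MY = {0<..<1}"
  and space_MO[simp]: "space MO = Omega"
  by (auto simp: MX_def MY_def MO_def space_restrict_space)

lemma finite_MX: "finite_measure MX"
  by (rule finite_measureI) (simp add: MX_def emeasure_restrict_space)

lemma finite_MY: "finite_measure MY"
  by (rule finite_measureI) (simp add: MY_def emeasure_restrict_space)

interpretation MX: finite_measure MX by (rule finite_MX)
interpretation MY: finite_measure MY by (rule finite_MY)
interpretation MXY: pair_sigma_finite MX MY ..

lemma Omega_borel[measurable, simp]: "Omega \<in> sets borel"
  unfolding Omega_def by (intro borel_open open_Times) auto

lemma id_measurable_MX[measurable]: "(\<lambda>x. x) \<in> measurable MX borel"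
  and id_measurable_MY[measurable]: "(\<lambda>x. x) \<in> measurable MY borel"
  by (auto simp: MX_def MY_def intro!: measurable_restrict_space1)

text \<open>Makes Fubini available on the rectangle. The sigma-algebras agree because the identity
  is measurable in both directions.\<close>

lemma MO_eq_pair: "MX \<Otimes>\<^sub>M MY = MO"
proof (rule pair_measure_eqI)
  have f: "fst \<in> measurable MO MX" unfolding MX_def MO_def
    by (rule measurable_restrict_space3) (auto simp: Omega_def borel_prod[symmetric])
  have s: "snd \<in> measurable MO MY" unfolding MY_def MO_def
    by (rule measurable_restrict_space3) (auto simp: Omega_def borel_prod[symmetric])
  have 1: "(\<lambda>z. (fst z, snd z)) \<in> measurable MO (MX \<Otimes>\<^sub>M MY)" by (intro measurable_Pair f s)
  have "(\<lambda>z. (fst z, snd z)) \<in> measurable (MX \<Otimes>\<^sub>M MY) (borel \<Otimes>\<^sub>M borel)" by measurable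
  then have 2: "(\<lambda>z. z) \<in> measurable (MX \<Otimes>\<^sub>M MY) borel" by (simp add: borel_prod)
  show "sets (MX \<Otimes>\<^sub>M MY) = sets MO"
  proof (intro set_eqI iffI)
    fix E assume E: "E \<in> sets (MX \<Otimes>\<^sub>M MY)"
    have "E \<subseteq> Omega" using sets.sets_into_space[OF E] by (auto simp: space_pair_measure Omega_def)
    then show "E \<in> sets MO" using measurable_sets[OF 1 E] by (auto simp: Int_absorb1 Int_absorb2)
  next
    fix E assume E: "E \<in> sets MO"
    then have "E \<in> sets borel" "E \<subseteq> Omega" by (auto simp: MO_def sets_restrict_space)
    then show "E \<in> sets (MX \<Otimes>\<^sub>M MY)" using measurable_sets[OF 2, of E]
      by (auto simp: space_pair_measure Omega_def Int_absorb2)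
  qed
next
  fix A B assume A: "A \<in> sets MX" and B: "B \<in> sets MY"
  have a: "A \<in> sets borel" "A \<subseteq> {-1<..<1}" using A by (auto simp: MX_def sets_restrict_space)
  have b: "B \<in> sets borel" "B \<subseteq> {0<..<1}" using B by (auto simp: MY_def sets_restrict_space)
  have "emeasure MO (A \<times> B) = emeasure lborel (A \<times> B)" unfolding MO_def
    by (rule emeasure_restrict_space) (use a b in \<open>auto simp: Omega_def[symmetric]\<close>, auto simp: Omega_def)
  also have "\<dots> = emeasure (lborel \<Otimes>\<^sub>M lborel) (A \<times> B)" by (simp add: lborel_prod)
  also have "\<dots> = emeasure lborel A * emeasure lborel B"
    by (rule lborel.emeasure_pair_measure_Times) (use a b in auto)
  also have "emeasure lborel A = emeasure MX A" unfolding MX_def using a by (simp add: emeasure_restrict_space)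
  also have "emeasure lborel B = emeasure MY B" unfolding MY_def using b by (simp add: emeasure_restrict_space)
  finally show "emeasure MX A * emeasure MY B = emeasure MO (A \<times> B)" by simp
qed unfold_locales

lemma finite_MO: "finite_measure MO"
proof (rule finite_measureI)
  have "Omega \<subseteq> cbox (-1,0) (1,1)" by (auto simp: Omega_def cbox_Pair_eq)
  then have "emeasure lborel Omega \<le> emeasure lborel (cbox (-1::real,0::real) (1,1))"
    by (intro emeasure_mono) auto
  also have "\<dots> < \<infinity>" by (rule emeasure_lborel_cbox_finite)
  finally show "emeasure MO (space MO) \<noteq> \<infinity>" by (auto simp: MO_def emeasure_restrict_space)
qed
interpretation MO: finite_measure MO by (rule finite_MO)

lemma L2_iff: "L2 f \<longleftrightarrow> sqi MO f"
  by (simp add: L2_def sqi_def MO_def borel_measurable_restrict_space_iff integrable_restrict_space)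

lemma set_integral_Omega: "(LINT z:Omega|lborel. f z) = (\<integral>z. f z \<partial>MO)" for f :: "_ \<Rightarrow> real"
  by (simp add: set_lebesgue_integral_def MO_def integral_restrict_space)

lemma L2dist2_eq: "L2dist2 f g = (n2 MO (\<lambda>z. f z - g z))\<^sup>2"
  by (simp add: L2dist2_def set_integral_Omega n2_sq)

lemma L2inner_eq: "L2inner f g = (\<integral>z. f z * g z \<partial>MO)"
  by (simp add: L2inner_def set_integral_Omega)

lemma measurable_MO: "f \<in> borel_measurable borel \<Longrightarrow> f \<in> borel_measurable MO"
  by (simp add: MO_def measurable_restrict_space1)

lemma continuous_bounded_Omega:
  fixes f :: "real \<times> real \<Rightarrow> real"
  assumes "continuous_on UNIV f" obtains B where "0 \<le> B" "\<And>z. z \<in> Omega \<Longrightarrow> \<bar>f z\<bar> \<le> B"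
proof -
  have "compact (f ` cbox (-1,0) (1,1))"
    by (intro compact_continuous_image continuous_on_subset[OF assms]) auto
  then obtain B where "\<forall>v \<in> f ` cbox (-1,0) (1,1). norm v \<le> B" using compact_imp_bounded bounded_iff by blast
  then have B: "\<And>z. z \<in> cbox (-1,0) (1,1) \<Longrightarrow> \<bar>f z\<bar> \<le> B" by auto
  have "Omega \<subseteq> cbox (-1,0) (1,1)" by (auto simp: Omega_def cbox_Pair_eq)
  with B have "\<And>z. z \<in> Omega \<Longrightarrow> \<bar>f z\<bar> \<le> max B 0" by (meson max.coboundedI1 subset_iff)
  then show ?thesis using that[of "max B 0"] by simp
qed

lemma continuous_sqi: assumes "continuous_on UNIV f" shows "sqi MO f"
proof -
  obtain B where B: "\<And>z. z \<in> Omega \<Longrightarrow> \<bar>f z\<bar> \<le> B" using continuous_bounded_Omega[OF assms] by blast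
  show ?thesis
    by (rule sqi_bounded[OF finite_MO measurable_MO[OF borel_measurable_continuous_onI[OF assms]], of B])
       (use B in simp)
qed

lemma continuous_integrable: "continuous_on UNIV f \<Longrightarrow> integrable MO (f :: _ \<Rightarrow> real)"
  by (rule sqi_integrable[OF finite_MO continuous_sqi])

lemma measurable_MX: "f \<in> borel_measurable borel \<Longrightarrow> f \<in> borel_measurable MX"
  and measurable_MY: "f \<in> borel_measurable borel \<Longrightarrow> f \<in> borel_measurable MY"
  by (simp_all add: MX_def MY_def measurable_restrict_space1)

lemma continuous_sqi_MX: assumes "continuous_on UNIV (f::real\<Rightarrow>real)" shows "sqi MX f"
proof -
  have "compact (f ` {-1..1})" by (intro compact_continuous_image continuous_on_subset[OF assms]) auto
  then obtain B where "\<forall>v \<in> f ` {-1..1}. norm v \<le> B" using compact_imp_bounded bounded_iff by blast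
  then have B: "\<And>z. z \<in> {-1..1} \<Longrightarrow> \<bar>f z\<bar> \<le> B" by auto
  show ?thesis
    by (rule sqi_bounded[OF finite_MX measurable_MX[OF borel_measurable_continuous_onI[OF assms]], of B])
       (use B in simp)
qed

lemma continuous_sqi_MY: assumes "continuous_on UNIV (f::real\<Rightarrow>real)" shows "sqi MY f"
proof -
  have "compact (f ` {0..1})" by (intro compact_continuous_image continuous_on_subset[OF assms]) auto
  then obtain B where "\<forall>v \<in> f ` {0..1}. norm v \<le> B" using compact_imp_bounded bounded_iff by blast
  then have B: "\<And>z. z \<in> {0..1} \<Longrightarrow> \<bar>f z\<bar> \<le> B" by auto
  show ?thesis
    by (rule sqi_bounded[OF finite_MY measurable_MY[OF borel_measurable_continuous_onI[OF assms]], of B])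
       (use B in simp)
qed

text \<open>Omega is built from open intervals while the fundamental theorem of calculus lives on
  closed ones; the endpoints form a null set.\<close>

lemma integral_MX_HK: assumes "continuous_on {-1..1} (f::real\<Rightarrow>real)"
  shows "(\<integral>x. f x \<partial>MX) = integral {-1..1} f"
proof -
  have "(\<integral>x. f x \<partial>MX) = (LINT x:{-1<..<1}|lborel. f x)"
    by (simp add: MX_def set_lebesgue_integral_def integral_restrict_space)
  also have "\<dots> = (LINT x:{-1..1}|lborel. f x)"
    unfolding set_lebesgue_integral_def
  proof (rule integral_cong_AE)
    have c: "continuous_on {-1<..<1} f" by (rule continuous_on_subset[OF assms]) auto
    show "(\<lambda>x. indicator {-1<..<1} x *\<^sub>R f x) \<in> borel_measurable lborel"
      using borel_measurable_continuous_on_indicator[OF _ c] by simp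
    show "(\<lambda>x. indicator {-1..1} x *\<^sub>R f x) \<in> borel_measurable lborel"
      using borel_measurable_continuous_on_indicator[OF _ assms] by simp
    show "AE x in lborel. indicator {-1<..<1} x *\<^sub>R f x = indicator {-1..1} x *\<^sub>R f x"
      by (rule AE_I[of _ _ "{-1,1}"]) (auto simp: indicator_def finite_imp_null_set_lborel[THEN null_setsD1] split: if_splits)
  qed
  also have "\<dots> = integral {-1..1} f"
    by (intro set_borel_integral_eq_integral(2) borel_integrable_atLeastAtMost' assms)
  finally show ?thesis .
qed

lemma integral_MY_HK: assumes "continuous_on {0..1} (f::real\<Rightarrow>real)"
  shows "(\<integral>x. f x \<partial>MY) = integral {0..1} f"
proof -
  have "(\<integral>x. f x \<partial>MY) = (LINT x:{0<..<1}|lborel. f x)"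
    by (simp add: MY_def set_lebesgue_integral_def integral_restrict_space)
  also have "\<dots> = (LINT x:{0..1}|lborel. f x)"
    unfolding set_lebesgue_integral_def
  proof (rule integral_cong_AE)
    have c: "continuous_on {0<..<1} f" by (rule continuous_on_subset[OF assms]) auto
    show "(\<lambda>x. indicator {0<..<1} x *\<^sub>R f x) \<in> borel_measurable lborel"
      using borel_measurable_continuous_on_indicator[OF _ c] by simp
    show "(\<lambda>x. indicator {0..1} x *\<^sub>R f x) \<in> borel_measurable lborel"
      using borel_measurable_continuous_on_indicator[OF _ assms] by simp
    show "AE x in lborel. indicator {0<..<1} x *\<^sub>R f x = indicator {0..1} x *\<^sub>R f x"
      by (rule AE_I[of _ _ "{0,1}"]) (auto simp: indicator_def finite_imp_null_set_lborel[THEN null_setsD1] split: if_splits)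
  qed
  also have "\<dots> = integral {0..1} f"
    by (intro set_borel_integral_eq_integral(2) borel_integrable_atLeastAtMost' assms)
  finally show ?thesis .
qed

lemma integral_MX_deriv:
  assumes "\<And>x. (F has_real_derivative f x) (at x)" "continuous_on UNIV f"
  shows "(\<integral>x. f x \<partial>MX) = F 1 - F (-1)"
proof -
  have "(f has_integral F 1 - F (-1)) {-1..1}"
    by (rule fundamental_theorem_of_calculus)
       (use assms(1) in \<open>auto simp: has_real_derivative_iff_has_vector_derivative intro: has_vector_derivative_at_within\<close>)
  then show ?thesis
    using integral_MX_HK[OF continuous_on_subset[OF assms(2)]] by (simp add: integral_unique)
qed

lemma integral_MY_deriv:
  assumes "\<And>x. (F has_real_derivative f x) (at x)" "continuous_on UNIV f"
  shows "(\<integral>x. f x \<partial>MY) = F 1 - F 0"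
proof -
  have "(f has_integral F 1 - F 0) {0..1}"
    by (rule fundamental_theorem_of_calculus)
       (use assms(1) in \<open>auto simp: has_real_derivative_iff_has_vector_derivative intro: has_vector_derivative_at_within\<close>)
  then show ?thesis
    using integral_MY_HK[OF continuous_on_subset[OF assms(2)]] by (simp add: integral_unique)
qed

lemma integral_MO_yx: "integrable MO f \<Longrightarrow> (\<integral>z. f z \<partial>MO) = (\<integral>y. (\<integral>x. f (x, y) \<partial>MX) \<partial>MY)" for f :: "_ \<Rightarrow> real"
  using MXY.integral_snd[of "\<lambda>x y. f (x,y)"] by (simp add: MO_eq_pair)

lemma integral_MO_xy: "integrable MO f \<Longrightarrow> (\<integral>z. f z \<partial>MO) = (\<integral>x. (\<integral>y. f (x, y) \<partial>MY) \<partial>MX)" for f :: "_ \<Rightarrow> real"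
  using MXY.integral_fst'[of f] by (simp add: MO_eq_pair)


section \<open>Smooth functions of one variable\<close>

text \<open>The derivatives of all orders are carried as explicit data, so that they can be bounded
  and multiplied by the Leibniz rule without iterating \<open>deriv\<close>.\<close>

definition tower :: "(nat \<Rightarrow> real \<Rightarrow> real) \<Rightarrow> bool" where
  "tower D \<longleftrightarrow> (\<forall>n x. (D n has_real_derivative D (Suc n) x) (at x))"

definition smooth1 :: "(real \<Rightarrow> real) \<Rightarrow> bool" where
  "smooth1 f \<longleftrightarrow> (\<exists>D. tower D \<and> D 0 = f)"

lemma tower_continuous: assumes "tower D" shows "continuous_on A (D n)"
proof (rule continuous_at_imp_continuous_on, rule ballI)
  fix x show "isCont (D n) x" using assms DERIV_isCont unfolding tower_def by blast
qed

lemma tower_mult: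
  assumes "tower A" "tower B"
  shows "tower (\<lambda>n x. \<Sum>i\<le>n. real (n choose i) * (A i x * B (n - i) x))"
  unfolding tower_def
proof (intro allI)
  fix n x
  have "((\<lambda>x. \<Sum>i\<le>n. real (n choose i) * (A i x * B (n - i) x)) has_real_derivative
      (\<Sum>i\<le>n. real (n choose i) * (A (Suc i) x * B (n - i) x + B (Suc (n - i)) x * A i x))) (at x)"
    by (intro DERIV_sum DERIV_cmult DERIV_mult) (use assms in \<open>auto simp: tower_def\<close>)
  also have "(\<Sum>i\<le>n. real (n choose i) * (A (Suc i) x * B (n - i) x + B (Suc (n - i)) x * A i x))
     = (\<Sum>i\<le>n. real (n choose i) * (A (Suc i) x * B (n - i) x)) + (\<Sum>i\<le>n. real (n choose i) * (A i x * B (Suc n - i) x))"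
    unfolding sum.distrib[symmetric] by (intro sum.cong refl) (simp add: Suc_diff_le algebra_simps)
  \<comment> \<open>The extra term at i = n+1 has coefficient 0. With it the sum can be shifted and
    merged with the other one by Pascal's rule.\<close>
  also have "(\<Sum>i\<le>n. real (n choose i) * (A i x * B (Suc n - i) x))
     = (\<Sum>i\<le>Suc n. real (n choose i) * (A i x * B (Suc n - i) x))" by simp
  also have "\<dots> = A 0 x * B (Suc n) x + (\<Sum>i\<le>n. real (n choose Suc i) * (A (Suc i) x * B (n - i) x))"
    by (subst sum.atMost_Suc_shift) simp
  also have "(\<Sum>i\<le>n. real (n choose i) * (A (Suc i) x * B (n - i) x)) +
      (A 0 x * B (Suc n) x + (\<Sum>i\<le>n. real (n choose Suc i) * (A (Suc i) x * B (n - i) x)))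
     = A 0 x * B (Suc n) x + (\<Sum>i\<le>n. real (Suc n choose Suc i) * (A (Suc i) x * B (Suc n - Suc i) x))"
    by (simp add: sum.distrib[symmetric] algebra_simps)
  also have "\<dots> = (\<Sum>i\<le>Suc n. real (Suc n choose i) * (A i x * B (Suc n - i) x))"
    by (subst sum.atMost_Suc_shift) simp
  finally show "((\<lambda>x. \<Sum>i\<le>n. real (n choose i) * (A i x * B (n - i) x)) has_real_derivative
      (\<Sum>i\<le>Suc n. real (Suc n choose i) * (A i x * B (Suc n - i) x))) (at x)" .
qed

lemma smooth1_mult: assumes "smooth1 f" "smooth1 g" shows "smooth1 (\<lambda>x. f x * g x)"
proof -
  obtain A B where "tower A" "A 0 = f" "tower B" "B 0 = g" using assms by (auto simp: smooth1_def)
  then show ?thesis unfolding smooth1_def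
    by (intro exI[of _ "\<lambda>n x. \<Sum>i\<le>n. real (n choose i) * (A i x * B (n - i) x)"] conjI tower_mult) auto
qed

lemma smooth1_const: "smooth1 (\<lambda>x. c)"
  unfolding smooth1_def tower_def
  by (rule exI[of _ "\<lambda>n x. if n = 0 then c else 0"]) (auto intro: derivative_eq_intros)

lemma smooth1_add: assumes "smooth1 f" "smooth1 g" shows "smooth1 (\<lambda>x. f x + g x)"
proof -
  obtain A B where "tower A" "A 0 = f" "tower B" "B 0 = g" using assms by (auto simp: smooth1_def)
  then show ?thesis unfolding smooth1_def tower_def
    by (intro exI[of _ "\<lambda>n x. A n x + B n x"]) (auto intro!: DERIV_add)
qed

lemma smooth1_antideriv:
  assumes "smooth1 f" "\<And>x. (F has_real_derivative f x) (at x)" shows "smooth1 F"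
proof -
  obtain A where "tower A" "A 0 = f" using assms by (auto simp: smooth1_def)
  then show ?thesis unfolding smooth1_def tower_def
    using assms(2) by (intro exI[of _ "\<lambda>n. case n of 0 \<Rightarrow> F | Suc m \<Rightarrow> A m"]) (auto split: nat.split)
qed

lemma smooth1_affine: assumes "smooth1 f" shows "smooth1 (\<lambda>x. f (c * x + d))"
proof -
  obtain A where A: "tower A" "A 0 = f" using assms by (auto simp: smooth1_def)
  have "((\<lambda>x. c ^ n * A n (c * x + d)) has_real_derivative c ^ Suc n * A (Suc n) (c * x + d)) (at x)" for n x
  proof -
    have "((\<lambda>x. A n (c * x + d)) has_real_derivative A (Suc n) (c * x + d) * c) (at x)"
      by (rule DERIV_chain2[where f = "A n"]) (use A in \<open>auto simp: tower_def intro!: derivative_eq_intros\<close>)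
    from DERIV_cmult[OF this, of "c ^ n"] show ?thesis by (simp add: algebra_simps)
  qed
  then show ?thesis unfolding smooth1_def tower_def
    using A by (intro exI[of _ "\<lambda>n x. c ^ n * A n (c * x + d)"]) auto
qed

lemma smooth1_continuous: assumes "smooth1 f" shows "continuous_on A f"
proof -
  obtain D where "tower D" "D 0 = f" using assms by (auto simp: smooth1_def)
  then show ?thesis using tower_continuous by blast
qed

lemma smooth1_polynomial: assumes "real_polynomial_function p" shows "smooth1 (p :: real \<Rightarrow> real)"
  using assms
proof (induction rule: real_polynomial_function.induct)
  case (linear f)
  then obtain c where c: "f = (\<lambda>x. x * c)" using real_bounded_linear by auto
  have "smooth1 (\<lambda>x. c * x)"
    by (rule smooth1_antideriv[OF smooth1_const[of c]]) (auto intro!: derivative_eq_intros)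
  then show ?case by (simp add: c mult.commute)
qed (auto intro: smooth1_const smooth1_add smooth1_mult)

text \<open>$m$-th derivative of $e^{-M/t}$, extended by $0$ to $t \le 0$. Cauchy's estimate on the disc of radius $t/2$ gives
  Gevrey bounds of order $2$ with ratio $9/M$, which is made small by taking $M$ large.\<close>

definition ef :: "real \<Rightarrow> nat \<Rightarrow> real \<Rightarrow> real" where
  "ef M m t = (if t > 0 then Re ((deriv ^^ m) (\<lambda>z. exp (- of_real M / z)) (of_real t)) else 0)"

text \<open>On the circle of radius t/2 about t one has Re z >= t/2 and |z| <= 3t/2, so Re (M/z) = M
  Re z / |z|^2 >= (2M/9)/t. This is the origin of the 2/9.\<close>

lemma ef_bound_pos:
  assumes "M > 0" "t > 0"
  shows "\<bar>ef M m t\<bar> \<le> fact m * (2 / t) ^ m * exp (- (2 * M / 9) / t)"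
proof -
  let ?f = "\<lambda>z::complex. exp (- of_real M / z)"
  have nz: "z \<noteq> 0" if "z \<in> cball (complex_of_real t) (t/2)" for z
    using that assms by (auto simp: dist_norm)
  have "norm ((deriv ^^ m) ?f (of_real t)) \<le> fact m * exp (- (2 * M / 9) / t) / (t/2) ^ m"
  proof (rule Cauchy_inequality)
    show "?f holomorphic_on ball (of_real t) (t/2)"
      by (intro holomorphic_intros) (use nz in force)
    show "continuous_on (cball (of_real t) (t/2)) ?f"
      by (intro continuous_intros) (use nz in force)
    show "0 < t/2" using assms by simp
    fix z assume z: "norm (complex_of_real t - z) = t/2"
    have 1: "Re z \<ge> t/2"
      using complex_Re_le_cmod[of "of_real t - z"] z by simp
    have "norm z \<le> norm (complex_of_real t) + norm (z - of_real t)" by (metis norm_triangle_sub)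
    then have 2: "norm z \<le> 3 * t / 2" using z assms by (simp add: norm_minus_commute)
    have 3: "norm z > 0" using 1 assms by auto
    have "Re (of_real M / z) = M * Re z / (norm z)\<^sup>2"
      by (simp add: Re_divide cmod_power2)
    also have "\<dots> \<ge> M * (t/2) / (3*t/2)\<^sup>2"
      by (intro frac_le mult_left_mono power_mono 1 2) (use 1 3 assms in auto)
    also have "M * (t/2) / (3*t/2)\<^sup>2 = (2 * M / 9) / t" using assms by (simp add: power2_eq_square field_simps)
    finally show "norm (?f z) \<le> exp (- (2 * M / 9) / t)" by simp
  qed
  also have "\<dots> = fact m * (2 / t) ^ m * exp (- (2 * M / 9) / t)" using assms by (simp add: power_divide)
  finally show ?thesis using abs_Re_le_cmod[of "(deriv ^^ m) ?f (of_real t)"] assms by (simp add: ef_def)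
qed

lemma exp_ge_power: "x \<ge> 0 \<Longrightarrow> x ^ m / fact m \<le> exp (x::real)"
proof -
  assume x: "x \<ge> 0"
  have s: "(\<lambda>n. x ^ n /\<^sub>R fact n) sums exp x" by (rule exp_converges)
  have "(\<Sum>n\<in>{m}. x ^ n /\<^sub>R fact n) \<le> (\<Sum>n. x ^ n /\<^sub>R fact n)"
    by (rule sum_le_suminf) (use s x in \<open>auto simp: sums_iff\<close>)
  then show ?thesis using s by (simp add: sums_iff divide_inverse mult.commute)
qed

text \<open>The singular factor t^(-m) is paid for by exp(-c/t) <= m! (t/c)^m with c = 2M/9. The
  powers of t cancel, at the price of a second factorial, and the bound becomes uniform in
  t.\<close>

lemma ef_bound:
  assumes "M > 0" shows "\<bar>ef M m t\<bar> \<le> (fact m)\<^sup>2 * (9 / M) ^ m"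
proof (cases "t > 0")
  case True
  have "((2 * M / 9) / t) ^ m / fact m \<le> exp ((2 * M / 9) / t)" by (rule exp_ge_power) (use assms True in auto)
  then have "exp (- ((2 * M / 9) / t)) \<le> fact m / ((2 * M / 9) / t) ^ m"
    unfolding exp_minus by (subst le_divide_eq) (use True assms in \<open>auto simp: field_simps\<close>)
  then have e: "exp (- (2 * M / 9) / t) \<le> fact m / ((2 * M / 9) / t) ^ m" by simp
  have "\<bar>ef M m t\<bar> \<le> fact m * (2 / t) ^ m * exp (- (2 * M / 9) / t)" by (rule ef_bound_pos[OF assms True])
  also have "\<dots> \<le> fact m * (2 / t) ^ m * (fact m / ((2 * M / 9) / t) ^ m)"
    by (rule mult_left_mono[OF e]) (use True in auto)
  also have "\<dots> = (fact m)\<^sup>2 * ((2 / t) / ((2 * M / 9) / t)) ^ m"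
    by (simp only: power2_eq_square power_divide) (simp add: mult_ac)
  also have "(2 / t) / ((2 * M / 9) / t) = 9 / M" using True assms by (simp add: field_simps)
  finally show ?thesis .
next
  case False then show ?thesis using assms by (simp add: ef_def)
qed

text \<open>Quadratic smallness at 0 makes the difference quotients there tend to 0, which glues
  every derivative to the zero branch in \<open>tower_ef\<close>.\<close>

lemma ef_quadratic:
  assumes "M > 0" shows "\<exists>K. \<forall>t. \<bar>ef M m t\<bar> \<le> K * t\<^sup>2"
proof -
  define c where "c = 2 * M / 9"
  have c: "c > 0" using assms by (simp add: c_def)
  have "\<bar>ef M m t\<bar> \<le> (fact m * 2 ^ m * fact (m+2) / c ^ (m+2)) * t\<^sup>2" for t
  proof (cases "t > 0")
    case True
    have "(c / t) ^ (m+2) / fact (m+2) \<le> exp (c / t)" by (rule exp_ge_power) (use c True in auto)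
    then have "exp (- (c / t)) \<le> fact (m+2) / (c / t) ^ (m+2)"
      unfolding exp_minus by (subst le_divide_eq) (use True c in \<open>auto simp: field_simps simp del: fact_Suc\<close>)
    then have e: "exp (- c / t) \<le> fact (m+2) / (c / t) ^ (m+2)" by simp
    have "\<bar>ef M m t\<bar> \<le> fact m * (2 / t) ^ m * exp (- c / t)" using ef_bound_pos[OF assms True] by (simp add: c_def)
    also have "\<dots> \<le> fact m * (2 / t) ^ m * (fact (m+2) / (c / t) ^ (m+2))"
      by (rule mult_left_mono[OF e]) (use True in auto)
    also have "\<dots> = (fact m * 2 ^ m * fact (m+2) / c ^ (m+2)) * t\<^sup>2"
      using True c by (simp add: power_divide power_add power2_eq_square del: fact_Suc) 
    finally show ?thesis .
  next
    case False then show ?thesis using c by (simp add: ef_def)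
  qed
  then show ?thesis by blast
qed

lemma tower_ef: assumes "M > 0" shows "tower (ef M)"
  unfolding tower_def
proof (intro allI)
  fix m :: nat and t :: real
  let ?f = "\<lambda>z::complex. exp (- of_real M / z)"
  consider "t > 0" | "t = 0" | "t < 0" by (meson linorder_cases)
  then show "(ef M m has_real_derivative ef M (Suc m) t) (at t)"
  proof cases
    case 1
    have "?f holomorphic_on - {0}" by (intro holomorphic_intros) auto
    then have "(deriv ^^ m) ?f holomorphic_on - {0}" by (rule holomorphic_higher_deriv) auto
    then have "((deriv ^^ m) ?f has_field_derivative deriv ((deriv ^^ m) ?f) (of_real t)) (at (of_real t))"
      by (rule holomorphic_derivI) (use 1 in auto)
    then have "((\<lambda>x. (deriv ^^ m) ?f (of_real x)) has_vector_derivative deriv ((deriv ^^ m) ?f) (of_real t)) (at t)"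
      by (rule has_vector_derivative_real_field)
    then have "((\<lambda>x. Re ((deriv ^^ m) ?f (of_real x))) has_real_derivative Re (deriv ((deriv ^^ m) ?f) (of_real t))) (at t)"
      by (rule has_field_derivative_Re)
    then have "(ef M m has_real_derivative Re (deriv ((deriv ^^ m) ?f) (of_real t))) (at t)"
      by (rule has_field_derivative_transform_within_open[of _ _ _ "{0<..}"]) (use 1 in \<open>auto simp: ef_def\<close>)
    then show ?thesis using 1 by (simp add: ef_def)
  next
    case 2
    obtain K where K: "\<And>t. \<bar>ef M m t\<bar> \<le> K * t\<^sup>2" using ef_quadratic[OF assms] by blast
    have "((\<lambda>h. ef M m h / h) \<longlongrightarrow> 0) (at 0)"
    proof (rule Lim_null_comparison)
      show "\<forall>\<^sub>F h in at 0. norm (ef M m h / h) \<le> \<bar>K\<bar> * \<bar>h\<bar>"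
      proof (rule always_eventually, rule allI)
        fix h :: real
        have "\<bar>ef M m h\<bar> \<le> \<bar>K\<bar> * h\<^sup>2" using K[of h] by (smt (verit) mult_right_mono zero_le_power2)
        then show "norm (ef M m h / h) \<le> \<bar>K\<bar> * \<bar>h\<bar>"
          by (cases "h = 0") (simp_all add: divide_le_eq power2_eq_square mult.assoc)
      qed
      show "((\<lambda>h. \<bar>K\<bar> * \<bar>h\<bar>) \<longlongrightarrow> 0) (at (0::real))" by (auto intro!: tendsto_eq_intros)
    qed
    then show ?thesis using 2 by (simp add: has_field_derivative_iff ef_def)
  next
    case 3
    have "((\<lambda>_. 0) has_real_derivative 0) (at t)" by simp
    then have "(ef M m has_real_derivative 0) (at t)"
      by (rule has_field_derivative_transform_within_open[of _ _ _ "{..<0}"]) (use 3 in \<open>auto simp: ef_def\<close>)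
    then show ?thesis using 3 by (simp add: ef_def)
  qed
qed

lemma ef_0: "ef M 0 t = (if t > 0 then exp (- M / t) else 0)"
proof -
  have "exp (- complex_of_real M / complex_of_real t) = complex_of_real (exp (- M / t))"
    by (simp flip: of_real_divide of_real_minus exp_of_real)
  then show ?thesis by (simp add: ef_def)
qed

lemma smooth1_ef: "M > 0 \<Longrightarrow> smooth1 (ef M 0)"
  using tower_ef by (auto simp: smooth1_def)

lemma ex_antiderivative:
  assumes "continuous_on UNIV (f :: real \<Rightarrow> real)"
  shows "\<exists>F. F c = 0 \<and> (\<forall>x. (F has_real_derivative f x) (at x))"
proof -
  have "\<exists>F. \<forall>x. -\<infinity> < ereal x \<longrightarrow> ereal x < \<infinity> \<longrightarrow> (F has_vector_derivative f x) (at x)"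
    by (rule einterval_antiderivative) (use assms in \<open>auto simp: continuous_on_eq_continuous_at\<close>)
  then obtain F where "\<And>x. (F has_real_derivative f x) (at x)"
    by (auto simp: has_real_derivative_iff_has_vector_derivative)
  then show ?thesis by (intro exI[of _ "\<lambda>x. F x - F c"]) (auto intro!: derivative_eq_intros)
qed

text \<open>The bump e^(-1/x) e^(-1/(1-x)) lives on [0,1]; its primitive divided by the total mass
  is the step.\<close>

lemma ex_smooth_step:
  "\<exists>H. smooth1 H \<and> (\<forall>x\<le>0. H x = 0) \<and> (\<forall>x\<ge>1. H x = 1) \<and> (\<forall>x. 0 \<le> H x \<and> H x \<le> (1::real))"
proof -
  define \<beta> where "\<beta> = (\<lambda>x. ef 1 0 x * ef 1 0 ((-1) * x + 1))"
  have sm: "smooth1 \<beta>" unfolding \<beta>_def by (intro smooth1_mult smooth1_ef smooth1_affine) auto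
  have nn: "\<beta> x \<ge> 0" for x by (simp add: \<beta>_def ef_0)
  have pos: "\<beta> x > 0" if "0 < x" "x < 1" for x using that by (simp add: \<beta>_def ef_0)
  have z: "\<beta> x = 0" if "x \<le> 0 \<or> x \<ge> 1" for x using that by (auto simp: \<beta>_def ef_0)
  obtain B where B0: "B 0 = 0" and B: "\<And>x. (B has_real_derivative \<beta> x) (at x)"
    using ex_antiderivative[OF smooth1_continuous[OF sm], of 0] by blast
  have mono: "B x \<le> B y" if "x \<le> y" for x y
    using that B nn by (intro DERIV_nonneg_imp_nondecreasing[of x y B]) auto
  have "B 0 < B 1"
    by (rule DERIV_pos_imp_increasing_open) (use B pos in \<open>auto intro!: DERIV_continuous_on intro: has_field_derivative_at_within\<close>)
  then have B1: "B 1 > 0" using B0 by simp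
  have lo: "B x = 0" if "x \<le> 0" for x
  proof -
    have "B x \<ge> B 0" if "x < 0"
    proof (rule DERIV_nonpos_imp_nonincreasing[of x 0])
      show "\<exists>y. (B has_real_derivative y) (at u) \<and> y \<le> 0" if "x \<le> u" "u \<le> 0" for u
        using B[of u] z[of u] that by auto
    qed (use that in auto)
    then show ?thesis using mono[OF that] B0 that by fastforce
  qed
  have hi: "B x = B 1" if "x \<ge> 1" for x
  proof -
    have "B 1 \<ge> B x"
    proof (rule DERIV_nonpos_imp_nonincreasing[of 1 x])
      show "\<exists>y. (B has_real_derivative y) (at u) \<and> y \<le> 0" if "1 \<le> u" "u \<le> x" for u
        using B[of u] z[of u] that by auto
    qed (use that in auto)
    then show ?thesis using mono[OF that] by simp
  qed
  have r: "0 \<le> B x \<and> B x \<le> B 1" for x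
    using mono[of 0 x] mono[of x 1] lo[of x] hi[of x] B0 B1 by (cases "x \<le> 0"; cases "x \<ge> 1") auto
  have "smooth1 (\<lambda>x. (1 / B 1) * B x)"
    by (intro smooth1_mult smooth1_const smooth1_antideriv[OF sm B])
  moreover have "(1 / B 1) * B x = 0" if "x \<le> 0" for x using lo[OF that] by simp
  moreover have "(1 / B 1) * B x = 1" if "x \<ge> 1" for x using hi[OF that] B1 by simp
  moreover have "0 \<le> (1 / B 1) * B x \<and> (1 / B 1) * B x \<le> 1" for x using r[of x] B1 by simp
  ultimately show ?thesis by blast
qed

section \<open>Tensor products p(x) q(y)\<close>

definition ten :: "(real \<Rightarrow> real) \<Rightarrow> (real \<Rightarrow> real) \<Rightarrow> real \<times> real \<Rightarrow> real" where
  "ten p q = (\<lambda>z. p (fst z) * q (snd z))"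

lemma ten_apply[simp]: "ten p q (x, y) = p x * q y" by (simp add: ten_def)

lemma pdx_ten: "(\<And>x. (p has_real_derivative p' x) (at x)) \<Longrightarrow> pdx (ten p q) = ten p' q"
  by (auto simp: pdx_def ten_def fun_eq_iff intro!: DERIV_imp_deriv derivative_eq_intros)

lemma pdy_ten: "(\<And>x. (q has_real_derivative q' x) (at x)) \<Longrightarrow> pdy (ten p q) = ten p q'"
  by (auto simp: pdy_def ten_def fun_eq_iff intro!: DERIV_imp_deriv derivative_eq_intros)

lemma continuous_ten:
  assumes "continuous_on UNIV p" "continuous_on UNIV q" shows "continuous_on UNIV (ten p q)"
  unfolding ten_def
  by (intro continuous_intros continuous_on_compose2[OF assms(1)] continuous_on_compose2[OF assms(2)]) auto

text \<open>The induction differentiates in either variable, so both starting indices are free. The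
  order k is finite because ground states enter as C^2 functions: their second derivative contains
  |x|^(2 gamma).\<close>

lemma Ck_ten:
  assumes A: "\<And>i x. i < k \<Longrightarrow> (A i has_real_derivative A (Suc i) x) (at x)" "\<And>i. i \<le> k \<Longrightarrow> continuous_on UNIV (A i)"
  assumes B: "\<And>i x. i < k \<Longrightarrow> (B i has_real_derivative B (Suc i) x) (at x)" "\<And>i. i \<le> k \<Longrightarrow> continuous_on UNIV (B i)"
  shows "i + n \<le> k \<Longrightarrow> j + n \<le> k \<Longrightarrow> Ck n (ten (A i) (B j))"
proof (induction n arbitrary: i j)
  case 0 then show ?case by (simp add: continuous_ten A B)
next
  case (Suc n)
  have i: "i < k" and j: "j < k" using Suc by auto
  have "(\<lambda>s. ten (A i) (B j) (s, y)) differentiable at x" for x y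
    unfolding ten_apply by (rule differentiableI[OF has_field_derivative_imp_has_derivative], rule DERIV_cmult_right, rule A(1)[OF i])
  moreover have "(\<lambda>s. ten (A i) (B j) (x, s)) differentiable at y" for x y
    unfolding ten_apply by (rule differentiableI[OF has_field_derivative_imp_has_derivative], rule DERIV_cmult, rule B(1)[OF j])
  ultimately show ?case using Suc i j
    by (simp add: continuous_ten A B pdx_ten[OF A(1)] pdy_ten[OF B(1)])
qed

lemma smooth1_ten: assumes "smooth1 p" "smooth1 q" shows "smooth2 (ten p q)"
  unfolding smooth2_def
proof
  fix n
  obtain A B where AB: "tower A" "A 0 = p" "tower B" "B 0 = q" using assms by (auto simp: smooth1_def)
  then have c: "continuous_on UNIV (A i)" "continuous_on UNIV (B i)" for i
    by (auto intro: tower_continuous)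
  show "Ck n (ten p q)" using Ck_ten[of n A B 0 n 0] AB c by (auto simp: tower_def)
qed


section \<open>The Grushin form and its closure\<close>

lemma continuous_wt: "\<gamma> > 0 \<Longrightarrow> continuous_on A (\<lambda>z. \<bar>fst z :: real\<bar> powr (2 * \<gamma>))"
  by (intro continuous_on_powr' continuous_intros) auto

lemma Ck_Suc_imp: "Ck (Suc n) f \<Longrightarrow> Ck n f"
proof (induction n arbitrary: f)
  case 0 then show ?case by simp
next
  case (Suc n)
  from Suc.prems have "Ck (Suc n) (pdx f)" "Ck (Suc n) (pdy f)" by (simp_all only: Ck.simps(2)[of "Suc n"])
  then have "Ck n (pdx f)" "Ck n (pdy f)" using Suc.IH by blast+
  then show ?case using Suc.prems unfolding Ck.simps(2) by blast
qed

lemma Ck_mono: "m \<le> n \<Longrightarrow> Ck n f \<Longrightarrow> Ck m f"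
  by (induction n arbitrary: m) (auto simp del: Ck.simps simp: le_Suc_eq dest: Ck_Suc_imp)

lemma Ck_continuous: "Ck n f \<Longrightarrow> continuous_on UNIV f"
  by (cases n) auto

lemma Ck_pdx: "Ck (Suc n) f \<Longrightarrow> ((\<lambda>s. f (s, y)) has_real_derivative pdx f (x, y)) (at x)"
  by (simp add: pdx_def DERIV_deriv_iff_real_differentiable)

lemma Ck_pdy: "Ck (Suc n) f \<Longrightarrow> ((\<lambda>s. f (x, s)) has_real_derivative pdy f (x, y)) (at y)"
  by (simp add: pdy_def DERIV_deriv_iff_real_differentiable)

lemma pdx_lin:
  assumes "Ck (Suc n) f" "Ck (Suc n) g"
  shows "pdx (\<lambda>z. f z + c * g z) = (\<lambda>z. pdx f z + c * pdx g z)"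
proof
  fix z :: "real \<times> real" obtain x y where z: "z = (x, y)" by force
  have "((\<lambda>s. f (s, y) + c * g (s, y)) has_real_derivative pdx f (x, y) + c * pdx g (x, y)) (at x)"
    by (intro DERIV_add DERIV_cmult Ck_pdx[OF assms(1)] Ck_pdx[OF assms(2)])
  then show "pdx (\<lambda>z. f z + c * g z) z = pdx f z + c * pdx g z"
    by (simp add: z pdx_def[of "\<lambda>z. f z + c * g z"] DERIV_imp_deriv)
qed

lemma pdy_lin:
  assumes "Ck (Suc n) f" "Ck (Suc n) g"
  shows "pdy (\<lambda>z. f z + c * g z) = (\<lambda>z. pdy f z + c * pdy g z)"
proof
  fix z :: "real \<times> real" obtain x y where z: "z = (x, y)" by force
  have "((\<lambda>s. f (x, s) + c * g (x, s)) has_real_derivative pdy f (x, y) + c * pdy g (x, y)) (at y)"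
    by (intro DERIV_add DERIV_cmult Ck_pdy[OF assms(1)] Ck_pdy[OF assms(2)])
  then show "pdy (\<lambda>z. f z + c * g z) z = pdy f z + c * pdy g z"
    by (simp add: z pdy_def[of "\<lambda>z. f z + c * g z"] DERIV_imp_deriv)
qed

lemma Ck_lin: "Ck n f \<Longrightarrow> Ck n g \<Longrightarrow> Ck n (\<lambda>z. f z + c * g z)"
proof (induction n arbitrary: f g)
  case 0 then show ?case by (auto intro!: continuous_intros)
next
  case (Suc n)
  have "(\<lambda>s. f (s, y) + c * g (s, y)) differentiable at x" for x y
    by (rule differentiableI[OF has_field_derivative_imp_has_derivative])
       (rule DERIV_add[OF Ck_pdx[OF Suc.prems(1)] DERIV_cmult[OF Ck_pdx[OF Suc.prems(2)]]])
  moreover have "(\<lambda>s. f (x, s) + c * g (x, s)) differentiable at y" for x y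
    by (rule differentiableI[OF has_field_derivative_imp_has_derivative])
       (rule DERIV_add[OF Ck_pdy[OF Suc.prems(1)] DERIV_cmult[OF Ck_pdy[OF Suc.prems(2)]]])
  ultimately show ?case
    using Suc.prems Suc.IH pdx_lin[OF Suc.prems] pdy_lin[OF Suc.prems]
    by (auto intro!: continuous_intros)
qed

lemma test_fun_Ck: "test_fun f \<Longrightarrow> Ck n f" by (simp add: test_fun_def smooth2_def)

lemma test_fun_lin: assumes "test_fun f" "test_fun g" shows "test_fun (\<lambda>z. f z + c * g z)"
proof -
  obtain K L where K: "compact K" "K \<subseteq> Omega" "\<And>z. z \<notin> K \<Longrightarrow> f z = 0"
    and L: "compact L" "L \<subseteq> Omega" "\<And>z. z \<notin> L \<Longrightarrow> g z = 0"
    using assms by (auto simp: test_fun_def)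
  then have "compact (K \<union> L) \<and> K \<union> L \<subseteq> Omega \<and> (\<forall>z. z \<notin> K \<union> L \<longrightarrow> f z + c * g z = 0)" by auto
  moreover have "smooth2 (\<lambda>z. f z + c * g z)"
    using assms by (auto simp: test_fun_def smooth2_def intro: Ck_lin)
  ultimately show ?thesis unfolding test_fun_def by blast
qed

lemma test_fun_diff: "test_fun f \<Longrightarrow> test_fun g \<Longrightarrow> test_fun (\<lambda>z. f z - g z)"
  using test_fun_lin[of f g "-1"] by simp

lemma Ck_diff: "Ck n f \<Longrightarrow> Ck n g \<Longrightarrow> Ck n (\<lambda>z. f z - g z)"
  using Ck_lin[of n f g "-1"] by simp

lemma test_fun_outside: "test_fun f \<Longrightarrow> z \<notin> Omega \<Longrightarrow> f z = 0"
  by (cases z) (auto simp: test_fun_def)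

section \<open>Algebra of the positive form on continuously differentiable functions\<close>

definition Vip :: "real \<Rightarrow> (real \<times> real \<Rightarrow> real) \<Rightarrow> (real \<times> real \<Rightarrow> real) \<Rightarrow> real" where
  "Vip \<gamma> f g = (\<integral>z. pdx f z * pdx g z + \<bar>fst z\<bar> powr (2 * \<gamma>) * (pdy f z * pdy g z) \<partial>MO)"

definition vn :: "real \<Rightarrow> (real \<times> real \<Rightarrow> real) \<Rightarrow> real" where "vn \<gamma> f = sqrt (Vip \<gamma> f f)"

lemma aform_Vip: "aform \<gamma> f g = - Vip \<gamma> f g"
  by (simp add: aform_def Vip_def set_integral_Omega mult.assoc)

lemma Vnorm2_Vip: "Vnorm2 \<gamma> f = Vip \<gamma> f f"
  by (simp add: Vnorm2_def Vip_def set_integral_Omega power2_eq_square)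

lemma Vip_nonneg: "0 \<le> Vip \<gamma> f f"
  unfolding Vip_def by (rule integral_nonneg_AE) auto

lemma vn_nonneg[simp]: "0 \<le> vn \<gamma> f" by (simp add: vn_def Vip_nonneg)

lemma vn_sq: "(vn \<gamma> f)\<^sup>2 = Vip \<gamma> f f" by (simp add: vn_def Vip_nonneg)

lemma Vip_sym: "Vip \<gamma> f g = Vip \<gamma> g f" by (simp add: Vip_def mult.commute)

lemma Vip_integrable:
  assumes "\<gamma> > 0" "Ck 1 f" "Ck 1 g"
  shows "integrable MO (\<lambda>z. pdx f z * pdx g z + \<bar>fst z\<bar> powr (2 * \<gamma>) * (pdy f z * pdy g z))"
  using assms by (intro continuous_integrable continuous_intros continuous_wt) auto

lemma Vip_lin1:
  assumes "\<gamma> > 0" "Ck 1 f" "Ck 1 g" "Ck 1 h"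
  shows "Vip \<gamma> (\<lambda>z. f z + c * g z) h = Vip \<gamma> f h + c * Vip \<gamma> g h"
proof -
  have "Vip \<gamma> (\<lambda>z. f z + c * g z) h = (\<integral>z. (pdx f z * pdx h z + \<bar>fst z\<bar> powr (2 * \<gamma>) * (pdy f z * pdy h z))
     + c * (pdx g z * pdx h z + \<bar>fst z\<bar> powr (2 * \<gamma>) * (pdy g z * pdy h z)) \<partial>MO)"
    unfolding Vip_def using assms
    by (intro Bochner_Integration.integral_cong refl) (simp add: pdx_lin[where n=0] pdy_lin[where n=0] algebra_simps)
  then show ?thesis unfolding Vip_def
    using Vip_integrable[OF assms(1,2,4)] Vip_integrable[OF assms(1,3,4)] by simp
qed

lemma Vip_lin2:
  assumes "\<gamma> > 0" "Ck 1 f" "Ck 1 g" "Ck 1 h"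
  shows "Vip \<gamma> h (\<lambda>z. f z + c * g z) = Vip \<gamma> h f + c * Vip \<gamma> h g"
  using Vip_lin1[OF assms] by (simp add: Vip_sym)

lemma Vip_diff1: "\<gamma> > 0 \<Longrightarrow> Ck 1 f \<Longrightarrow> Ck 1 g \<Longrightarrow> Ck 1 h \<Longrightarrow> Vip \<gamma> (\<lambda>z. f z - g z) h = Vip \<gamma> f h - Vip \<gamma> g h"
  using Vip_lin1[of \<gamma> f g h "-1"] by simp

lemma Vip_diff2: "\<gamma> > 0 \<Longrightarrow> Ck 1 f \<Longrightarrow> Ck 1 g \<Longrightarrow> Ck 1 h \<Longrightarrow> Vip \<gamma> h (\<lambda>z. f z - g z) = Vip \<gamma> h f - Vip \<gamma> h g"
  using Vip_lin2[of \<gamma> f g h "-1"] by simp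

lemma Vip_expand:
  assumes "\<gamma> > 0" "Ck 1 f" "Ck 1 g"
  shows "Vip \<gamma> (\<lambda>z. f z + t * g z) (\<lambda>z. f z + t * g z) = Vip \<gamma> f f + 2 * t * Vip \<gamma> f g + t\<^sup>2 * Vip \<gamma> g g"
proof -
  have "Ck 1 (\<lambda>z. f z + t * g z)" using Ck_lin assms by blast
  then show ?thesis using assms
    by (simp add: Vip_lin1 Vip_lin2 Vip_sym[of \<gamma> g f] power2_eq_square algebra_simps)
qed

lemma Vip_cauchy_schwarz:
  assumes "\<gamma> > 0" "Ck 1 f" "Ck 1 g" shows "\<bar>Vip \<gamma> f g\<bar> \<le> vn \<gamma> f * vn \<gamma> g"
  unfolding vn_def
proof (rule nonneg_quadratic_discriminant)
  fix t show "0 \<le> Vip \<gamma> f f + 2 * t * Vip \<gamma> f g + t\<^sup>2 * Vip \<gamma> g g"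
    unfolding Vip_expand[OF assms, symmetric] by (rule Vip_nonneg)
qed

lemma vn_triangle_lin:
  assumes "\<gamma> > 0" "Ck 1 f" "Ck 1 g" "\<bar>c\<bar> = 1" shows "vn \<gamma> (\<lambda>z. f z + c * g z) \<le> vn \<gamma> f + vn \<gamma> g"
proof (rule power2_le_imp_le)
  have c: "c\<^sup>2 = 1" using assms(4) by (metis one_power2 power2_abs)
  have "(vn \<gamma> (\<lambda>z. f z + c * g z))\<^sup>2 = (vn \<gamma> f)\<^sup>2 + 2 * (c * Vip \<gamma> f g) + (vn \<gamma> g)\<^sup>2"
    using Vip_expand[OF assms(1-3), of c] c by (simp add: vn_sq)
  also have "\<dots> \<le> (vn \<gamma> f)\<^sup>2 + 2 * (vn \<gamma> f * vn \<gamma> g) + (vn \<gamma> g)\<^sup>2"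
  proof -
    have "c * Vip \<gamma> f g \<le> \<bar>Vip \<gamma> f g\<bar>" using assms(4) by (metis abs_ge_self abs_mult mult_1)
    then show ?thesis using Vip_cauchy_schwarz[OF assms(1-3)] by simp
  qed
  also have "\<dots> = (vn \<gamma> f + vn \<gamma> g)\<^sup>2" by (simp add: power2_sum)
  finally show "(vn \<gamma> (\<lambda>z. f z + c * g z))\<^sup>2 \<le> (vn \<gamma> f + vn \<gamma> g)\<^sup>2" .
qed simp

lemma vn_triangle_diff:
  assumes "\<gamma> > 0" "Ck 1 f" "Ck 1 g" shows "vn \<gamma> (\<lambda>z. f z - g z) \<le> vn \<gamma> f + vn \<gamma> g"
  using vn_triangle_lin[OF assms, of "-1"] by simp

lemma vn_triangle3:
  assumes "\<gamma> > 0" "Ck 1 f" "Ck 1 g" "Ck 1 h"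
  shows "vn \<gamma> (\<lambda>z. f z - h z) \<le> vn \<gamma> (\<lambda>z. f z - g z) + vn \<gamma> (\<lambda>z. g z - h z)"
  using vn_triangle_lin[OF assms(1) Ck_diff[OF assms(2,3)] Ck_diff[OF assms(3,4)], of 1] by simp

lemma vn_commute:
  assumes "\<gamma> > 0" "Ck 1 f" "Ck 1 g" shows "vn \<gamma> (\<lambda>z. f z - g z) = vn \<gamma> (\<lambda>z. g z - f z)"
  using Vip_expand[OF assms, of "-1"] Vip_expand[OF assms(1,3,2), of "-1"] by (simp add: vn_def Vip_sym)

lemma vn_bound_diff:
  assumes "\<gamma> > 0" "Ck 1 f" "Ck 1 g" shows "vn \<gamma> f \<le> vn \<gamma> (\<lambda>z. f z - g z) + vn \<gamma> g"
  using vn_triangle_lin[OF assms(1) Ck_diff[OF assms(2,3)] assms(3), of 1] by simp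

definition Lop :: "real \<Rightarrow> (real \<times> real \<Rightarrow> real) \<Rightarrow> real \<times> real \<Rightarrow> real" where
  "Lop \<gamma> f = (\<lambda>z. pdx (pdx f) z + \<bar>fst z\<bar> powr (2 * \<gamma>) * pdy (pdy f) z)"

lemma continuous_Lop: "\<gamma> > 0 \<Longrightarrow> Ck 2 f \<Longrightarrow> continuous_on UNIV (Lop \<gamma> f)"
  unfolding Lop_def by (intro continuous_intros continuous_wt) (auto simp: numeral_2_eq_2)

text \<open>All boundary terms vanish with \<open>\<phi>\<close>, so \<open>f\<close> is free at the
  boundary. The weight depends on x but is differentiated across only in y, so the singularity of
  |x|^(2 gamma) at x = 0 does no harm.\<close>

lemma Vip_by_parts:
  assumes "\<gamma> > 0" "test_fun \<phi>" "Ck 2 f"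
  shows "Vip \<gamma> \<phi> f = - (\<integral>z. \<phi> z * Lop \<gamma> f z \<partial>MO)"
proof -
  have f2: "Ck (Suc (Suc 0)) f" using assms(3) by (simp add: numeral_2_eq_2)
  have fx: "Ck (Suc 0) (pdx f)" and fy: "Ck (Suc 0) (pdy f)" using f2 by auto
  have p: "Ck (Suc 0) \<phi>" by (rule test_fun_Ck[OF assms(2)])
  define X where "X = (\<lambda>z. pdx \<phi> z * pdx f z + \<phi> z * pdx (pdx f) z)"
  define Y where "Y = (\<lambda>z. \<bar>fst z\<bar> powr (2 * \<gamma>) * (pdy \<phi> z * pdy f z + \<phi> z * pdy (pdy f) z))"
  have cx: "continuous_on UNIV X" unfolding X_def
    using f2 fx p by (intro continuous_intros) auto
  have cy: "continuous_on UNIV Y" unfolding Y_def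
    using f2 fy p assms(1) by (intro continuous_intros continuous_wt) auto
  have "(\<integral>z. X z \<partial>MO) = (\<integral>y. (\<integral>x. X (x, y) \<partial>MX) \<partial>MY)" by (rule integral_MO_yx[OF continuous_integrable[OF cx]])
  also have "\<dots> = (\<integral>y. 0 \<partial>MY)"
  proof (rule Bochner_Integration.integral_cong[OF refl])
    fix y
    have "(\<integral>x. X (x, y) \<partial>MX) = \<phi> (1, y) * pdx f (1, y) - \<phi> (-1, y) * pdx f (-1, y)"
    proof (rule integral_MX_deriv)
      show "((\<lambda>x. \<phi> (x, y) * pdx f (x, y)) has_real_derivative X (x, y)) (at x)" for x
        using DERIV_mult[OF Ck_pdx[OF p, of y x] Ck_pdx[OF fx, of y x]] by (simp add: X_def algebra_simps)
      show "continuous_on UNIV (\<lambda>x. X (x, y))"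
        by (rule continuous_on_compose2[OF cx]) (auto intro: continuous_intros)
    qed
    then show "(\<integral>x. X (x, y) \<partial>MX) = 0"
      using test_fun_outside[OF assms(2), of "(1,y)"] test_fun_outside[OF assms(2), of "(-1,y)"]
      by (simp add: Omega_def)
  qed
  finally have X0: "(\<integral>z. X z \<partial>MO) = 0" by simp
  have "(\<integral>z. Y z \<partial>MO) = (\<integral>x. (\<integral>y. Y (x, y) \<partial>MY) \<partial>MX)" by (rule integral_MO_xy[OF continuous_integrable[OF cy]])
  also have "\<dots> = (\<integral>x. 0 \<partial>MX)"
  proof (rule Bochner_Integration.integral_cong[OF refl])
    fix x
    have "(\<integral>y. Y (x, y) \<partial>MY) = \<bar>x\<bar> powr (2*\<gamma>) * (\<phi> (x, 1) * pdy f (x, 1)) - \<bar>x\<bar> powr (2*\<gamma>) * (\<phi> (x, 0) * pdy f (x, 0))"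
    proof (rule integral_MY_deriv)
      show "((\<lambda>y. \<bar>x\<bar> powr (2*\<gamma>) * (\<phi> (x, y) * pdy f (x, y))) has_real_derivative Y (x, y)) (at y)" for y
        using DERIV_cmult[OF DERIV_mult[OF Ck_pdy[OF p, of x y] Ck_pdy[OF fy, of x y]], of "\<bar>x\<bar> powr (2*\<gamma>)"]
        by (simp add: Y_def algebra_simps)
      show "continuous_on UNIV (\<lambda>y. Y (x, y))"
        by (rule continuous_on_compose2[OF cy]) (auto intro: continuous_intros)
    qed
    then show "(\<integral>y. Y (x, y) \<partial>MY) = 0"
      using test_fun_outside[OF assms(2), of "(x,1)"] test_fun_outside[OF assms(2), of "(x,0)"]
      by (simp add: Omega_def)
  qed
  finally have Y0: "(\<integral>z. Y z \<partial>MO) = 0" by simp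
  have "0 = (\<integral>z. X z + Y z \<partial>MO)" using X0 Y0 continuous_integrable[OF cx] continuous_integrable[OF cy] by simp
  also have "\<dots> = (\<integral>z. (pdx \<phi> z * pdx f z + \<bar>fst z\<bar> powr (2 * \<gamma>) * (pdy \<phi> z * pdy f z)) + \<phi> z * Lop \<gamma> f z \<partial>MO)"
    by (intro Bochner_Integration.integral_cong refl) (simp add: X_def Y_def Lop_def algebra_simps)
  also have "\<dots> = Vip \<gamma> \<phi> f + (\<integral>z. \<phi> z * Lop \<gamma> f z \<partial>MO)"
    unfolding Vip_def using f2 p assms
    by (intro Bochner_Integration.integral_add Vip_integrable continuous_integrable continuous_intros continuous_Lop) auto
  finally show ?thesis by simp
qed

section \<open>Closability and the extended form\<close>

definition Vcauchy :: "real \<Rightarrow> (nat \<Rightarrow> real \<times> real \<Rightarrow> real) \<Rightarrow> bool" where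
  "Vcauchy \<gamma> \<phi> \<longleftrightarrow> (\<forall>e>0. \<exists>N. \<forall>m\<ge>N. \<forall>n\<ge>N. vn \<gamma> (\<lambda>z. \<phi> m z - \<phi> n z) < e)"

lemma approx_seq_iff:
  "approx_seq \<gamma> \<phi> f \<longleftrightarrow> (\<forall>k. test_fun (\<phi> k)) \<and> Vcauchy \<gamma> \<phi> \<and> (\<lambda>k. n2 MO (\<lambda>z. \<phi> k z - f z)) \<longlonglongrightarrow> 0"
proof -
  have "(\<forall>e>0. \<exists>N. \<forall>m\<ge>N. \<forall>n\<ge>N. Vnorm2 \<gamma> (\<lambda>z. \<phi> m z - \<phi> n z) < e) \<longleftrightarrow> Vcauchy \<gamma> \<phi>"
  proof
    assume L: "\<forall>e>0. \<exists>N. \<forall>m\<ge>N. \<forall>n\<ge>N. Vnorm2 \<gamma> (\<lambda>z. \<phi> m z - \<phi> n z) < e"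
    show "Vcauchy \<gamma> \<phi>" unfolding Vcauchy_def
    proof (intro allI impI)
      fix e :: real assume "e > 0"
      then obtain N where N: "\<forall>m\<ge>N. \<forall>n\<ge>N. Vnorm2 \<gamma> (\<lambda>z. \<phi> m z - \<phi> n z) < e\<^sup>2" using L by (meson zero_less_power)
      have "vn \<gamma> (\<lambda>z. \<phi> m z - \<phi> n z) < e" if "m \<ge> N" "n \<ge> N" for m n
        using N that \<open>e > 0\<close> by (intro power2_less_imp_less[of _ e]) (auto simp: Vnorm2_Vip vn_sq)
      then show "\<exists>N. \<forall>m\<ge>N. \<forall>n\<ge>N. vn \<gamma> (\<lambda>z. \<phi> m z - \<phi> n z) < e" by blast
    qed
  next
    assume R: "Vcauchy \<gamma> \<phi>"
    show "\<forall>e>0. \<exists>N. \<forall>m\<ge>N. \<forall>n\<ge>N. Vnorm2 \<gamma> (\<lambda>z. \<phi> m z - \<phi> n z) < e"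
    proof (intro allI impI)
      fix e :: real assume "e > 0"
      then obtain N where N: "\<forall>m\<ge>N. \<forall>n\<ge>N. vn \<gamma> (\<lambda>z. \<phi> m z - \<phi> n z) < sqrt e" 
        using R unfolding Vcauchy_def by (meson real_sqrt_gt_zero)
      have "Vnorm2 \<gamma> (\<lambda>z. \<phi> m z - \<phi> n z) < e" if "m \<ge> N" "n \<ge> N" for m n
        using N that by (simp add: Vnorm2_Vip vn_def)
      then show "\<exists>N. \<forall>m\<ge>N. \<forall>n\<ge>N. Vnorm2 \<gamma> (\<lambda>z. \<phi> m z - \<phi> n z) < e" by blast
    qed
  qed
  moreover have "((\<lambda>k. L2dist2 (\<phi> k) f) \<longlonglongrightarrow> 0) \<longleftrightarrow> (\<lambda>k. n2 MO (\<lambda>z. \<phi> k z - f z)) \<longlonglongrightarrow> 0"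
  proof
    assume "(\<lambda>k. L2dist2 (\<phi> k) f) \<longlonglongrightarrow> 0"
    from tendsto_real_sqrt[OF this] show "(\<lambda>k. n2 MO (\<lambda>z. \<phi> k z - f z)) \<longlonglongrightarrow> 0" by (simp add: L2dist2_eq)
  next
    assume "(\<lambda>k. n2 MO (\<lambda>z. \<phi> k z - f z)) \<longlonglongrightarrow> 0"
    from tendsto_power[OF this, of 2] show "(\<lambda>k. L2dist2 (\<phi> k) f) \<longlonglongrightarrow> 0" by (simp add: L2dist2_eq)
  qed
  ultimately show ?thesis by (auto simp: approx_seq_def)
qed

lemma integral_mult_tendsto:
  assumes "sqi MO h" "\<And>k. sqi MO (\<phi> k)" "sqi MO f" "((\<lambda>k. n2 MO (\<lambda>z. \<phi> k z - f z)) \<longlongrightarrow> 0) F"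
  shows "((\<lambda>k. \<integral>z. \<phi> k z * h z \<partial>MO) \<longlongrightarrow> (\<integral>z. f z * h z \<partial>MO)) F"
proof -
  have "((\<lambda>k. (\<integral>z. \<phi> k z * h z \<partial>MO) - (\<integral>z. f z * h z \<partial>MO)) \<longlongrightarrow> 0) F"
  proof (rule Lim_null_comparison)
    show "\<forall>\<^sub>F k in F. norm ((\<integral>z. \<phi> k z * h z \<partial>MO) - (\<integral>z. f z * h z \<partial>MO)) \<le> n2 MO (\<lambda>z. \<phi> k z - f z) * n2 MO h"
    proof (rule always_eventually, rule allI)
      fix k
      have "(\<integral>z. \<phi> k z * h z \<partial>MO) - (\<integral>z. f z * h z \<partial>MO) = (\<integral>z. (\<phi> k z - f z) * h z \<partial>MO)"
        using sqi_integrable_mult[OF assms(2,1)] sqi_integrable_mult[OF assms(3,1)]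
        by (simp add: left_diff_distrib)
      then show "norm ((\<integral>z. \<phi> k z * h z \<partial>MO) - (\<integral>z. f z * h z \<partial>MO)) \<le> n2 MO (\<lambda>z. \<phi> k z - f z) * n2 MO h"
        using cauchy_schwarz_integral[OF sqi_diff[OF assms(2,3)] assms(1)] by simp
    qed
    show "((\<lambda>k. n2 MO (\<lambda>z. \<phi> k z - f z) * n2 MO h) \<longlongrightarrow> 0) F" using tendsto_mult_left_zero[OF assms(4)] by simp
  qed
  then show ?thesis by (simp add: LIM_zero_iff)
qed

lemma test_fun_sqi: "test_fun f \<Longrightarrow> sqi MO f"
  by (rule continuous_sqi, rule Ck_continuous, rule test_fun_Ck)

lemma Vcauchy_bounded:
  assumes "\<gamma> > 0" "\<And>k. Ck 1 (\<phi> k)" "Vcauchy \<gamma> \<phi>" shows "\<exists>B. 0 \<le> B \<and> (\<forall>k. vn \<gamma> (\<phi> k) \<le> B)"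
proof -
  obtain N where N: "\<And>m n. m \<ge> N \<Longrightarrow> n \<ge> N \<Longrightarrow> vn \<gamma> (\<lambda>z. \<phi> m z - \<phi> n z) < 1"
    using assms(3) unfolding Vcauchy_def by (meson zero_less_one)
  define B where "B = 1 + (\<Sum>k\<le>N. vn \<gamma> (\<phi> k))"
  have le: "vn \<gamma> (\<phi> k) \<le> (\<Sum>k\<le>N. vn \<gamma> (\<phi> k))" if "k \<le> N" for k
    by (rule member_le_sum[where f = "\<lambda>k. vn \<gamma> (\<phi> k)"]) (use that in auto)
  have "vn \<gamma> (\<phi> k) \<le> B" for k
  proof (cases "k \<le> N")
    case True then show ?thesis using le unfolding B_def by fastforce
  next
    case False
    then have "vn \<gamma> (\<phi> k) \<le> 1 + vn \<gamma> (\<phi> N)" using vn_bound_diff[OF assms(1,2,2), of k N] N[of k N] by linarith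
    then show ?thesis using le[of N] by (simp add: B_def)
  qed
  moreover have "0 \<le> B" by (simp add: B_def sum_nonneg)
  ultimately show ?thesis by blast
qed

text \<open>For fixed k, integration by parts turns Vip (delta_m) (delta_k) into a pairing of
  delta_m with a fixed L^2 function, which tends to 0 as m grows. The remaining term Vip (delta_k)
  (delta_k - delta_m) is small by the Cauchy property. This is what lets the completion V sit inside
  L^2.\<close>

lemma form_closable:
  assumes g: "\<gamma> > 0" and t: "\<And>k. test_fun (\<delta> k)" and c: "Vcauchy \<gamma> \<delta>" and z: "(\<lambda>k. n2 MO (\<delta> k)) \<longlonglongrightarrow> 0"
  shows "(\<lambda>k. vn \<gamma> (\<delta> k)) \<longlonglongrightarrow> 0"
proof (rule LIMSEQ_I)
  fix e :: real assume "e > 0"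
  then obtain N where N: "\<And>m n. m \<ge> N \<Longrightarrow> n \<ge> N \<Longrightarrow> vn \<gamma> (\<lambda>z. \<delta> m z - \<delta> n z) < e/2"
    using c unfolding Vcauchy_def by (meson half_gt_zero)
  have C1: "Ck 1 (\<delta> k)" for k by (rule test_fun_Ck[OF t])
  have "vn \<gamma> (\<delta> k) \<le> e/2" if k: "k \<ge> N" for k
  proof -
    have "(\<lambda>m. \<integral>z. \<delta> m z * Lop \<gamma> (\<delta> k) z \<partial>MO) \<longlonglongrightarrow> (\<integral>z. 0 * Lop \<gamma> (\<delta> k) z \<partial>MO)"
      by (rule integral_mult_tendsto) (use z test_fun_sqi[OF t] continuous_sqi[OF continuous_Lop[OF g test_fun_Ck[OF t]]] in \<open>auto simp: sqi_def\<close>)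
    then have l: "(\<lambda>m. Vip \<gamma> (\<delta> m) (\<delta> k)) \<longlonglongrightarrow> 0"
      using tendsto_minus[where a = "0::real"] by (auto simp: Vip_by_parts[OF g t test_fun_Ck[OF t]] dest: tendsto_minus)
    have "(vn \<gamma> (\<delta> k))\<^sup>2 \<le> vn \<gamma> (\<delta> k) * (e/2)"
    proof (rule tendsto_lowerbound)
      show "(\<lambda>m. vn \<gamma> (\<delta> k) * (e/2) + Vip \<gamma> (\<delta> m) (\<delta> k)) \<longlonglongrightarrow> vn \<gamma> (\<delta> k) * (e/2)"
        using tendsto_add[OF tendsto_const l] by simp
      show "\<forall>\<^sub>F m in sequentially. (vn \<gamma> (\<delta> k))\<^sup>2 \<le> vn \<gamma> (\<delta> k) * (e/2) + Vip \<gamma> (\<delta> m) (\<delta> k)"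
      proof (rule eventually_sequentiallyI)
        fix m assume m: "m \<ge> N"
        have "(vn \<gamma> (\<delta> k))\<^sup>2 = Vip \<gamma> (\<delta> k) (\<lambda>z. \<delta> k z - \<delta> m z) + Vip \<gamma> (\<delta> m) (\<delta> k)"
          using Vip_diff2[OF g C1 C1 C1] by (simp add: vn_sq Vip_sym)
        also have "Vip \<gamma> (\<delta> k) (\<lambda>z. \<delta> k z - \<delta> m z) \<le> vn \<gamma> (\<delta> k) * vn \<gamma> (\<lambda>z. \<delta> k z - \<delta> m z)"
          using Vip_cauchy_schwarz[OF g C1 Ck_diff[OF C1 C1]] by (meson abs_le_D1)
        also have "\<dots> \<le> vn \<gamma> (\<delta> k) * (e/2)" using N[OF k m] by (intro mult_left_mono) auto
        finally show "(vn \<gamma> (\<delta> k))\<^sup>2 \<le> vn \<gamma> (\<delta> k) * (e/2) + Vip \<gamma> (\<delta> m) (\<delta> k)" by simp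
      qed
    qed simp
    then show ?thesis using \<open>e > 0\<close> vn_nonneg[of \<gamma> "\<delta> k"]
      by (cases "vn \<gamma> (\<delta> k) = 0") (auto simp: power2_eq_square simp del: vn_nonneg)
  qed
  then show "\<exists>no. \<forall>n\<ge>no. norm (vn \<gamma> (\<delta> n) - 0) < e" using \<open>e > 0\<close> by (intro exI[of _ N]) fastforce
qed

lemma Vcauchy_diff:
  assumes g: "\<gamma> > 0" "\<And>k. Ck 1 (\<phi> k)" "\<And>k. Ck 1 (\<psi> k)" and c: "Vcauchy \<gamma> \<phi>" "Vcauchy \<gamma> \<psi>"
  shows "Vcauchy \<gamma> (\<lambda>k z. \<phi> k z - \<psi> k z)"
  unfolding Vcauchy_def
proof (intro allI impI)
  fix e :: real assume "e > 0"
  obtain N1 where 1: "\<And>m n. m \<ge> N1 \<Longrightarrow> n \<ge> N1 \<Longrightarrow> vn \<gamma> (\<lambda>z. \<phi> m z - \<phi> n z) < e/2"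
    using c(1) \<open>e > 0\<close> unfolding Vcauchy_def by (meson half_gt_zero)
  obtain N2 where 2: "\<And>m n. m \<ge> N2 \<Longrightarrow> n \<ge> N2 \<Longrightarrow> vn \<gamma> (\<lambda>z. \<psi> m z - \<psi> n z) < e/2"
    using c(2) \<open>e > 0\<close> unfolding Vcauchy_def by (meson half_gt_zero)
  have "vn \<gamma> (\<lambda>z. (\<phi> m z - \<psi> m z) - (\<phi> n z - \<psi> n z)) < e" if "m \<ge> max N1 N2" "n \<ge> max N1 N2" for m n
  proof -
    have "(\<lambda>z. (\<phi> m z - \<psi> m z) - (\<phi> n z - \<psi> n z)) = (\<lambda>z. (\<phi> m z - \<phi> n z) - (\<psi> m z - \<psi> n z))" by auto
    then have "vn \<gamma> (\<lambda>z. (\<phi> m z - \<psi> m z) - (\<phi> n z - \<psi> n z)) \<le> vn \<gamma> (\<lambda>z. \<phi> m z - \<phi> n z) + vn \<gamma> (\<lambda>z. \<psi> m z - \<psi> n z)"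
      using vn_triangle_diff[OF g(1) Ck_diff[OF g(2,2)] Ck_diff[OF g(3,3)]] by simp
    then show ?thesis using 1[of m n] 2[of m n] that by simp
  qed
  then show "\<exists>N. \<forall>m\<ge>N. \<forall>n\<ge>N. vn \<gamma> (\<lambda>z. (\<phi> m z - \<psi> m z) - (\<phi> n z - \<psi> n z)) < e" by blast
qed

text \<open>Closability applied to the difference of two approximating sequences; it makes the value
  of the extended form independent of the chosen sequences.\<close>

lemma approx_seq_unique:
  assumes g: "\<gamma> > 0" "sqi MO f" and a: "approx_seq \<gamma> \<phi> f" "approx_seq \<gamma> \<psi> f"
  shows "(\<lambda>k. vn \<gamma> (\<lambda>z. \<phi> k z - \<psi> k z)) \<longlonglongrightarrow> 0"
proof (rule form_closable[OF g(1)])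
  have t: "\<And>k. test_fun (\<phi> k)" "\<And>k. test_fun (\<psi> k)" using a by (auto simp: approx_seq_iff)
  show "test_fun (\<lambda>z. \<phi> k z - \<psi> k z)" for k using t by (intro test_fun_diff)
  show "Vcauchy \<gamma> (\<lambda>k z. \<phi> k z - \<psi> k z)"
    by (rule Vcauchy_diff[OF g(1)]) (use a t in \<open>auto simp: approx_seq_iff intro: test_fun_Ck simp del: Ck.simps\<close>)
  show "(\<lambda>k. n2 MO (\<lambda>z. \<phi> k z - \<psi> k z)) \<longlonglongrightarrow> 0"
  proof (rule tendsto_sandwich[OF _ _ tendsto_const])
    show "(\<lambda>k. n2 MO (\<lambda>z. \<phi> k z - f z) + n2 MO (\<lambda>z. \<psi> k z - f z)) \<longlonglongrightarrow> 0"
      using a by (auto simp: approx_seq_iff intro!: tendsto_add_zero)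
    show "\<forall>\<^sub>F k in sequentially. n2 MO (\<lambda>z. \<phi> k z - \<psi> k z) \<le> n2 MO (\<lambda>z. \<phi> k z - f z) + n2 MO (\<lambda>z. \<psi> k z - f z)"
    proof (rule always_eventually, rule allI)
      fix k
      have s: "sqi MO (\<lambda>z. \<phi> k z - f z)" "sqi MO (\<lambda>z. \<psi> k z - f z)" using t g by (auto intro: sqi_diff test_fun_sqi)
      show "n2 MO (\<lambda>z. \<phi> k z - \<psi> k z) \<le> n2 MO (\<lambda>z. \<phi> k z - f z) + n2 MO (\<lambda>z. \<psi> k z - f z)"
        using n2_triangle[OF s(1) sqi_cmult[OF s(2), of "-1"]] n2_cmult[of MO "-1" "\<lambda>z. \<psi> k z - f z"]
        by simp
    qed
  qed simp
qed

lemma Vip_seq_diff: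
  assumes g: "\<gamma> > 0" and c: "Ck 1 f" "Ck 1 g" "Ck 1 f'" "Ck 1 g'" and b: "vn \<gamma> g \<le> B" "vn \<gamma> f' \<le> B"
  shows "\<bar>Vip \<gamma> f g - Vip \<gamma> f' g'\<bar> \<le> B * (vn \<gamma> (\<lambda>z. f z - f' z) + vn \<gamma> (\<lambda>z. g z - g' z))"
proof -
  have "Vip \<gamma> f g - Vip \<gamma> f' g' = Vip \<gamma> (\<lambda>z. f z - f' z) g + Vip \<gamma> f' (\<lambda>z. g z - g' z)"
    using g c by (simp add: Vip_diff1 Vip_diff2)
  also have "\<bar>\<dots>\<bar> \<le> vn \<gamma> (\<lambda>z. f z - f' z) * vn \<gamma> g + vn \<gamma> f' * vn \<gamma> (\<lambda>z. g z - g' z)"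
    using Vip_cauchy_schwarz[OF g Ck_diff[OF c(1,3)] c(2)] Vip_cauchy_schwarz[OF g c(3) Ck_diff[OF c(2,4)]] by linarith
  also have "\<dots> \<le> vn \<gamma> (\<lambda>z. f z - f' z) * B + B * vn \<gamma> (\<lambda>z. g z - g' z)"
    by (intro add_mono mult_left_mono mult_right_mono b) auto
  finally show ?thesis by (simp add: algebra_simps)
qed

text \<open>Shows that the \<open>THE\<close> in \<open>aV\<close> denotes: the values along one
  pair of sequences are Cauchy because V-Cauchy sequences are bounded, and any other pair has the
  same limit by \<open>approx_seq_unique\<close>.\<close>

lemma aV_limit:
  assumes g: "\<gamma> > 0" "sqi MO f" "sqi MO h" and a: "approx_seq \<gamma> \<phi> f" "approx_seq \<gamma> \<psi> h"
  shows "(\<lambda>k. Vip \<gamma> (\<phi> k) (\<psi> k)) \<longlonglongrightarrow> - aV \<gamma> f h"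
proof -
  have t: "\<And>k. Ck 1 (\<phi> k)" "\<And>k. Ck 1 (\<psi> k)" using a by (auto simp: approx_seq_iff intro: test_fun_Ck simp del: Ck.simps)
  obtain B1 where B1: "0 \<le> B1" "\<And>k. vn \<gamma> (\<phi> k) \<le> B1" using Vcauchy_bounded[of \<gamma> \<phi>, OF g(1) t(1)] a by (auto simp: approx_seq_iff)
  obtain B2 where B2: "0 \<le> B2" "\<And>k. vn \<gamma> (\<psi> k) \<le> B2" using Vcauchy_bounded[of \<gamma> \<psi>, OF g(1) t(2)] a by (auto simp: approx_seq_iff)
  define B where "B = B1 + B2 + 1"
  have B: "B > 0" "\<And>k. vn \<gamma> (\<phi> k) \<le> B" "\<And>k. vn \<gamma> (\<psi> k) \<le> B"
    unfolding B_def using B1(1) B2(1) B1(2) B2(2) by (linarith, smt (verit), smt (verit))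
  have "Cauchy (\<lambda>k. Vip \<gamma> (\<phi> k) (\<psi> k))"
  proof (rule metric_CauchyI)
    fix e :: real assume e: "e > 0"
    then have "e/(2*B) > 0" using B by simp
    then obtain N1 N2 where 1: "\<And>m n. m \<ge> N1 \<Longrightarrow> n \<ge> N1 \<Longrightarrow> vn \<gamma> (\<lambda>z. \<phi> m z - \<phi> n z) < e/(2*B)"
       and 2: "\<And>m n. m \<ge> N2 \<Longrightarrow> n \<ge> N2 \<Longrightarrow> vn \<gamma> (\<lambda>z. \<psi> m z - \<psi> n z) < e/(2*B)"
      using a unfolding approx_seq_iff Vcauchy_def by meson
    have "dist (Vip \<gamma> (\<phi> m) (\<psi> m)) (Vip \<gamma> (\<phi> n) (\<psi> n)) < e" if "m \<ge> max N1 N2" "n \<ge> max N1 N2" for m n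
    proof -
      have "\<bar>Vip \<gamma> (\<phi> m) (\<psi> m) - Vip \<gamma> (\<phi> n) (\<psi> n)\<bar> \<le> B * (vn \<gamma> (\<lambda>z. \<phi> m z - \<phi> n z) + vn \<gamma> (\<lambda>z. \<psi> m z - \<psi> n z))"
        by (rule Vip_seq_diff[OF g(1) t t B(3) B(2)])
      also have "\<dots> < B * (e/(2*B) + e/(2*B))"
        by (rule mult_strict_left_mono[OF _ B(1)]) (use 1[of m n] 2[of m n] that in auto)
      also have "\<dots> = e" using B by (simp add: field_simps)
      finally show ?thesis by (simp add: dist_real_def)
    qed
    then show "\<exists>M. \<forall>m\<ge>M. \<forall>n\<ge>M. dist (Vip \<gamma> (\<phi> m) (\<psi> m)) (Vip \<gamma> (\<phi> n) (\<psi> n)) < e" by blast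
  qed
  then obtain c where c: "(\<lambda>k. Vip \<gamma> (\<phi> k) (\<psi> k)) \<longlonglongrightarrow> c" using Cauchy_convergent convergent_def by blast
  have oth: "(\<lambda>k. Vip \<gamma> (\<phi>' k) (\<psi>' k)) \<longlonglongrightarrow> c" if a': "approx_seq \<gamma> \<phi>' f" "approx_seq \<gamma> \<psi>' h" for \<phi>' \<psi>'
  proof -
    have t': "\<And>k. Ck 1 (\<phi>' k)" "\<And>k. Ck 1 (\<psi>' k)" using a' by (auto simp: approx_seq_iff intro: test_fun_Ck simp del: Ck.simps)
    obtain B' where B': "0 \<le> B'" "\<And>k. vn \<gamma> (\<phi>' k) \<le> B'" using Vcauchy_bounded[of \<gamma> \<phi>', OF g(1) t'(1)] a' by (auto simp: approx_seq_iff)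
    have "(\<lambda>k. Vip \<gamma> (\<phi> k) (\<psi> k) - Vip \<gamma> (\<phi>' k) (\<psi>' k)) \<longlonglongrightarrow> 0"
    proof (rule Lim_null_comparison[OF always_eventually], rule allI)
      show "norm (Vip \<gamma> (\<phi> k) (\<psi> k) - Vip \<gamma> (\<phi>' k) (\<psi>' k)) \<le> (B + B') * (vn \<gamma> (\<lambda>z. \<phi> k z - \<phi>' k z) + vn \<gamma> (\<lambda>z. \<psi> k z - \<psi>' k z))" for k
        using Vip_seq_diff[OF g(1) t t', where B = "B+B'"] B(1) B(3)[of k] B'(1) B'(2)[of k] by simp
      show "(\<lambda>k. (B + B') * (vn \<gamma> (\<lambda>z. \<phi> k z - \<phi>' k z) + vn \<gamma> (\<lambda>z. \<psi> k z - \<psi>' k z))) \<longlonglongrightarrow> 0"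
        using approx_seq_unique[OF g(1,2) a(1) a'(1)] approx_seq_unique[OF g(1,3) a(2) a'(2)]
        by (auto intro!: tendsto_eq_intros)
    qed
    from tendsto_diff[OF c this] show ?thesis by simp
  qed
  have "aV \<gamma> f h = - c" unfolding aV_def aform_Vip
  proof (rule the_equality)
    show "\<forall>\<phi> \<psi>. approx_seq \<gamma> \<phi> f \<longrightarrow> approx_seq \<gamma> \<psi> h \<longrightarrow> (\<lambda>k. - Vip \<gamma> (\<phi> k) (\<psi> k)) \<longlonglongrightarrow> - c"
      using oth tendsto_minus by blast
    fix c' assume "\<forall>\<phi> \<psi>. approx_seq \<gamma> \<phi> f \<longrightarrow> approx_seq \<gamma> \<psi> h \<longrightarrow> (\<lambda>k. - Vip \<gamma> (\<phi> k) (\<psi> k)) \<longlonglongrightarrow> c'"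
    then have "(\<lambda>k. - Vip \<gamma> (\<phi> k) (\<psi> k)) \<longlonglongrightarrow> c'" using a by blast
    with tendsto_minus[OF c] show "c' = - c" using LIMSEQ_unique by blast
  qed
  then show ?thesis using c by simp
qed

text \<open>Replacing \<open>\<psi> k\<close> by the C^2 function e costs only the V-norm of their
  difference; then parts can be integrated since each \<open>\<phi> k\<close> is a test function.
  The second claim is exported for \<open>A_op_Qf_limit\<close>, where the two arguments reach their
  limits one after the other.\<close>

lemma aV_smooth:
  assumes g: "\<gamma> > 0" "sqi MO f" "Ck 2 e" and a: "approx_seq \<gamma> \<phi> f" "approx_seq \<gamma> \<psi> e"
    and s: "(\<lambda>k. vn \<gamma> (\<lambda>z. \<psi> k z - e z)) \<longlonglongrightarrow> 0"
  shows "aV \<gamma> f e = (\<integral>z. f z * Lop \<gamma> e z \<partial>MO)"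
    and "(\<lambda>k. Vip \<gamma> (\<phi> k) e) \<longlonglongrightarrow> - aV \<gamma> f e"
proof -
  have t: "\<And>k. test_fun (\<phi> k)" using a by (auto simp: approx_seq_iff)
  have C1: "\<And>k. Ck 1 (\<phi> k)" "\<And>k. Ck 1 (\<psi> k)" using a by (auto simp: approx_seq_iff intro: test_fun_Ck simp del: Ck.simps)
  have e1: "Ck 1 e" using Ck_mono[OF _ g(3), of 1] by simp
  obtain B where B: "0 \<le> B" "\<And>k. vn \<gamma> (\<phi> k) \<le> B" using Vcauchy_bounded[of \<gamma> \<phi>, OF g(1) C1(1)] a by (auto simp: approx_seq_iff)
  have 1: "(\<lambda>k. Vip \<gamma> (\<phi> k) (\<psi> k)) \<longlonglongrightarrow> - aV \<gamma> f e"
    by (rule aV_limit[OF g(1,2) continuous_sqi[OF Ck_continuous[OF g(3)]] a])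
  have "(\<lambda>k. Vip \<gamma> (\<phi> k) (\<psi> k) - Vip \<gamma> (\<phi> k) e) \<longlonglongrightarrow> 0"
  proof (rule Lim_null_comparison[OF always_eventually], rule allI)
    fix k
    have "\<bar>Vip \<gamma> (\<phi> k) (\<psi> k) - Vip \<gamma> (\<phi> k) e\<bar> \<le> vn \<gamma> (\<phi> k) * vn \<gamma> (\<lambda>z. \<psi> k z - e z)"
      using Vip_cauchy_schwarz[OF g(1) C1(1) Ck_diff[OF C1(2) e1]] Vip_diff2[OF g(1) C1(2) e1 C1(1)] by simp
    also have "\<dots> \<le> B * vn \<gamma> (\<lambda>z. \<psi> k z - e z)" by (intro mult_right_mono B) auto
    finally show "norm (Vip \<gamma> (\<phi> k) (\<psi> k) - Vip \<gamma> (\<phi> k) e) \<le> B * vn \<gamma> (\<lambda>z. \<psi> k z - e z)" by simp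
  next
    show "(\<lambda>k. B * vn \<gamma> (\<lambda>z. \<psi> k z - e z)) \<longlonglongrightarrow> 0" using tendsto_mult_right_zero[OF s] by simp
  qed
  from tendsto_diff[OF 1 this] show 2: "(\<lambda>k. Vip \<gamma> (\<phi> k) e) \<longlonglongrightarrow> - aV \<gamma> f e" by simp
  have "(\<lambda>k. \<integral>z. \<phi> k z * Lop \<gamma> e z \<partial>MO) \<longlonglongrightarrow> (\<integral>z. f z * Lop \<gamma> e z \<partial>MO)"
    by (rule integral_mult_tendsto) (use a test_fun_sqi[OF t] g continuous_sqi[OF continuous_Lop[OF g(1,3)]] in \<open>auto simp: approx_seq_iff\<close>)
  from tendsto_minus[OF this] have "(\<lambda>k. Vip \<gamma> (\<phi> k) e) \<longlonglongrightarrow> - (\<integral>z. f z * Lop \<gamma> e z \<partial>MO)"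
    by (simp add: Vip_by_parts[OF g(1) t g(3)])
  from LIMSEQ_unique[OF 2 this] show "aV \<gamma> f e = (\<integral>z. f z * Lop \<gamma> e z \<partial>MO)" by simp
qed


section \<open>Tensor products in the form domain\<close>

lemma smooth_cutoffs:
  "\<exists>\<xi>. (\<forall>k. smooth1 (\<xi> k)) \<and> (\<forall>k x. 0 \<le> \<xi> k x \<and> \<xi> k x \<le> (1::real)) \<and>
     (\<forall>k x. x \<notin> {\<alpha> + 1 / real (Suc k)..\<beta> - 1 / real (Suc k)} \<longrightarrow> \<xi> k x = 0) \<and>
     (\<forall>x\<in>{\<alpha><..<\<beta>}. (\<lambda>k. \<xi> k x) \<longlonglongrightarrow> 1)"
proof -
  obtain H :: "real \<Rightarrow> real" where H: "smooth1 H" "\<And>x. x \<le> 0 \<Longrightarrow> H x = 0" "\<And>x. x \<ge> 1 \<Longrightarrow> H x = 1" "\<And>x. 0 \<le> H x \<and> H x \<le> 1"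
    using ex_smooth_step by blast
  \<comment> \<open>The first argument is (k+1)(x - alpha) - 1, so the ramp at the left end occupies
    [alpha + 1/(k+1), alpha + 2/(k+1)]; the second factor mirrors it at beta.\<close>
  define \<xi> where "\<xi> k x = H (real (Suc k) * x + (- real (Suc k) * \<alpha> - 1)) * H (- real (Suc k) * x + (real (Suc k) * \<beta> - 1))" for k x
  have 1: "smooth1 (\<xi> k)" for k unfolding \<xi>_def[abs_def] by (intro smooth1_mult smooth1_affine H)
  have 2: "0 \<le> \<xi> k x \<and> \<xi> k x \<le> 1" for k x unfolding \<xi>_def using H(4) by (simp add: mult_le_one)
  have 3: "\<xi> k x = 0" if "x \<notin> {\<alpha> + 1 / real (Suc k)..\<beta> - 1 / real (Suc k)}" for k x
  proof -
    have "x < \<alpha> + 1 / real (Suc k) \<or> x > \<beta> - 1 / real (Suc k)" using that by auto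
    then have "real (Suc k) * (x - \<alpha>) < 1 \<or> real (Suc k) * (\<beta> - x) < 1"
      by (auto simp: field_simps)
    then have "real (Suc k) * x + (- real (Suc k) * \<alpha> - 1) \<le> 0 \<or> - real (Suc k) * x + (real (Suc k) * \<beta> - 1) \<le> 0"
      by (auto simp: algebra_simps)
    then show ?thesis unfolding \<xi>_def using H(2) by auto
  qed
  have 4: "(\<lambda>k. \<xi> k x) \<longlonglongrightarrow> 1" if x: "x \<in> {\<alpha><..<\<beta>}" for x
  proof (rule tendsto_eventually)
    define m where "m = min (x - \<alpha>) (\<beta> - x)"
    have m: "m > 0" using x by (simp add: m_def)
    obtain K where K: "real K > 2 / m" using reals_Archimedean2 by blast
    show "\<forall>\<^sub>F k in sequentially. \<xi> k x = 1"
    proof (rule eventually_sequentiallyI)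
      fix k assume "k \<ge> K"
      then have "real (Suc k) > 2 / m" using K by linarith
      then have r: "real (Suc k) * m \<ge> 2" using m by (simp add: field_simps)
      have "real (Suc k) * m \<le> real (Suc k) * (x - \<alpha>)" "real (Suc k) * m \<le> real (Suc k) * (\<beta> - x)"
        by (auto simp: m_def intro!: mult_left_mono)
      then have "real (Suc k) * (x - \<alpha>) \<ge> 2" "real (Suc k) * (\<beta> - x) \<ge> 2" using r by linarith+
      then have "real (Suc k) * x + (- real (Suc k) * \<alpha> - 1) \<ge> 1" "- real (Suc k) * x + (real (Suc k) * \<beta> - 1) \<ge> 1"
        by (auto simp: algebra_simps)
      then show "\<xi> k x = 1" unfolding \<xi>_def using H(3) by simp
    qed
  qed
  show ?thesis using 1 2 3 4 by blast
qed

lemma DERIV_zero_const_interval: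
  assumes "\<And>x. (F has_real_derivative f x) (at x)" "\<And>u. min x y \<le> u \<Longrightarrow> u \<le> max x y \<Longrightarrow> f u = 0"
  shows "F x = (F y :: real)"
proof -
  have cst: "F a = F b" if ab: "a \<le> b" and f0: "\<And>u. a \<le> u \<Longrightarrow> u \<le> b \<Longrightarrow> f u = 0" for a b
  proof (rule antisym)
    have "\<exists>y. (F has_real_derivative y) (at u) \<and> y = 0" if u: "a \<le> u" "u \<le> b" for u
      using assms(1)[of u] f0[OF u] by auto
    then show "F a \<le> F b" "F b \<le> F a"
      using DERIV_nonneg_imp_nondecreasing[OF ab, of F] DERIV_nonpos_imp_nonincreasing[OF ab, of F] by force+
  qed
  show ?thesis
  proof (cases "x \<le> y")
    case True
    then show ?thesis by (intro cst) (use assms(2) in simp_all)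
  next
    case False
    then have "F y = F x" by (intro cst) (use assms(2) in simp_all)
    then show ?thesis by simp
  qed
qed

lemma has_integral_deriv_Ioo:
  assumes "\<And>x. (F has_real_derivative f x) (at x)" "a \<le> b"
  shows "(f has_integral (F b - F a)) {a<..<b::real}"
  using fundamental_theorem_of_calculus[OF assms(2), of F f] assms(1)
  by (auto simp: has_real_derivative_iff_has_vector_derivative has_integral_Icc_iff_Ioo intro: has_vector_derivative_at_within)

text \<open>The derivative $p'$ is approximated by cut-off polynomials, corrected by a multiple of a fixed bump so that
  their primitives again vanish at both ends.\<close>

lemma H01_approx:
  assumes ab: "\<alpha> < \<beta>" and d: "\<And>x. (p has_real_derivative p' x) (at x)" and c: "continuous_on UNIV p'"
    and z: "p \<alpha> = 0" "p \<beta> = (0::real)"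
  shows "\<exists>P P' B. (\<forall>k. smooth1 (P k)) \<and> (\<forall>k x. (P k has_real_derivative P' k x) (at x)) \<and>
     (\<forall>k. continuous_on UNIV (P' k)) \<and>
     (\<forall>k. \<exists>e>0. \<forall>x. x \<notin> {\<alpha> + e..\<beta> - e} \<longrightarrow> P k x = 0) \<and>
     (\<forall>k. \<forall>x\<in>{\<alpha><..<\<beta>}. \<bar>P k x\<bar> \<le> B \<and> \<bar>P' k x\<bar> \<le> B) \<and>
     (\<forall>x\<in>{\<alpha><..<\<beta>}. (\<lambda>k. P k x) \<longlonglongrightarrow> p x \<and> (\<lambda>k. P' k x) \<longlonglongrightarrow> p' x)"
proof -
  obtain \<xi> where \<xi>: "\<And>k. smooth1 (\<xi> k)" "\<And>k x. 0 \<le> \<xi> k x \<and> \<xi> k x \<le> (1::real)"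
     "\<And>k x. x \<notin> {\<alpha> + 1 / real (Suc k)..\<beta> - 1 / real (Suc k)} \<Longrightarrow> \<xi> k x = 0"
     "\<And>x. x\<in>{\<alpha><..<\<beta>} \<Longrightarrow> (\<lambda>k. \<xi> k x) \<longlonglongrightarrow> 1" using smooth_cutoffs[of \<alpha> \<beta>] by blast
  have "\<exists>q. real_polynomial_function q \<and> (\<forall>x\<in>{\<alpha>..\<beta>}. \<bar>p' x - q x\<bar> < 1 / real (Suc k))" for k
    using Stone_Weierstrass_real_polynomial_function[of "{\<alpha>..\<beta>}" p' "1 / real (Suc k)"]
       continuous_on_subset[OF c, of "{\<alpha>..\<beta>}"] by (metis compact_Icc of_nat_0_less_iff subset_UNIV zero_less_Suc zero_less_divide_1_iff)
  then obtain q where q: "\<And>k. real_polynomial_function (q k)" "\<And>k x. x \<in> {\<alpha>..\<beta>} \<Longrightarrow> \<bar>p' x - q k x\<bar> < 1 / real (Suc k)"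
    by metis
  define r where "r k x = \<xi> k x * q k x" for k x
  have rs: "smooth1 (r k)" for k unfolding r_def[abs_def] by (intro smooth1_mult \<xi> smooth1_polynomial q)
  have "\<exists>R. R \<alpha> = 0 \<and> (\<forall>x. (R has_real_derivative r k x) (at x))" for k
    by (rule ex_antiderivative[OF smooth1_continuous[OF rs]])
  then obtain R where R: "\<And>k. R k \<alpha> = 0" "\<And>k x. (R k has_real_derivative r k x) (at x)" by metis
  have "compact (p' ` {\<alpha>..\<beta>})" by (intro compact_continuous_image continuous_on_subset[OF c]) auto
  then obtain B0 where "\<forall>v \<in> p' ` {\<alpha>..\<beta>}. norm v \<le> B0" using compact_imp_bounded bounded_iff by blast
  then have B0: "\<And>x. x \<in> {\<alpha>..\<beta>} \<Longrightarrow> \<bar>p' x\<bar> \<le> B0" by auto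
  have B00: "0 \<le> B0" using B0[of \<alpha>] ab by auto
  have qb: "\<bar>q k x\<bar> \<le> B0 + 1" if "x \<in> {\<alpha>..\<beta>}" for k x
  proof -
    have "1 / real (Suc k) \<le> 1" by simp
    then show ?thesis using q(2)[OF that, of k] B0[OF that] by linarith
  qed
  have rb: "\<bar>r k x\<bar> \<le> B0 + 1" if "x \<in> {\<alpha>..\<beta>}" for k x
  proof -
    have "\<bar>r k x\<bar> = \<xi> k x * \<bar>q k x\<bar>" using \<xi>(2) by (simp add: r_def abs_mult)
    also have "\<dots> \<le> 1 * (B0 + 1)" by (intro mult_mono qb that) (use \<xi>(2) in auto)
    finally show ?thesis by simp
  qed
  have ql: "(\<lambda>k. q k x) \<longlonglongrightarrow> p' x" if "x \<in> {\<alpha>..\<beta>}" for x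
  proof -
    have "(\<lambda>k. q k x - p' x) \<longlonglongrightarrow> 0"
    proof (rule Lim_null_comparison[OF always_eventually], rule allI)
      show "norm (q k x - p' x) \<le> 1 / real (Suc k)" for k using q(2)[OF that, of k] by simp
      show "(\<lambda>k. 1 / real (Suc k)) \<longlonglongrightarrow> 0" by (rule LIMSEQ_Suc[OF lim_1_over_n])
    qed
    then show ?thesis by (simp add: LIM_zero_iff)
  qed
  have rl: "(\<lambda>k. r k x) \<longlonglongrightarrow> p' x" if "x \<in> {\<alpha><..<\<beta>}" for x
    unfolding r_def using tendsto_mult[OF \<xi>(4)[OF that] ql[of x]] that by auto
  have Rl: "(\<lambda>k. R k x) \<longlonglongrightarrow> p x" if x: "x \<in> {\<alpha>..\<beta>}" for x
  proof -
    have i: "(r k has_integral R k x) {\<alpha><..<x}" for k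
      using has_integral_deriv_Ioo[OF R(2), of \<alpha> x k] x R(1) by simp
    have j: "(p' has_integral p x) {\<alpha><..<x}"
      using has_integral_deriv_Ioo[OF d, of \<alpha> x] x z by simp
    have "(\<lambda>k. integral {\<alpha><..<x} (r k)) \<longlonglongrightarrow> integral {\<alpha><..<x} p'"
    proof (rule dominated_convergence(2)[where h = "\<lambda>_. B0 + 1"])
      show "r k integrable_on {\<alpha><..<x}" for k using i by blast
      show "(\<lambda>_. B0 + 1) integrable_on {\<alpha><..<x}"
        using integrable_const_ivl[of "B0+1" \<alpha> x] by (simp add: integrable_on_Icc_iff_Ioo)
      show "norm (r k u) \<le> B0 + 1" if "u \<in> {\<alpha><..<x}" for k u using rb[of u k] that x by auto
      show "(\<lambda>k. r k u) \<longlonglongrightarrow> p' u" if "u \<in> {\<alpha><..<x}" for u using rl[of u] that x by auto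
    qed
    then show ?thesis using integral_unique[OF i] integral_unique[OF j] by simp
  qed
  have Rb: "\<bar>R k x\<bar> \<le> (B0 + 1) * (\<beta> - \<alpha>)" if x: "x \<in> {\<alpha>..\<beta>}" for k x
  proof (cases "x = \<alpha>")
    case True then show ?thesis using R(1) B00 ab by simp
  next
    case False
    then have "\<alpha> < x" using x by simp
    then obtain u where u: "\<alpha> < u" "u < x" "R k x - R k \<alpha> = (x - \<alpha>) * r k u" using MVT2[of \<alpha> x "R k" "r k"] R(2) by blast
    have "\<bar>R k x\<bar> = (x - \<alpha>) * \<bar>r k u\<bar>" using u R(1) \<open>\<alpha> < x\<close> by (simp add: abs_mult)
    also have "\<dots> \<le> (\<beta> - \<alpha>) * (B0 + 1)" by (intro mult_mono rb) (use x u ab in auto)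
    finally show ?thesis by (simp add: mult.commute)
  qed
  \<comment> \<open>The correcting bump sits in the middle half of the interval, so subtracting a
    multiple of it leaves the function constant near both ends.\<close>
  define l where "l = (\<beta> - \<alpha>) / 4"
  have l: "l > 0" using ab by (simp add: l_def)
  define b where "b x = ef 1 0 (1 * x + (- (\<alpha> + l))) * ef 1 0 ((-1) * x + (\<beta> - l))" for x
  have bs: "smooth1 b" unfolding b_def[abs_def] by (intro smooth1_mult smooth1_affine smooth1_ef) auto
  have efb: "0 \<le> ef 1 0 u \<and> ef 1 0 u \<le> 1" for u by (auto simp: ef_0)
  have bb: "0 \<le> b x \<and> b x \<le> 1" for x unfolding b_def using efb by (simp add: mult_le_one)
  have b0: "b x = 0" if "x \<notin> {\<alpha> + l..\<beta> - l}" for x using that by (auto simp: b_def ef_0)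
  have bp: "b x > 0" if "x \<in> {\<alpha> + l<..<\<beta> - l}" for x using that by (auto simp: b_def ef_0)
  obtain A where A: "A \<alpha> = 0" "\<And>x. (A has_real_derivative b x) (at x)"
    using ex_antiderivative[OF smooth1_continuous[OF bs]] by blast
  have Am: "A x \<le> A y" if "x \<le> y" for x y
    using that A(2) bb by (intro DERIV_nonneg_imp_nondecreasing[of x y A]) auto
  have "A (\<alpha> + l) < A (\<beta> - l)"
    by (rule DERIV_pos_imp_increasing_open) (use A bp l in \<open>auto simp: l_def field_simps intro!: DERIV_continuous_on intro: has_field_derivative_at_within\<close>)
  then have Ab: "A \<beta> > 0" using Am[of \<alpha> "\<alpha> + l"] Am[of "\<beta> - l" \<beta>] A(1) l by simp
  \<comment> \<open>The coefficient tends to p(beta)/A(beta) = 0, so the correction that restores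
    the right end value disappears in the limit.\<close>
  define P where "P k x = R k x - (R k \<beta> / A \<beta>) * A x" for k x
  define P' where "P' k x = r k x - (R k \<beta> / A \<beta>) * b x" for k x
  have Pd: "(P k has_real_derivative P' k x) (at x)" for k x
    unfolding P_def[abs_def] P'_def by (intro DERIV_diff DERIV_cmult R A)
  have P's: "smooth1 (P' k)" for k
    using smooth1_add[OF rs smooth1_mult[OF smooth1_const[of "- (R k \<beta> / A \<beta>)"] bs], of k]
    by (simp add: P'_def[abs_def])
  have Ps: "smooth1 (P k)" for k by (rule smooth1_antideriv[OF P's Pd])
  have supp: "\<exists>e>0. \<forall>x. x \<notin> {\<alpha> + e..\<beta> - e} \<longrightarrow> P k x = 0" for k
  proof -
    define e where "e = min (1 / real (Suc k)) l"
    have e: "e > 0" "e \<le> l" using l by (auto simp: e_def)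
    have P'0: "P' k x = 0" if "x \<notin> {\<alpha> + e..\<beta> - e}" for x
    proof -
      have "x \<notin> {\<alpha> + 1 / real (Suc k)..\<beta> - 1 / real (Suc k)}" "x \<notin> {\<alpha> + l..\<beta> - l}"
        using that by (auto simp: e_def min_def split: if_splits)
      then show ?thesis unfolding P'_def r_def using \<xi>(3) b0 by simp
    qed
    have Pa: "P k \<alpha> = 0" using R A by (simp add: P_def)
    have Pb: "P k \<beta> = 0" using Ab by (simp add: P_def)
    have "P k x = 0" if "x \<notin> {\<alpha> + e..\<beta> - e}" for x
    proof (cases "x < \<alpha> + e")
      case True
      have "P k x = P k \<alpha>"
      proof (rule DERIV_zero_const_interval[OF Pd])
        fix u assume "u \<le> max x \<alpha>"
        then have "u < \<alpha> + e" using True e by auto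
        then show "P' k u = 0" by (intro P'0) auto
      qed
      then show ?thesis using Pa by simp
    next
      case False
      then have "x > \<beta> - e" using that by auto
      have "P k x = P k \<beta>"
      proof (rule DERIV_zero_const_interval[OF Pd])
        fix u assume "min x \<beta> \<le> u"
        then have "u > \<beta> - e" using \<open>x > \<beta> - e\<close> e by auto
        then show "P' k u = 0" by (intro P'0) auto
      qed
      then show ?thesis using Pb by simp
    qed
    then show ?thesis using e by blast
  qed
  define K where "K = (B0 + 1) * (\<beta> - \<alpha>)"
  have K0: "0 \<le> K" using B00 ab by (simp add: K_def)
  have cb: "\<bar>R k \<beta> / A \<beta>\<bar> \<le> K / A \<beta>" for k using Rb[of \<beta> k] Ab ab by (simp add: K_def divide_right_mono)
  have tri: "\<bar>u - v * w\<bar> \<le> \<bar>u\<bar> + \<bar>v\<bar> * w" if "0 \<le> w" for u v w :: real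
    using abs_triangle_ineq4[of u "v * w"] that by (simp add: abs_mult)
  define B where "B = (K + K) + (B0 + 1 + K / A \<beta>)"
  have "\<bar>P k x\<bar> \<le> B \<and> \<bar>P' k x\<bar> \<le> B" if x: "x \<in> {\<alpha><..<\<beta>}" for k x
  proof
    have A1: "0 \<le> A x" "A x \<le> A \<beta>" using Am[of \<alpha> x] Am[of x \<beta>] A(1) x by auto
    have "\<bar>P k x\<bar> \<le> \<bar>R k x\<bar> + \<bar>R k \<beta> / A \<beta>\<bar> * A x" unfolding P_def by (rule tri[OF A1(1)])
    also have "\<bar>R k \<beta> / A \<beta>\<bar> * A x \<le> (K / A \<beta>) * A \<beta>" by (intro mult_mono cb A1) (use K0 Ab A1 in auto)
    also have "(K / A \<beta>) * A \<beta> = K" using Ab by simp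
    finally have "\<bar>P k x\<bar> \<le> K + K" using Rb[of x k, folded K_def] x by auto
    moreover have "0 \<le> B0 + 1 + K / A \<beta>" using K0 Ab B00 by simp
    ultimately show "\<bar>P k x\<bar> \<le> B" by (simp add: B_def)
    have "\<bar>P' k x\<bar> \<le> \<bar>r k x\<bar> + \<bar>R k \<beta> / A \<beta>\<bar> * b x" unfolding P'_def by (rule tri) (use bb in auto)
    also have "\<bar>R k \<beta> / A \<beta>\<bar> * b x \<le> (K / A \<beta>) * 1" by (intro mult_mono cb) (use K0 Ab bb in auto)
    finally have "\<bar>P' k x\<bar> \<le> B0 + 1 + K / A \<beta>" using rb[of x k] x by auto
    then show "\<bar>P' k x\<bar> \<le> B" using K0 by (simp add: B_def)
  qed
  moreover have "(\<lambda>k. P k x) \<longlonglongrightarrow> p x \<and> (\<lambda>k. P' k x) \<longlonglongrightarrow> p' x" if x: "x \<in> {\<alpha><..<\<beta>}" for x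
  proof
    have cl: "(\<lambda>k. R k \<beta> / A \<beta>) \<longlonglongrightarrow> 0" using tendsto_divide[OF Rl[of \<beta>] tendsto_const[of "A \<beta>"]] ab Ab z by simp
    have "(\<lambda>k. P k x) \<longlonglongrightarrow> p x - 0 * A x" unfolding P_def
      by (intro tendsto_diff tendsto_mult cl tendsto_const Rl) (use x in auto)
    then show "(\<lambda>k. P k x) \<longlonglongrightarrow> p x" by simp
    have "(\<lambda>k. P' k x) \<longlonglongrightarrow> p' x - 0 * b x" unfolding P'_def
      by (intro tendsto_diff tendsto_mult cl tendsto_const rl x)
    then show "(\<lambda>k. P' k x) \<longlonglongrightarrow> p' x" by simp
  qed
  ultimately show ?thesis using Ps Pd supp smooth1_continuous[OF P's] by blast
qed

lemma Ck_ten1: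
  assumes "\<And>x. (p has_real_derivative p' x) (at x)" "continuous_on UNIV p'"
    "\<And>x. (q has_real_derivative q' x) (at x)" "continuous_on UNIV q'"
  shows "Ck 1 (ten p q)"
proof -
  have cp: "continuous_on UNIV p" "continuous_on UNIV q"
    using assms by (auto intro!: DERIV_continuous_on intro: has_field_derivative_at_within)
  show ?thesis
    using Ck_ten[of 1 "\<lambda>i. if i = 0 then p else p'" "\<lambda>i. if i = 0 then q else q'" 0 1 0] assms cp by simp
qed

text \<open>Each factor and its first derivative converge boundedly and pointwise, and the weight is
  at most 1 on Omega, so dominated convergence handles both the V-norm and the L^2 norm. The V-norm
  convergence is stated separately because \<open>Vcauchy\<close> alone does not compare
  \<open>\<psi> k\<close> with the limit.\<close>

lemma ten_approx:
  assumes g: "\<gamma> > 0" and p: "\<And>x. (p has_real_derivative p' x) (at x)" "continuous_on UNIV p'" "p (-1) = 0" "p 1 = 0"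
    and q: "\<And>x. (q has_real_derivative q' x) (at x)" "continuous_on UNIV q'" "q 0 = 0" "q 1 = 0"
  shows "\<exists>\<psi>. approx_seq \<gamma> \<psi> (ten p q) \<and> (\<lambda>k. vn \<gamma> (\<lambda>z. \<psi> k z - ten p q z)) \<longlonglongrightarrow> 0"
proof -
  have m1: "-1 < (1::real)" by simp
  obtain P P' B where P: "\<And>k. smooth1 (P k)" "\<And>k x. (P k has_real_derivative P' k x) (at x)" "\<And>k. continuous_on UNIV (P' k)"
     "\<And>k. \<exists>e>0. \<forall>x. x \<notin> {-1 + e..1 - e} \<longrightarrow> P k x = 0"
     "\<And>k x. x \<in> {-1<..<1} \<Longrightarrow> \<bar>P k x\<bar> \<le> B \<and> \<bar>P' k x\<bar> \<le> B"
     "\<And>x. x \<in> {-1<..<1} \<Longrightarrow> (\<lambda>k. P k x) \<longlonglongrightarrow> p x \<and> (\<lambda>k. P' k x) \<longlonglongrightarrow> p' x"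
    using H01_approx[of "-1" 1 p p', OF _ p] m1 by blast
  obtain Q Q' C where Q: "\<And>k. smooth1 (Q k)" "\<And>k x. (Q k has_real_derivative Q' k x) (at x)" "\<And>k. continuous_on UNIV (Q' k)"
     "\<And>k. \<exists>e>0. \<forall>x. x \<notin> {0 + e..1 - e} \<longrightarrow> Q k x = 0"
     "\<And>k x. x \<in> {0<..<1} \<Longrightarrow> \<bar>Q k x\<bar> \<le> C \<and> \<bar>Q' k x\<bar> \<le> C"
     "\<And>x. x \<in> {0<..<1} \<Longrightarrow> (\<lambda>k. Q k x) \<longlonglongrightarrow> q x \<and> (\<lambda>k. Q' k x) \<longlonglongrightarrow> q' x"
    using H01_approx[of 0 1 q q', OF _ q] zero_less_one by blast
  have cP: "continuous_on UNIV (P k)" "continuous_on UNIV (Q k)" for k using P Q smooth1_continuous by auto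
  have cp: "continuous_on UNIV p" "continuous_on UNIV q"
    using p q by (auto intro!: DERIV_continuous_on intro: has_field_derivative_at_within)
  define \<psi> where "\<psi> k = ten (P k) (Q k)" for k
  have t: "test_fun (\<psi> k)" for k
  proof -
    obtain e1 e2 where e: "e1 > 0" "\<And>x. x \<notin> {-1 + e1..1 - e1} \<Longrightarrow> P k x = 0" "e2 > 0" "\<And>x. x \<notin> {0 + e2..1 - e2} \<Longrightarrow> Q k x = 0"
      using P(4)[of k] Q(4)[of k] by blast
    have "compact ({-1 + e1..1 - e1} \<times> {0 + e2..1 - e2})" by (intro compact_Times) auto
    moreover have "{-1 + e1..1 - e1} \<times> {0 + e2..1 - e2} \<subseteq> Omega" using e by (auto simp: Omega_def)
    moreover have "\<forall>z. z \<notin> {-1 + e1..1 - e1} \<times> {0 + e2..1 - e2} \<longrightarrow> \<psi> k z = 0" using e(2,4) unfolding \<psi>_def ten_def by fastforce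
    ultimately show ?thesis unfolding test_fun_def using smooth1_ten[OF P(1)[of k] Q(1)[of k]] unfolding \<psi>_def by blast
  qed
  have C1: "Ck 1 (ten p q)" "Ck 1 (\<psi> k)" for k
    using Ck_ten1[OF p(1,2) q(1,2)] test_fun_Ck[OF t] by auto
  define D where "D k z = (P' k (fst z) * Q k (snd z) - p' (fst z) * q (snd z))\<^sup>2 +
     \<bar>fst z\<bar> powr (2 * \<gamma>) * (P k (fst z) * Q' k (snd z) - p (fst z) * q' (snd z))\<^sup>2" for k z
  have dx: "pdx (\<lambda>z. \<psi> k z - ten p q z) = (\<lambda>z. P' k (fst z) * Q k (snd z) - p' (fst z) * q (snd z))" for k
  proof -
    have "pdx (\<lambda>z. \<psi> k z + (-1) * ten p q z) = (\<lambda>z. pdx (\<psi> k) z + (-1) * pdx (ten p q) z)"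
      by (rule pdx_lin[of 0]) (use C1 in \<open>simp_all del: Ck.simps\<close>)
    moreover have "pdx (\<psi> k) = ten (P' k) (Q k)" unfolding \<psi>_def by (rule pdx_ten[OF P(2)])
    ultimately show ?thesis using pdx_ten[of p p' q, OF p(1)] by (simp add: ten_def fun_eq_iff)
  qed
  have dy: "pdy (\<lambda>z. \<psi> k z - ten p q z) = (\<lambda>z. P k (fst z) * Q' k (snd z) - p (fst z) * q' (snd z))" for k
  proof -
    have "pdy (\<lambda>z. \<psi> k z + (-1) * ten p q z) = (\<lambda>z. pdy (\<psi> k) z + (-1) * pdy (ten p q) z)"
      by (rule pdy_lin[of 0]) (use C1 in \<open>simp_all del: Ck.simps\<close>)
    moreover have "pdy (\<psi> k) = ten (P k) (Q' k)" unfolding \<psi>_def by (rule pdy_ten[OF Q(2)])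
    ultimately show ?thesis using pdy_ten[of q q' p, OF q(1)] by (simp add: ten_def fun_eq_iff)
  qed
  have vD: "Vip \<gamma> (\<lambda>z. \<psi> k z - ten p q z) (\<lambda>z. \<psi> k z - ten p q z) = (\<integral>z. D k z \<partial>MO)" for k
    unfolding Vip_def dx dy D_def by (simp add: power2_eq_square)
  have cont1: "continuous_on UNIV f \<Longrightarrow> continuous_on UNIV (\<lambda>z::real\<times>real. f (fst z))" for f :: "real \<Rightarrow> real"
    by (rule continuous_on_compose2[of UNIV f]) (auto intro: continuous_intros)
  have cont2: "continuous_on UNIV f \<Longrightarrow> continuous_on UNIV (\<lambda>z::real\<times>real. f (snd z))" for f :: "real \<Rightarrow> real"
    by (rule continuous_on_compose2[of UNIV f]) (auto intro: continuous_intros)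
  have cD: "continuous_on UNIV (D k)" for k
    unfolding D_def[abs_def]
    by (intro continuous_on_add continuous_on_mult continuous_on_diff continuous_on_power continuous_wt[OF g]
        cont1[OF P(3)] cont1[OF p(2)] cont1[OF cP(1)] cont1[OF cp(1)] cont2[OF Q(3)] cont2[OF q(2)] cont2[OF cP(2)] cont2[OF cp(2)])
  have compact_bd: "\<exists>K. \<forall>x\<in>S. \<bar>f x\<bar> \<le> K" if "compact S" "continuous_on UNIV f" for S and f :: "real \<Rightarrow> real"
  proof -
    have "compact (f ` S)" by (intro compact_continuous_image continuous_on_subset[OF that(2)] that(1)) auto
    then obtain K where "\<forall>v \<in> f ` S. norm v \<le> K" using compact_imp_bounded bounded_iff by blast
    then show ?thesis by auto
  qed
  have bd: "\<exists>K. \<forall>k. \<forall>z\<in>Omega. \<bar>D k z\<bar> \<le> K"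
  proof -
    have ic: "compact {-1..1::real}" "compact {0..1::real}" by auto
    obtain K1 K2 K3 K4 where K: "\<forall>x\<in>{-1..1}. \<bar>p x\<bar> \<le> K1" "\<forall>x\<in>{-1..1}. \<bar>p' x\<bar> \<le> K2" "\<forall>x\<in>{0..1}. \<bar>q x\<bar> \<le> K3" "\<forall>x\<in>{0..1}. \<bar>q' x\<bar> \<le> K4"
      using compact_bd[OF ic(1) cp(1)] compact_bd[OF ic(1) p(2)] compact_bd[OF ic(2) cp(2)] compact_bd[OF ic(2) q(2)] by blast
    have "\<bar>D k z\<bar> \<le> (B*C + K2*K3)\<^sup>2 + 1 * (B*C + K1*K4)\<^sup>2" if z: "z \<in> Omega" for k z
    proof -
      obtain x y where xy: "z = (x,y)" "x \<in> {-1<..<1}" "y \<in> {0<..<1}" using z by (auto simp: Omega_def)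
      have b: "\<bar>P k x\<bar> \<le> B" "\<bar>P' k x\<bar> \<le> B" "\<bar>Q k y\<bar> \<le> C" "\<bar>Q' k y\<bar> \<le> C" "\<bar>p x\<bar> \<le> K1" "\<bar>p' x\<bar> \<le> K2" "\<bar>q y\<bar> \<le> K3" "\<bar>q' y\<bar> \<le> K4"
        using P(5)[OF xy(2)] Q(5)[OF xy(3)] K xy by auto
      have m: "\<bar>u * v - u' * v'\<bar> \<le> U * V + U' * V'" if "\<bar>u\<bar> \<le> U" "\<bar>v\<bar> \<le> V" "\<bar>u'\<bar> \<le> U'" "\<bar>v'\<bar> \<le> V'" for u v u' v' U V U' V' :: real
      proof -
        have "\<bar>u * v\<bar> \<le> U * V" "\<bar>u' * v'\<bar> \<le> U' * V'" unfolding abs_mult using that by (auto intro!: mult_mono)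
        then show ?thesis by linarith
      qed
      have s: "u\<^sup>2 \<le> U\<^sup>2" if "\<bar>u\<bar> \<le> U" for u U :: real using that by (simp add: abs_le_square_iff[symmetric])
      have w: "\<bar>x\<bar> powr (2*\<gamma>) \<le> 1" using xy g by (intro powr_le1) auto
      have "D k z \<le> (B*C + K2*K3)\<^sup>2 + 1 * (B*C + K1*K4)\<^sup>2" unfolding D_def xy fst_conv snd_conv
        by (intro add_mono mult_mono s m b w) auto
      moreover have "D k z \<ge> 0" by (simp add: D_def)
      ultimately show ?thesis by simp
    qed
    then show ?thesis by blast
  qed
  then obtain K where K: "\<And>k z. z \<in> Omega \<Longrightarrow> \<bar>D k z\<bar> \<le> K" by blast
  have "(\<lambda>k. \<integral>z. D k z \<partial>MO) \<longlonglongrightarrow> (\<integral>z. 0 \<partial>MO)"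
  proof (rule integral_dominated_convergence[where w = "\<lambda>_. K"])
    show "AE z in MO. (\<lambda>k. D k z) \<longlonglongrightarrow> 0"
    proof (rule AE_I2)
      fix z assume "z \<in> space MO"
      then obtain x y where xy: "z = (x,y)" "x \<in> {-1<..<1}" "y \<in> {0<..<1}" by (auto simp: Omega_def)
      have "(\<lambda>k. D k z) \<longlonglongrightarrow> (p' x * q y - p' x * q y)\<^sup>2 + \<bar>x\<bar> powr (2 * \<gamma>) * (p x * q' y - p x * q' y)\<^sup>2"
        unfolding D_def xy fst_conv snd_conv
        using P(6)[OF xy(2)] Q(6)[OF xy(3)] by (intro tendsto_intros) auto
      then show "(\<lambda>k. D k z) \<longlonglongrightarrow> 0" by simp
    qed
    show "AE z in MO. norm (D k z) \<le> K" for k using K by auto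
    show "D k \<in> borel_measurable MO" for k by (intro measurable_MO borel_measurable_continuous_onI cD)
  qed auto
  then have v0: "(\<lambda>k. vn \<gamma> (\<lambda>z. \<psi> k z - ten p q z)) \<longlonglongrightarrow> 0"
    unfolding vn_def vD using tendsto_real_sqrt by fastforce
  have "Vcauchy \<gamma> \<psi>" unfolding Vcauchy_def
  proof (intro allI impI)
    fix e :: real assume "e > 0"
    then have "\<forall>\<^sub>F k in sequentially. vn \<gamma> (\<lambda>z. \<psi> k z - ten p q z) < e/2" using v0 order_tendstoD(2)[of _ 0 _ "e/2"] by simp
    then obtain N where N: "\<And>k. k \<ge> N \<Longrightarrow> vn \<gamma> (\<lambda>z. \<psi> k z - ten p q z) < e/2" by (auto simp: eventually_sequentially)
    have "vn \<gamma> (\<lambda>z. \<psi> m z - \<psi> n z) < e" if "m \<ge> N" "n \<ge> N" for m n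
    proof -
      have "vn \<gamma> (\<lambda>z. \<psi> m z - \<psi> n z) \<le> vn \<gamma> (\<lambda>z. \<psi> m z - ten p q z) + vn \<gamma> (\<lambda>z. ten p q z - \<psi> n z)"
        by (rule vn_triangle3[OF g C1(2) C1(1) C1(2)])
      then show ?thesis using N[of m] N[of n] that vn_commute[OF g C1(1) C1(2), of n] by simp
    qed
    then show "\<exists>N. \<forall>m\<ge>N. \<forall>n\<ge>N. vn \<gamma> (\<lambda>z. \<psi> m z - \<psi> n z) < e" by blast
  qed
  moreover have "(\<lambda>k. n2 MO (\<lambda>z. \<psi> k z - ten p q z)) \<longlonglongrightarrow> 0"
  proof -
    obtain K1 K3 where K13: "\<forall>x\<in>{-1..1}. \<bar>p x\<bar> \<le> K1" "\<forall>x\<in>{0..1}. \<bar>q x\<bar> \<le> K3"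
      using compact_bd[OF _ cp(1), of "{-1..1}"] compact_bd[OF _ cp(2), of "{0..1}"] by auto
    have "(\<lambda>k. \<integral>z. (\<psi> k z - ten p q z)\<^sup>2 \<partial>MO) \<longlonglongrightarrow> (\<integral>z. 0 \<partial>MO)"
    proof (rule integral_dominated_convergence[where w = "\<lambda>_. (B*C + K1*K3)\<^sup>2"])
      show "AE z in MO. norm ((\<psi> k z - ten p q z)\<^sup>2) \<le> (B*C + K1*K3)\<^sup>2" for k
      proof (rule AE_I2)
        fix z assume "z \<in> space MO"
        then obtain x y where xy: "z = (x,y)" "x \<in> {-1<..<1}" "y \<in> {0<..<1}" by (auto simp: Omega_def)
        have "\<bar>P k x * Q k y\<bar> \<le> B * C" "\<bar>p x * q y\<bar> \<le> K1 * K3" unfolding abs_mult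
          using P(5)[OF xy(2), of k] Q(5)[OF xy(3), of k] K13 xy by (auto intro!: mult_mono')
        then have "\<bar>P k x * Q k y - p x * q y\<bar> \<le> B*C + K1*K3" by linarith
        then show "norm ((\<psi> k z - ten p q z)\<^sup>2) \<le> (B*C + K1*K3)\<^sup>2" by (simp add: \<psi>_def xy abs_le_square_iff[symmetric])
      qed
      show "AE z in MO. (\<lambda>k. (\<psi> k z - ten p q z)\<^sup>2) \<longlonglongrightarrow> 0"
      proof (rule AE_I2)
        fix z assume "z \<in> space MO"
        then obtain x y where xy: "z = (x,y)" "x \<in> {-1<..<1}" "y \<in> {0<..<1}" by (auto simp: Omega_def)
        have "(\<lambda>k. (\<psi> k z - ten p q z)\<^sup>2) \<longlonglongrightarrow> (p x * q y - p x * q y)\<^sup>2"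
          unfolding \<psi>_def xy ten_apply
          using P(6)[OF xy(2)] Q(6)[OF xy(3)] by (intro tendsto_intros) auto
        then show "(\<lambda>k. (\<psi> k z - ten p q z)\<^sup>2) \<longlonglongrightarrow> 0" by simp
      qed
      show "(\<lambda>z. (\<psi> k z - ten p q z)\<^sup>2) \<in> borel_measurable MO" for k
        using Ck_continuous[OF C1(1)] Ck_continuous[OF C1(2)]
        by (intro measurable_MO borel_measurable_continuous_onI continuous_intros) auto
    qed auto
    then show ?thesis unfolding n2_def using tendsto_real_sqrt by fastforce
  qed
  ultimately show ?thesis using t v0 by (auto simp: approx_seq_iff)
qed


section \<open>Linear second-order equations on the line\<close>

text \<open>Integrate |F''| <= h'' twice. Used with explicit powers as majorants and with
  supersolutions of a linear equation.\<close>

lemma second_derivative_bound: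
  fixes F F1 f h h1 h2 :: "real \<Rightarrow> real"
  assumes F: "\<And>u. 0 \<le> u \<Longrightarrow> u \<le> x \<Longrightarrow> (F has_real_derivative F1 u) (at u)" "\<And>u. 0 \<le> u \<Longrightarrow> u \<le> x \<Longrightarrow> (F1 has_real_derivative f u) (at u)"
    and h: "\<And>u. 0 \<le> u \<Longrightarrow> u \<le> x \<Longrightarrow> (h has_real_derivative h1 u) (at u)" "\<And>u. 0 \<le> u \<Longrightarrow> u \<le> x \<Longrightarrow> (h1 has_real_derivative h2 u) (at u)"
    and b: "\<And>u. 0 \<le> u \<Longrightarrow> u \<le> x \<Longrightarrow> \<bar>f u\<bar> \<le> h2 u" and z: "\<bar>F 0\<bar> \<le> h 0" "\<bar>F1 0\<bar> \<le> h1 0" and x: "0 \<le> x"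
  shows "\<bar>F x\<bar> \<le> h x \<and> \<bar>F1 x\<bar> \<le> h1 x"
proof -
  have mono: "G 0 \<le> G y" if "0 \<le> y" "\<And>u. 0 \<le> u \<Longrightarrow> u \<le> y \<Longrightarrow> (G has_real_derivative g u) (at u)" "\<And>u. 0 \<le> u \<Longrightarrow> u \<le> y \<Longrightarrow> 0 \<le> g u"
    for G g :: "real \<Rightarrow> real" and y
    by (rule DERIV_nonneg_imp_nondecreasing[OF that(1)]) (use that(2,3) in blast)
  have 1: "h1 0 - F1 0 \<le> h1 y - F1 y" "h1 0 + F1 0 \<le> h1 y + F1 y" if "0 \<le> y" "y \<le> x" for y
  proof -
    show "h1 0 - F1 0 \<le> h1 y - F1 y"
      by (rule mono[of y "\<lambda>u. h1 u - F1 u" "\<lambda>u. h2 u - f u", OF that(1)])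
         (use that b in \<open>auto intro!: DERIV_diff h(2) F(2) simp: abs_le_iff\<close>)
    show "h1 0 + F1 0 \<le> h1 y + F1 y"
      by (rule mono[of y "\<lambda>u. h1 u + F1 u" "\<lambda>u. h2 u + f u", OF that(1)])
         (use that b in \<open>auto intro!: DERIV_add h(2) F(2) simp: abs_le_iff\<close>, smt (verit) b)
  qed
  have 2: "\<bar>F1 y\<bar> \<le> h1 y" if "0 \<le> y" "y \<le> x" for y using 1[OF that] z(2) by linarith
  have "h 0 - F 0 \<le> h x - F x"
    by (rule mono[of x "\<lambda>u. h u - F u" "\<lambda>u. h1 u - F1 u", OF x])
       (use 2 in \<open>auto intro!: DERIV_diff h(1) F(1) simp: abs_le_iff\<close>)
  moreover have "h 0 + F 0 \<le> h x + F x"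
  proof (rule mono[of x "\<lambda>u. h u + F u" "\<lambda>u. h1 u + F1 u", OF x])
    show "0 \<le> h1 u + F1 u" if "0 \<le> u" "u \<le> x" for u using 2[OF that] by linarith
  qed (auto intro!: DERIV_add h(1) F(1))
  ultimately show ?thesis using z(1) 2[of x] x by auto
qed

text \<open>The second antiderivative that vanishes to first order at $0$.\<close>

definition Kop :: "(real \<Rightarrow> real) \<Rightarrow> real \<Rightarrow> real" where
  "Kop f = (SOME F. F 0 = 0 \<and> (\<exists>F1. F1 0 = 0 \<and> (\<forall>x. (F has_real_derivative F1 x) (at x)) \<and> (\<forall>x. (F1 has_real_derivative f x) (at x))))"

definition Kop1 :: "(real \<Rightarrow> real) \<Rightarrow> real \<Rightarrow> real" where "Kop1 f = deriv (Kop f)"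

lemma Kop:
  assumes "continuous_on UNIV f"
  shows "Kop f 0 = 0" "Kop1 f 0 = 0" "(Kop f has_real_derivative Kop1 f x) (at x)" "(Kop1 f has_real_derivative f x) (at x)"
proof -
  obtain F1 where F1: "F1 0 = 0" "\<And>x. (F1 has_real_derivative f x) (at x)" using ex_antiderivative[OF assms] by blast
  then have "continuous_on UNIV F1" by (auto intro!: DERIV_continuous_on intro: has_field_derivative_at_within)
  then obtain F where F: "F 0 = 0" "\<And>x. (F has_real_derivative F1 x) (at x)" using ex_antiderivative by blast
  have "Kop f 0 = 0 \<and> (\<exists>F1. F1 0 = 0 \<and> (\<forall>x. (Kop f has_real_derivative F1 x) (at x)) \<and> (\<forall>x. (F1 has_real_derivative f x) (at x)))"
    unfolding Kop_def by (rule someI[of _ F]) (use F F1 in blast)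
  then obtain G where G: "Kop f 0 = 0" "G 0 = 0" "\<And>x. (Kop f has_real_derivative G x) (at x)" "\<And>x. (G has_real_derivative f x) (at x)" by blast
  have "Kop1 f = G" unfolding Kop1_def using G(3) by (auto simp: fun_eq_iff intro: DERIV_imp_deriv)
  then show "Kop f 0 = 0" "Kop1 f 0 = 0" "(Kop f has_real_derivative Kop1 f x) (at x)" "(Kop1 f has_real_derivative f x) (at x)"
    using G by auto
qed

lemma DERIV_power_fact:
  "((\<lambda>x. c * x ^ (Suc n) / fact (Suc n)) has_real_derivative c * x ^ n / fact n) (at (x::real))"
proof -
  have "((\<lambda>x. c * x ^ (Suc n) / fact (Suc n)) has_real_derivative c * (real (Suc n) * x ^ n) / fact (Suc n)) (at x)"
    by (intro DERIV_cdivide DERIV_cmult) (use DERIV_pow[of "Suc n" x] in simp)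
  moreover have "c * (real (Suc n) * x ^ n) / fact (Suc n) = c * x ^ n / fact n"
  proof -
    have "c * (real (Suc n) * x ^ n) / (real (Suc n) * fact n) = c * x ^ n / fact n"
      by (simp add: field_simps del: of_nat_Suc)
    then show ?thesis by simp
  qed
  ultimately show ?thesis by simp
qed

text \<open>Each double integration raises the power and the factorial by two; this drives the
  Picard iteration on the whole line. Negative x is reduced to positive x by reflection.\<close>

lemma Kop_like_power_bound:
  fixes F F1 f :: "real \<Rightarrow> real"
  assumes F: "\<And>x. (F has_real_derivative F1 x) (at x)" "\<And>x. (F1 has_real_derivative f x) (at x)" "F 0 = 0" "F1 0 = 0"
    and b: "\<And>u. \<bar>u\<bar> \<le> R \<Longrightarrow> \<bar>f u\<bar> \<le> c * \<bar>u\<bar> ^ k / fact k" and x: "\<bar>x\<bar> \<le> R"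
  shows "\<bar>F x\<bar> \<le> c * \<bar>x\<bar> ^ (k + 2) / fact (k + 2)"
proof (cases "0 \<le> x")
  case True
  have "\<bar>F x\<bar> \<le> c * x ^ Suc (Suc k) / fact (Suc (Suc k)) \<and> \<bar>F1 x\<bar> \<le> c * x ^ Suc k / fact (Suc k)"
  proof (rule second_derivative_bound[OF F(1) F(2) DERIV_power_fact DERIV_power_fact])
    show "\<bar>f u\<bar> \<le> c * u ^ k / fact k" if "0 \<le> u" "u \<le> x" for u using b[of u] that x by auto
  qed (use F True in auto)
  then show ?thesis using True by (simp del: fact_Suc)
next
  case False
  have d: "((\<lambda>u. F (- u)) has_real_derivative - F1 (- u)) (at u)" for u
    using F(1)[of "- u"] by (simp add: DERIV_mirror)
  have "((\<lambda>u. F1 (- u)) has_real_derivative - f (- u)) (at u)" for u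
    using F(2)[of "- u"] by (simp add: DERIV_mirror)
  from DERIV_minus[OF this] have e: "((\<lambda>u. - F1 (- u)) has_real_derivative f (- u)) (at u)" for u by simp
  have "\<bar>F (- (- x))\<bar> \<le> c * (-x) ^ Suc (Suc k) / fact (Suc (Suc k)) \<and> \<bar>- F1 (- (- x))\<bar> \<le> c * (-x) ^ Suc k / fact (Suc k)"
  proof (rule second_derivative_bound[OF d e DERIV_power_fact DERIV_power_fact])
    show "\<bar>f (- u)\<bar> \<le> c * u ^ k / fact k" if "0 \<le> u" "u \<le> - x" for u using b[of "-u"] that x by auto
  qed (use F False in auto)
  then show ?thesis using False by (simp del: fact_Suc)
qed

text \<open>Picard iteration for P'' = wP + Q. The last clause is a comparison principle: a function
  Z with Z'' >= MZ + |Q| and zero data dominates P. It is proved on the iterates, which start from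
  the constant c = 0 and stay below Z, and so is part of the existence statement.\<close>

lemma linear_ode:
  fixes w Q :: "real \<Rightarrow> real"
  assumes w: "continuous_on UNIV w" "\<And>x. \<bar>w x\<bar> \<le> M" and Q: "continuous_on UNIV Q"
  shows "\<exists>P P1. P 0 = c \<and> P1 0 = 0 \<and> (\<forall>x. (P has_real_derivative P1 x) (at x)) \<and>
     (\<forall>x. (P1 has_real_derivative w x * P x + Q x) (at x)) \<and>
     (\<forall>Z Z1 Z2. c = 0 \<longrightarrow> Z 0 = 0 \<longrightarrow> Z1 0 = 0 \<longrightarrow> (\<forall>u\<ge>0. (Z has_real_derivative Z1 u) (at u)) \<longrightarrow> (\<forall>u\<ge>0. (Z1 has_real_derivative Z2 u) (at u)) \<longrightarrow>
        (\<forall>u\<ge>0. 0 \<le> Z u \<and> M * Z u + \<bar>Q u\<bar> \<le> Z2 u) \<longrightarrow> (\<forall>x\<ge>0. \<bar>P x\<bar> \<le> Z x \<and> \<bar>P1 x\<bar> \<le> Z1 x))"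
proof -
  have M: "0 \<le> M" using w(2)[of 0] by linarith
  define S where "S = rec_nat (\<lambda>x::real. c) (\<lambda>_ s x. c + Kop (\<lambda>y. w y * s y + Q y) x)"
  have S0: "S 0 = (\<lambda>x. c)" and SS: "S (Suc n) = (\<lambda>x. c + Kop (\<lambda>y. w y * S n y + Q y) x)" for n by (simp_all add: S_def)
  have Sc: "continuous_on UNIV (S n)" for n
  proof (induction n)
    case 0 then show ?case by (simp add: S0)
  next
    case (Suc n)
    have "continuous_on UNIV (\<lambda>y. w y * S n y + Q y)" using w Q Suc by (intro continuous_intros)
    from Kop(3)[OF this] show ?case unfolding SS
      by (intro continuous_intros DERIV_continuous_on) (auto intro: has_field_derivative_at_within)
  qed
  have fc: "continuous_on UNIV (\<lambda>y. w y * S n y + Q y)" for n using w Q Sc by (intro continuous_intros)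
  define D where "D n x = S (Suc n) x - S n x" for n x
  have Db: "\<bar>D n x\<bar> \<le> B * M ^ n * \<bar>x\<bar> ^ (2 * n) / fact (2 * n)" if B: "\<And>x. \<bar>x\<bar> \<le> R \<Longrightarrow> \<bar>D 0 x\<bar> \<le> B" and x: "\<bar>x\<bar> \<le> R" for n x R B
    using x
  proof (induction n arbitrary: x)
    case 0 then show ?case using B by simp
  next
    case (Suc n)
    let ?F = "\<lambda>x. Kop (\<lambda>y. w y * S (Suc n) y + Q y) x - Kop (\<lambda>y. w y * S n y + Q y) x"
    let ?F1 = "\<lambda>x. Kop1 (\<lambda>y. w y * S (Suc n) y + Q y) x - Kop1 (\<lambda>y. w y * S n y + Q y) x"
    have "\<bar>?F x\<bar> \<le> (B * M ^ Suc n) * \<bar>x\<bar> ^ (2 * n + 2) / fact (2 * n + 2)"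
    proof (rule Kop_like_power_bound[where ?F1.0 = ?F1 and f = "\<lambda>x. w x * D n x" and R = R])
      show "(?F has_real_derivative ?F1 x) (at x)" for x by (intro DERIV_diff Kop(3) fc)
      have "(?F1 has_real_derivative (w x * S (Suc n) x + Q x) - (w x * S n x + Q x)) (at x)" for x
        by (intro DERIV_diff Kop(4) fc)
      then show "(?F1 has_real_derivative w x * D n x) (at x)" for x by (simp add: D_def algebra_simps)
      show "?F 0 = 0" "?F1 0 = 0" using Kop(1,2)[OF fc] by auto
      show "\<bar>w u * D n u\<bar> \<le> (B * M ^ Suc n) * \<bar>u\<bar> ^ (2 * n) / fact (2 * n)" if "\<bar>u\<bar> \<le> R" for u
      proof -
        have "\<bar>w u * D n u\<bar> \<le> M * (B * M ^ n * \<bar>u\<bar> ^ (2 * n) / fact (2 * n))"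
          unfolding abs_mult by (intro mult_mono w Suc.IH that M) auto
        then show ?thesis by (simp add: algebra_simps)
      qed
    qed (rule Suc.prems)
    then show ?case by (simp add: D_def[of "Suc n"] SS[of "Suc n"] SS[of n] del: fact_Suc)
  qed
  have S_sum: "S n x = S 0 x + (\<Sum>i<n. D i x)" for n x
    by (induction n) (auto simp: D_def)
  define P where "P x = c + (\<Sum>i. D i x)" for x
  have ul: "uniform_limit {-R..R} S P sequentially" if R: "R \<ge> 0" for R
  proof -
    have cD: "continuous_on {-R..R} (D 0)" unfolding D_def[abs_def]
      by (intro continuous_intros continuous_on_subset[OF Sc]) auto
    have "compact (D 0 ` {-R..R})" by (intro compact_continuous_image cD) auto
    then obtain B where "\<forall>v \<in> D 0 ` {-R..R}. norm v \<le> B" using compact_imp_bounded bounded_iff by blast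
    then have B: "\<And>x. \<bar>x\<bar> \<le> R \<Longrightarrow> \<bar>D 0 x\<bar> \<le> B" by (auto simp: abs_le_iff)
    have B0: "0 \<le> B" using B[of 0] R by auto
    define q where "q = sqrt M * R"
    have q: "q \<ge> 0" "q\<^sup>2 = M * R\<^sup>2" using M R by (auto simp: q_def power_mult_distrib)
    have "uniform_limit {-R..R} (\<lambda>n x. \<Sum>i<n. D i x) (\<lambda>x. \<Sum>i. D i x) sequentially"
    proof (rule Weierstrass_m_test)
      fix n x assume x: "x \<in> {-R..R}"
      have "\<bar>D n x\<bar> \<le> B * M ^ n * \<bar>x\<bar> ^ (2 * n) / fact (2 * n)" by (rule Db[of R B, OF B]) (use x in auto)
      also have "\<dots> \<le> B * M ^ n * R ^ (2 * n) / fact (2 * n)"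
        by (intro divide_right_mono mult_left_mono power_mono) (use x B0 M in auto)
      also have "\<dots> = B * (M * R\<^sup>2) ^ n / fact (2 * n)" by (simp add: power_mult power_mult_distrib)
      also have "\<dots> = B * q ^ (2*n) / fact (2*n)" by (simp add: power_mult q)
      also have "\<dots> \<le> B * (q\<^sup>2) ^ n / fact n"
        unfolding power_mult by (intro divide_left_mono mult_nonneg_nonneg B0 fact_mono) auto
      finally show "norm (D n x) \<le> B * (q\<^sup>2) ^ n / fact n" by simp
    next
      have "summable (\<lambda>n. B * ((q\<^sup>2) ^ n /\<^sub>R fact n))" by (intro summable_mult summable_exp_generic)
      then show "summable (\<lambda>n. B * (q\<^sup>2) ^ n / fact n)" by (simp add: divide_inverse mult_ac)
    qed
    then have "uniform_limit {-R..R} (\<lambda>n x. c + (\<Sum>i<n. D i x)) P sequentially"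
      unfolding P_def by (intro uniform_limit_intros)
    moreover have "(\<lambda>n x. c + (\<Sum>i<n. D i x)) = S" by (auto simp: fun_eq_iff S_sum S0)
    ultimately show ?thesis by simp
  qed
  have Pc: "continuous_on UNIV P"
  proof (rule continuous_at_imp_continuous_on, rule ballI)
    fix x :: real
    have "continuous_on {-(\<bar>x\<bar>+1)..\<bar>x\<bar>+1} P"
      by (rule uniform_limit_theorem[OF _ ul]) (auto intro!: always_eventually continuous_on_subset[OF Sc])
    then show "isCont P x" by (rule continuous_on_interior) auto
  qed
  have Sl: "(\<lambda>n. S n x) \<longlonglongrightarrow> P x" for x
    by (rule tendsto_uniform_limitI[OF ul[of "\<bar>x\<bar>"]]) auto
  have gc: "continuous_on UNIV (\<lambda>y. w y * P y + Q y)" using w Q Pc by (intro continuous_intros)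
  have PK: "P x = c + Kop (\<lambda>y. w y * P y + Q y) x" for x
  proof -
    have "(\<lambda>n. S (Suc n) x) \<longlonglongrightarrow> c + Kop (\<lambda>y. w y * P y + Q y) x"
    proof (rule metric_LIMSEQ_I)
      fix e :: real assume e: "e > 0"
      \<comment> \<open>If an iterate is within d of P on [-|x|,|x|], the next one is within M d x^2
        / 2 of the integral operator applied to P; this choice makes that less than e.\<close>
      define d where "d = e / (M * x\<^sup>2 + 1)"
      have den: "M * x\<^sup>2 + 1 > 0" using M by (simp add: add_nonneg_pos)
      have d: "d > 0" using e den by (simp add: d_def)
      have "\<forall>\<^sub>F n in sequentially. \<forall>u\<in>{-\<bar>x\<bar>..\<bar>x\<bar>}. dist (S n u) (P u) < d"
        using uniform_limitD[OF ul[of "\<bar>x\<bar>"] d] by simp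
      then obtain N where N: "\<And>n u. n \<ge> N \<Longrightarrow> u \<in> {-\<bar>x\<bar>..\<bar>x\<bar>} \<Longrightarrow> \<bar>S n u - P u\<bar> < d"
        unfolding eventually_sequentially dist_real_def by blast
      have "dist (S (Suc n) x) (c + Kop (\<lambda>y. w y * P y + Q y) x) < e" if n: "n \<ge> N" for n
      proof -
        let ?F = "\<lambda>x. Kop (\<lambda>y. w y * S n y + Q y) x - Kop (\<lambda>y. w y * P y + Q y) x"
        let ?F1 = "\<lambda>x. Kop1 (\<lambda>y. w y * S n y + Q y) x - Kop1 (\<lambda>y. w y * P y + Q y) x"
        have "\<bar>?F x\<bar> \<le> (M * d) * \<bar>x\<bar> ^ (0 + 2) / fact (0 + 2)"
        proof (rule Kop_like_power_bound[where ?F1.0 = ?F1 and f = "\<lambda>x. w x * (S n x - P x)" and R = "\<bar>x\<bar>"])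
          show "(?F has_real_derivative ?F1 x) (at x)" for x by (intro DERIV_diff Kop(3) fc gc)
          have "(?F1 has_real_derivative (w x * S n x + Q x) - (w x * P x + Q x)) (at x)" for x
            by (intro DERIV_diff Kop(4) fc gc)
          then show "(?F1 has_real_derivative w x * (S n x - P x)) (at x)" for x by (simp add: algebra_simps)
          show "?F 0 = 0" "?F1 0 = 0" using Kop(1,2)[OF fc] Kop(1,2)[OF gc] by auto
          show "\<bar>w u * (S n u - P u)\<bar> \<le> (M * d) * \<bar>u\<bar> ^ 0 / fact 0" if u: "\<bar>u\<bar> \<le> \<bar>x\<bar>" for u
          proof -
            have "\<bar>S n u - P u\<bar> \<le> d" using N[OF n, of u] u by (auto simp: abs_le_iff less_imp_le)
            then show ?thesis unfolding abs_mult using w(2)[of u] M by (simp add: mult_mono)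
          qed
        qed simp
        also have "\<dots> = (M * x\<^sup>2) * d / 2" by (simp add: mult_ac fact_2 power2_eq_square)
        also have "\<dots> \<le> (M * x\<^sup>2) * d" using mult_nonneg_nonneg[of "M * x\<^sup>2" d] M d by simp
        also have "\<dots> < (M * x\<^sup>2 + 1) * d" using d by (simp add: algebra_simps)
        also have "\<dots> = e" using den by (simp add: d_def)
        finally show ?thesis by (simp add: SS dist_real_def)
      qed
      then show "\<exists>no. \<forall>n\<ge>no. dist (S (Suc n) x) (c + Kop (\<lambda>y. w y * P y + Q y) x) < e" by blast
    qed
    then show ?thesis using LIMSEQ_unique LIMSEQ_Suc[OF Sl[of x]] by blast
  qed
  define P1 where "P1 = Kop1 (\<lambda>y. w y * P y + Q y)"
  have Pd: "(P has_real_derivative P1 x) (at x)" for x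
  proof -
    have "((\<lambda>x. c + Kop (\<lambda>y. w y * P y + Q y) x) has_real_derivative 0 + P1 x) (at x)"
      unfolding P1_def by (intro DERIV_add DERIV_const Kop gc)
    moreover have "(\<lambda>x. c + Kop (\<lambda>y. w y * P y + Q y) x) = P" by (rule ext) (rule PK[symmetric])
    ultimately show ?thesis by simp
  qed
  have P1d: "(P1 has_real_derivative w x * P x + Q x) (at x)" for x unfolding P1_def by (rule Kop(4)[OF gc])
  have "\<bar>P x\<bar> \<le> Z x \<and> \<bar>P1 x\<bar> \<le> Z1 x" if c0: "c = 0" and Z0: "Z 0 = 0" "Z1 0 = 0"
     and Zd: "\<And>u. u \<ge> 0 \<Longrightarrow> (Z has_real_derivative Z1 u) (at u)" "\<And>u. u \<ge> 0 \<Longrightarrow> (Z1 has_real_derivative Z2 u) (at u)"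
     and Zs: "\<And>u. u \<ge> 0 \<Longrightarrow> 0 \<le> Z u \<and> M * Z u + \<bar>Q u\<bar> \<le> Z2 u" and x: "x \<ge> 0" for Z Z1 Z2 x
  proof -
    have wb: "\<bar>w u * s + Q u\<bar> \<le> Z2 u" if "\<bar>s\<bar> \<le> Z u" "u \<ge> 0" for s u
    proof -
      have "\<bar>w u * s\<bar> \<le> M * Z u" unfolding abs_mult by (intro mult_mono w that M) auto
      then show ?thesis using Zs[OF that(2)] by linarith
    qed
    have SZ: "\<bar>S n y\<bar> \<le> Z y" if "y \<ge> 0" for n y
      using that
    proof (induction n arbitrary: y)
      case 0 then show ?case using Zs by (simp add: S0 c0)
    next
      case (Suc n)
      have "\<bar>Kop (\<lambda>y. w y * S n y + Q y) y\<bar> \<le> Z y \<and> \<bar>Kop1 (\<lambda>y. w y * S n y + Q y) y\<bar> \<le> Z1 y"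
        by (rule second_derivative_bound[OF Kop(3)[OF fc] Kop(4)[OF fc] Zd(1) Zd(2)])
           (use Z0 wb Suc Kop(1,2)[OF fc] in auto)
      then show ?case by (simp add: SS c0)
    qed
    have PZ: "\<bar>P y\<bar> \<le> Z y" if "y \<ge> 0" for y
      by (rule tendsto_upperbound[OF tendsto_rabs[OF Sl]]) (use SZ[OF that] in auto)
    have "P 0 = 0" "P1 0 = 0" by (subst PK, simp add: c0 Kop(1)[OF gc], simp add: P1_def Kop(2)[OF gc])
    then show ?thesis
      by (intro second_derivative_bound[OF Pd P1d Zd(1) Zd(2)]) (use Z0 wb PZ x in auto)
  qed
  moreover have "P 0 = c" "P1 0 = 0" by (subst PK, simp add: Kop(1)[OF gc], simp add: P1_def Kop(2)[OF gc])
  ultimately show ?thesis using Pd P1d by blast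
qed

text \<open>Gronwall for P^2 + P1^2 + q^2; carrying the constant q^2 inside the energy absorbs the
  forcing. With zero data and no forcing it gives uniqueness, with small forcing continuous
  dependence on the spectral parameter.\<close>

lemma ode_energy:
  fixes P P1 w Q :: "real \<Rightarrow> real"
  assumes P: "\<And>u. 0 \<le> u \<Longrightarrow> u \<le> x \<Longrightarrow> (P has_real_derivative P1 u) (at u)" 
     "\<And>u. 0 \<le> u \<Longrightarrow> u \<le> x \<Longrightarrow> (P1 has_real_derivative w u * P u + Q u) (at u)"
    and b: "\<And>u. 0 \<le> u \<Longrightarrow> u \<le> x \<Longrightarrow> \<bar>w u\<bar> \<le> M \<and> \<bar>Q u\<bar> \<le> q" and x: "0 \<le> x" and M: "0 \<le> M"
  shows "(P x)\<^sup>2 + (P1 x)\<^sup>2 \<le> ((P 0)\<^sup>2 + (P1 0)\<^sup>2 + q\<^sup>2) * exp ((M + 2) * x)"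
proof -
  define L where "L = M + 2"
  define E where "E u = ((P u)\<^sup>2 + (P1 u)\<^sup>2 + q\<^sup>2) * exp (- L * u)" for u
  define E' where "E' u = ((2 * P u * P1 u + 2 * P1 u * (w u * P u + Q u)) - L * ((P u)\<^sup>2 + (P1 u)\<^sup>2 + q\<^sup>2)) * exp (- L * u)" for u
  have d: "(E has_real_derivative E' u) (at u)" if "0 \<le> u" "u \<le> x" for u
    unfolding E_def[abs_def] E'_def
    by (rule derivative_eq_intros P(1)[OF that] P(2)[OF that] refl | simp)+ (simp add: algebra_simps power2_eq_square)
  have n: "E' u \<le> 0" if u: "0 \<le> u" "u \<le> x" for u
  proof -
    have ab: "2 * a * c \<le> a\<^sup>2 + c\<^sup>2" for a c :: real using sum_squares_bound[of a c] by simp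
    have "2 * P1 u * (w u * P u) \<le> M * ((P u)\<^sup>2 + (P1 u)\<^sup>2)"
    proof -
      have "2 * P1 u * (w u * P u) \<le> \<bar>w u\<bar> * (2 * \<bar>P u\<bar> * \<bar>P1 u\<bar>)"
        using abs_ge_self[of "2 * P1 u * (w u * P u)"] by (simp add: abs_mult mult_ac)
      also have "\<dots> \<le> M * (2 * \<bar>P u\<bar> * \<bar>P1 u\<bar>)" using b[OF u] by (intro mult_right_mono) auto
      also have "\<dots> \<le> M * ((P u)\<^sup>2 + (P1 u)\<^sup>2)" using ab[of "\<bar>P u\<bar>" "\<bar>P1 u\<bar>"] M by (intro mult_left_mono) auto
      finally show ?thesis .
    qed
    moreover have "2 * P1 u * Q u \<le> (P1 u)\<^sup>2 + q\<^sup>2"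
    proof -
      have "(Q u)\<^sup>2 \<le> q\<^sup>2" using b[OF u] by (intro power2_le_iff_abs_le[THEN iffD2]) auto
      then show ?thesis using ab[of "P1 u" "Q u"] by simp
    qed
    moreover have "2 * P u * P1 u \<le> (P u)\<^sup>2 + (P1 u)\<^sup>2" by (rule ab)
    ultimately have "2 * P u * P1 u + 2 * P1 u * (w u * P u + Q u) \<le> M * ((P u)\<^sup>2 + (P1 u)\<^sup>2) + ((P u)\<^sup>2 + 2 * (P1 u)\<^sup>2 + q\<^sup>2)"
      by (simp add: algebra_simps)
    also have "\<dots> \<le> L * ((P u)\<^sup>2 + (P1 u)\<^sup>2 + q\<^sup>2)"
      using M by (simp add: L_def algebra_simps)
    finally show ?thesis unfolding E'_def by (simp add: mult_nonpos_nonneg)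
  qed
  have "E x \<le> E 0" by (rule DERIV_nonpos_imp_nonincreasing[OF x]) (use d n in blast)
  then have "((P x)\<^sup>2 + (P1 x)\<^sup>2 + q\<^sup>2) * exp (- L * x) * exp (L * x) \<le> ((P 0)\<^sup>2 + (P1 0)\<^sup>2 + q\<^sup>2) * exp (L * x)"
    unfolding E_def by (intro mult_right_mono) auto
  moreover have "A * exp (- L * x) * exp (L * x) = A" for A by (simp add: mult.assoc flip: exp_add)
  ultimately have "(P x)\<^sup>2 + (P1 x)\<^sup>2 + q\<^sup>2 \<le> ((P 0)\<^sup>2 + (P1 0)\<^sup>2 + q\<^sup>2) * exp (L * x)" by metis
  then show ?thesis unfolding L_def by (smt (verit) zero_le_power2)
qed


section \<open>The ground state of the mode operators\<close>

text \<open>The potential is frozen outside $[-1,1]$ to make the coefficients of the mode equations globally bounded.\<close>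

definition wpot :: "real \<Rightarrow> real \<Rightarrow> real \<Rightarrow> real" where
  "wpot \<gamma> N x = N\<^sup>2 * (min 1 \<bar>x\<bar>) powr (2 * \<gamma>)"

lemma wpot_continuous: "\<gamma> > 0 \<Longrightarrow> continuous_on A (wpot \<gamma> N)"
  unfolding wpot_def[abs_def] by (intro continuous_intros continuous_on_powr') auto

lemma wpot_bounds: "\<gamma> > 0 \<Longrightarrow> 0 \<le> wpot \<gamma> N x \<and> wpot \<gamma> N x \<le> N\<^sup>2"
proof -
  assume "\<gamma> > 0"
  then have "(min 1 \<bar>x\<bar>) powr (2 * \<gamma>) \<le> 1" by (intro powr_le1) auto
  then show ?thesis unfolding wpot_def by (auto intro: mult_left_le)
qed

lemma wpot_eq: "\<bar>x\<bar> \<le> 1 \<Longrightarrow> wpot \<gamma> N x = N\<^sup>2 * \<bar>x\<bar> powr (2 * \<gamma>)"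
  by (simp add: wpot_def min_def)

lemma wpot_even: "wpot \<gamma> N (- x) = wpot \<gamma> N x" by (simp add: wpot_def)

lemma wpot_mono: "\<gamma> > 0 \<Longrightarrow> 0 \<le> x \<Longrightarrow> x \<le> y \<Longrightarrow> wpot \<gamma> N x \<le> wpot \<gamma> N y"
  unfolding wpot_def by (intro mult_left_mono powr_mono2) auto

text \<open>Shooting from $0$ with $v(0)=1$, $v'(0)=0$: the minimum of $v$ over $[0,1]$ depends continuously on the spectral
  parameter. Where it vanishes, the zero cannot lie in $[0,1)$, as it would be a double zero. The upper bound compares
  with $\cos(\pi x/2\varepsilon)$, $\varepsilon = N^{-1/(1+\gamma)}$.\<close>

lemma ground_state:
  assumes g: "\<gamma> > 0" and N: "N \<ge> 1"
  shows "\<exists>v v1 l. 0 \<le> l \<and> l \<le> 4 * N powr (2 / (1 + \<gamma>)) \<and> (\<forall>x. (v has_real_derivative v1 x) (at x)) \<and>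
     (\<forall>x. (v1 has_real_derivative (wpot \<gamma> N x - l) * v x) (at x)) \<and>
     v (-1) = 0 \<and> v 1 = 0 \<and> v1 1 \<le> 0 \<and> (\<forall>x\<in>{0..<1}. v x > 0)"
proof -
  have cw: "continuous_on UNIV (\<lambda>x. wpot \<gamma> N x - l)" for l by (intro continuous_intros wpot_continuous g)
  have bw: "\<bar>wpot \<gamma> N x - l\<bar> \<le> N\<^sup>2 + \<bar>l\<bar>" for x l using wpot_bounds[OF g, of N x] by linarith
  have "\<exists>P P1. P 0 = 1 \<and> P1 0 = 0 \<and> (\<forall>x. (P has_real_derivative P1 x) (at x)) \<and>
     (\<forall>x. (P1 has_real_derivative (wpot \<gamma> N x - l) * P x) (at x))" for l
    using linear_ode[OF cw[of l] bw[of _ l], of "\<lambda>_. 0" 1] by auto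
  then obtain v v1 where v: "\<And>l. v l 0 = 1" "\<And>l. v1 l 0 = 0" "\<And>l x. (v l has_real_derivative v1 l x) (at x)"
     "\<And>l x. (v1 l has_real_derivative (wpot \<gamma> N x - l) * v l x) (at (x::real))" by metis
  have vc: "continuous_on A (v l)" for A l
    using v(3) by (auto intro!: DERIV_continuous_on intro: has_field_derivative_at_within)
  have energy: "(v l x)\<^sup>2 \<le> exp (N\<^sup>2 + \<bar>l\<bar> + 2)" if x: "0 \<le> x" "x \<le> 1" for l x
  proof -
    have "(v l x)\<^sup>2 + (v1 l x)\<^sup>2 \<le> ((v l 0)\<^sup>2 + (v1 l 0)\<^sup>2 + 0\<^sup>2) * exp ((N\<^sup>2 + \<bar>l\<bar> + 2) * x)"
      by (rule ode_energy[where w = "\<lambda>x. wpot \<gamma> N x - l" and Q = "\<lambda>_. 0"]) (use v bw x in auto)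
    also have "\<dots> \<le> exp (N\<^sup>2 + \<bar>l\<bar> + 2)" using v x by (simp add: mult_left_le)
    finally show ?thesis by (smt (verit) zero_le_power2)
  qed
  have lip: "(v l x - v m x)\<^sup>2 \<le> (l - m)\<^sup>2 * exp (N\<^sup>2 + \<bar>m\<bar> + 2) * exp (N\<^sup>2 + \<bar>l\<bar> + 2)" if x: "0 \<le> x" "x \<le> 1" for l m x
  proof -
    \<comment> \<open>The difference of two solutions solves the equation for l with forcing (m - l)
      v_m; q bounds that forcing.\<close>
    define q where "q = \<bar>l - m\<bar> * sqrt (exp (N\<^sup>2 + \<bar>m\<bar> + 2))"
    have "(v l x - v m x)\<^sup>2 + (v1 l x - v1 m x)\<^sup>2 \<le> ((v l 0 - v m 0)\<^sup>2 + (v1 l 0 - v1 m 0)\<^sup>2 + q\<^sup>2) * exp ((N\<^sup>2 + \<bar>l\<bar> + 2) * x)"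
    proof (rule ode_energy[where w = "\<lambda>x. wpot \<gamma> N x - l" and Q = "\<lambda>x. (m - l) * v m x"])
      show "((\<lambda>x. v l x - v m x) has_real_derivative v1 l u - v1 m u) (at u)" for u by (intro DERIV_diff v)
      have "((\<lambda>x. v1 l x - v1 m x) has_real_derivative (wpot \<gamma> N u - l) * v l u - (wpot \<gamma> N u - m) * v m u) (at u)" for u
        by (intro DERIV_diff v)
      then show "((\<lambda>x. v1 l x - v1 m x) has_real_derivative (wpot \<gamma> N u - l) * (v l u - v m u) + (m - l) * v m u) (at u)" for u
        by (simp add: algebra_simps)
      show "\<bar>wpot \<gamma> N u - l\<bar> \<le> N\<^sup>2 + \<bar>l\<bar> \<and> \<bar>(m - l) * v m u\<bar> \<le> q" if "0 \<le> u" "u \<le> x" for u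
      proof
        have "\<bar>v m u\<bar> \<le> sqrt (exp (N\<^sup>2 + \<bar>m\<bar> + 2))" using energy[of u m] that x by (intro real_le_rsqrt) auto
        then show "\<bar>(m - l) * v m u\<bar> \<le> q" unfolding q_def abs_mult by (intro mult_mono) auto
      qed (rule bw)
    qed (use x in auto)
    also have "\<dots> \<le> q\<^sup>2 * exp (N\<^sup>2 + \<bar>l\<bar> + 2)" using v x by (simp, intro mult_left_mono) (auto simp: mult_left_le)
    also have "q\<^sup>2 = (l - m)\<^sup>2 * exp (N\<^sup>2 + \<bar>m\<bar> + 2)" by (simp add: q_def power_mult_distrib)
    finally show ?thesis by (smt (verit) zero_le_power2)
  qed
  have "\<exists>y\<in>{0..1}. \<forall>x\<in>{0..1}. v l y \<le> v l x" for l
    using continuous_attains_inf[of "{0..1}" "v l"] vc by auto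
  then obtain xm where xm: "\<And>l. xm l \<in> {0..1}" "\<And>l x. x \<in> {0..1} \<Longrightarrow> v l (xm l) \<le> v l x" by metis
  define mn where "mn l = v l (xm l)" for l
  \<comment> \<open>The part pi^2/4 gives b^2 for the comparison cosine on [0, eps], and the added 1
    pays for the potential there, at most N^2 eps^(2 gamma). With eps = N^(-1/(1+gamma)) both
    eps^(-2) and N^2 eps^(2 gamma) are N^(2/(1+gamma)).\<close>
  define l1 where "l1 = (pi\<^sup>2 / 4 + 1) * N powr (2 / (1 + \<gamma>))"
  have l10: "l1 \<ge> 0" by (simp add: l1_def)
  have "continuous_on {0..l1} mn"
  proof (rule continuous_onI)
    fix m e :: real assume m: "m \<in> {0..l1}" and e: "e > 0"
    define C where "C = exp (N\<^sup>2 + l1 + 2)"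
    have C: "C > 0" by (simp add: C_def)
    have dv: "\<bar>v l x - v k x\<bar> \<le> \<bar>l - k\<bar> * C" if "l \<in> {0..l1}" "k \<in> {0..l1}" "x \<in> {0..1}" for l k x
    proof (rule power2_le_imp_le)
      have "(v l x - v k x)\<^sup>2 \<le> (l - k)\<^sup>2 * exp (N\<^sup>2 + \<bar>k\<bar> + 2) * exp (N\<^sup>2 + \<bar>l\<bar> + 2)" using lip[of x l k] that by auto
      also have "\<dots> \<le> (l - k)\<^sup>2 * exp (N\<^sup>2 + l1 + 2) * exp (N\<^sup>2 + l1 + 2)"
        by (intro mult_mono) (use that in auto)
      finally show "\<bar>v l x - v k x\<bar>\<^sup>2 \<le> (\<bar>l - k\<bar> * C)\<^sup>2" by (simp add: C_def power_mult_distrib mult.assoc power2_eq_square[of "exp _"])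
    qed (use C in auto)
    have "dist (mn l) (mn m) \<le> e" if l: "l \<in> {0..l1}" "dist l m < e / C" for l
    proof -
      have "mn l \<le> v l (xm m)" unfolding mn_def using xm by auto
      moreover have "mn m \<le> v m (xm l)" unfolding mn_def using xm by auto
      moreover have "\<bar>l - m\<bar> * C \<le> e" using l(2) C by (simp add: dist_real_def field_simps)
      ultimately show ?thesis using dv[OF l(1) m xm(1)[of m]] dv[OF l(1) m xm(1)[of l]] by (simp add: dist_real_def mn_def abs_le_iff)
    qed
    then show "\<exists>d>0. \<forall>x'\<in>{0..l1}. dist x' m < d \<longrightarrow> dist (mn x') (mn m) \<le> e" using e C by (intro exI[of _ "e / C"]) auto
  qed
  moreover have "mn 0 \<ge> 0"
  proof (rule ccontr)
    assume "\<not> mn 0 \<ge> 0"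
    then have neg: "v 0 (xm 0) \<le> 0" "0 \<le> xm 0" using xm(1)[of 0] by (auto simp: mn_def)
    then obtain y where y: "0 \<le> y" "y \<le> xm 0" "v 0 y = 0"
      using IVT2'[of "v 0" "xm 0" 0 0] vc v(1)[of 0] by auto
    \<comment> \<open>For l = 0 the product v v' is nondecreasing from 0, so v^2 cannot decrease and
      v cannot come down from v(0) = 1 to a zero.\<close>
    have vv: "((\<lambda>x. v 0 x * v1 0 x) has_real_derivative (v1 0 u)\<^sup>2 + wpot \<gamma> N u * (v 0 u)\<^sup>2) (at u)" for u
      using DERIV_mult[OF v(3)[of 0 u] v(4)[of 0 u]] by (simp add: power2_eq_square algebra_simps)
    have "v 0 0 * v1 0 0 \<le> v 0 u * v1 0 u" if "0 \<le> u" for u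
      by (rule DERIV_nonneg_imp_nondecreasing[OF that])
         (use vv wpot_bounds[OF g] in \<open>meson add_nonneg_nonneg mult_nonneg_nonneg zero_le_power2\<close>)
    then have vn: "0 \<le> v 0 u * v1 0 u" if "0 \<le> u" for u using that v(2) by simp
    have "((\<lambda>x. (v 0 x)\<^sup>2) has_real_derivative 2 * (v 0 u * v1 0 u)) (at u)" for u
      by (rule derivative_eq_intros v(3) refl | simp)+
    then have "(v 0 0)\<^sup>2 \<le> (v 0 y)\<^sup>2"
      by (intro DERIV_nonneg_imp_nondecreasing[OF y(1)]) (use vn in fastforce)
    then show False using y v(1) by simp
  qed
  moreover have "mn l1 \<le> 0"
  proof (rule ccontr)
    assume "\<not> mn l1 \<le> 0"
    then have vp: "v l1 x > 0" if "x \<in> {0..1}" for x using xm(2)[OF that, of l1] by (simp add: mn_def)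
    define \<epsilon> where "\<epsilon> = N powr (- (1 / (1 + \<gamma>)))"
    have \<epsilon>: "0 < \<epsilon>" "\<epsilon> \<le> 1"
    proof -
      show "0 < \<epsilon>" using N by (simp add: \<epsilon>_def)
      have "N powr (- (1 / (1 + \<gamma>))) \<le> N powr 0" using N g by (intro powr_mono) auto
      then show "\<epsilon> \<le> 1" using N by (simp add: \<epsilon>_def)
    qed
    have e2: "1 / \<epsilon>\<^sup>2 = N powr (2 / (1 + \<gamma>))"
    proof -
      have "\<epsilon>\<^sup>2 = N powr (- (2 / (1 + \<gamma>)))" using N by (simp add: \<epsilon>_def power2_eq_square powr_add[symmetric])
      then show ?thesis by (simp add: powr_minus field_simps)
    qed
    have e3: "N\<^sup>2 * \<epsilon> powr (2 * \<gamma>) = N powr (2 / (1 + \<gamma>))"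
    proof -
      have "\<epsilon> powr (2 * \<gamma>) = N powr (- (2 * \<gamma> / (1 + \<gamma>)))" by (simp add: \<epsilon>_def powr_powr)
      moreover have "N\<^sup>2 = N powr 2" using N by simp
      ultimately have "N\<^sup>2 * \<epsilon> powr (2 * \<gamma>) = N powr (2 + - (2 * \<gamma> / (1 + \<gamma>)))" by (simp only: powr_add)
      also have "2 + - (2 * \<gamma> / (1 + \<gamma>)) = 2 / (1 + \<gamma>)" using g by (simp add: field_simps)
      finally show ?thesis .
    qed
    define b where "b = pi / (2 * \<epsilon>)"
    have b2: "b\<^sup>2 = pi\<^sup>2 / 4 * N powr (2 / (1 + \<gamma>))" using e2 by (simp add: b_def power_divide power_mult_distrib flip: e2)
    \<comment> \<open>The Wronskian of v with cos(bx). If v stayed positive it would be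
      nonincreasing on [0, eps] with W(0) = 0, yet W(eps) = b v(eps) > 0.\<close>
    define W where "W x = v1 l1 x * cos (b * x) + b * v l1 x * sin (b * x)" for x
    have Wd: "(W has_real_derivative (wpot \<gamma> N x - l1 + b\<^sup>2) * v l1 x * cos (b * x)) (at x)" for x
      unfolding W_def[abs_def]
      by (rule derivative_eq_intros v refl | simp)+ (simp add: algebra_simps power2_eq_square)
    have "W \<epsilon> \<le> W 0"
    proof (rule DERIV_nonpos_imp_nonincreasing[of 0 \<epsilon> W])
      fix x assume x: "0 \<le> x" "x \<le> \<epsilon>"
      have "wpot \<gamma> N x \<le> wpot \<gamma> N \<epsilon>" using wpot_mono[OF g x] .
      also have "\<dots> = N powr (2 / (1 + \<gamma>))" using e3 \<epsilon> by (simp add: wpot_eq)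
      finally have "wpot \<gamma> N x - l1 + b\<^sup>2 \<le> 0" by (simp add: l1_def b2 algebra_simps)
      moreover have "v l1 x > 0" using vp x \<epsilon> by simp
      moreover have "cos (b * x) \<ge> 0"
      proof (rule cos_ge_zero)
        have "b * x \<le> b * \<epsilon>" using x \<epsilon> by (intro mult_left_mono) (auto simp: b_def)
        also have "b * \<epsilon> = pi / 2" using \<epsilon> by (simp add: b_def)
        finally show "b * x \<le> pi / 2" .
        have "0 \<le> b * x" using x \<epsilon> by (simp add: b_def)
        then show "- (pi / 2) \<le> b * x" using pi_gt_zero by linarith
      qed
      ultimately have "(wpot \<gamma> N x - l1 + b\<^sup>2) * v l1 x * cos (b * x) \<le> 0"
        by (intro mult_nonpos_nonneg) auto
      then show "\<exists>y. (W has_real_derivative y) (at x) \<and> y \<le> 0" using Wd by blast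
    qed (use \<epsilon> in simp)
    moreover have "W 0 = 0" using v by (simp add: W_def)
    moreover have "W \<epsilon> = b * v l1 \<epsilon>"
    proof -
      have "b * \<epsilon> = pi / 2" using \<epsilon> by (simp add: b_def)
      then show ?thesis unfolding W_def by (simp only:) simp
    qed
    moreover have "b * v l1 \<epsilon> > 0" using vp[of \<epsilon>] \<epsilon> by (simp add: b_def)
    ultimately show False by simp
  qed
  ultimately obtain l where l: "0 \<le> l" "l \<le> l1" "mn l = 0" using IVT2'[of mn l1 0 0] l10 by auto
  have nn: "v l x \<ge> 0" if "x \<in> {0..1}" for x using xm(2)[OF that, of l] l(3) by (simp add: mn_def)
  have pos: "v l x > 0" if x: "x \<in> {0..<1}" for x
  proof (rule ccontr)
    assume "\<not> v l x > 0"
    then have z: "v l x = 0" using nn[of x] x by auto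
    have x0: "x \<noteq> 0" using z v(1) by auto
    have "v1 l x = 0"
    proof (rule DERIV_local_min[OF v(3)])
      show "0 < min x (1 - x)" using x x0 by auto
      show "\<forall>y. \<bar>x - y\<bar> < min x (1 - x) \<longrightarrow> v l x \<le> v l y" using z nn by (auto simp: abs_less_iff)
    qed
    \<comment> \<open>At x both v and v' vanish; the energy estimate run backwards from x to 0
      forces v(0) = 0, against v(0) = 1.\<close>
    have "(v l (x - x))\<^sup>2 + (- v1 l (x - x))\<^sup>2 \<le> ((v l (x - 0))\<^sup>2 + (- v1 l (x - 0))\<^sup>2 + 0\<^sup>2) * exp ((N\<^sup>2 + \<bar>l\<bar> + 2) * x)"
    proof (rule ode_energy[where w = "\<lambda>u. wpot \<gamma> N (x - u) - l" and Q = "\<lambda>_. 0"])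
      have lin: "((\<lambda>u. x - u) has_real_derivative -1) (at u)" for u by (auto intro!: derivative_eq_intros)
      show "((\<lambda>u. v l (x - u)) has_real_derivative - v1 l (x - u)) (at u)" for u
        using DERIV_chain2[of "v l" "v1 l (x - u)" "\<lambda>u. x - u" u "-1" UNIV, OF v(3) lin] by simp
      have "((\<lambda>u. v1 l (x - u)) has_real_derivative - ((wpot \<gamma> N (x - u) - l) * v l (x - u))) (at u)" for u
        using DERIV_chain2[of "v1 l" "(wpot \<gamma> N (x - u) - l) * v l (x - u)" "\<lambda>u. x - u" u "-1" UNIV, OF v(4) lin] by simp
      from DERIV_minus[OF this] show "((\<lambda>u. - v1 l (x - u)) has_real_derivative (wpot \<gamma> N (x - u) - l) * v l (x - u) + 0) (at u)" for u by simp
    qed (use bw x in auto)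
    then show False using z \<open>v1 l x = 0\<close> v(1,2) by simp
  qed
  have v1z: "v l 1 = 0"
  proof -
    have "v l (xm l) = 0" using l(3) by (simp add: mn_def)
    then have "xm l = 1" using pos[of "xm l"] xm(1)[of l] by force
    then show ?thesis using \<open>v l (xm l) = 0\<close> by simp
  qed
  have "v l (- 1) = 0"
  proof -
    \<comment> \<open>The potential is even, so v(u) - v(-u) solves the same equation with zero data
      at 0. Hence v is even and v(-1) = v(1).\<close>
    have "(v l 1 - v l (- 1))\<^sup>2 + (v1 l 1 + v1 l (- 1))\<^sup>2 \<le> ((v l 0 - v l (- 0))\<^sup>2 + (v1 l 0 + v1 l (- 0))\<^sup>2 + 0\<^sup>2) * exp ((N\<^sup>2 + \<bar>l\<bar> + 2) * 1)"
    proof (rule ode_energy[where P = "\<lambda>u. v l u - v l (- u)" and ?P1.0 = "\<lambda>u. v1 l u + v1 l (- u)" and w = "\<lambda>u. wpot \<gamma> N u - l" and Q = "\<lambda>_. 0" and x = 1])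
      have m1: "((\<lambda>u. v l (- u)) has_real_derivative - v1 l (- u)) (at u)" for u
        using v(3)[of l "- u"] by (simp add: DERIV_mirror)
      have m2: "((\<lambda>u. v1 l (- u)) has_real_derivative - ((wpot \<gamma> N u - l) * v l (- u))) (at u)" for u
        using v(4)[of l "- u"] by (simp add: DERIV_mirror wpot_even)
      show "((\<lambda>u. v l u - v l (- u)) has_real_derivative v1 l u + v1 l (- u)) (at u)" for u
        using DERIV_diff[OF v(3) m1] by simp
      show "((\<lambda>u. v1 l u + v1 l (- u)) has_real_derivative (wpot \<gamma> N u - l) * (v l u - v l (- u)) + 0) (at u)" for u
        using DERIV_add[OF v(4) m2] by (simp add: algebra_simps)
    qed (use bw in auto)
    then show ?thesis using v(1,2) v1z by (simp add: sum_power2_le_zero_iff)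
  qed
  moreover have "v1 l 1 \<le> 0"
  proof (rule ccontr)
    assume "\<not> v1 l 1 \<le> 0"
    then obtain d where d: "d > 0" "\<And>h. 0 < h \<Longrightarrow> h < d \<Longrightarrow> v l (1 - h) < v l 1" using DERIV_pos_inc_left[OF v(3)[of l 1]] by auto
    have "v l (1 - min (d/2) (1/2)) < v l 1" by (rule d(2)) (use d(1) in auto)
    moreover have "1 - min (d/2) (1/2) \<in> {0..1}" using d(1) by (auto simp: min_def)
    ultimately show False using v1z nn[of "1 - min (d/2) (1/2)"] by linarith
  qed
  moreover have "l \<le> 4 * N powr (2 / (1 + \<gamma>))"
  proof -
    have "pi\<^sup>2 \<le> (3.2)\<^sup>2" using pi_less_4 pi_approx by (intro power_mono) auto
    then have "pi\<^sup>2 / 4 + 1 \<le> 4" by (simp add: power2_eq_square)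
    then have "l1 \<le> 4 * N powr (2 / (1 + \<gamma>))" unfolding l1_def by (intro mult_right_mono) auto
    then show ?thesis using l by simp
  qed
  ultimately show ?thesis using v(3,4) v1z pos l(1) by blast
qed

text \<open>On [a/4,1] the function (v' + kappa v) e^(-kappa x) is nondecreasing, since its
  derivative is (W - kappa^2) v e^(-kappa x), and it is nonpositive at 1. Hence v e^(kappa x) is
  nonincreasing. From a/2 to a this gains exp(-kappa a/2), while v stays above v(a/2) on [a/4, a/2];
  the latter bounds the total mass from below.\<close>

lemma ground_state_decay:
  assumes a: "0 < a" "a < 1" and k: "\<kappa> > 0"
    and v: "\<And>x. (v has_real_derivative v1 x) (at x)" "\<And>x. (v1 has_real_derivative W x * v x) (at x)"
    and z: "v 1 = 0" "v1 1 \<le> 0" "\<And>x. x \<in> {0..<1} \<Longrightarrow> v x > 0"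
    and W: "\<And>x. x \<in> {a/4..1} \<Longrightarrow> W x \<ge> \<kappa>\<^sup>2"
  shows "\<And>x. x \<in> {a..1} \<Longrightarrow> v x \<le> v (a/2) * exp (- \<kappa> * a / 2)" "\<And>x. x \<in> {a/4..a/2} \<Longrightarrow> v x \<ge> v (a/2)"
proof -
  have nn: "v x \<ge> 0" if "x \<in> {0..1}" for x using z(1) z(3)[of x] that by (cases "x = 1") (auto simp: less_imp_le)
  define h where "h x = (v1 x + \<kappa> * v x) * exp (- \<kappa> * x)" for x
  have hd: "(h has_real_derivative (W x * v x - \<kappa>\<^sup>2 * v x) * exp (- \<kappa> * x)) (at x)" for x
    unfolding h_def[abs_def] by (rule derivative_eq_intros v refl | simp)+ (simp add: algebra_simps power2_eq_square)
  have h0: "v1 x + \<kappa> * v x \<le> 0" if x: "x \<in> {a/4..1}" for x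
  proof -
    have "h x \<le> h 1"
    proof (rule DERIV_nonneg_imp_nondecreasing[of x 1 h])
      fix u assume u: "x \<le> u" "u \<le> 1"
      have "0 \<le> (W u - \<kappa>\<^sup>2) * v u * exp (- \<kappa> * u)"
        using W[of u] nn[of u] u x a by (intro mult_nonneg_nonneg) auto
      then show "\<exists>y. (h has_real_derivative y) (at u) \<and> y \<ge> 0" using hd[of u] by (auto simp: algebra_simps)
    qed (use x in auto)
    also have "h 1 \<le> 0" unfolding h_def using z by (simp add: mult_nonpos_nonneg)
    finally show ?thesis unfolding h_def by (simp add: mult_le_0_iff)
  qed
  define r where "r x = v x * exp (\<kappa> * x)" for x
  have rd: "(r has_real_derivative (v1 x + \<kappa> * v x) * exp (\<kappa> * x)) (at x)" for x
    unfolding r_def[abs_def] by (rule derivative_eq_intros v refl | simp)+ (simp add: algebra_simps)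
  have rm: "r y \<le> r x" if xy: "a/4 \<le> x" "x \<le> y" "y \<le> 1" for x y
  proof (rule DERIV_nonpos_imp_nonincreasing[OF xy(2)])
    fix u assume u: "x \<le> u" "u \<le> y"
    have "(v1 u + \<kappa> * v u) * exp (\<kappa> * u) \<le> 0" using h0[of u] u xy by (intro mult_nonpos_nonneg) auto
    then show "\<exists>y. (r has_real_derivative y) (at u) \<and> y \<le> 0" using rd by blast
  qed
  show "v x \<le> v (a/2) * exp (- \<kappa> * a / 2)" if x: "x \<in> {a..1}" for x
  proof -
    have "r x \<le> r (a/2)" using rm[of "a/2" x] x a by auto
    then have "v x * exp (\<kappa> * x) * exp (- \<kappa> * x) \<le> v (a/2) * exp (\<kappa> * (a/2)) * exp (- \<kappa> * x)"
      unfolding r_def by (intro mult_right_mono) auto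
    moreover have "v x * exp (\<kappa> * x) * exp (- \<kappa> * x) = v x" by (simp add: mult.assoc flip: exp_add)
    moreover have "v (a/2) * exp (\<kappa> * (a/2)) * exp (- \<kappa> * x) = v (a/2) * exp (\<kappa> * (a/2) - \<kappa> * x)" by (simp add: mult.assoc flip: exp_add)
    moreover have "v (a/2) * exp (\<kappa> * (a/2) - \<kappa> * x) \<le> v (a/2) * exp (- \<kappa> * a / 2)"
    proof (rule mult_left_mono)
      have "\<kappa> * a \<le> \<kappa> * x" using x k by (intro mult_left_mono) auto
      then show "exp (\<kappa> * (a/2) - \<kappa> * x) \<le> exp (- \<kappa> * a / 2)" by simp
    qed (use nn[of "a/2"] a in auto)
    ultimately show ?thesis by linarith
  qed
  show "v x \<ge> v (a/2)" if x: "x \<in> {a/4..a/2}" for x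
  proof (rule DERIV_nonpos_imp_nonincreasing[of x "a/2" v])
    fix u assume u: "x \<le> u" "u \<le> a/2"
    have "v1 u \<le> - \<kappa> * v u" using h0[of u] u x a by auto
    also have "\<dots> \<le> 0" using nn[of u] k u x a by (simp add: mult_nonpos_nonneg)
    finally show "\<exists>y. (v has_real_derivative y) (at u) \<and> y \<le> 0" using v(1) by blast
  qed (use x in auto)
qed


section \<open>Failure of observability\<close>

definition sn :: "nat \<Rightarrow> real \<Rightarrow> real" where "sn n y = sqrt 2 * sin (real n * pi * y)"
definition cn :: "nat \<Rightarrow> real \<Rightarrow> real" where "cn n y = sqrt 2 * (real n * pi) * cos (real n * pi * y)"

lemma sn_deriv: "(sn n has_real_derivative cn n y) (at y)"
  unfolding sn_def[abs_def] cn_def by (rule derivative_eq_intros refl | simp)+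

lemma cn_deriv: "(cn n has_real_derivative - (real n * pi)\<^sup>2 * sn n y) (at y)"
  unfolding sn_def cn_def[abs_def] by (rule derivative_eq_intros refl | simp)+ (simp add: power2_eq_square)

lemma sn_continuous[continuous_intros]: "continuous_on A (sn n)" and cn_continuous[continuous_intros]: "continuous_on A (cn n)"
  unfolding sn_def[abs_def] cn_def[abs_def] by (intro continuous_intros)+

lemma sin_npi_real[simp]: "sin (real n * pi) = 0" "sin (pi * real n) = 0"
  by (simp_all add: sin_zero_iff_int2 mult.commute) 

lemma sn_ends[simp]: "sn n 0 = 0" "sn n 1 = 0" by (auto simp: sn_def)

lemma sn_bound: "\<bar>sn n y\<bar> \<le> sqrt 2"
  unfolding sn_def abs_mult using abs_sin_le_one[of "real n * pi * y"] by (simp add: mult_left_le)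

lemma integral_cos_MY: assumes "k \<noteq> 0" shows "(\<integral>y. cos (real_of_int k * pi * y) \<partial>MY) = 0"
proof -
  have "(\<integral>y. cos (real_of_int k * pi * y) \<partial>MY) = sin (real_of_int k * pi * 1) / (real_of_int k * pi) - sin (real_of_int k * pi * 0) / (real_of_int k * pi)"
    by (rule integral_MY_deriv) (use assms in \<open>auto intro!: derivative_eq_intros continuous_intros\<close>)
  moreover have "sin (real_of_int k * pi) = 0" using sin_zero_iff_int2 by blast
  ultimately show ?thesis by simp
qed

lemma sn_orthonormal:
  assumes "n \<ge> 1" "m \<ge> 1" shows "(\<integral>y. sn n y * sn m y \<partial>MY) = (if n = m then 1 else 0)"
proof -
  have e: "sn n y * sn m y = cos (real_of_int (int n - int m) * pi * y) - cos (real_of_int (int n + int m) * pi * y)" for y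
  proof -
    have "sn n y * sn m y = 2 * (sin (real n * pi * y) * sin (real m * pi * y))"
      unfolding sn_def by (simp add: algebra_simps)
    also have "\<dots> = cos (real n * pi * y - real m * pi * y) - cos (real n * pi * y + real m * pi * y)"
      by (simp add: cos_diff cos_add)
    finally show ?thesis by (simp add: algebra_simps)
  qed
  have i: "integrable MY (\<lambda>y. cos (c * y))" for c :: real
    by (rule sqi_integrable[OF finite_MY continuous_sqi_MY]) (intro continuous_intros)
  have "(\<integral>y. sn n y * sn m y \<partial>MY) = (\<integral>y. cos (real_of_int (int n - int m) * pi * y) \<partial>MY) - (\<integral>y. cos (real_of_int (int n + int m) * pi * y) \<partial>MY)"
    unfolding e by (rule Bochner_Integration.integral_diff) (rule i)+
  also have "(\<integral>y. cos (real_of_int (int n + int m) * pi * y) \<partial>MY) = 0" by (rule integral_cos_MY) (use assms in linarith)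
  finally show ?thesis
  proof (cases "n = m")
    case True
    have "(\<integral>y. (1::real) \<partial>MY) = 1" using integral_MY_deriv[of "\<lambda>x. x" "\<lambda>_. 1"] by (auto intro!: derivative_eq_intros)
    then show ?thesis if "(\<integral>y. sn n y * sn m y \<partial>MY) = (\<integral>y. cos (real_of_int (int n - int m) * pi * y) \<partial>MY) - 0"
      using that True by simp
  next
    case False
    then show ?thesis if "(\<integral>y. sn n y * sn m y \<partial>MY) = (\<integral>y. cos (real_of_int (int n - int m) * pi * y) \<partial>MY) - 0"
      using that integral_cos_MY[of "int n - int m"] by simp
  qed
qed

lemma integral_ten:
  assumes "integrable MX f" "integrable MY g" shows "integrable MO (ten f g)" "(\<integral>z. ten f g z \<partial>MO) = (\<integral>x. f x \<partial>MX) * (\<integral>y. g y \<partial>MY)"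
proof -
  have "integrable (MX \<Otimes>\<^sub>M MY) (\<lambda>(x,y). f x * g y)"
  proof (rule MXY.Fubini_integrable)
    show "(\<lambda>(x, y). f x * g y) \<in> borel_measurable (MX \<Otimes>\<^sub>M MY)"
      using assms by (auto simp: split_beta')
    show "integrable MX (\<lambda>x. \<integral>y. norm (case (x, y) of (x, y) \<Rightarrow> f x * g y) \<partial>MY)"
      using assms by (simp add: abs_mult)
    show "AE x in MX. integrable MY (\<lambda>y. case (x, y) of (x, y) \<Rightarrow> f x * g y)" using assms by simp
  qed
  then show i: "integrable MO (ten f g)" by (simp add: MO_eq_pair ten_def split_beta')
  show "(\<integral>z. ten f g z \<partial>MO) = (\<integral>x. f x \<partial>MX) * (\<integral>y. g y \<partial>MY)"
    unfolding integral_MO_xy[OF i] by simp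
qed

lemma integral_MO_cong: "(\<And>x y. x \<in> {-1<..<1} \<Longrightarrow> y \<in> {0<..<1} \<Longrightarrow> f (x,y) = g (x,y)) \<Longrightarrow> (\<integral>z. f z \<partial>MO) = (\<integral>z. g z \<partial>MO)"
  by (rule Bochner_Integration.integral_cong) (auto simp: Omega_def)

lemma aV_sym: assumes "\<gamma> > 0" "f \<in> Vspace \<gamma>" "h \<in> Vspace \<gamma>" shows "aV \<gamma> f h = aV \<gamma> h f"
proof -
  obtain \<phi> \<psi> where a: "approx_seq \<gamma> \<phi> f" "approx_seq \<gamma> \<psi> h" "sqi MO f" "sqi MO h" using assms by (auto simp: Vspace_def L2_iff)
  have "(\<lambda>k. Vip \<gamma> (\<phi> k) (\<psi> k)) \<longlonglongrightarrow> - aV \<gamma> f h" by (rule aV_limit[OF assms(1) a(3,4,1,2)])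
  moreover have "(\<lambda>k. Vip \<gamma> (\<phi> k) (\<psi> k)) \<longlonglongrightarrow> - aV \<gamma> h f"
    using aV_limit[OF assms(1) a(4,3,2,1)] by (simp add: Vip_sym)
  ultimately show ?thesis using LIMSEQ_unique by fastforce
qed

lemma Ck2_ten_sn:
  assumes "\<And>x. (p has_real_derivative p1 x) (at x)" "\<And>x. (p1 has_real_derivative p2 x) (at x)" "continuous_on UNIV p2"
  shows "Ck 2 (ten p (sn n))"
proof -
  define A where "A i = (if i = 0 then p else if i = 1 then p1 else p2)" for i :: nat
  define B where "B i = (if i = 0 then sn n else if i = 1 then cn n else (\<lambda>y. - (real n * pi)\<^sup>2 * sn n y))" for i :: nat
  have c: "continuous_on UNIV p" "continuous_on UNIV p1"
    using assms(1,2) by (auto intro!: DERIV_continuous_on intro: has_field_derivative_at_within)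
  have "Ck 2 (ten (A 0) (B 0))"
  proof (rule Ck_ten[of 2])
    show "(A i has_real_derivative A (Suc i) x) (at x)" if "i < 2" for i x using that assms by (auto simp: A_def less_2_cases_iff)
    show "(B i has_real_derivative B (Suc i) x) (at x)" if "i < 2" for i x
      using that sn_deriv cn_deriv by (auto simp: B_def less_2_cases_iff)
    show "continuous_on UNIV (A i)" for i using c assms by (auto simp: A_def)
    show "continuous_on UNIV (B i)" for i by (auto simp: B_def intro!: continuous_intros)
  qed auto
  then show ?thesis by (simp add: A_def B_def)
qed

lemma ten_sn_domain:
  assumes g: "\<gamma> > 0" and p: "\<And>x. (p has_real_derivative p1 x) (at x)" "\<And>x. (p1 has_real_derivative p2 x) (at x)" "continuous_on UNIV p2"
     "p (-1) = 0" "p 1 = 0"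
  shows "ten p (sn n) \<in> Vspace \<gamma>"
    and "f \<in> Vspace \<gamma> \<Longrightarrow> aV \<gamma> f (ten p (sn n)) = (\<integral>z. f z * ten (\<lambda>x. p2 x - wpot \<gamma> (real n * pi) x * p x) (sn n) z \<partial>MO)"
    and "sqi MO f \<Longrightarrow> approx_seq \<gamma> \<phi> f \<Longrightarrow> (\<lambda>k. Vip \<gamma> (\<phi> k) (ten p (sn n))) \<longlonglongrightarrow> - aV \<gamma> f (ten p (sn n))"
proof -
  have c: "continuous_on UNIV p1" using p(2) by (auto intro!: DERIV_continuous_on intro: has_field_derivative_at_within)
  have C2: "Ck 2 (ten p (sn n))" by (rule Ck2_ten_sn[OF p(1-3)])
  obtain \<psi> where \<psi>: "approx_seq \<gamma> \<psi> (ten p (sn n))" "(\<lambda>k. vn \<gamma> (\<lambda>z. \<psi> k z - ten p (sn n) z)) \<longlonglongrightarrow> 0"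
    using ten_approx[OF g p(1) c p(4,5) sn_deriv] by (auto intro: continuous_intros)
  show V: "ten p (sn n) \<in> Vspace \<gamma>" using \<psi> continuous_sqi[OF Ck_continuous[OF C2]] by (auto simp: Vspace_def L2_iff)
  have dx: "pdx (pdx (ten p (sn n))) = ten p2 (sn n)" by (simp add: pdx_ten[OF p(1)] pdx_ten[OF p(2)])
  have dy: "pdy (pdy (ten p (sn n))) = ten p (\<lambda>y. - (real n * pi)\<^sup>2 * sn n y)"
    by (simp only: pdy_ten[OF sn_deriv] pdy_ten[OF cn_deriv])
  have L: "Lop \<gamma> (ten p (sn n)) (x, y) = ten (\<lambda>x. p2 x - wpot \<gamma> (real n * pi) x * p x) (sn n) (x, y)" if "x \<in> {-1<..<1}" for x y
  proof -
    have "\<bar>x\<bar> \<le> 1" using that by auto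
    then show ?thesis using dx dy by (simp add: Lop_def wpot_eq algebra_simps power_mult_distrib)
  qed
  show "(\<lambda>k. Vip \<gamma> (\<phi> k) (ten p (sn n))) \<longlonglongrightarrow> - aV \<gamma> f (ten p (sn n))" if "sqi MO f" "approx_seq \<gamma> \<phi> f" for f \<phi>
    by (rule aV_smooth(2)[OF g that(1) C2 that(2) \<psi>])
  assume f: "f \<in> Vspace \<gamma>"
  then obtain \<phi> where \<phi>: "sqi MO f" "approx_seq \<gamma> \<phi> f" by (auto simp: Vspace_def L2_iff)
  have "aV \<gamma> f (ten p (sn n)) = (\<integral>z. f z * Lop \<gamma> (ten p (sn n)) z \<partial>MO)"
    by (rule aV_smooth(1)[OF g \<phi>(1) C2 \<phi>(2) \<psi>])
  also have "\<dots> = (\<integral>z. f z * ten (\<lambda>x. p2 x - wpot \<gamma> (real n * pi) x * p x) (sn n) z \<partial>MO)"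
    by (rule integral_MO_cong) (simp only: L)
  finally show "aV \<gamma> f (ten p (sn n)) = (\<integral>z. f z * ten (\<lambda>x. p2 x - wpot \<gamma> (real n * pi) x * p x) (sn n) z \<partial>MO)" .
qed

text \<open>Along the trajectory everything is a scalar multiple of one function, so all L^2 limits
  reduce to limits of exp(-lt). Symmetry of \<open>aV\<close> moves the eigenfunction into the
  second slot, where \<open>ten_sn_domain\<close> applies.\<close>

lemma eigen_solution:
  assumes g: "\<gamma> > 0" and v: "\<And>x. (v has_real_derivative v1 x) (at x)" "\<And>x. (v1 has_real_derivative (wpot \<gamma> (real n * pi) x - l) * v x) (at x)"
     "v (-1) = 0" "v 1 = 0"
  shows "L2 (ten v (sn n))" "is_solution \<gamma> (ten v (sn n)) (\<lambda>t z. exp (- l * t) * ten v (sn n) z)"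
proof -
  define e where "e = ten v (sn n)"
  have vc: "continuous_on UNIV v" using v by (auto intro!: DERIV_continuous_on intro: has_field_derivative_at_within)
  have ec: "continuous_on UNIV e" unfolding e_def by (intro continuous_ten vc continuous_intros)
  have es: "sqi MO (\<lambda>z. c * e z)" for c by (intro sqi_cmult continuous_sqi ec)
  show "L2 (ten v (sn n))" using es[of 1] by (simp add: L2_iff e_def)
  have A: "A_op \<gamma> (\<lambda>z. c * e z) (\<lambda>z. - l * (c * e z))" for c
  proof -
    have d: "((\<lambda>x. c * v x) has_real_derivative c * v1 x) (at x)" "((\<lambda>x. c * v1 x) has_real_derivative c * ((wpot \<gamma> (real n * pi) x - l) * v x)) (at x)" for x
      by (intro DERIV_cmult v)+
    have cc: "continuous_on UNIV (\<lambda>x. c * ((wpot \<gamma> (real n * pi) x - l) * v x))" by (intro continuous_intros vc wpot_continuous g)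
    have ce: "(\<lambda>z. c * e z) = ten (\<lambda>x. c * v x) (sn n)" by (auto simp: e_def ten_def)
    have V: "(\<lambda>z. c * e z) \<in> Vspace \<gamma>" unfolding ce by (rule ten_sn_domain(1)[OF g d cc]) (use v in auto)
    have "aV \<gamma> (\<lambda>z. c * e z) w = L2inner (\<lambda>z. - l * (c * e z)) w" if w: "w \<in> Vspace \<gamma>" for w
    proof -
      have "aV \<gamma> (\<lambda>z. c * e z) w = aV \<gamma> w (ten (\<lambda>x. c * v x) (sn n))" using aV_sym[OF g V w] by (simp add: ce)
      also have "\<dots> = (\<integral>z. w z * ten (\<lambda>x. c * ((wpot \<gamma> (real n * pi) x - l) * v x) - wpot \<gamma> (real n * pi) x * (c * v x)) (sn n) z \<partial>MO)"
        by (rule ten_sn_domain(2)[OF g d cc _ _ w]) (use v in auto)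
      also have "\<dots> = L2inner (\<lambda>z. - l * (c * e z)) w" unfolding L2inner_eq
        by (rule Bochner_Integration.integral_cong) (auto simp: e_def ten_def algebra_simps)
      finally show ?thesis .
    qed
    then show ?thesis unfolding A_op_def using V es[of "- l * c"] by (simp add: L2_iff mult.assoc)
  qed
  have dist: "L2dist2 (\<lambda>z. c * e z) (\<lambda>z. d * e z) = (c - d)\<^sup>2 * (n2 MO e)\<^sup>2" for c d
  proof -
    have "(\<lambda>z. c * e z - d * e z) = (\<lambda>z. (c - d) * e z)" by (auto simp: algebra_simps)
    then show ?thesis unfolding L2dist2_eq by (simp add: n2_cmult power_mult_distrib)
  qed
  have ex: "((\<lambda>t. exp (- l * t)) has_real_derivative - l * exp (- l * t)) (at t)" for t
    by (rule derivative_eq_intros refl | simp)+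
  show "is_solution \<gamma> (ten v (sn n)) (\<lambda>t z. exp (- l * t) * ten v (sn n) z)"
    unfolding is_solution_def e_def[symmetric]
  proof (intro conjI allI impI)
    show "L2 (\<lambda>z. exp (- l * t) * e z)" for t using es by (simp add: L2_iff)
    show "L2dist2 (\<lambda>z. exp (- l * 0) * e z) e = 0" using dist[of 1 1] by simp
    show "((\<lambda>s. L2dist2 (\<lambda>z. exp (- l * s) * e z) (\<lambda>z. exp (- l * t) * e z)) \<longlongrightarrow> 0) (at t within {0..})" for t
    proof -
      have "((\<lambda>s. (exp (- l * s) - exp (- l * t))\<^sup>2 * (n2 MO e)\<^sup>2) \<longlongrightarrow> (exp (- l * t) - exp (- l * t))\<^sup>2 * (n2 MO e)\<^sup>2) (at t within {0..})"
        by (intro tendsto_intros)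
      then show ?thesis by (simp add: dist)
    qed
    show "\<exists>h. A_op \<gamma> (\<lambda>z. exp (- l * t) * e z) h \<and>
         ((\<lambda>s. L2dist2 (\<lambda>z. (exp (- l * s) * e z - exp (- l * t) * e z) / (s - t)) h) \<longlongrightarrow> 0) (at t within {0<..})" for t
    proof (intro exI conjI)
      show "A_op \<gamma> (\<lambda>z. exp (- l * t) * e z) (\<lambda>z. - l * (exp (- l * t) * e z))" by (rule A)
      have eq: "L2dist2 (\<lambda>z. (exp (- l * s) * e z - exp (- l * t) * e z) / (s - t)) (\<lambda>z. - l * (exp (- l * t) * e z)) =
          ((exp (- l * s) - exp (- l * t)) / (s - t) - (- l * exp (- l * t)))\<^sup>2 * (n2 MO e)\<^sup>2" for s
      proof -
        have "(\<lambda>z. (exp (- l * s) * e z - exp (- l * t) * e z) / (s - t)) = (\<lambda>z. ((exp (- l * s) - exp (- l * t)) / (s - t)) * e z)"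
          by (auto simp: algebra_simps diff_divide_distrib)
        moreover have "(\<lambda>z. - l * (exp (- l * t) * e z)) = (\<lambda>z. (- l * exp (- l * t)) * e z)" by (auto simp: algebra_simps)
        ultimately show ?thesis using dist by presburger
      qed
      have "((\<lambda>s. (exp (- l * s) - exp (- l * t)) / (s - t)) \<longlongrightarrow> - l * exp (- l * t)) (at t within {0<..})"
        using has_field_derivative_at_within[OF ex[of t], of "{0<..}"] by (simp add: has_field_derivative_iff)
      then have "((\<lambda>s. ((exp (- l * s) - exp (- l * t)) / (s - t) - (- l * exp (- l * t)))\<^sup>2 * (n2 MO e)\<^sup>2) \<longlongrightarrow>
          ((- l * exp (- l * t)) - (- l * exp (- l * t)))\<^sup>2 * (n2 MO e)\<^sup>2) (at t within {0<..})"
        by (intro tendsto_intros)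
      then show "((\<lambda>s. L2dist2 (\<lambda>z. (exp (- l * s) * e z - exp (- l * t) * e z) / (s - t)) (\<lambda>z. - l * (exp (- l * t) * e z))) \<longlongrightarrow> 0) (at t within {0<..})"
        unfolding eq by simp
    qed
  qed
qed

lemma omega_integral: "(LINT z:omega a b|lborel. f z) = (\<integral>z. indicator {a<..<b} (fst z) * f z \<partial>MO)" if "-1 \<le> a" "b \<le> 1" for f :: "_ \<Rightarrow> real"
proof -
  have "(LINT z:omega a b|lborel. f z) = (LINT z:Omega|lborel. indicator {a<..<b} (fst z) * f z)"
    unfolding set_lebesgue_integral_def
    by (rule Bochner_Integration.integral_cong) (use that in \<open>auto simp: omega_def Omega_def indicator_def\<close>)
  then show ?thesis by (simp add: set_integral_Omega)
qed

text \<open>With s = v(a/2), the mass at time T is at least e^(-2lT) s^2 a/4, from the window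
  [a/4, a/2] alone. The observation is at most 2 T s^2 e^(-kappa a), where 2 is the length of (-1,1)
  and the decay in time is dropped. Their quotient is the claim.\<close>

lemma observable_eigen_bound:
  assumes g: "\<gamma> > 0" and ab: "0 < a" "a < b" "b < 1" and T: "T > 0" and k: "\<kappa> > 0" and n: "n \<ge> 1" and l: "l \<ge> 0"
    and v: "\<And>x. (v has_real_derivative v1 x) (at x)" "\<And>x. (v1 has_real_derivative (wpot \<gamma> (real n * pi) x - l) * v x) (at x)"
     "v (-1) = 0" "v 1 = 0" "v1 1 \<le> 0" "\<And>x. x \<in> {0..<1} \<Longrightarrow> v x > 0"
    and W: "\<And>x. x \<in> {a/4..1} \<Longrightarrow> wpot \<gamma> (real n * pi) x - l \<ge> \<kappa>\<^sup>2"
    and obs: "\<And>g0 g. L2 g0 \<Longrightarrow> is_solution \<gamma> g0 g \<Longrightarrow> (LINT z:Omega|lborel. (g T z)\<^sup>2) \<le>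
        C * (LINT t:{0..T}|lborel. (LINT z:omega a b|lborel. (g t z)\<^sup>2))" and C: "C > 0"
  shows "exp (\<kappa> * a - 2 * l * T) \<le> 8 * C * T / a"
proof -
  define e where "e = ten v (sn n)"
  define s where "s = v (a/2)"
  have sp: "s > 0" unfolding s_def using v(6)[of "a/2"] ab by auto
  have a1: "a < 1" using ab by simp
  have dec: "\<And>x. x \<in> {a..1} \<Longrightarrow> v x \<le> v (a/2) * exp (- \<kappa> * a / 2)" "\<And>x. x \<in> {a/4..a/2} \<Longrightarrow> v x \<ge> v (a/2)"
    using ground_state_decay[OF ab(1) a1 k v(1,2,4,5)] v(6) W by blast+
  have vc: "continuous_on UNIV v" using v by (auto intro!: DERIV_continuous_on intro: has_field_derivative_at_within)
  have ec: "continuous_on UNIV e" unfolding e_def by (intro continuous_ten vc continuous_intros)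
  have es: "sqi MO e" by (rule continuous_sqi[OF ec])
  have sn1: "(\<integral>y. (sn n y)\<^sup>2 \<partial>MY) = 1" using sn_orthonormal[OF n n] by (simp add: power2_eq_square)
  have sni: "integrable MY (\<lambda>y. (sn n y)\<^sup>2)" by (intro sqi_integrable_sq continuous_sqi_MY continuous_intros)
  define E where "E = (\<integral>z. indicator {a<..<b} (fst z) * (e z)\<^sup>2 \<partial>MO)"
  have ic: "integrable MX (\<lambda>x. c * indicator S x)" if "S \<in> sets borel" for c :: real and S
  proof (rule MX.integrable_const_bound[where B = "\<bar>c\<bar>"])
    show "AE x in MX. norm (c * indicator S x) \<le> \<bar>c\<bar>" by (auto simp: indicator_def)
    show "(\<lambda>x. c * indicator S x) \<in> borel_measurable MX" using that by (intro measurable_MX) auto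
  qed
  have E0: "0 \<le> E" unfolding E_def by (rule integral_nonneg_AE) auto
  have eint: "integrable MO (\<lambda>z. indicator {a<..<b} (fst z) * (e z)\<^sup>2)"
  proof (rule Bochner_Integration.integrable_bound[OF sqi_integrable_sq[OF es]])
    show "(\<lambda>z. indicator {a<..<b} (fst z) * (e z)\<^sup>2) \<in> borel_measurable MO"
      by (intro measurable_MO borel_measurable_times borel_measurable_power borel_measurable_continuous_onI[OF ec])
         (auto intro!: borel_measurable_indicator' simp: borel_prod[symmetric])
    show "AE x in MO. norm (indicator {a<..<b} (fst x) * (e x)\<^sup>2) \<le> norm ((e x)\<^sup>2)" by (auto simp: indicator_def)
  qed
  have Eu: "E \<le> s\<^sup>2 * exp (- \<kappa> * a) * 2"
  proof -
    have "E \<le> (\<integral>z. ten (\<lambda>x. s\<^sup>2 * exp (- \<kappa> * a) * indicator UNIV x) (\<lambda>y. (sn n y)\<^sup>2) z \<partial>MO)" unfolding E_def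
    proof (rule integral_mono[OF eint])
      show "integrable MO (ten (\<lambda>x. s\<^sup>2 * exp (- \<kappa> * a) * indicator UNIV x) (\<lambda>y. (sn n y)\<^sup>2))"
        by (rule integral_ten(1)[OF ic sni]) simp
      fix z assume "z \<in> space MO"
      obtain x y where z: "z = (x,y)" by force
      show "indicator {a<..<b} (fst z) * (e z)\<^sup>2 \<le> ten (\<lambda>x. s\<^sup>2 * exp (- \<kappa> * a) * indicator UNIV x) (\<lambda>y. (sn n y)\<^sup>2) z"
      proof (cases "x \<in> {a<..<b}")
        case True
        have "v x \<le> s * exp (- \<kappa> * a / 2)" using dec(1)[of x] True ab by (auto simp: s_def)
        moreover have "0 \<le> v x" using v(6)[of x] True ab by (auto simp: less_imp_le)
        ultimately have "(v x)\<^sup>2 \<le> (s * exp (- \<kappa> * a / 2))\<^sup>2" by (intro power_mono)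
        also have "\<dots> = s\<^sup>2 * exp (- \<kappa> * a)" by (simp add: power_mult_distrib power2_eq_square flip: exp_add)
        finally show ?thesis using True by (simp add: z e_def power_mult_distrib mult_right_mono)
      qed (simp add: z)
    qed
    also have "\<dots> = s\<^sup>2 * exp (- \<kappa> * a) * 2"
    proof -
      have "(\<integral>x. (1::real) \<partial>MX) = 2" using integral_MX_deriv[of "\<lambda>x. x" "\<lambda>_. 1"] by (auto intro!: derivative_eq_intros)
      then show ?thesis using integral_ten(2)[OF ic[of UNIV] sni] sn1 by simp
    qed
    finally show ?thesis .
  qed
  have El: "s\<^sup>2 * (a/4) \<le> (\<integral>z. (e z)\<^sup>2 \<partial>MO)"
  proof -
    have "{a/4..a/2} \<subseteq> {-1<..<1}" using ab by auto
    then have "measure MX {a/4..a/2} = measure lborel {a/4..a/2}" unfolding MX_def by (intro measure_restrict_space) auto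
    then have "measure MX {a/4..a/2} = a/4" using ab by simp
    then have i: "(\<integral>x. s\<^sup>2 * indicator {a/4..a/2} x \<partial>MX) = s\<^sup>2 * (a/4)" 
    proof -
      assume m: "measure MX {a/4..a/2} = a/4"
      have "{a/4..a/2} \<inter> space MX = {a/4..a/2}" using ab by auto
      then show ?thesis using m by (simp add: Bochner_Integration.integral_indicator)
    qed
    have "s\<^sup>2 * (a/4) = (\<integral>z. ten (\<lambda>x. s\<^sup>2 * indicator {a/4..a/2} x) (\<lambda>y. (sn n y)\<^sup>2) z \<partial>MO)"
    proof -
      have it: "(\<integral>z. ten (\<lambda>x. s\<^sup>2 * indicator {a/4..a/2} x) (\<lambda>y. (sn n y)\<^sup>2) z \<partial>MO) = (\<integral>x. s\<^sup>2 * indicator {a/4..a/2} x \<partial>MX) * (\<integral>y. (sn n y)\<^sup>2 \<partial>MY)"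
        by (rule integral_ten(2)[OF ic sni]) simp
      show ?thesis unfolding it i sn1 by simp
    qed
    also have "\<dots> \<le> (\<integral>z. (e z)\<^sup>2 \<partial>MO)"
    proof (rule integral_mono[OF _ sqi_integrable_sq[OF es]])
      show "integrable MO (ten (\<lambda>x. s\<^sup>2 * indicator {a/4..a/2} x) (\<lambda>y. (sn n y)\<^sup>2))"
        by (rule integral_ten(1)[OF ic sni]) simp
      fix z assume "z \<in> space MO"
      obtain x y where z: "z = (x,y)" by force
      show "ten (\<lambda>x. s\<^sup>2 * indicator {a/4..a/2} x) (\<lambda>y. (sn n y)\<^sup>2) z \<le> (e z)\<^sup>2"
      proof (cases "x \<in> {a/4..a/2}")
        case True
        have "s\<^sup>2 \<le> (v x)\<^sup>2" using dec(2)[OF True] sp by (intro power_mono) (auto simp: s_def)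
        then show ?thesis using True by (simp add: z e_def power_mult_distrib mult_right_mono)
      qed (simp add: z)
    qed
    finally show ?thesis .
  qed
  have o1: "(LINT z:Omega|lborel. (exp (- l * T) * e z)\<^sup>2) \<le> C * (LINT t:{0..T}|lborel. (LINT z:omega a b|lborel. (exp (- l * t) * e z)\<^sup>2))"
    unfolding e_def by (rule obs[OF eigen_solution[OF g v(1-4)]])
  have o2: "(LINT z:Omega|lborel. (exp (- l * T) * e z)\<^sup>2) = exp (- 2 * l * T) * (\<integral>z. (e z)\<^sup>2 \<partial>MO)"
    unfolding set_integral_Omega by (simp add: power_mult_distrib exp_double[symmetric] algebra_simps flip: exp_add power2_eq_square)
  have o3: "(LINT z:omega a b|lborel. (exp (- l * t) * e z)\<^sup>2) = exp (- l * t) ^ 2 * E" for t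
  proof -
    have "(LINT z:omega a b|lborel. (exp (- l * t) * e z)\<^sup>2) = (\<integral>z. exp (- l * t) ^ 2 * (indicator {a<..<b} (fst z) * (e z)\<^sup>2) \<partial>MO)"
      using ab by (subst omega_integral) (auto simp: power_mult_distrib algebra_simps intro!: Bochner_Integration.integral_cong)
    then show ?thesis by (simp add: E_def)
  qed
  have o4: "(LINT t:{0..T}|lborel. exp (- l * t) ^ 2 * E) \<le> (LINT t:{0..T}|lborel. E)"
  proof (rule set_integral_mono)
    show "set_integrable lborel {0..T} (\<lambda>t. exp (- l * t) ^ 2 * E)"
      by (intro borel_integrable_atLeastAtMost' continuous_intros)
    show "set_integrable lborel {0..T} (\<lambda>t. E)" by (intro borel_integrable_atLeastAtMost' continuous_intros)
    fix t assume t: "t \<in> {0..T}"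
    then have "exp (- l * t) \<le> 1" using l by simp
    then have "exp (- l * t) ^ 2 \<le> 1" by (intro power_le_one) auto
    then show "exp (- l * t) ^ 2 * E \<le> E" using E0 by (intro mult_left_le_one_le) auto
  qed
  have o5: "(LINT t:{0..T}|lborel. E) = E * T" using T by (simp add: set_integral_const measure_def mult.commute)
  have "exp (- 2 * l * T) * (\<integral>z. (e z)\<^sup>2 \<partial>MO) \<le> C * (LINT t:{0..T}|lborel. exp (- l * t) ^ 2 * E)"
    using o1 unfolding o2 o3 .
  also have "\<dots> \<le> C * (LINT t:{0..T}|lborel. E)" using o4 C by (intro mult_left_mono) auto
  finally have "exp (- 2 * l * T) * (\<integral>z. (e z)\<^sup>2 \<partial>MO) \<le> C * (E * T)" unfolding o5 .
  moreover have "exp (- 2 * l * T) * (s\<^sup>2 * (a/4)) \<le> exp (- 2 * l * T) * (\<integral>z. (e z)\<^sup>2 \<partial>MO)"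
    by (intro mult_left_mono El) auto
  moreover have "C * (E * T) \<le> C * ((s\<^sup>2 * exp (- \<kappa> * a) * 2) * T)" using C T Eu by (intro mult_left_mono mult_right_mono) auto
  ultimately have "exp (- 2 * l * T) * (s\<^sup>2 * (a/4)) \<le> C * ((s\<^sup>2 * exp (- \<kappa> * a) * 2) * T)" by linarith
  then have "s\<^sup>2 * (exp (- 2 * l * T) * (a/4)) \<le> s\<^sup>2 * (C * exp (- \<kappa> * a) * 2 * T)" by (simp add: algebra_simps)
  then have "exp (- 2 * l * T) * (a/4) \<le> C * exp (- \<kappa> * a) * 2 * T" using sp by simp
  then have "exp (- 2 * l * T) * (a/4) * exp (\<kappa> * a) \<le> C * exp (- \<kappa> * a) * 2 * T * exp (\<kappa> * a)" by (intro mult_right_mono) auto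
  moreover have "exp (- 2 * l * T) * (a/4) * exp (\<kappa> * a) = exp (\<kappa> * a - 2 * l * T) * (a/4)" by (simp add: exp_diff exp_minus field_simps)
  moreover have "C * exp (- \<kappa> * a) * 2 * T * exp (\<kappa> * a) = 2 * C * T" by (simp add: exp_minus field_simps)
  ultimately have "exp (\<kappa> * a - 2 * l * T) * (a/4) \<le> 2 * C * T" by (simp only:)
  then show ?thesis using ab by (simp add: field_simps)
qed

text \<open>Take kappa = cN with c = (a/4)^gamma / 2. On [a/4,1] the potential is at least 4 c^2
  N^2, and l <= 4N takes at most 3 c^2 N^2 of it for large N. The growth hypothesis says that 2lT
  uses up at most half of the exponent caN, so the left side of
  \<open>observable_eigen_bound\<close> is unbounded in N.\<close>

lemma not_observable:
  assumes g: "\<gamma> \<ge> 1" and ab: "0 < a" "a < b" "b < 1" and T: "T > 0"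
    and ev: "\<forall>\<^sub>F N in at_top. 8 * T * N powr (2 / (1 + \<gamma>)) \<le> ((a/4) powr \<gamma> / 2 * a / 2) * N"
  shows "\<not> observable \<gamma> a b T"
proof
  assume "observable \<gamma> a b T"
  then obtain C where C: "C > 0" "\<And>g0 g. L2 g0 \<Longrightarrow> is_solution \<gamma> g0 g \<Longrightarrow> (LINT z:Omega|lborel. (g T z)\<^sup>2) \<le>
        C * (LINT t:{0..T}|lborel. (LINT z:omega a b|lborel. (g t z)\<^sup>2))" unfolding observable_def by blast
  have g0: "\<gamma> > 0" using g by simp
  define c where "c = (a/4) powr \<gamma> / 2"
  have c: "c > 0" using ab by (simp add: c_def)
  obtain N0 where N0: "\<And>N. N \<ge> N0 \<Longrightarrow> 8 * T * N powr (2 / (1 + \<gamma>)) \<le> (c * a / 2) * N"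
    using ev unfolding eventually_at_top_linorder c_def by auto
  define K where "K = 8 * C * T / a"
  have K: "K > 0" using C T ab by (simp add: K_def)
  \<comment> \<open>The thresholds are for \<open>ground_state\<close>, for the growth hypothesis,
    for l <= 3 c^2 N^2, and for the final contradiction caN/2 > K.\<close>
  obtain n :: nat where n: "real n > max 1 (max N0 (max (4 / (3 * c\<^sup>2)) (K * 2 / (c * a))))" using reals_Archimedean2 by blast
  define N where "N = real n * pi"
  have "N \<ge> real n * 1" unfolding N_def using pi_ge_two by (intro mult_left_mono) auto
  then have N: "N \<ge> 1" "N \<ge> N0" "N > 4 / (3 * c\<^sup>2)" "N > K * 2 / (c * a)" using n by auto
  have n1: "n \<ge> 1" using n by auto
  obtain v v1 l where v: "0 \<le> l" "l \<le> 4 * N powr (2 / (1 + \<gamma>))" "\<And>x. (v has_real_derivative v1 x) (at x)"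
     "\<And>x. (v1 has_real_derivative (wpot \<gamma> N x - l) * v x) (at x)" "v (-1) = 0" "v 1 = 0" "v1 1 \<le> 0" "\<And>x. x \<in> {0..<1} \<Longrightarrow> v x > 0"
    using ground_state[OF g0 N(1)] by blast
  have c2: "(a/4) powr (2 * \<gamma>) = 4 * c\<^sup>2"
  proof -
    have "(a/4) powr (2 * \<gamma>) = ((a/4) powr \<gamma>)\<^sup>2" using ab by (simp add: power2_eq_square flip: powr_add)
    then show ?thesis by (simp add: c_def power_divide)
  qed
  have lN: "l \<le> 4 * N"
  proof -
    have "N powr (2 / (1 + \<gamma>)) \<le> N powr 1" using N g by (intro powr_mono) (auto simp: field_simps)
    then show ?thesis using v(2) N by simp
  qed
  have W: "wpot \<gamma> N x - l \<ge> (c * N)\<^sup>2" if x: "x \<in> {a/4..1}" for x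
  proof -
    have "wpot \<gamma> N (a/4) \<le> wpot \<gamma> N x" using x ab by (intro wpot_mono[OF g0]) auto
    moreover have "wpot \<gamma> N (a/4) = N\<^sup>2 * (4 * c\<^sup>2)" using ab c2 by (simp add: wpot_eq)
    moreover have "4 * N \<le> 3 * c\<^sup>2 * N * N" 
    proof -
      have "4 \<le> 3 * c\<^sup>2 * N" using N(3) c by (simp add: field_simps)
      then show ?thesis using N by (intro mult_right_mono) auto
    qed
    ultimately show ?thesis using lN by (simp add: power2_eq_square algebra_simps)
  qed
  have "exp ((c * (real n * pi)) * a - 2 * l * T) \<le> 8 * C * T / a"
    by (rule observable_eigen_bound[OF g0 ab T _ n1 v(1,3) v(4)[unfolded N_def] v(5-8) W[unfolded N_def] C(2) C(1)])
       (use c n1 in auto)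
  then have "exp ((c * N) * a - 2 * l * T) \<le> K" by (simp add: K_def N_def)
  moreover have "2 * l * T \<le> (c * a / 2) * N"
  proof -
    have "2 * l * T \<le> 2 * (4 * N powr (2 / (1 + \<gamma>))) * T" using v(2) T by (intro mult_right_mono mult_left_mono) auto
    then show ?thesis using N0[OF N(2)] by (simp add: mult_ac)
  qed
  moreover have "(c * N) * a = 2 * ((c * a / 2) * N)" by simp
  ultimately have "exp ((c * a / 2) * N) \<le> K" by (smt (verit) exp_le_cancel_iff)
  moreover have "(c * a / 2) * N > K" using N(4) c ab by (simp add: field_simps)
  ultimately show False using exp_ge_add_one_self[of "(c * a / 2) * N"] by linarith
qed

lemma not_observable_critical:
  assumes ab: "0 < a" "a < b" "b < 1" shows "\<exists>T0>0. \<forall>T. 0 < T \<and> T < T0 \<longrightarrow> \<not> observable 1 a b T"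
proof (intro exI conjI allI impI)
  \<comment> \<open>For gamma = 1 both sides of the growth condition are linear in N; this is the
    time at which 8T equals ca/2, c = (a/4)/2.\<close>
  show "0 < (a/4) powr 1 / 2 * a / 16" using ab by simp
  fix T assume T: "0 < T \<and> T < (a/4) powr 1 / 2 * a / 16"
  show "\<not> observable 1 a b T"
  proof (rule not_observable)
    show "\<forall>\<^sub>F N in at_top. 8 * T * N powr (2 / (1 + 1)) \<le> ((a/4) powr 1 / 2 * a / 2) * N"
    proof (rule eventually_mono[OF eventually_ge_at_top[of 0]])
      fix N :: real assume "0 \<le> N"
      moreover have "8 * T \<le> (a/4) powr 1 / 2 * a / 2" using T by simp
      ultimately show "8 * T * N powr (2 / (1 + 1)) \<le> ((a/4) powr 1 / 2 * a / 2) * N"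
        using mult_right_mono[of "8 * T" "(a/4) powr 1 / 2 * a / 2" N] by simp
    qed
  qed (use ab T in auto)
qed

lemma not_observable_supercritical:
  assumes "\<gamma> > 1" "0 < a" "a < b" "b < 1" "T > 0" shows "\<not> observable \<gamma> a b T"
proof (rule not_observable)
  define c where "c = ((a/4) powr \<gamma> / 2 * a / 2) / (8 * T)"
  have c: "c > 0" using assms by (simp add: c_def)
  have "((\<lambda>N::real. N powr (- ((\<gamma> - 1) / (1 + \<gamma>)))) \<longlongrightarrow> 0) at_top"
    by (rule tendsto_neg_powr) (use assms filterlim_ident in \<open>auto simp: field_simps\<close>)
  then have "\<forall>\<^sub>F N::real in at_top. N powr (- ((\<gamma> - 1) / (1 + \<gamma>))) < c" using c by (rule order_tendstoD)
  then show "\<forall>\<^sub>F N in at_top. 8 * T * N powr (2 / (1 + \<gamma>)) \<le> ((a/4) powr \<gamma> / 2 * a / 2) * N"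
  proof (rule eventually_elim2[OF _ eventually_gt_at_top[of 0]])
    fix N :: real assume N: "N powr (- ((\<gamma> - 1) / (1 + \<gamma>))) < c" "N > 0"
    have e: "2 / (1 + \<gamma>) = - ((\<gamma> - 1) / (1 + \<gamma>)) + 1" using assms by (simp add: field_simps)
    have "N powr (2 / (1 + \<gamma>)) = N powr (- ((\<gamma> - 1) / (1 + \<gamma>))) * N" unfolding e powr_add using N by simp
    also have "\<dots> \<le> c * N" using N by (intro mult_right_mono) auto
    finally have "8 * T * N powr (2 / (1 + \<gamma>)) \<le> 8 * T * (c * N)" using assms by simp
    also have "\<dots> = ((a/4) powr \<gamma> / 2 * a / 2) * N" using assms by (simp add: c_def)
    finally show "8 * T * N powr (2 / (1 + \<gamma>)) \<le> ((a/4) powr \<gamma> / 2 * a / 2) * N" .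
  qed
qed (use assms in auto)


section \<open>Sine modes\<close>

text \<open>On a slice where the integrand fails to be integrable the integral takes its default
  value, so linearity and Bessel's inequality are stated for almost every x.\<close>

definition mode :: "nat \<Rightarrow> (real \<times> real \<Rightarrow> real) \<Rightarrow> real \<Rightarrow> real" where
  "mode n f x = (\<integral>y. f (x, y) * sn n y \<partial>MY)"

lemma sqi_sn: "sqi MY (sn n)" by (intro continuous_sqi_MY continuous_intros)

lemma measurable_snd_MO: "f \<in> borel_measurable MY \<Longrightarrow> (\<lambda>z. f (snd z)) \<in> borel_measurable MO"
  and measurable_fst_MO: "f \<in> borel_measurable MX \<Longrightarrow> (\<lambda>z. f (fst z)) \<in> borel_measurable MO"
  unfolding MO_eq_pair[symmetric] by (auto intro: measurable_compose[OF measurable_snd] measurable_compose[OF measurable_fst])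

lemma mode_measurable: assumes "sqi MO f" shows "mode n f \<in> borel_measurable MX"
proof -
  have "(\<lambda>z. f z * sn n (snd z)) \<in> borel_measurable MO"
    using assms sqi_sn[of n] by (intro borel_measurable_times measurable_snd_MO) (auto simp: sqi_def)
  then have "(\<lambda>(x, y). f (x, y) * sn n y) \<in> borel_measurable (MX \<Otimes>\<^sub>M MY)" by (simp add: MO_eq_pair split_beta')
  then have "(\<lambda>x. \<integral>y. f (x, y) * sn n y \<partial>MY) \<in> borel_measurable MX" by (rule MY.borel_measurable_lebesgue_integral)
  then show ?thesis unfolding mode_def[abs_def] .
qed

lemma AE_slice: assumes "sqi MO f" shows "AE x in MX. sqi MY (\<lambda>y. f (x, y))"
proof -
  have f: "f \<in> borel_measurable (MX \<Otimes>\<^sub>M MY)" "integrable (MX \<Otimes>\<^sub>M MY) (\<lambda>z. (f z)\<^sup>2)"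
    using assms by (auto simp: sqi_def MO_eq_pair)
  have "AE x in MX. integrable MY (\<lambda>y. (f (x, y))\<^sup>2)" using MXY.AE_integrable_fst'[OF f(2)] by simp
  moreover have "AE x in MX. (\<lambda>y. f (x, y)) \<in> borel_measurable MY"
    by (rule AE_I2) (rule measurable_compose[OF measurable_Pair1' f(1)])
  ultimately show ?thesis by eventually_elim (simp add: sqi_def)
qed

text \<open>The coefficients are arbitrary on purpose: the sine coefficients of h give Bessel's
  inequality, and general ones give the best approximation property.\<close>

lemma slice_expand:
  assumes h: "sqi MY h" and I: "finite I" "\<And>i. i \<in> I \<Longrightarrow> i \<ge> (1::nat)"
  shows "(\<integral>y. (h y - (\<Sum>i\<in>I. \<alpha> i * sn i y))\<^sup>2 \<partial>MY) = (\<integral>y. (h y)\<^sup>2 \<partial>MY) - 2 * (\<Sum>i\<in>I. \<alpha> i * (\<integral>y. h y * sn i y \<partial>MY)) + (\<Sum>i\<in>I. (\<alpha> i)\<^sup>2)"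
proof -
  let ?S = "\<lambda>y. \<Sum>i\<in>I. \<alpha> i * sn i y"
  have S: "sqi MY ?S" by (intro sqi_sum I sqi_cmult sqi_sn)
  have "(\<integral>y. (h y - ?S y)\<^sup>2 \<partial>MY) = (\<integral>y. (h y)\<^sup>2 \<partial>MY) - 2 * (\<integral>y. h y * ?S y \<partial>MY) + (\<integral>y. (?S y)\<^sup>2 \<partial>MY)"
    using integral_sq_expand[OF h S, of "-1"] by simp
  also have "(\<integral>y. h y * ?S y \<partial>MY) = (\<Sum>i\<in>I. \<alpha> i * (\<integral>y. h y * sn i y \<partial>MY))"
  proof -
    have "(\<integral>y. h y * ?S y \<partial>MY) = (\<integral>y. (\<Sum>i\<in>I. \<alpha> i * (h y * sn i y)) \<partial>MY)"
      by (intro Bochner_Integration.integral_cong refl) (simp add: sum_distrib_left algebra_simps)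
    also have "\<dots> = (\<Sum>i\<in>I. \<integral>y. \<alpha> i * (h y * sn i y) \<partial>MY)"
      by (intro Bochner_Integration.integral_sum integrable_mult_right sqi_integrable_mult h sqi_sn)
    finally show ?thesis by simp
  qed
  also have "(\<integral>y. (?S y)\<^sup>2 \<partial>MY) = (\<Sum>i\<in>I. (\<alpha> i)\<^sup>2)"
  proof -
    have "(\<integral>y. (?S y)\<^sup>2 \<partial>MY) = (\<integral>y. (\<Sum>i\<in>I. \<Sum>j\<in>I. \<alpha> i * \<alpha> j * (sn i y * sn j y)) \<partial>MY)"
      by (intro Bochner_Integration.integral_cong refl) (simp add: power2_eq_square sum_product algebra_simps)
    also have "\<dots> = (\<Sum>i\<in>I. \<Sum>j\<in>I. \<alpha> i * \<alpha> j * (\<integral>y. sn i y * sn j y \<partial>MY))"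
    proof -
      have "(\<integral>y. (\<Sum>i\<in>I. \<Sum>j\<in>I. \<alpha> i * \<alpha> j * (sn i y * sn j y)) \<partial>MY) = (\<Sum>i\<in>I. \<integral>y. (\<Sum>j\<in>I. \<alpha> i * \<alpha> j * (sn i y * sn j y)) \<partial>MY)"
        by (intro Bochner_Integration.integral_sum Bochner_Integration.integrable_sum integrable_mult_right sqi_integrable_mult sqi_sn)
      also have "\<dots> = (\<Sum>i\<in>I. \<Sum>j\<in>I. \<integral>y. \<alpha> i * \<alpha> j * (sn i y * sn j y) \<partial>MY)"
        by (intro sum.cong refl Bochner_Integration.integral_sum integrable_mult_right sqi_integrable_mult sqi_sn)
      finally show ?thesis by simp
    qed
    also have "\<dots> = (\<Sum>i\<in>I. \<Sum>j\<in>I. if i = j then (\<alpha> i)\<^sup>2 else 0)"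
      using I by (intro sum.cong refl) (auto simp: sn_orthonormal power2_eq_square)
    also have "\<dots> = (\<Sum>i\<in>I. (\<alpha> i)\<^sup>2)" using I by (simp add: sum.delta)
    finally show ?thesis .
  qed
  finally show ?thesis .
qed

lemma slice_bessel:
  assumes h: "sqi MY h" and I: "finite I" "\<And>i. i \<in> I \<Longrightarrow> i \<ge> (1::nat)"
  shows "(\<Sum>i\<in>I. (\<integral>y. h y * sn i y \<partial>MY)\<^sup>2) \<le> (\<integral>y. (h y)\<^sup>2 \<partial>MY)"
proof -
  have "0 \<le> (\<integral>y. (h y - (\<Sum>i\<in>I. (\<integral>y. h y * sn i y \<partial>MY) * sn i y))\<^sup>2 \<partial>MY)" by simp
  also have "\<dots> = (\<integral>y. (h y)\<^sup>2 \<partial>MY) - (\<Sum>i\<in>I. (\<integral>y. h y * sn i y \<partial>MY)\<^sup>2)"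
    by (subst slice_expand[OF h I(1)]) (use I(2) in \<open>auto simp: power2_eq_square\<close>)
  finally show ?thesis by simp
qed

lemma integral_slices: "sqi MO f \<Longrightarrow> integrable MX (\<lambda>x. \<integral>y. (f (x, y))\<^sup>2 \<partial>MY)"
    "sqi MO f \<Longrightarrow> (\<integral>x. (\<integral>y. (f (x, y))\<^sup>2 \<partial>MY) \<partial>MX) = (\<integral>z. (f z)\<^sup>2 \<partial>MO)"
  using MXY.integrable_fst'[of "\<lambda>z. (f z)\<^sup>2"] MXY.integral_fst'[of "\<lambda>z. (f z)\<^sup>2"] by (auto simp: sqi_def MO_eq_pair)

lemma mode_bessel:
  assumes "sqi MO f" "finite I" "\<And>i. i \<in> I \<Longrightarrow> i \<ge> 1"
  shows "AE x in MX. (\<Sum>n\<in>I. (mode n f x)\<^sup>2) \<le> (\<integral>y. (f (x, y))\<^sup>2 \<partial>MY)"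
  using AE_slice[OF assms(1)]
proof eventually_elim
  case (elim x) from slice_bessel[OF elim assms(2)] assms(3) show ?case by (simp add: mode_def)
qed

lemma mode_sqi: assumes "sqi MO f" "n \<ge> 1" shows "sqi MX (mode n f)"
proof -
  have "integrable MX (\<lambda>x. (mode n f x)\<^sup>2)"
  proof (rule Bochner_Integration.integrable_bound[OF integral_slices(1)[OF assms(1)]])
    show "(\<lambda>x. (mode n f x)\<^sup>2) \<in> borel_measurable MX" using mode_measurable[OF assms(1)] by auto
    show "AE x in MX. norm ((mode n f x)\<^sup>2) \<le> norm (\<integral>y. (f (x, y))\<^sup>2 \<partial>MY)"
      using mode_bessel[OF assms(1), of "{n}"] assms(2) by auto
  qed
  then show ?thesis using mode_measurable[OF assms(1)] by (simp add: sqi_def)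
qed

lemma mode_lin:
  assumes "sqi MO f" "sqi MO g"
  shows "AE x in MX. mode n (\<lambda>z. f z + c * g z) x = mode n f x + c * mode n g x"
  using AE_slice[OF assms(1)] AE_slice[OF assms(2)]
proof eventually_elim
  case (elim x)
  have "(\<integral>y. (f (x, y) + c * g (x, y)) * sn n y \<partial>MY) = (\<integral>y. f (x, y) * sn n y + c * (g (x, y) * sn n y) \<partial>MY)"
    by (simp add: algebra_simps)
  also have "\<dots> = mode n f x + c * mode n g x"
    unfolding mode_def using sqi_integrable_mult[OF elim(1) sqi_sn] sqi_integrable_mult[OF elim(2) sqi_sn] by simp
  finally show ?case by (simp add: mode_def)
qed

lemma ten_sqi: assumes "sqi MX f" "sqi MY g" shows "sqi MO (ten f g)"
proof -
  have "integrable MO (ten (\<lambda>x. (f x)\<^sup>2) (\<lambda>y. (g y)\<^sup>2))" by (rule integral_ten) (use assms in \<open>auto simp: sqi_def\<close>)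
  then have "integrable MO (\<lambda>z. (ten f g z)\<^sup>2)" by (simp add: ten_def power_mult_distrib)
  moreover have "ten f g \<in> borel_measurable MO" unfolding ten_def
    using assms by (intro borel_measurable_times measurable_snd_MO measurable_fst_MO) (auto simp: sqi_def)
  ultimately show ?thesis by (simp add: sqi_def)
qed

lemma integral_mult_ten_sn:
  assumes "sqi MO f" "sqi MX p" shows "(\<integral>z. f z * ten p (sn n) z \<partial>MO) = (\<integral>x. mode n f x * p x \<partial>MX)"
proof -
  have "(\<integral>z. f z * ten p (sn n) z \<partial>MO) = (\<integral>x. (\<integral>y. f (x, y) * ten p (sn n) (x, y) \<partial>MY) \<partial>MX)"
    by (rule integral_MO_xy[OF sqi_integrable_mult[OF assms(1) ten_sqi[OF assms(2) sqi_sn]]])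
  also have "\<dots> = (\<integral>x. mode n f x * p x \<partial>MX)"
    unfolding mode_def by (intro Bochner_Integration.integral_cong refl)
      (simp add: mult.assoc[symmetric] mult.commute[of "p _"] flip: Bochner_Integration.integral_mult_left_zero)
  finally show ?thesis .
qed

text \<open>What the products over a strip and the products of single modes have in common.
  Continuity and differentiation in time along a trajectory are proved once for all such b. The laws
  are restricted to square-integrable arguments, outside of which the integrals carry no
  meaning.\<close>

definition bbil :: "((real \<times> real \<Rightarrow> real) \<Rightarrow> (real \<times> real \<Rightarrow> real) \<Rightarrow> real) \<Rightarrow> bool" where
  "bbil b \<longleftrightarrow> (\<forall>f g. sqi MO f \<longrightarrow> sqi MO g \<longrightarrow> b f g = b g f) \<and>
     (\<forall>f g h c. sqi MO f \<longrightarrow> sqi MO g \<longrightarrow> sqi MO h \<longrightarrow> b (\<lambda>z. f z + c * g z) h = b f h + c * b g h) \<and>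
     (\<forall>f. sqi MO f \<longrightarrow> 0 \<le> b f f \<and> b f f \<le> (n2 MO f)\<^sup>2)"

lemma bbilD:
  assumes "bbil b"
  shows "sqi MO f \<Longrightarrow> sqi MO g \<Longrightarrow> b f g = b g f"
    "sqi MO f \<Longrightarrow> sqi MO g \<Longrightarrow> sqi MO h \<Longrightarrow> b (\<lambda>z. f z + c * g z) h = b f h + c * b g h"
    "sqi MO f \<Longrightarrow> 0 \<le> b f f" "sqi MO f \<Longrightarrow> b f f \<le> (n2 MO f)\<^sup>2"
  using assms unfolding bbil_def by blast+

lemma bbil_cs: assumes b: "bbil b" "sqi MO f" "sqi MO g" shows "\<bar>b f g\<bar> \<le> sqrt (b f f) * sqrt (b g g)"
proof (rule nonneg_quadratic_discriminant)
  fix t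
  have s: "sqi MO (\<lambda>z. f z + t * g z)" by (intro sqi_add sqi_cmult assms)
  have "0 \<le> b (\<lambda>z. f z + t * g z) (\<lambda>z. f z + t * g z)" by (rule bbilD(3)[OF b(1) s])
  also have "\<dots> = b f (\<lambda>z. f z + t * g z) + t * b g (\<lambda>z. f z + t * g z)" by (rule bbilD(2)[OF b(1) b(2,3) s])
  also have "b f (\<lambda>z. f z + t * g z) = b f f + t * b f g"
    using bbilD(1)[OF b(1) b(2) s] bbilD(2)[OF b(1) b(2,3,2)] bbilD(1)[OF b(1) b(3,2)] by simp
  also have "b g (\<lambda>z. f z + t * g z) = b f g + t * b g g"
    using bbilD(1)[OF b(1) b(3) s] bbilD(2)[OF b(1) b(2,3,3)] by simp
  finally show "0 \<le> b f f + 2 * t * b f g + t\<^sup>2 * b g g" by (simp add: algebra_simps power2_eq_square)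
qed

lemma bbil_bound: assumes b: "bbil b" "sqi MO f" "sqi MO g" shows "\<bar>b f g\<bar> \<le> n2 MO f * n2 MO g"
proof -
  have "sqrt (b h h) \<le> n2 MO h" if "sqi MO h" for h
    using bbilD(4)[OF b(1) that] by (intro real_le_lsqrt) auto
  then show ?thesis using bbil_cs[OF assms] b
    by (smt (verit) mult_mono n2_nonneg real_sqrt_ge_zero bbilD(3))
qed

lemma bbil_diff: assumes b: "bbil b" "sqi MO f" "sqi MO g" "sqi MO h"
  shows "b (\<lambda>z. f z - g z) h = b f h - b g h" "b h (\<lambda>z. f z - g z) = b h f - b h g"
proof -
  show 1: "b (\<lambda>z. f z - g z) h = b f h - b g h" using bbilD(2)[OF assms, of "-1"] by simp
  show "b h (\<lambda>z. f z - g z) = b h f - b h g"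
    using 1 bbilD(1)[OF b(1) b(4) sqi_diff[OF b(2,3)]] bbilD(1)[OF b(1) b(4,2)] bbilD(1)[OF b(1) b(4,3)] by simp
qed

lemma bbil_cmult: assumes b: "bbil b" "sqi MO f" "sqi MO h" shows "b (\<lambda>z. c * f z) h = c * b f h" "b h (\<lambda>z. c * f z) = c * b h f"
proof -
  have z: "sqi MO (\<lambda>z. 0::real)" by (simp add: sqi_def)
  \<comment> \<open>The instance reads b 0 h = 2 b 0 h, hence b 0 h = 0; homogeneity is then
    additivity with first summand 0.\<close>
  have "b (\<lambda>z. 0 + 1 * 0) h = b (\<lambda>z. 0) h + 1 * b (\<lambda>z. 0) h" by (rule bbilD(2)[OF b(1) z z b(3)])
  then have "b (\<lambda>z. 0) h = 0" by simp
  then show 1: "b (\<lambda>z. c * f z) h = c * b f h" using bbilD(2)[OF b(1) z b(2,3), of c] by simp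
  show "b h (\<lambda>z. c * f z) = c * b h f"
    using 1 bbilD(1)[OF b(1) b(3) sqi_cmult[OF b(2)]] bbilD(1)[OF b(1) b(3,2)] by simp
qed

lemma integrable_ind_mult: assumes "S \<in> sets borel" "integrable MX f" shows "integrable MX (\<lambda>x. indicator S x * (f x :: real))"
proof (rule Bochner_Integration.integrable_bound[OF assms(2)])
  have "indicator S \<in> borel_measurable MX" using assms by (intro measurable_MX) auto
  then show "(\<lambda>x. indicator S x * f x) \<in> borel_measurable MX" using assms by (intro borel_measurable_times) auto
  show "AE x in MX. norm (indicator S x * f x) \<le> norm (f x)" by (auto simp: indicator_def)
qed

text \<open>With S = UNIV this is the L^2 product of the n-th modes, with S = (a,b) the part of it
  that the observation sees.\<close>

definition Qf :: "nat \<Rightarrow> real set \<Rightarrow> (real \<times> real \<Rightarrow> real) \<Rightarrow> (real \<times> real \<Rightarrow> real) \<Rightarrow> real" where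
  "Qf n S f g = (\<integral>x. indicator S x * (mode n f x * mode n g x) \<partial>MX)"

lemma bbil_Qf: assumes n: "n \<ge> 1" and S: "S \<in> sets borel" shows "bbil (Qf n S)"
  unfolding bbil_def
proof (intro conjI allI impI)
  show "Qf n S f g = Qf n S g f" for f g by (simp add: Qf_def mult.commute)
  fix f g h c assume s: "sqi MO f" "sqi MO g" "sqi MO h"
  have i: "integrable MX (\<lambda>x. indicator S x * (mode n f x * mode n h x))" "integrable MX (\<lambda>x. indicator S x * (mode n g x * mode n h x))"
    using s n by (auto intro!: integrable_ind_mult[OF S] sqi_integrable_mult mode_sqi)
  have "Qf n S (\<lambda>z. f z + c * g z) h = (\<integral>x. indicator S x * (mode n f x * mode n h x) + c * (indicator S x * (mode n g x * mode n h x)) \<partial>MX)"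
    unfolding Qf_def
  proof (rule integral_cong_AE)
    show "AE x in MX. indicator S x * (mode n (\<lambda>z. f z + c * g z) x * mode n h x) =
        indicator S x * (mode n f x * mode n h x) + c * (indicator S x * (mode n g x * mode n h x))"
      using mode_lin[OF s(1,2), of n c] by eventually_elim (simp add: algebra_simps)
    show "(\<lambda>x. indicator S x * (mode n (\<lambda>z. f z + c * g z) x * mode n h x)) \<in> borel_measurable MX"
      using S s by (intro borel_measurable_times measurable_MX mode_measurable sqi_add sqi_cmult) auto
    show "(\<lambda>x. indicator S x * (mode n f x * mode n h x) + c * (indicator S x * (mode n g x * mode n h x))) \<in> borel_measurable MX"
      using i by auto
  qed
  then show "Qf n S (\<lambda>z. f z + c * g z) h = Qf n S f h + c * Qf n S g h" unfolding Qf_def using i by simp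
next
  fix f assume s: "sqi MO f"
  show "0 \<le> Qf n S f f" unfolding Qf_def by (rule integral_nonneg_AE) (auto simp: indicator_def)
  have "Qf n S f f \<le> (\<integral>x. (\<integral>y. (f (x, y))\<^sup>2 \<partial>MY) \<partial>MX)" unfolding Qf_def
  proof (rule integral_mono_AE)
    show "integrable MX (\<lambda>x. indicator S x * (mode n f x * mode n f x))"
      using s n by (auto intro!: integrable_ind_mult[OF S] sqi_integrable_mult mode_sqi)
    show "integrable MX (\<lambda>x. \<integral>y. (f (x, y))\<^sup>2 \<partial>MY)" by (rule integral_slices(1)[OF s])
    have "AE x in MX. (\<Sum>m\<in>{n}. (mode m f x)\<^sup>2) \<le> (\<integral>y. (f (x, y))\<^sup>2 \<partial>MY)" by (rule mode_bessel[OF s]) (use n in auto)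
    then show "AE x in MX. indicator S x * (mode n f x * mode n f x) \<le> (\<integral>y. (f (x, y))\<^sup>2 \<partial>MY)"
      by eventually_elim (auto simp: indicator_def power2_eq_square)
  qed
  then show "Qf n S f f \<le> (n2 MO f)\<^sup>2" by (simp add: n2_sq integral_slices(2)[OF s])
qed

definition ipS :: "real set \<Rightarrow> (real \<times> real \<Rightarrow> real) \<Rightarrow> (real \<times> real \<Rightarrow> real) \<Rightarrow> real" where
  "ipS S f g = (\<integral>z. indicator S (fst z) * (f z * g z) \<partial>MO)"

lemma ipS_integrable: assumes "S \<in> sets borel" "sqi MO f" "sqi MO g" shows "integrable MO (\<lambda>z. indicator S (fst z) * (f z * g z))"
proof (rule Bochner_Integration.integrable_bound[OF sqi_integrable_mult[OF assms(2,3)]])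
  show "(\<lambda>z. indicator S (fst z) * (f z * g z)) \<in> borel_measurable MO"
    using assms by (intro borel_measurable_times measurable_fst_MO measurable_MX) (auto simp: sqi_def)
  show "AE z in MO. norm (indicator S (fst z) * (f z * g z)) \<le> norm (f z * g z)" by (auto simp: indicator_def)
qed

lemma bbil_ipS: assumes S: "S \<in> sets borel" shows "bbil (ipS S)"
  unfolding bbil_def
proof (intro conjI allI impI)
  show "ipS S f g = ipS S g f" for f g by (simp add: ipS_def mult.commute)
  fix f g h c assume s: "sqi MO f" "sqi MO g" "sqi MO h"
  have "ipS S (\<lambda>z. f z + c * g z) h = (\<integral>z. indicator S (fst z) * (f z * h z) + c * (indicator S (fst z) * (g z * h z)) \<partial>MO)"
    unfolding ipS_def by (intro Bochner_Integration.integral_cong refl) (simp add: algebra_simps)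
  then show "ipS S (\<lambda>z. f z + c * g z) h = ipS S f h + c * ipS S g h"
    unfolding ipS_def using ipS_integrable[OF S s(1,3)] ipS_integrable[OF S s(2,3)] by simp
next
  fix f assume s: "sqi MO f"
  show "0 \<le> ipS S f f" unfolding ipS_def by (rule integral_nonneg_AE) (auto simp: indicator_def)
  show "ipS S f f \<le> (n2 MO f)\<^sup>2" unfolding ipS_def n2_sq
    by (rule integral_mono[OF ipS_integrable[OF S s s] sqi_integrable_sq[OF s]]) (auto simp: indicator_def power2_eq_square)
qed

lemma bbil_tendsto:
  assumes b: "bbil b" and f: "\<forall>\<^sub>F s in F. sqi MO (f s)" "sqi MO f0" "((\<lambda>s. n2 MO (\<lambda>z. f s z - f0 z)) \<longlongrightarrow> 0) F"
    and h: "\<forall>\<^sub>F s in F. sqi MO (h s)" "sqi MO h0" "((\<lambda>s. n2 MO (\<lambda>z. h s z - h0 z)) \<longlongrightarrow> 0) F"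
  shows "((\<lambda>s. b (f s) (h s)) \<longlongrightarrow> b f0 h0) F"
proof -
  have "((\<lambda>s. b (f s) (h s) - b f0 h0) \<longlongrightarrow> 0) F"
  proof (rule Lim_null_comparison)
    show "\<forall>\<^sub>F s in F. norm (b (f s) (h s) - b f0 h0) \<le> 
       n2 MO (\<lambda>z. f s z - f0 z) * n2 MO (\<lambda>z. h s z - h0 z) + n2 MO (\<lambda>z. f s z - f0 z) * n2 MO h0 + n2 MO f0 * n2 MO (\<lambda>z. h s z - h0 z)"
      using f(1) h(1)
    proof eventually_elim
      case (elim s)
      have d: "sqi MO (\<lambda>z. f s z - f0 z)" "sqi MO (\<lambda>z. h s z - h0 z)" using elim f h by (auto intro: sqi_diff)
      have "b (f s) (h s) - b f0 h0 = b (\<lambda>z. f s z - f0 z) (\<lambda>z. h s z - h0 z) + b (\<lambda>z. f s z - f0 z) h0 + b f0 (\<lambda>z. h s z - h0 z)"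
        using elim f h d by (simp add: bbil_diff[OF b])
      then show ?case using bbil_bound[OF b d(1) d(2)] bbil_bound[OF b d(1) h(2)] bbil_bound[OF b f(2) d(2)] by simp
    qed
    have "((\<lambda>s. n2 MO (\<lambda>z. f s z - f0 z) * n2 MO (\<lambda>z. h s z - h0 z) + n2 MO (\<lambda>z. f s z - f0 z) * n2 MO h0 + n2 MO f0 * n2 MO (\<lambda>z. h s z - h0 z)) \<longlongrightarrow> 0 * 0 + 0 * n2 MO h0 + n2 MO f0 * 0) F"
      by (intro tendsto_intros f h)
    then show "((\<lambda>s. n2 MO (\<lambda>z. f s z - f0 z) * n2 MO (\<lambda>z. h s z - h0 z) + n2 MO (\<lambda>z. f s z - f0 z) * n2 MO h0 + n2 MO f0 * n2 MO (\<lambda>z. h s z - h0 z)) \<longlongrightarrow> 0) F"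
      by simp
  qed
  then show ?thesis by (simp add: LIM_zero_iff)
qed

text \<open>The product rule for two different moving arguments, each differentiable in L^2. Two are
  wanted because \<open>mode_symmetric\<close> pairs a trajectory with its own time
  reversal.\<close>

lemma bbil_deriv:
  assumes b: "bbil b" 
    and f: "\<forall>\<^sub>F s in at t within S. sqi MO (f s)" "sqi MO (f t)" "sqi MO f'" "((\<lambda>s. n2 MO (\<lambda>z. (f s z - f t z) / (s - t) - f' z)) \<longlongrightarrow> 0) (at t within S)"
    and h: "\<forall>\<^sub>F s in at t within S. sqi MO (h s)" "sqi MO (h t)" "sqi MO h'" "((\<lambda>s. n2 MO (\<lambda>z. (h s z - h t z) / (s - t) - h' z)) \<longlongrightarrow> 0) (at t within S)"
    and hc: "((\<lambda>s. n2 MO (\<lambda>z. h s z - h t z)) \<longlongrightarrow> 0) (at t within S)"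
  shows "((\<lambda>s. b (f s) (h s)) has_real_derivative b f' (h t) + b (f t) h') (at t within S)"
proof -
  have sf: "\<forall>\<^sub>F s in at t within S. sqi MO (\<lambda>z. (f s z - f t z) / (s - t))"
    using f(1) by eventually_elim (use f(2) in \<open>auto simp: divide_inverse mult.commute[of _ "inverse _"] intro: sqi_cmult sqi_diff\<close>)
  have sh: "\<forall>\<^sub>F s in at t within S. sqi MO (\<lambda>z. (h s z - h t z) / (s - t))"
    using h(1) by eventually_elim (use h(2) in \<open>auto simp: divide_inverse mult.commute[of _ "inverse _"] intro: sqi_cmult sqi_diff\<close>)
  have 1: "((\<lambda>s. b (\<lambda>z. (f s z - f t z) / (s - t)) (h s)) \<longlongrightarrow> b f' (h t)) (at t within S)"
    by (rule bbil_tendsto[OF b sf f(3,4) h(1,2) hc])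
  have zero: "((\<lambda>s. n2 MO (\<lambda>z. f t z - f t z)) \<longlongrightarrow> 0) (at t within S)" by (simp add: n2_def)
  have 2: "((\<lambda>s. b (f t) (\<lambda>z. (h s z - h t z) / (s - t))) \<longlongrightarrow> b (f t) h') (at t within S)"
    by (rule bbil_tendsto[OF b _ f(2) zero sh h(3,4)]) (use f(2) in simp)
  have "\<forall>\<^sub>F s in at t within S. b (\<lambda>z. (f s z - f t z) / (s - t)) (h s) + b (f t) (\<lambda>z. (h s z - h t z) / (s - t)) =
      (b (f s) (h s) - b (f t) (h t)) / (s - t)"
    using f(1) h(1)
  proof eventually_elim
    case (elim s)
    have "b (\<lambda>z. (f s z - f t z) / (s - t)) (h s) = (b (f s) (h s) - b (f t) (h s)) / (s - t)"
      using bbil_cmult(1)[OF b sqi_diff[OF elim(1) f(2)] elim(2), of "inverse (s - t)"] bbil_diff(1)[OF b elim(1) f(2) elim(2)]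
      by (simp add: divide_inverse mult.commute[of _ "inverse _"])
    moreover have "b (f t) (\<lambda>z. (h s z - h t z) / (s - t)) = (b (f t) (h s) - b (f t) (h t)) / (s - t)"
      using bbil_cmult(2)[OF b sqi_diff[OF elim(2) h(2)] f(2), of "inverse (s - t)"] bbil_diff(2)[OF b elim(2) h(2) f(2)]
      by (simp add: divide_inverse mult.commute[of _ "inverse _"])
    ultimately show ?case by (simp add: diff_divide_distrib add_divide_distrib)
  qed
  from Lim_transform_eventually[OF tendsto_add[OF 1 2] this] show ?thesis by (simp add: has_field_derivative_iff)
qed


section \<open>Dynamics of the modes\<close>

lemma solution_sqi: "is_solution \<gamma> g0 g \<Longrightarrow> t \<ge> 0 \<Longrightarrow> sqi MO (g t)"
  by (simp add: is_solution_def L2_iff)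

lemma tendsto_sqrt_zero: "((\<lambda>s. (X s)\<^sup>2) \<longlongrightarrow> 0) F \<Longrightarrow> (\<And>s. X s \<ge> 0) \<Longrightarrow> (X \<longlongrightarrow> (0::real)) F"
  using tendsto_real_sqrt[of "\<lambda>s. (X s)\<^sup>2" 0 F] by simp

lemma solution_cont: "is_solution \<gamma> g0 g \<Longrightarrow> t \<ge> 0 \<Longrightarrow> ((\<lambda>s. n2 MO (\<lambda>z. g s z - g t z)) \<longlongrightarrow> 0) (at t within {0..})"
  by (rule tendsto_sqrt_zero) (auto simp: is_solution_def L2dist2_eq)

lemma solution_cont_at:
  assumes "is_solution \<gamma> g0 g" "t > 0" shows "((\<lambda>s. n2 MO (\<lambda>z. g s z - g t z)) \<longlongrightarrow> 0) (at t)"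
proof -
  have "at t within {0..} = at t" using assms by (intro at_within_interior) (simp add: interior_Ici[of _ "-1"])
  then show ?thesis using solution_cont[OF assms(1), of t] assms(2) by simp
qed

lemma solution_deriv:
  assumes "is_solution \<gamma> g0 g" "t > 0"
  obtains h where "A_op \<gamma> (g t) h" "sqi MO h" "((\<lambda>s. n2 MO (\<lambda>z. (g s z - g t z) / (s - t) - h z)) \<longlongrightarrow> 0) (at t)"
proof -
  obtain h where h: "A_op \<gamma> (g t) h" "((\<lambda>s. L2dist2 (\<lambda>z. (g s z - g t z) / (s - t)) h) \<longlongrightarrow> 0) (at t within {0<..})"
    using assms by (auto simp: is_solution_def)
  have "at t within {0<..} = at t" using assms by (intro at_within_open) auto
  then have "((\<lambda>s. (n2 MO (\<lambda>z. (g s z - g t z) / (s - t) - h z))\<^sup>2) \<longlongrightarrow> 0) (at t)"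
    using h(2) by (simp add: L2dist2_eq)
  then have "((\<lambda>s. n2 MO (\<lambda>z. (g s z - g t z) / (s - t) - h z)) \<longlongrightarrow> 0) (at t)" by (rule tendsto_sqrt_zero) simp
  then show ?thesis using that h(1) by (auto simp: A_op_def L2_iff)
qed

lemma solution_sqi_ev: "is_solution \<gamma> g0 g \<Longrightarrow> t > 0 \<Longrightarrow> \<forall>\<^sub>F s in at t. sqi MO (g s)"
  using eventually_at_in_open'[of "{0<..}" t] by (auto elim!: eventually_mono intro: solution_sqi)

text \<open>A constant argument as a trajectory with derivative 0, in the shape of the hypotheses of
  \<open>bbil_deriv\<close> and \<open>bbil_tendsto\<close>.\<close>

lemma const_n2: "((\<lambda>s. n2 MO (\<lambda>z. (f z - f z) / c s - 0)) \<longlongrightarrow> 0) F" "((\<lambda>s. n2 MO (\<lambda>z. f z - f z)) \<longlongrightarrow> 0) F"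
  by (simp_all add: n2_def)

lemma solution_bbil_cont:
  assumes b: "bbil b" and s: "is_solution \<gamma> g0 g" and e: "sqi MO e"
  shows "continuous_on {0..} (\<lambda>t. b (g t) e)" "continuous_on {0..} (\<lambda>t. b (g t) (g t))"
proof -
  have ev: "\<forall>\<^sub>F u in at t within {0..}. sqi MO (g u)" for t
    using solution_sqi[OF s] by (auto simp: eventually_at_filter)
  show "continuous_on {0..} (\<lambda>t. b (g t) e)" unfolding continuous_on_def
  proof
    fix t :: real assume t: "t \<in> {0..}"
    show "((\<lambda>t. b (g t) e) \<longlongrightarrow> b (g t) e) (at t within {0..})"
      by (rule bbil_tendsto[OF b ev _ _ _ e const_n2(2)]) (use t e solution_sqi[OF s] solution_cont[OF s] in auto)
  qed
  show "continuous_on {0..} (\<lambda>t. b (g t) (g t))" unfolding continuous_on_def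
  proof
    fix t :: real assume t: "t \<in> {0..}"
    show "((\<lambda>t. b (g t) (g t)) \<longlongrightarrow> b (g t) (g t)) (at t within {0..})"
      by (rule bbil_tendsto[OF b ev _ _ ev]) (use t solution_sqi[OF s] solution_cont[OF s] in auto)
  qed
qed

lemma sqi_zero: "sqi M (\<lambda>z. 0::real)" by (simp add: sqi_def)

lemma solution_bbil_deriv:
  assumes b: "bbil b" and s: "is_solution \<gamma> g0 g" and t: "t > 0" and e: "sqi MO e"
    and h: "sqi MO h" "((\<lambda>s. n2 MO (\<lambda>z. (g s z - g t z) / (s - t) - h z)) \<longlongrightarrow> 0) (at t)"
  shows "((\<lambda>t. b (g t) e) has_real_derivative b h e) (at t)"
    "((\<lambda>t. b (g t) (g t)) has_real_derivative 2 * b h (g t)) (at t)"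
proof -
  note ev = solution_sqi_ev[OF s t]
  have gt: "sqi MO (g t)" using solution_sqi[OF s] t by simp
  have "((\<lambda>t. b (g t) e) has_real_derivative b h e + b (g t) (\<lambda>z. 0)) (at t)"
    by (rule bbil_deriv[OF b ev gt h _ e sqi_zero const_n2(1) const_n2(2)]) (use e in simp)
  moreover have "b (g t) (\<lambda>z. 0) = 0" using bbil_cmult(2)[OF b sqi_zero gt, of 0] by simp
  ultimately show "((\<lambda>t. b (g t) e) has_real_derivative b h e) (at t)" by simp
  have "((\<lambda>t. b (g t) (g t)) has_real_derivative b h (g t) + b (g t) h) (at t)"
    by (rule bbil_deriv[OF b ev gt h ev gt h solution_cont_at[OF s t]])
  then show "((\<lambda>t. b (g t) (g t)) has_real_derivative 2 * b h (g t)) (at t)" using bbilD(1)[OF b gt h(1)] by simp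
qed

section \<open>Sine modes of smooth functions inside the form\<close>

lemma mode_continuous: assumes "continuous_on UNIV f" shows "continuous_on UNIV (mode n f)"
proof -
  have c: "continuous_on UNIV (\<lambda>(x, y). f (x, y) * sn n y)"
    unfolding split_beta' by (intro continuous_intros continuous_on_compose2[OF assms] continuous_on_compose2[OF sn_continuous[of UNIV n]]) auto
  have "mode n f = (\<lambda>x. integral (cbox 0 1) (\<lambda>y. f (x, y) * sn n y))"
  proof
    fix x
    have "continuous_on UNIV (\<lambda>y. f (x, y) * sn n y)"
      by (intro continuous_intros continuous_on_compose2[OF assms]) auto
    then have "continuous_on {0..1} (\<lambda>y. f (x, y) * sn n y)" by (rule continuous_on_subset) simp
    from integral_MY_HK[OF this] show "mode n f x = integral (cbox 0 1) (\<lambda>y. f (x, y) * sn n y)" by (simp add: mode_def)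
  qed
  moreover have "continuous_on UNIV (\<lambda>x. integral (cbox 0 1) (\<lambda>y. f (x, y) * sn n y))"
    by (rule integral_continuous_on_param) (use c continuous_on_subset in auto)
  ultimately show ?thesis by simp
qed

lemma mode_deriv: assumes "Ck (Suc k) f" shows "(mode n f has_real_derivative mode n (pdx f) x) (at x)"
proof -
  have cf: "continuous_on UNIV f" "continuous_on UNIV (pdx f)"
    using assms Ck_continuous[of k "pdx f"] by (auto simp del: Ck.simps(1) dest: Ck_continuous)
  have eq: "mode n h x = integral (cbox 0 1) (\<lambda>y. h (x, y) * sn n y)" if "continuous_on UNIV h" for h x
  proof -
    have "continuous_on UNIV (\<lambda>y. h (x, y) * sn n y)"
      by (intro continuous_intros continuous_on_compose2[OF that]) auto
    then have "continuous_on {0..1} (\<lambda>y. h (x, y) * sn n y)" by (rule continuous_on_subset) simp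
    from integral_MY_HK[OF this] show ?thesis by (simp add: mode_def)
  qed
  have "((\<lambda>x. integral (cbox 0 1) (\<lambda>y. f (x, y) * sn n y)) has_field_derivative integral (cbox 0 1) (\<lambda>y. pdx f (x, y) * sn n y)) (at x within UNIV)"
  proof (rule leibniz_rule_field_derivative)
    show "((\<lambda>x. f (x, t) * sn n t) has_field_derivative pdx f (x, t) * sn n t) (at x within UNIV)" for x t
      using DERIV_cmult_right[OF Ck_pdx[OF assms]] by simp
    show "(\<lambda>y. f (x, y) * sn n y) integrable_on cbox 0 1" for x
      by (intro integrable_continuous continuous_intros continuous_on_compose2[OF cf(1)]) auto
    show "continuous_on (UNIV \<times> cbox 0 1) (\<lambda>(x, t). pdx f (x, t) * sn n t)"
      unfolding split_beta'
      by (intro continuous_intros continuous_on_compose2[OF cf(2)] continuous_on_compose2[OF sn_continuous[of UNIV n]]) auto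
  qed auto
  moreover have "mode n f = (\<lambda>x. integral (cbox 0 1) (\<lambda>y. f (x, y) * sn n y))" using eq[OF cf(1)] by blast
  ultimately show ?thesis using eq[OF cf(2), of x] by simp
qed

lemma mode_ten: "n \<ge> 1 \<Longrightarrow> mode n (ten v (sn n)) x = v x"
  using sn_orthonormal[of n n] by (simp add: mode_def mult.assoc)

text \<open>Parts in y turn the coefficient of the y-derivative against the cosine into N^2 times
  the sine coefficient, N = n pi. The hypothesis on \<open>\<phi>\<close> is C^1 with zero values at
  y = 0 and y = 1, which fits test functions and also their projections.\<close>

lemma Vip_mode:
  assumes g: "\<gamma> > 0" and f: "Ck 1 \<phi>" "\<And>x. \<phi> (x, 0) = 0" "\<And>x. \<phi> (x, 1) = 0"
    and v: "\<And>x. (v has_real_derivative v1 x) (at x)" "continuous_on UNIV v1"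
  shows "Vip \<gamma> \<phi> (ten v (sn n)) = (\<integral>x. mode n (pdx \<phi>) x * v1 x + wpot \<gamma> (real n * pi) x * (mode n \<phi> x * v x) \<partial>MX)"
proof -
  have p1: "Ck (Suc 0) \<phi>" using f by simp
  have cf: "continuous_on UNIV \<phi>" "continuous_on UNIV (pdx \<phi>)" "continuous_on UNIV (pdy \<phi>)" using p1 by auto
  have C1: "Ck 1 (ten v (sn n))" by (rule Ck_ten1[OF v sn_deriv cn_continuous])
  have cy: "continuous_on UNIV (\<lambda>y. F (x, y))" if "continuous_on UNIV F" for F :: "real \<times> real \<Rightarrow> real" and x
    by (rule continuous_on_compose2[OF that]) (auto intro: continuous_intros)
  have "Vip \<gamma> \<phi> (ten v (sn n)) = (\<integral>x. (\<integral>y. pdx \<phi> (x, y) * (v1 x * sn n y) + \<bar>x\<bar> powr (2 * \<gamma>) * (pdy \<phi> (x, y) * (v x * cn n y)) \<partial>MY) \<partial>MX)"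
    unfolding Vip_def using integral_MO_xy[OF Vip_integrable[OF g f(1) C1]]
    by (simp add: pdx_ten[OF v(1)] pdy_ten[OF sn_deriv])
  also have "\<dots> = (\<integral>x. mode n (pdx \<phi>) x * v1 x + wpot \<gamma> (real n * pi) x * (mode n \<phi> x * v x) \<partial>MX)"
  proof (rule Bochner_Integration.integral_cong[OF refl])
    fix x assume "x \<in> space MX"
    then have x: "\<bar>x\<bar> \<le> 1" by auto
    have i: "integrable MY (\<lambda>y. pdx \<phi> (x, y) * sn n y)" "integrable MY (\<lambda>y. pdy \<phi> (x, y) * cn n y)" "integrable MY (\<lambda>y. \<phi> (x, y) * sn n y)"
      using cf by (auto intro!: sqi_integrable_mult continuous_sqi_MY cy continuous_intros)
    have "(\<integral>y. pdy \<phi> (x, y) * cn n y + \<phi> (x, y) * (- (real n * pi)\<^sup>2 * sn n y) \<partial>MY) = \<phi> (x, 1) * cn n 1 - \<phi> (x, 0) * cn n 0"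
    proof (rule integral_MY_deriv)
      show "((\<lambda>y. \<phi> (x, y) * cn n y) has_real_derivative pdy \<phi> (x, y) * cn n y + \<phi> (x, y) * (- (real n * pi)\<^sup>2 * sn n y)) (at y)" for y
        using DERIV_mult[OF Ck_pdy[OF p1, of x y] cn_deriv[of n y]] by (simp add: algebra_simps)
      show "continuous_on UNIV (\<lambda>y. pdy \<phi> (x, y) * cn n y + \<phi> (x, y) * (- (real n * pi)\<^sup>2 * sn n y))"
        using cf by (intro continuous_intros cy)
    qed
    moreover have "(\<integral>y. pdy \<phi> (x, y) * cn n y + \<phi> (x, y) * (- (real n * pi)\<^sup>2 * sn n y) \<partial>MY) =
        (\<integral>y. pdy \<phi> (x, y) * cn n y \<partial>MY) - (real n * pi)\<^sup>2 * mode n \<phi> x"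
    proof -
      have "(\<integral>y. pdy \<phi> (x, y) * cn n y + \<phi> (x, y) * (- (real n * pi)\<^sup>2 * sn n y) \<partial>MY) = (\<integral>y. pdy \<phi> (x, y) * cn n y + (- (real n * pi)\<^sup>2) * (\<phi> (x, y) * sn n y) \<partial>MY)"
        by (intro Bochner_Integration.integral_cong refl) (simp add: algebra_simps)
      then show ?thesis using i by (simp add: mode_def)
    qed
    ultimately have c: "(\<integral>y. pdy \<phi> (x, y) * cn n y \<partial>MY) = (real n * pi)\<^sup>2 * mode n \<phi> x" using f by simp
    have "(\<integral>y. pdx \<phi> (x, y) * (v1 x * sn n y) + \<bar>x\<bar> powr (2 * \<gamma>) * (pdy \<phi> (x, y) * (v x * cn n y)) \<partial>MY)
       = (\<integral>y. v1 x * (pdx \<phi> (x, y) * sn n y) + (\<bar>x\<bar> powr (2 * \<gamma>) * v x) * (pdy \<phi> (x, y) * cn n y) \<partial>MY)"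
      by (intro Bochner_Integration.integral_cong refl) (simp add: algebra_simps)
    also have "\<dots> = v1 x * mode n (pdx \<phi>) x + (\<bar>x\<bar> powr (2 * \<gamma>) * v x) * ((real n * pi)\<^sup>2 * mode n \<phi> x)"
      using i by (simp add: mode_def[of n "pdx \<phi>"] c)
    finally show "(\<integral>y. pdx \<phi> (x, y) * (v1 x * sn n y) + \<bar>x\<bar> powr (2 * \<gamma>) * (pdy \<phi> (x, y) * (v x * cn n y)) \<partial>MY)
       = mode n (pdx \<phi>) x * v1 x + wpot \<gamma> (real n * pi) x * (mode n \<phi> x * v x)"
      by (simp add: wpot_eq[OF x] algebra_simps)
  qed
  finally show ?thesis .
qed

text \<open>The orthogonal projection onto the n-th sine mode. It destroys compact support in y, so
  the result is placed in V by \<open>ten_sn_domain\<close> and not as a test function.\<close>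

definition proj :: "nat \<Rightarrow> (real \<times> real \<Rightarrow> real) \<Rightarrow> real \<times> real \<Rightarrow> real" where "proj n \<phi> = ten (mode n \<phi>) (sn n)"

lemma proj_facts:
  assumes "test_fun \<phi>"
  shows "\<And>x. (mode n \<phi> has_real_derivative mode n (pdx \<phi>) x) (at x)" "\<And>x. (mode n (pdx \<phi>) has_real_derivative mode n (pdx (pdx \<phi>)) x) (at x)"
    "continuous_on UNIV (mode n (pdx (pdx \<phi>)))" "continuous_on UNIV (mode n (pdx \<phi>))" "continuous_on UNIV (mode n \<phi>)"
    "mode n \<phi> (-1) = 0" "mode n \<phi> 1 = 0" "Ck 2 (proj n \<phi>)" "Ck 1 (proj n \<phi>)"
proof -
  have c: "Ck (Suc (Suc 0)) \<phi>" by (rule test_fun_Ck[OF assms])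
  have c1: "Ck (Suc 0) (pdx \<phi>)" using c by simp
  have c2: "continuous_on UNIV (pdx (pdx \<phi>))" using c1 by simp
  show 1: "\<And>x. (mode n \<phi> has_real_derivative mode n (pdx \<phi>) x) (at x)" by (rule mode_deriv[OF c])
  show 2: "\<And>x. (mode n (pdx \<phi>) has_real_derivative mode n (pdx (pdx \<phi>)) x) (at x)" by (rule mode_deriv[OF c1])
  show 3: "continuous_on UNIV (mode n (pdx (pdx \<phi>)))" by (rule mode_continuous[OF c2])
  show "continuous_on UNIV (mode n (pdx \<phi>))" "continuous_on UNIV (mode n \<phi>)"
    by (rule mode_continuous[OF Ck_continuous[OF c1]], rule mode_continuous[OF Ck_continuous[OF c]])
  show "mode n \<phi> (-1) = 0" "mode n \<phi> 1 = 0" using test_fun_outside[OF assms] by (auto simp: mode_def Omega_def)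
  show C2: "Ck 2 (proj n \<phi>)" unfolding proj_def by (rule Ck2_ten_sn[OF 1 2 3])
  show "Ck 1 (proj n \<phi>)" using Ck_mono[OF _ C2, of 1] by simp
qed

lemma Vip_proj:
  assumes g: "\<gamma> > 0" and t: "test_fun \<phi>" "test_fun \<psi>"
  shows "Vip \<gamma> \<phi> (proj n \<psi>) = (\<integral>x. mode n (pdx \<phi>) x * mode n (pdx \<psi>) x + wpot \<gamma> (real n * pi) x * (mode n \<phi> x * mode n \<psi> x) \<partial>MX)"
  unfolding proj_def
  by (rule Vip_mode[OF g test_fun_Ck[OF t(1)] _ _ proj_facts(1)[OF t(2)] proj_facts(4)[OF t(2)]])
     (use test_fun_outside[OF t(1)] in \<open>auto simp: Omega_def\<close>)

lemma Vip_proj_sym: "\<gamma> > 0 \<Longrightarrow> test_fun \<phi> \<Longrightarrow> test_fun \<psi> \<Longrightarrow> Vip \<gamma> \<phi> (proj n \<psi>) = Vip \<gamma> \<psi> (proj n \<phi>)"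
  by (simp add: Vip_proj mult.commute)

text \<open>The projection P is orthogonal for the form too: Vip (P phi) (P phi) = Vip phi (P phi)
  because P phi has the same n-th mode as phi. Cauchy-Schwarz does the rest.\<close>

lemma vn_proj: assumes g: "\<gamma> > 0" and t: "test_fun \<phi>" and n: "n \<ge> 1" shows "vn \<gamma> (proj n \<phi>) \<le> vn \<gamma> \<phi>"
proof -
  have "Vip \<gamma> (proj n \<phi>) (proj n \<phi>) = Vip \<gamma> \<phi> (proj n \<phi>)"
  proof -
    have "Vip \<gamma> (proj n \<phi>) (ten (mode n \<phi>) (sn n)) = (\<integral>x. mode n (pdx (proj n \<phi>)) x * mode n (pdx \<phi>) x + wpot \<gamma> (real n * pi) x * (mode n (proj n \<phi>) x * mode n \<phi> x) \<partial>MX)"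
      by (rule Vip_mode[OF g proj_facts(9)[OF t] _ _ proj_facts(1)[OF t] proj_facts(4)[OF t]]) (auto simp: proj_def)
    moreover have "pdx (proj n \<phi>) = ten (mode n (pdx \<phi>)) (sn n)" unfolding proj_def by (rule pdx_ten[OF proj_facts(1)[OF t]])
    ultimately show ?thesis unfolding Vip_proj[OF g t t] by (simp add: mode_ten[OF n] proj_def)
  qed
  then have "(vn \<gamma> (proj n \<phi>))\<^sup>2 \<le> vn \<gamma> \<phi> * vn \<gamma> (proj n \<phi>)"
    using Vip_cauchy_schwarz[OF g test_fun_Ck[OF t] proj_facts(9)[OF t], of n] by (simp add: vn_sq)
  then show ?thesis using vn_nonneg[of \<gamma> "proj n \<phi>"] vn_nonneg[of \<gamma> \<phi>] by (cases "vn \<gamma> (proj n \<phi>) = 0") (auto simp: power2_eq_square simp del: vn_nonneg)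
qed

text \<open>Localises the equation Af = h to one sine mode. For fixed k the identity comes from
  testing with \<open>proj n (\<phi>' k)\<close>. The diagonal limit is legitimate because these
  projections are bounded in the V-norm by \<open>vn_proj\<close> and \<open>\<phi>\<close> is
  Cauchy there. Symmetry and coercivity of the mode operator are both read off from this
  limit.\<close>

lemma A_op_Qf_limit:
  assumes g: "\<gamma> > 0" and n: "n \<ge> 1" and A: "A_op \<gamma> f h" and a: "approx_seq \<gamma> \<phi> f"
    and f': "sqi MO f'" "approx_seq \<gamma> \<phi>' f'"
  shows "(\<lambda>k. Vip \<gamma> (\<phi> k) (proj n (\<phi>' k))) \<longlonglongrightarrow> - Qf n UNIV h f'"
proof -
  have t: "\<And>k. test_fun (\<phi> k)" "\<And>k. test_fun (\<phi>' k)" using a f' by (auto simp: approx_seq_iff)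
  have fs: "sqi MO f" "sqi MO h" using A by (auto simp: A_op_def Vspace_def L2_iff)
  have C1: "\<And>k. Ck 1 (\<phi> k)" "\<And>k. Ck 1 (\<phi>' k)" by (rule test_fun_Ck[OF t(1)], rule test_fun_Ck[OF t(2)])
  obtain B where B: "0 \<le> B" "\<And>k. vn \<gamma> (\<phi>' k) \<le> B" using Vcauchy_bounded[of \<gamma> \<phi>', OF g C1(2)] f' by (auto simp: approx_seq_iff)
  have bq: "bbil (Qf n UNIV)" by (rule bbil_Qf[OF n]) simp
  have lim: "(\<lambda>j. Vip \<gamma> (\<phi> j) (proj n (\<phi>' k))) \<longlonglongrightarrow> - Qf n UNIV h (\<phi>' k)" for k
  proof -
    have V: "proj n (\<phi>' k) \<in> Vspace \<gamma>" unfolding proj_def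
      by (rule ten_sn_domain(1)[OF g proj_facts(1)[OF t(2)] proj_facts(2)[OF t(2)] proj_facts(3)[OF t(2)] proj_facts(6)[OF t(2)] proj_facts(7)[OF t(2)]])
    have "(\<lambda>j. Vip \<gamma> (\<phi> j) (proj n (\<phi>' k))) \<longlonglongrightarrow> - aV \<gamma> f (proj n (\<phi>' k))" unfolding proj_def
      by (rule ten_sn_domain(3)[OF g proj_facts(1)[OF t(2)] proj_facts(2)[OF t(2)] proj_facts(3)[OF t(2)] proj_facts(6)[OF t(2)] proj_facts(7)[OF t(2)] fs(1) a])
    moreover have "aV \<gamma> f (proj n (\<phi>' k)) = L2inner h (proj n (\<phi>' k))" using A V by (simp add: A_op_def)
    moreover have "L2inner h (proj n (\<phi>' k)) = Qf n UNIV h (\<phi>' k)"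
      unfolding L2inner_eq proj_def Qf_def
      using integral_mult_ten_sn[OF fs(2) continuous_sqi_MX[OF proj_facts(5)[OF t(2)]]] by simp
    ultimately show ?thesis by simp
  qed
  have "(\<lambda>k. Vip \<gamma> (\<phi> k) (proj n (\<phi>' k)) + Qf n UNIV h (\<phi>' k)) \<longlonglongrightarrow> 0"
  proof (rule LIMSEQ_I)
    fix e :: real assume e: "e > 0"
    define d where "d = e / (B + 1) / 2"
    have d: "d > 0" using e B by (simp add: d_def)
    obtain N where N: "\<And>j k. j \<ge> N \<Longrightarrow> k \<ge> N \<Longrightarrow> vn \<gamma> (\<lambda>z. \<phi> j z - \<phi> k z) < d"
      using a d unfolding approx_seq_iff Vcauchy_def by meson
    have "\<bar>Vip \<gamma> (\<phi> k) (proj n (\<phi>' k)) + Qf n UNIV h (\<phi>' k)\<bar> \<le> d * B" if k: "k \<ge> N" for k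
    proof (rule tendsto_upperbound)
      show "(\<lambda>j. \<bar>Vip \<gamma> (\<phi> k) (proj n (\<phi>' k)) - Vip \<gamma> (\<phi> j) (proj n (\<phi>' k))\<bar>) \<longlonglongrightarrow> \<bar>Vip \<gamma> (\<phi> k) (proj n (\<phi>' k)) + Qf n UNIV h (\<phi>' k)\<bar>"
        using tendsto_rabs[OF tendsto_diff[OF tendsto_const lim[of k]]] by simp
      show "\<forall>\<^sub>F j in sequentially. \<bar>Vip \<gamma> (\<phi> k) (proj n (\<phi>' k)) - Vip \<gamma> (\<phi> j) (proj n (\<phi>' k))\<bar> \<le> d * B"
      proof (rule eventually_sequentiallyI)
        fix j assume j: "j \<ge> N"
        have "\<bar>Vip \<gamma> (\<phi> k) (proj n (\<phi>' k)) - Vip \<gamma> (\<phi> j) (proj n (\<phi>' k))\<bar> \<le> vn \<gamma> (\<lambda>z. \<phi> k z - \<phi> j z) * vn \<gamma> (proj n (\<phi>' k))"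
          using Vip_cauchy_schwarz[OF g Ck_diff[OF C1(1) C1(1)] proj_facts(9)[OF t(2)]] Vip_diff1[OF g C1(1) C1(1) proj_facts(9)[OF t(2)]] by simp
        also have "\<dots> \<le> d * B"
          by (intro mult_mono less_imp_le[OF N[OF k j]] order_trans[OF vn_proj[OF g t(2) n] B(2)]) (use d in auto)
        finally show "\<bar>Vip \<gamma> (\<phi> k) (proj n (\<phi>' k)) - Vip \<gamma> (\<phi> j) (proj n (\<phi>' k))\<bar> \<le> d * B" .
      qed
    qed simp
    moreover have "d * B < e"
    proof -
      have "d * B \<le> d * (B + 1)" using d by (simp add: algebra_simps)
      also have "\<dots> = e / 2"
      proof -
        have "B + 1 \<noteq> 0" using B by simp
        then show ?thesis unfolding d_def by (simp only: times_divide_eq_left nonzero_mult_div_cancel_right) simp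
      qed
      finally show ?thesis using e by simp
    qed
    ultimately show "\<exists>no. \<forall>k\<ge>no. norm (Vip \<gamma> (\<phi> k) (proj n (\<phi>' k)) + Qf n UNIV h (\<phi>' k) - 0) < e"
      by (intro exI[of _ N]) fastforce
  qed
  moreover have "(\<lambda>k. Qf n UNIV h (\<phi>' k)) \<longlonglongrightarrow> Qf n UNIV h f'"
    by (rule bbil_tendsto[OF bq _ fs(2) const_n2(2)]) (use fs f' test_fun_sqi[OF t(2)] in \<open>auto simp: approx_seq_iff\<close>)
  ultimately have "(\<lambda>k. (Vip \<gamma> (\<phi> k) (proj n (\<phi>' k)) + Qf n UNIV h (\<phi>' k)) - Qf n UNIV h (\<phi>' k)) \<longlonglongrightarrow> 0 - Qf n UNIV h f'"
    by (rule tendsto_diff)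
  then show ?thesis by simp
qed

section \<open>Symmetry, coercivity and decay of a single mode\<close>

lemma Qf_A_sym:
  assumes g: "\<gamma> > 0" and n: "n \<ge> 1" and A: "A_op \<gamma> f h" "A_op \<gamma> f' h'"
  shows "Qf n UNIV h f' = Qf n UNIV h' f"
proof -
  obtain \<phi> \<phi>' where a: "approx_seq \<gamma> \<phi> f" "approx_seq \<gamma> \<phi>' f'" "sqi MO f" "sqi MO f'"
    using A by (auto simp: A_op_def Vspace_def L2_iff)
  have t: "\<And>k. test_fun (\<phi> k)" "\<And>k. test_fun (\<phi>' k)" using a by (auto simp: approx_seq_iff)
  have "(\<lambda>k. Vip \<gamma> (\<phi> k) (proj n (\<phi>' k))) \<longlonglongrightarrow> - Qf n UNIV h f'" by (rule A_op_Qf_limit[OF g n A(1) a(1,4,2)])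
  moreover have "(\<lambda>k. Vip \<gamma> (\<phi>' k) (proj n (\<phi> k))) \<longlonglongrightarrow> - Qf n UNIV h' f" by (rule A_op_Qf_limit[OF g n A(2) a(2,3,1)])
  ultimately show ?thesis using LIMSEQ_unique by (simp add: Vip_proj_sym[OF g t(1) t(2)]) fastforce
qed

text \<open>A lower bound for the ground energy, of the same order N^(2/(1+gamma)) as the upper
  bound in \<open>ground_state\<close>. For gamma = 1 it equals N/8.\<close>

definition muN :: "real \<Rightarrow> real \<Rightarrow> real" where "muN \<gamma> N = (N / 2 powr \<gamma>) powr (2 / (1 + \<gamma>)) / 4"

text \<open>Expand $\int (v' - q v)^2 \ge 0$, where $q$ is the logarithmic derivative of $(1+\kappa x^2)^{-1/2}$.\<close>

lemma coercive_1d: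
  assumes g: "\<gamma> > 0" and N: "N > 0" and v: "\<And>x. (v has_real_derivative v1 x) (at x)" "continuous_on UNIV v1" "v (-1) = 0" "v 1 = 0"
  shows "muN \<gamma> N * (\<integral>x. (v x)\<^sup>2 \<partial>MX) \<le> (\<integral>x. (v1 x)\<^sup>2 + wpot \<gamma> N x * (v x)\<^sup>2 \<partial>MX)"
proof -
  have vc: "continuous_on UNIV v" using v by (auto intro!: DERIV_continuous_on intro: has_field_derivative_at_within)
  \<comment> \<open>Chosen so that N^2 |x|^(2 gamma) at |x| = eps/2 equals kappa = eps^(-2).\<close>
  define \<epsilon> where "\<epsilon> = (2 powr \<gamma> / N) powr (1 / (1 + \<gamma>))"
  define \<kappa> where "\<kappa> = 1 / \<epsilon>\<^sup>2"
  have \<epsilon>: "\<epsilon> > 0" using N by (simp add: \<epsilon>_def)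
  have \<kappa>: "\<kappa> > 0" "\<kappa> * \<epsilon>\<^sup>2 = 1" using \<epsilon> by (auto simp: \<kappa>_def)
  have mu: "muN \<gamma> N = \<kappa> / 4"
  proof -
    have "\<epsilon>\<^sup>2 = (2 powr \<gamma> / N) powr (2 / (1 + \<gamma>))" using N by (simp add: \<epsilon>_def power2_eq_square flip: powr_add)
    moreover have "(2 powr \<gamma> / N) powr (2 / (1 + \<gamma>)) * (N / 2 powr \<gamma>) powr (2 / (1 + \<gamma>)) = 1"
      using N by (simp flip: powr_mult)
    ultimately have "(N / 2 powr \<gamma>) powr (2 / (1 + \<gamma>)) * \<epsilon>\<^sup>2 = 1" by (simp only: mult.commute)
    then have "\<kappa> = (N / 2 powr \<gamma>) powr (2 / (1 + \<gamma>))" unfolding \<kappa>_def using \<epsilon> by (simp add: divide_eq_eq)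
    then show ?thesis by (simp add: muN_def)
  qed
  have pot: "\<kappa> \<le> N\<^sup>2 * \<bar>x\<bar> powr (2 * \<gamma>)" if "\<epsilon> / 2 \<le> \<bar>x\<bar>" for x
  proof -
    have e1: "\<epsilon> powr (2 + 2 * \<gamma>) = (2 powr \<gamma> / N)\<^sup>2"
    proof -
      have "\<epsilon> powr (2 + 2 * \<gamma>) = (2 powr \<gamma> / N) powr (1 / (1 + \<gamma>) * (2 + 2 * \<gamma>))" by (simp add: \<epsilon>_def powr_powr)
      also have "1 / (1 + \<gamma>) * (2 + 2 * \<gamma>) = 2" using g by (simp add: field_simps)
      finally show ?thesis using N by simp
    qed
    have "\<kappa> = \<epsilon> powr (2 * \<gamma>) / \<epsilon> powr (2 + 2 * \<gamma>)" using \<epsilon> by (simp add: \<kappa>_def powr_add)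
    also have "\<dots> = \<epsilon> powr (2 * \<gamma>) * (N\<^sup>2 / (2 powr \<gamma>)\<^sup>2)" unfolding e1 using N by (simp add: power_divide)
    also have "(2 powr \<gamma>)\<^sup>2 = 2 powr (2 * \<gamma>)" by (simp add: power2_eq_square flip: powr_add)
    also have "\<epsilon> powr (2 * \<gamma>) * (N\<^sup>2 / 2 powr (2 * \<gamma>)) = N\<^sup>2 * (\<epsilon> / 2) powr (2 * \<gamma>)"
      using \<epsilon> by (simp add: powr_divide)
    also have "\<dots> \<le> N\<^sup>2 * \<bar>x\<bar> powr (2 * \<gamma>)" using that \<epsilon> g by (intro mult_left_mono powr_mono2) auto
    finally show ?thesis .
  qed
  define q where "q x = - \<kappa> * x / (1 + \<kappa> * x\<^sup>2)" for x
  define q1 where "q1 x = - \<kappa> * (1 - \<kappa> * x\<^sup>2) / (1 + \<kappa> * x\<^sup>2)\<^sup>2" for x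
  have den: "1 + \<kappa> * x\<^sup>2 > 0" for x using \<kappa> by (simp add: add_pos_nonneg)
  have qd: "(q has_real_derivative q1 x) (at x)" for x
  proof -
    have a: "((\<lambda>x. - \<kappa> * x) has_real_derivative - \<kappa>) (at x)" by (auto intro!: derivative_eq_intros)
    have b: "((\<lambda>x. 1 + \<kappa> * x\<^sup>2) has_real_derivative 2 * \<kappa> * x) (at x)" by (auto intro!: derivative_eq_intros)
    have "1 + \<kappa> * x\<^sup>2 \<noteq> 0" using den[of x] by simp
    from DERIV_divide[OF a b this] have "(q has_real_derivative (- \<kappa> * (1 + \<kappa> * x\<^sup>2) - (- \<kappa> * x) * (2 * \<kappa> * x)) / ((1 + \<kappa> * x\<^sup>2) * (1 + \<kappa> * x\<^sup>2))) (at x)"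
      unfolding q_def[abs_def] by simp
    moreover have "- \<kappa> * (1 + \<kappa> * x\<^sup>2) - (- \<kappa> * x) * (2 * \<kappa> * x) = - \<kappa> * (1 - \<kappa> * x\<^sup>2)" by (simp add: power2_eq_square algebra_simps)
    ultimately show ?thesis unfolding q1_def power2_eq_square[of "1 + \<kappa> * x\<^sup>2"] by (simp only:)
  qed
  have qc: "continuous_on UNIV q" "continuous_on UNIV q1"
  proof -
    have nz: "1 + \<kappa> * x\<^sup>2 \<noteq> 0" "(1 + \<kappa> * x\<^sup>2)\<^sup>2 \<noteq> 0" for x using den[of x] by simp_all
    show "continuous_on UNIV q" "continuous_on UNIV q1"
      unfolding q_def[abs_def] q1_def[abs_def] by (intro continuous_intros ballI nz)+
  qed
  have low: "\<kappa> / 4 \<le> - q1 x - (q x)\<^sup>2 + wpot \<gamma> N x" if x: "\<bar>x\<bar> < 1" for x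
  proof -
    define r where "r = \<kappa> * x\<^sup>2"
    have r: "r \<ge> 0" using \<kappa> by (simp add: r_def)
    have D: "(1 + r)\<^sup>2 > 0" using r by simp
    have "- q1 x - (q x)\<^sup>2 = \<kappa> * (1 - 2 * r) / (1 + r)\<^sup>2"
    proof -
      have "(q x)\<^sup>2 = \<kappa> * r / (1 + r)\<^sup>2" unfolding q_def r_def by (simp add: power_divide power_mult_distrib power2_eq_square)
      moreover have "- q1 x = \<kappa> * (1 - r) / (1 + r)\<^sup>2" unfolding q1_def r_def by simp
      ultimately show ?thesis by (simp add: diff_divide_distrib[symmetric] algebra_simps)
    qed
    \<comment> \<open>The case r <= 1/4 means |x| <= eps/2, and there the contribution of q is at
      least kappa/4. Elsewhere it loses at most kappa/3, while the potential is at least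
      kappa.\<close>
    moreover have "\<kappa> / 4 \<le> \<kappa> * (1 - 2 * r) / (1 + r)\<^sup>2 + wpot \<gamma> N x"
    proof (cases "r \<le> 1/4")
      case True
      have "(1 + r)\<^sup>2 / 4 \<le> 1 - 2 * r"
      proof -
        have "r * r \<le> r * (1/4)" using r True by (intro mult_left_mono) auto
        moreover have "(1 + r)\<^sup>2 = 1 + 2 * r + r * r" by (simp add: power2_eq_square algebra_simps)
        ultimately show ?thesis using True r by linarith
      qed
      then have "1/4 \<le> (1 - 2 * r) / (1 + r)\<^sup>2" using D by (simp add: field_simps)
      then have "\<kappa> * (1/4) \<le> \<kappa> * ((1 - 2 * r) / (1 + r)\<^sup>2)" using \<kappa> by (intro mult_left_mono) auto
      then show ?thesis using wpot_bounds[OF g, of N x] by simp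
    next
      case False
      have "1/3 * (1 + r)\<^sup>2 \<ge> 2 * r - 1"
      proof -
        have "0 \<le> (r - 2)\<^sup>2" by simp
        then show ?thesis by (simp add: power2_eq_square algebra_simps)
      qed
      then have "- (1/3) \<le> (1 - 2 * r) / (1 + r)\<^sup>2" using D by (simp add: field_simps)
      then have 1: "\<kappa> * (- (1/3)) \<le> \<kappa> * ((1 - 2 * r) / (1 + r)\<^sup>2)" using \<kappa> by (intro mult_left_mono) auto
      have "\<epsilon> / 2 \<le> \<bar>x\<bar>"
      proof (rule power2_le_imp_le)
        have "\<kappa> * (\<epsilon>/2)\<^sup>2 = 1/4" using \<kappa> by (simp add: power_divide)
        then have "\<kappa> * (\<epsilon>/2)\<^sup>2 \<le> \<kappa> * x\<^sup>2" using False by (simp add: r_def)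
        then show "(\<epsilon> / 2)\<^sup>2 \<le> \<bar>x\<bar>\<^sup>2" using \<kappa> by simp
      qed simp
      then have "\<kappa> \<le> wpot \<gamma> N x" using pot x by (simp add: wpot_eq)
      then show ?thesis using 1 \<kappa> by simp
    qed
    ultimately show ?thesis by simp
  qed
  have ii: "integrable MX F" if "continuous_on UNIV F" for F :: "real \<Rightarrow> real"
    by (rule sqi_integrable[OF finite_MX continuous_sqi_MX[OF that]])
  have wc: "continuous_on UNIV (wpot \<gamma> N)" by (rule wpot_continuous[OF g])
  have by_parts: "(\<integral>x. q1 x * (v x)\<^sup>2 + q x * (2 * (v x * v1 x)) \<partial>MX) = 0"
  proof -
    have "(\<integral>x. q1 x * (v x)\<^sup>2 + q x * (2 * (v x * v1 x)) \<partial>MX) = q 1 * (v 1)\<^sup>2 - q (-1) * (v (-1))\<^sup>2"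
    proof (rule integral_MX_deriv)
      show "((\<lambda>x. q x * (v x)\<^sup>2) has_real_derivative q1 x * (v x)\<^sup>2 + q x * (2 * (v x * v1 x))) (at x)" for x
        by (rule derivative_eq_intros qd v refl | simp)+
    qed (intro continuous_intros qc vc v)
    then show ?thesis using v by simp
  qed
  have "muN \<gamma> N * (\<integral>x. (v x)\<^sup>2 \<partial>MX) = (\<integral>x. \<kappa> / 4 * (v x)\<^sup>2 \<partial>MX)" by (simp add: mu)
  also have "\<dots> \<le> (\<integral>x. (- q1 x - (q x)\<^sup>2 + wpot \<gamma> N x) * (v x)\<^sup>2 \<partial>MX)"
  proof (rule integral_mono)
    show "\<kappa> / 4 * (v x)\<^sup>2 \<le> (- q1 x - (q x)\<^sup>2 + wpot \<gamma> N x) * (v x)\<^sup>2" if "x \<in> space MX" for x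
      by (intro mult_right_mono low) (use that in auto)
  qed (intro ii continuous_intros qc vc wc)+
  also have "\<dots> \<le> (\<integral>x. (- q1 x - (q x)\<^sup>2 + wpot \<gamma> N x) * (v x)\<^sup>2 + (v1 x - q x * v x)\<^sup>2 \<partial>MX)"
    by (rule integral_mono) (auto intro!: ii continuous_intros qc vc wc v)
  also have "\<dots> = (\<integral>x. ((v1 x)\<^sup>2 + wpot \<gamma> N x * (v x)\<^sup>2) - (q1 x * (v x)\<^sup>2 + q x * (2 * (v x * v1 x))) \<partial>MX)"
    by (intro Bochner_Integration.integral_cong refl) (simp add: power2_eq_square algebra_simps)
  also have "\<dots> = (\<integral>x. (v1 x)\<^sup>2 + wpot \<gamma> N x * (v x)\<^sup>2 \<partial>MX) - (\<integral>x. q1 x * (v x)\<^sup>2 + q x * (2 * (v x * v1 x)) \<partial>MX)"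
    by (rule Bochner_Integration.integral_diff; rule ii; intro continuous_intros qc vc wc v)
  finally show ?thesis using by_parts by simp
qed

lemma Qf_A_coercive:
  assumes g: "\<gamma> > 0" and n: "n \<ge> 1" and A: "A_op \<gamma> f h"
  shows "Qf n UNIV h f \<le> - muN \<gamma> (real n * pi) * Qf n UNIV f f"
proof -
  obtain \<phi> where a: "approx_seq \<gamma> \<phi> f" "sqi MO f" using A by (auto simp: A_op_def Vspace_def L2_iff)
  have t: "\<And>k. test_fun (\<phi> k)" using a by (auto simp: approx_seq_iff)
  have bq: "bbil (Qf n UNIV)" by (rule bbil_Qf[OF n]) simp
  have N: "real n * pi > 0" using n by simp
  have 1: "(\<lambda>k. Vip \<gamma> (\<phi> k) (proj n (\<phi> k))) \<longlonglongrightarrow> - Qf n UNIV h f" by (rule A_op_Qf_limit[OF g n A a(1,2,1)])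
  have 2: "(\<lambda>k. Qf n UNIV (\<phi> k) (\<phi> k)) \<longlonglongrightarrow> Qf n UNIV f f"
    by (rule bbil_tendsto[OF bq]) (use a test_fun_sqi[OF t] in \<open>auto simp: approx_seq_iff\<close>)
  have "muN \<gamma> (real n * pi) * Qf n UNIV f f \<le> - Qf n UNIV h f"
  proof (rule tendsto_le[OF _ 1 tendsto_mult_left[OF 2]])
    show "\<forall>\<^sub>F k in sequentially. muN \<gamma> (real n * pi) * Qf n UNIV (\<phi> k) (\<phi> k) \<le> Vip \<gamma> (\<phi> k) (proj n (\<phi> k))"
      using coercive_1d[OF g N proj_facts(1)[OF t] proj_facts(4)[OF t] proj_facts(6)[OF t] proj_facts(7)[OF t]]
      by (simp add: Vip_proj[OF g t t] Qf_def power2_eq_square)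
  qed simp
  then show ?thesis by simp
qed

lemma muN_nonneg: "0 \<le> muN \<gamma> N" by (simp add: muN_def)

text \<open>Gronwall with \<open>Qf_A_coercive\<close>. It starts at t > 0, where the trajectory
  lies in the domain of the generator.\<close>

lemma mode_decay:
  assumes g: "\<gamma> > 0" and n: "n \<ge> 1" and s: "is_solution \<gamma> g0 g" and t: "0 < t" "t \<le> t'"
  shows "Qf n UNIV (g t') (g t') \<le> exp (- 2 * muN \<gamma> (real n * pi) * (t' - t)) * Qf n UNIV (g t) (g t)"
proof -
  define m where "m = muN \<gamma> (real n * pi)"
  have bq: "bbil (Qf n UNIV)" by (rule bbil_Qf[OF n]) simp
  define E where "E u = Qf n UNIV (g u) (g u) * exp (2 * m * u)" for u
  have "E t' \<le> E t"
  proof (rule DERIV_nonpos_imp_nonincreasing[OF t(2)])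
    fix u assume u: "t \<le> u" "u \<le> t'"
    then have u0: "u > 0" using t by simp
    obtain h where h: "A_op \<gamma> (g u) h" "sqi MO h" "((\<lambda>s. n2 MO (\<lambda>z. (g s z - g u z) / (s - u) - h z)) \<longlongrightarrow> 0) (at u)"
      using solution_deriv[OF s u0] by blast
    have "(E has_real_derivative 2 * Qf n UNIV h (g u) * exp (2 * m * u) + Qf n UNIV (g u) (g u) * (exp (2 * m * u) * (2 * m))) (at u)"
      unfolding E_def[abs_def]
      by (rule derivative_eq_intros solution_bbil_deriv(2)[OF bq s u0 h(2) h(2,3)] refl | simp)+
    moreover have "2 * Qf n UNIV h (g u) * exp (2 * m * u) + Qf n UNIV (g u) (g u) * (exp (2 * m * u) * (2 * m)) \<le> 0"
    proof -
      have "Qf n UNIV h (g u) + m * Qf n UNIV (g u) (g u) \<le> 0" using Qf_A_coercive[OF g n h(1)] by (simp add: m_def)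
      then have "2 * exp (2 * m * u) * (Qf n UNIV h (g u) + m * Qf n UNIV (g u) (g u)) \<le> 0" by (intro mult_nonneg_nonpos) auto
      then show ?thesis by (simp add: algebra_simps)
    qed
    ultimately show "\<exists>y. (E has_real_derivative y) (at u) \<and> y \<le> 0" by blast
  qed
  then have "E t' * exp (- 2 * m * t') \<le> E t * exp (- 2 * m * t')" by (intro mult_right_mono) auto
  moreover have "E t' * exp (- 2 * m * t') = Qf n UNIV (g t') (g t')" by (simp add: E_def mult.assoc flip: exp_add)
  moreover have "E t * exp (- 2 * m * t') = exp (- 2 * m * (t' - t)) * Qf n UNIV (g t) (g t)"
    by (simp add: E_def mult.assoc flip: exp_add) (simp add: algebra_simps)
  ultimately show ?thesis unfolding m_def by (simp only:)
qed

text \<open>$\langle u(s), u(c-s)\rangle$ does not depend on $s$ because the generator is symmetric; take $c = t + T$ and $s = c/2$.\<close>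

lemma mode_symmetric:
  assumes g: "\<gamma> > 0" and n: "n \<ge> 1" and s: "is_solution \<gamma> g0 g" and t: "0 < t" "t \<le> T"
  shows "Qf n UNIV (g T) (g T) \<le> Qf n UNIV (g t) (g T)"
proof -
  define c where "c = t + T"
  have bq: "bbil (Qf n UNIV)" by (rule bbil_Qf[OF n]) simp
  define F where "F u = Qf n UNIV (g u) (g (c - u))" for u
  have d: "(F has_real_derivative 0) (at u)" if u: "0 < u" "u < c" for u
  proof -
    have cu: "c - u > 0" using u by simp
    obtain h where h: "A_op \<gamma> (g u) h" "sqi MO h" "((\<lambda>s. n2 MO (\<lambda>z. (g s z - g u z) / (s - u) - h z)) \<longlongrightarrow> 0) (at u)"
      using solution_deriv[OF s u(1)] by blast
    obtain k where k: "A_op \<gamma> (g (c - u)) k" "sqi MO k" "((\<lambda>s. n2 MO (\<lambda>z. (g s z - g (c - u) z) / (s - (c - u)) - k z)) \<longlongrightarrow> 0) (at (c - u))"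
      using solution_deriv[OF s cu] by blast
    \<comment> \<open>Reversing time flips the sign of the difference quotient, so u(c - s) has
      derivative -k. The two terms of the product rule then cancel by
      \<open>Qf_A_sym\<close>.\<close>
    have fl: "filterlim (\<lambda>s. c - s) (at (c - u)) (at u)"
      unfolding filterlim_at by (auto intro!: tendsto_intros simp: eventually_at_filter)
    have 1: "((\<lambda>s. n2 MO (\<lambda>z. (g (c - s) z - g (c - u) z) / (s - u) - (- 1) * k z)) \<longlongrightarrow> 0) (at u)"
    proof -
      have "((\<lambda>s. n2 MO (\<lambda>z. (g (c - s) z - g (c - u) z) / ((c - s) - (c - u)) - k z)) \<longlongrightarrow> 0) (at u)"
        using filterlim_compose[OF k(3) fl] by simp
      moreover have "n2 MO (\<lambda>z. (g (c - s) z - g (c - u) z) / ((c - s) - (c - u)) - k z) = n2 MO (\<lambda>z. (g (c - s) z - g (c - u) z) / (s - u) - (- 1) * k z)" for s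
      proof -
        have "(\<lambda>z. (g (c - s) z - g (c - u) z) / ((c - s) - (c - u)) - k z) = (\<lambda>z. (-1) * ((g (c - s) z - g (c - u) z) / (s - u) - (- 1) * k z))"
        proof -
          have "(c - s) - (c - u) = - (s - u)" by simp
          then show ?thesis by (simp only: divide_minus_right) (simp add: fun_eq_iff)
        qed
        then have "n2 MO (\<lambda>z. (g (c - s) z - g (c - u) z) / ((c - s) - (c - u)) - k z) = \<bar>-1\<bar> * n2 MO (\<lambda>z. (g (c - s) z - g (c - u) z) / (s - u) - (- 1) * k z)"
          by (simp only: n2_cmult)
        then show ?thesis by (simp only: abs_neg_one mult_1_left)
      qed
      ultimately show ?thesis by simp
    qed
    have 2: "((\<lambda>s. n2 MO (\<lambda>z. g (c - s) z - g (c - u) z)) \<longlongrightarrow> 0) (at u)"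
      using filterlim_compose[OF solution_cont_at[OF s cu] fl] by simp
    have ev: "\<forall>\<^sub>F w in at u. sqi MO (g (c - w))"
      using fl solution_sqi_ev[OF s cu] unfolding filterlim_iff by blast
    have gu: "sqi MO (g u)" "sqi MO (g (c - u))" using solution_sqi[OF s] u by auto
    have "((\<lambda>w. Qf n UNIV (g w) (g (c - w))) has_real_derivative Qf n UNIV h (g (c - u)) + Qf n UNIV (g u) (\<lambda>z. (-1) * k z)) (at u)"
      by (rule bbil_deriv[OF bq solution_sqi_ev[OF s u(1)] gu(1) h(2,3) ev gu(2) sqi_cmult[OF k(2)] 1 2])
    moreover have "Qf n UNIV (g u) (\<lambda>z. (-1) * k z) = - Qf n UNIV h (g (c - u))"
      using bbil_cmult(2)[OF bq k(2) gu(1), of "-1"] bbilD(1)[OF bq gu(1) k(2)] Qf_A_sym[OF g n h(1) k(1)] by simp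
    ultimately show ?thesis by (simp add: F_def[abs_def])
  qed
  define m where "m = c / 2"
  have m: "t \<le> m" "m \<le> T" "0 < m" using t by (auto simp: m_def c_def)
  have "F m = F t"
  proof (cases "t = m")
    case False
    then have "t < m" using m by simp
    have dd: "(F has_real_derivative 0) (at u)" if "t \<le> u" "u \<le> m" for u
      by (rule d) (use that t m in \<open>auto simp: m_def c_def\<close>)
    have "continuous_on {t..m} F"
      by (rule DERIV_continuous_on[where D = "\<lambda>_. 0"]) (use dd in \<open>auto intro: has_field_derivative_at_within\<close>)
    then show ?thesis using DERIV_isconst2[OF \<open>t < m\<close>, of F m] \<open>t < m\<close> dd by simp
  qed simp
  moreover have "c - t = T" "c - m = m" by (simp_all add: c_def m_def field_simps)
  then have "F t = Qf n UNIV (g t) (g T)" "F m = Qf n UNIV (g m) (g m)" by (simp_all add: F_def)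
  moreover have "Qf n UNIV (g T) (g T) \<le> exp (- 2 * muN \<gamma> (real n * pi) * (T - m)) * Qf n UNIV (g m) (g m)"
    by (rule mode_decay[OF g n s m(3,2)])
  moreover have "exp (- 2 * muN \<gamma> (real n * pi) * (T - m)) * Qf n UNIV (g m) (g m) \<le> 1 * Qf n UNIV (g m) (g m)"
  proof (rule mult_right_mono)
    show "exp (- 2 * muN \<gamma> (real n * pi) * (T - m)) \<le> 1" using m muN_nonneg[of \<gamma> "real n * pi"] by (simp add: mult_nonneg_nonneg)
    show "0 \<le> Qf n UNIV (g m) (g m)" by (rule bbilD(3)[OF bq solution_sqi[OF s]]) (use m in simp)
  qed
  ultimately show ?thesis by simp
qed

text \<open>The derivative of the squared norm is twice the form, which is nonpositive as a limit of
  - Vip phi_k phi_k. It is what makes observability persist when T grows.\<close>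

lemma solution_contraction:
  assumes g: "\<gamma> > 0" and s: "is_solution \<gamma> g0 g" and t: "0 < t" "t \<le> t'"
  shows "(\<integral>z. (g t' z)\<^sup>2 \<partial>MO) \<le> (\<integral>z. (g t z)\<^sup>2 \<partial>MO)"
proof -
  have bi: "bbil (ipS UNIV)" by (rule bbil_ipS) simp
  have "ipS UNIV (g t') (g t') \<le> ipS UNIV (g t) (g t)"
  proof (rule DERIV_nonpos_imp_nonincreasing[OF t(2), of "\<lambda>t. ipS UNIV (g t) (g t)"])
    fix u assume u: "t \<le> u" "u \<le> t'"
    then have u0: "u > 0" using t by simp
    obtain h where h: "A_op \<gamma> (g u) h" "sqi MO h" "((\<lambda>s. n2 MO (\<lambda>z. (g s z - g u z) / (s - u) - h z)) \<longlongrightarrow> 0) (at u)"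
      using solution_deriv[OF s u0] by blast
    have V: "g u \<in> Vspace \<gamma>" "aV \<gamma> (g u) (g u) = L2inner h (g u)" using h(1) by (auto simp: A_op_def)
    obtain \<phi> where a: "approx_seq \<gamma> \<phi> (g u)" "sqi MO (g u)" using V(1) by (auto simp: Vspace_def L2_iff)
    have "0 \<le> - aV \<gamma> (g u) (g u)"
      by (rule tendsto_lowerbound[OF aV_limit[OF g a(2,2,1,1)]]) (auto simp: Vip_nonneg)
    then have "2 * ipS UNIV h (g u) \<le> 0" using V(2) by (simp add: ipS_def L2inner_eq)
    then show "\<exists>y. ((\<lambda>t. ipS UNIV (g t) (g t)) has_real_derivative y) (at u) \<and> y \<le> 0"
      using solution_bbil_deriv(2)[OF bi s u0 h(2) h(2,3)] by blast
  qed
  then show ?thesis by (simp add: ipS_def power2_eq_square)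
qed


section \<open>Iterated sideways equations\<close>

text \<open>If h'' = k with h, h' >= 0, then Z = e^(Nx) h satisfies Z'' >= N^2 Z + e^(Nx) k. So
  e^(Nx) times the potential-free chain h, started from |Theta|, dominates the true chain: the
  potential costs one factor e^(Nx) in total and not one per step. The constant
  \<open>Kop1 (\<lambda>x. \<bar>\<Theta> x\<bar>) 2\<close> is the integral of |Theta| over
  [0,2].\<close>

lemma chain_functions_from_origin:
  fixes w \<Theta> :: "real \<Rightarrow> real"
  assumes w: "continuous_on UNIV w" "\<And>x. \<bar>w x\<bar> \<le> N\<^sup>2" and N: "N > 0" and \<Theta>: "continuous_on UNIV \<Theta>"
  shows "\<exists>R R1. R 0 = \<Theta> \<and> (\<forall>m. continuous_on UNIV (R m)) \<and> (\<forall>m x. (R (Suc m) has_real_derivative R1 (Suc m) x) (at x)) \<and>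
     (\<forall>m x. (R1 (Suc m) has_real_derivative w x * R (Suc m) x + R m x) (at x)) \<and> (\<forall>m. R (Suc m) 0 = 0) \<and>
     (\<forall>m. \<forall>x\<in>{0..2}. \<bar>R (Suc m) x\<bar> \<le> exp (2 * N) * (Kop1 (\<lambda>x. \<bar>\<Theta> x\<bar>) 2 * 2 ^ (2*m+1) / fact (2*m+1)) \<and>
        \<bar>R1 (Suc m) x\<bar> \<le> exp (2 * N) * (N * (Kop1 (\<lambda>x. \<bar>\<Theta> x\<bar>) 2 * 2 ^ (2*m+1) / fact (2*m+1)) + Kop1 (\<lambda>x. \<bar>\<Theta> x\<bar>) 2 * 2 ^ (2*m) / fact (2*m)))"
proof -
  \<comment> \<open>Equation and comparison principle are packed together, so that the solution
    picked by \<open>SOME\<close> comes with its bound.\<close>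
  define sprop where "sprop Q P P1 \<longleftrightarrow> P 0 = 0 \<and> P1 0 = 0 \<and> (\<forall>x. (P has_real_derivative P1 x) (at x)) \<and>
     (\<forall>x. (P1 has_real_derivative w x * P x + Q x) (at x)) \<and>
     (\<forall>Z Z1 Z2. Z 0 = 0 \<longrightarrow> Z1 0 = 0 \<longrightarrow> (\<forall>u\<ge>0. (Z has_real_derivative Z1 u) (at u)) \<longrightarrow> (\<forall>u\<ge>0. (Z1 has_real_derivative Z2 u) (at u)) \<longrightarrow>
        (\<forall>u\<ge>0. 0 \<le> Z u \<and> N\<^sup>2 * Z u + \<bar>Q u\<bar> \<le> Z2 u) \<longrightarrow> (\<forall>x\<ge>0. \<bar>P x\<bar> \<le> Z x \<and> \<bar>P1 x\<bar> \<le> Z1 x))" for Q P P1 :: "real \<Rightarrow> real"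
  define S where "S Q = (SOME PP. sprop Q (fst PP) (snd PP))" for Q
  have S: "sprop Q (fst (S Q)) (snd (S Q))" if "continuous_on UNIV Q" for Q
  proof -
    have "\<exists>P P1. sprop Q P P1" unfolding sprop_def using linear_ode[OF w that, of 0] by simp
    then have "\<exists>PP. sprop Q (fst PP) (snd PP)" by auto
    then show ?thesis unfolding S_def by (rule someI_ex)
  qed
  define R where "R = rec_nat \<Theta> (\<lambda>_ Q. fst (S Q))"
  have R0: "R 0 = \<Theta>" and RS: "R (Suc m) = fst (S (R m))" for m by (simp_all add: R_def)
  define R1 where "R1 m = snd (S (R (m - 1)))" for m
  have cont: "continuous_on UNIV (R m)" for m
  proof (induction m)
    case 0 then show ?case using \<Theta> by (simp add: R0)
  next
    case (Suc m)
    have "\<forall>x. (R (Suc m) has_real_derivative snd (S (R m)) x) (at x)" using S[OF Suc] by (simp add: sprop_def RS)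
    then show ?case by (auto intro!: DERIV_continuous_on intro: has_field_derivative_at_within)
  qed
  have P: "sprop (R m) (R (Suc m)) (R1 (Suc m))" for m using S[OF cont[of m]] by (simp add: RS R1_def)
  define h where "h = rec_nat (\<lambda>x. \<bar>\<Theta> x\<bar>) (\<lambda>_ Q. Kop Q)"
  have h0: "h 0 = (\<lambda>x. \<bar>\<Theta> x\<bar>)" and hS: "h (Suc m) = Kop (h m)" for m by (simp_all add: h_def)
  define h1 where "h1 m = Kop1 (h (m - 1))" for m
  have hc: "continuous_on UNIV (h m)" for m
  proof (induction m)
    case 0 then show ?case using \<Theta> by (simp add: h0 continuous_intros)
  next
    case (Suc m)
    from Kop(3)[OF this] show ?case unfolding hS by (auto intro!: DERIV_continuous_on intro: has_field_derivative_at_within)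
  qed
  have hd: "(h (Suc m) has_real_derivative h1 (Suc m) x) (at x)" "(h1 (Suc m) has_real_derivative h m x) (at x)"
    "h (Suc m) 0 = 0" "h1 (Suc m) 0 = 0" for m x
    using Kop[OF hc[of m]] by (auto simp: hS h1_def)
  have mono: "G 0 \<le> G y" if "0 \<le> y" "\<And>u. (G has_real_derivative g u) (at u)" "\<And>u. 0 \<le> u \<Longrightarrow> 0 \<le> g u"
    for G g :: "real \<Rightarrow> real" and y
    by (rule DERIV_nonneg_imp_nondecreasing[OF that(1)]) (use that(2,3) in blast)
  have hn: "0 \<le> h m x" if "0 \<le> x" for m x using that
  proof (induction m arbitrary: x)
    case 0 then show ?case by (simp add: h0)
  next
    case (Suc m)
    have "0 \<le> h1 (Suc m) u" if "0 \<le> u" for u using mono[OF that hd(2)[of m] Suc.IH] hd(4)[of m] by simp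
    then show ?case using mono[OF Suc.prems hd(1)[of m]] hd(3)[of m] by simp
  qed
  have h1n: "0 \<le> h1 (Suc m) x" if "0 \<le> x" for m x using mono[OF that hd(2)[of m] hn] hd(4)[of m] by simp
  have step: "\<forall>x\<ge>0. \<bar>R (Suc m) x\<bar> \<le> exp (N * x) * h (Suc m) x \<and> \<bar>R1 (Suc m) x\<bar> \<le> exp (N * x) * (N * h (Suc m) x + h1 (Suc m) x)"
    if IH: "\<forall>x\<ge>0. \<bar>R m x\<bar> \<le> exp (N * x) * h m x" for m
  proof -
    let ?Z = "\<lambda>x. exp (N * x) * h (Suc m) x"
    let ?Z1 = "\<lambda>x. exp (N * x) * (N * h (Suc m) x + h1 (Suc m) x)"
    let ?Z2 = "\<lambda>x. exp (N * x) * (N\<^sup>2 * h (Suc m) x + 2 * N * h1 (Suc m) x + h m x)"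
    have ex: "((\<lambda>x. exp (N * x)) has_real_derivative N * exp (N * u)) (at u)" for u
      by (auto intro!: derivative_eq_intros)
    have d1: "(?Z has_real_derivative ?Z1 u) (at u)" for u
      using DERIV_mult[OF ex hd(1)[of m u]] by (simp add: algebra_simps)
    have d2: "(?Z1 has_real_derivative ?Z2 u) (at u)" for u
      using DERIV_mult[OF ex DERIV_add[OF DERIV_cmult[OF hd(1)[of m u], of N] hd(2)[of m u]]]
      by (simp add: algebra_simps power2_eq_square)
    have s: "0 \<le> ?Z u \<and> N\<^sup>2 * ?Z u + \<bar>R m u\<bar> \<le> ?Z2 u" if u: "u \<ge> 0" for u
    proof
      show "0 \<le> ?Z u" using hn[OF u] by simp
      have "0 \<le> exp (N * u) * (2 * N * h1 (Suc m) u)" using h1n[OF u] N by (intro mult_nonneg_nonneg) auto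
      moreover have "\<bar>R m u\<bar> \<le> exp (N * u) * h m u" using IH u by blast
      ultimately show "N\<^sup>2 * ?Z u + \<bar>R m u\<bar> \<le> ?Z2 u" by (simp add: algebra_simps)
    qed
    have "\<forall>Z Z1 Z2. Z 0 = 0 \<longrightarrow> Z1 0 = 0 \<longrightarrow> (\<forall>u\<ge>0. (Z has_real_derivative Z1 u) (at u)) \<longrightarrow> (\<forall>u\<ge>0. (Z1 has_real_derivative Z2 u) (at u)) \<longrightarrow>
      (\<forall>u\<ge>0. 0 \<le> Z u \<and> N\<^sup>2 * Z u + \<bar>R m u\<bar> \<le> Z2 u) \<longrightarrow> (\<forall>x\<ge>0. \<bar>R (Suc m) x\<bar> \<le> Z x \<and> \<bar>R1 (Suc m) x\<bar> \<le> Z1 x)"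
      using P[of m] unfolding sprop_def by blast
    from this[rule_format, of ?Z ?Z1 ?Z2] show ?thesis using d1 d2 s hd(3,4)[of m] by simp
  qed
  have b: "\<forall>x\<ge>0. \<bar>R m x\<bar> \<le> exp (N * x) * h m x" for m
  proof (induction m)
    case 0 show ?case
    proof (intro allI impI)
      fix x :: real assume "x \<ge> 0"
      then have "1 \<le> exp (N * x)" using N by simp
      then show "\<bar>R 0 x\<bar> \<le> exp (N * x) * h 0 x" using mult_right_mono[of 1 "exp (N * x)" "\<bar>\<Theta> x\<bar>"] by (simp add: R0 h0)
    qed
  next
    case (Suc m) then show ?case using step by blast
  qed
  have b1: "\<bar>R1 (Suc m) x\<bar> \<le> exp (N * x) * (N * h (Suc m) x + h1 (Suc m) x)" if "x \<ge> 0" for m x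
    using step[OF b] that by blast
  define L where "L = Kop1 (\<lambda>x. \<bar>\<Theta> x\<bar>) 2"
  \<comment> \<open>Only the L^1 norm L of Theta is kept: h_1' <= L and h_1 <= Lx, and each later
    step integrates twice. The exponents are therefore one lower than a sup norm would give.\<close>
  have hL: "h (Suc m) x \<le> L * x ^ (2*m+1) / fact (2*m+1) \<and> h1 (Suc m) x \<le> L * x ^ (2*m) / fact (2*m)" if x: "x \<in> {0..2}" for m x
    using x
  proof (induction m arbitrary: x)
    case 0
    have l: "h1 (Suc 0) u \<le> L" if "0 \<le> u" "u \<le> 2" for u
    proof -
      have "h1 (Suc 0) u \<le> h1 (Suc 0) 2"
        by (rule DERIV_nonneg_imp_nondecreasing[OF that(2)]) (use hd(2)[of 0] h0 in \<open>auto intro!: exI[of _ "\<bar>\<Theta> _\<bar>"]\<close>)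
      then show ?thesis by (simp add: L_def h1_def h0)
    qed
    have "0 - h (Suc 0) 0 \<le> L * x - h (Suc 0) x"
    proof (rule DERIV_nonneg_imp_nondecreasing[of 0 x "\<lambda>x. L * x - h (Suc 0) x", simplified mult_zero_right])
      fix u assume u: "0 \<le> u" "u \<le> x"
      have "((\<lambda>x. L * x - h (Suc 0) x) has_real_derivative L - h1 (Suc 0) u) (at u)"
        using DERIV_diff[OF DERIV_cmult_Id hd(1)] by simp
      then show "\<exists>y. ((\<lambda>x. L * x - h (Suc 0) x) has_real_derivative y) (at u) \<and> 0 \<le> y" using l[of u] u 0 by auto
    qed (use 0 in auto)
    then show ?case using l[of x] 0 hd(3)[of 0] by simp
  next
    case (Suc m)
    have "\<bar>h (Suc (Suc m)) x\<bar> \<le> L * x ^ Suc (Suc (2*m+1)) / fact (Suc (Suc (2*m+1))) \<and> \<bar>h1 (Suc (Suc m)) x\<bar> \<le> L * x ^ Suc (2*m+1) / fact (Suc (2*m+1))"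
    proof (rule second_derivative_bound[OF hd(1) hd(2) DERIV_power_fact DERIV_power_fact])
      show "\<bar>h (Suc m) u\<bar> \<le> L * u ^ (2*m+1) / fact (2*m+1)" if "0 \<le> u" "u \<le> x" for u
        using Suc.IH[of u] hn[OF that(1), of "Suc m"] that Suc.prems by auto
    qed (use hd(3,4)[of "Suc m"] Suc.prems in auto)
    moreover have "Suc (Suc (2*m+1)) = 2 * Suc m + 1" "Suc (2*m+1) = 2 * Suc m" by auto
    ultimately show ?case by (metis abs_le_D1)
  qed
  have L0: "0 \<le> L" using h1n[of 2 0] by (simp add: L_def h1_def h0)
  have fin: "\<bar>R (Suc m) x\<bar> \<le> exp (2 * N) * (L * 2 ^ (2*m+1) / fact (2*m+1)) \<and>
        \<bar>R1 (Suc m) x\<bar> \<le> exp (2 * N) * (N * (L * 2 ^ (2*m+1) / fact (2*m+1)) + L * 2 ^ (2*m) / fact (2*m))" if x: "x \<in> {0..2}" for m x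
  proof -
    have e: "exp (N * x) \<le> exp (2 * N)" using x N by simp
    have p: "L * x ^ k / fact k \<le> L * 2 ^ k / fact k" for k
      using x L0 by (intro divide_right_mono mult_left_mono power_mono) auto
    have q1: "h (Suc m) x \<le> L * 2 ^ (2*m+1) / fact (2*m+1)" using hL[OF x, of m] p[of "2*m+1"] by linarith
    have q2: "h1 (Suc m) x \<le> L * 2 ^ (2*m) / fact (2*m)" using hL[OF x, of m] p[of "2*m"] by linarith
    have x0: "0 \<le> x" using x by simp
    show ?thesis
    proof
      have "\<bar>R (Suc m) x\<bar> \<le> exp (N * x) * h (Suc m) x" using b x0 by blast
      also have "\<dots> \<le> exp (2 * N) * (L * 2 ^ (2*m+1) / fact (2*m+1))" by (intro mult_mono e q1 hn x0) auto
      finally show "\<bar>R (Suc m) x\<bar> \<le> exp (2 * N) * (L * 2 ^ (2*m+1) / fact (2*m+1))" .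
      have "\<bar>R1 (Suc m) x\<bar> \<le> exp (N * x) * (N * h (Suc m) x + h1 (Suc m) x)" by (rule b1[OF x0])
      also have "\<dots> \<le> exp (2 * N) * (N * (L * 2 ^ (2*m+1) / fact (2*m+1)) + L * 2 ^ (2*m) / fact (2*m))"
        by (intro mult_mono e add_mono q1 q2 order_refl add_nonneg_nonneg mult_nonneg_nonneg hn h1n x0) (use N in auto)
      finally show "\<bar>R1 (Suc m) x\<bar> \<le> exp (2 * N) * (N * (L * 2 ^ (2*m+1) / fact (2*m+1)) + L * 2 ^ (2*m) / fact (2*m))" .
    qed
  qed
  show ?thesis
  proof (intro exI conjI)
    show "R 0 = \<Theta>" by (rule R0)
    show "\<forall>m. continuous_on UNIV (R m)" using cont by blast
    show "\<forall>m x. (R (Suc m) has_real_derivative R1 (Suc m) x) (at x)"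
      "\<forall>m x. (R1 (Suc m) has_real_derivative w x * R (Suc m) x + R m x) (at x)" "\<forall>m. R (Suc m) 0 = 0"
      using P unfolding sprop_def by blast+
  qed (use fin in \<open>auto simp: L_def\<close>)
qed

text \<open>The substitution d = 1 + sigma x carries the endpoint -sigma to the origin and the other
  endpoint to 2. It preserves the equation because sigma^2 = 1 and the potential is even. The factor
  4^m is 2^(2m), from the length 2 of the interval.\<close>

lemma chain_functions:
  assumes g: "\<gamma> > 0" and N: "N > 0" and \<theta>: "continuous_on UNIV \<theta>" and \<sigma>: "\<sigma> = 1 \<or> \<sigma> = (-1::real)"
  shows "\<exists>Q Q1. Q 0 = \<theta> \<and> (\<forall>m. continuous_on UNIV (Q m)) \<and> (\<forall>m x. (Q (Suc m) has_real_derivative Q1 (Suc m) x) (at x)) \<and>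
     (\<forall>m x. (Q1 (Suc m) has_real_derivative wpot \<gamma> N x * Q (Suc m) x + Q m x) (at x)) \<and> (\<forall>m. Q (Suc m) (- \<sigma>) = 0) \<and>
     (\<forall>m. \<forall>x\<in>{-1..1}. \<bar>Q (Suc m) x\<bar> \<le> exp (2 * N) * (\<integral>x. \<bar>\<theta> x\<bar> \<partial>MX) * 2 * (4 ^ m / fact (2*m)) \<and>
        \<bar>Q1 (Suc m) x\<bar> \<le> exp (2 * N) * (\<integral>x. \<bar>\<theta> x\<bar> \<partial>MX) * (2 * N + 1) * (4 ^ m / fact (2*m)))"
proof -
  have \<sigma>2: "\<sigma> * \<sigma> = 1" using \<sigma> by auto
  define \<Theta> where "\<Theta> d = \<theta> (\<sigma> * (d - 1))" for d
  have \<Theta>c: "continuous_on UNIV \<Theta>" unfolding \<Theta>_def[abs_def] by (intro continuous_on_compose2[OF \<theta>] continuous_intros) auto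
  define w where "w d = wpot \<gamma> N (d - 1)" for d
  have wc: "continuous_on UNIV w" unfolding w_def[abs_def] by (intro continuous_on_compose2[OF wpot_continuous[OF g, of UNIV]] continuous_intros) auto
  have wb: "\<bar>w x\<bar> \<le> N\<^sup>2" for x using wpot_bounds[OF g, of N "x - 1"] by (simp add: w_def)
  define L where "L = Kop1 (\<lambda>x. \<bar>\<Theta> x\<bar>) 2"
  obtain R R1 where R: "R 0 = \<Theta>" "\<And>m. continuous_on UNIV (R m)" "\<And>m x. (R (Suc m) has_real_derivative R1 (Suc m) x) (at x)"
     "\<And>m x. (R1 (Suc m) has_real_derivative w x * R (Suc m) x + R m x) (at x)" "\<And>m. R (Suc m) 0 = 0"
     "\<And>m x. x \<in> {0..2} \<Longrightarrow> \<bar>R (Suc m) x\<bar> \<le> exp (2 * N) * (L * 2 ^ (2*m+1) / fact (2*m+1)) \<and>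
        \<bar>R1 (Suc m) x\<bar> \<le> exp (2 * N) * (N * (L * 2 ^ (2*m+1) / fact (2*m+1)) + L * 2 ^ (2*m) / fact (2*m))"
    using chain_functions_from_origin[OF wc wb N \<Theta>c] unfolding L_def by blast
  have Lint: "(\<integral>x. \<bar>\<theta> x\<bar> \<partial>MX) = L"
  proof -
    have ca: "continuous_on UNIV (\<lambda>x. \<bar>\<Theta> x\<bar>)" by (intro continuous_intros \<Theta>c)
    have "(\<integral>x. \<bar>\<theta> x\<bar> \<partial>MX) = \<sigma> * Kop1 (\<lambda>x. \<bar>\<Theta> x\<bar>) (1 + \<sigma> * 1) - \<sigma> * Kop1 (\<lambda>x. \<bar>\<Theta> x\<bar>) (1 + \<sigma> * (-1))"
    proof (rule integral_MX_deriv)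
      fix x
      have "((\<lambda>x. 1 + \<sigma> * x) has_real_derivative \<sigma>) (at x)" by (auto intro!: derivative_eq_intros)
      from DERIV_cmult[OF DERIV_chain2[OF Kop(4)[OF ca] this], of \<sigma>]
      have "((\<lambda>x. \<sigma> * Kop1 (\<lambda>x. \<bar>\<Theta> x\<bar>) (1 + \<sigma> * x)) has_real_derivative (\<sigma> * \<sigma>) * \<bar>\<Theta> (1 + \<sigma> * x)\<bar>) (at x)" by (simp add: mult_ac)
      moreover have "\<Theta> (1 + \<sigma> * x) = \<theta> x" by (simp add: \<Theta>_def mult.assoc[symmetric] \<sigma>2)
      ultimately show "((\<lambda>x. \<sigma> * Kop1 (\<lambda>x. \<bar>\<Theta> x\<bar>) (1 + \<sigma> * x)) has_real_derivative \<bar>\<theta> x\<bar>) (at x)" by (simp add: \<sigma>2)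
    qed (intro continuous_intros \<theta>)
    then show ?thesis using \<sigma> Kop(2)[OF ca] by (auto simp: L_def)
  qed
  have L0: "0 \<le> L" unfolding Lint[symmetric] by (rule integral_nonneg_AE) simp
  define Q where "Q m x = R m (1 + \<sigma> * x)" for m x
  define Q1 where "Q1 m x = \<sigma> * R1 m (1 + \<sigma> * x)" for m x
  have lin: "((\<lambda>x. 1 + \<sigma> * x) has_real_derivative \<sigma>) (at x)" for x by (auto intro!: derivative_eq_intros)
  have f: "2 ^ (2*m+1) / fact (2*m+1) \<le> 2 * (4 ^ m / (fact (2*m) :: real))" for m
  proof -
    have "(2::real) ^ (2*m+1) = 2 * 4 ^ m" by (simp add: power_mult)
    moreover have "(fact (2*m) :: real) \<le> fact (2*m+1)" by (intro fact_mono) auto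
    ultimately show ?thesis by (simp add: frac_le del: fact_Suc)
  qed
  have f2: "(2::real) ^ (2*m) = 4 ^ m" for m by (simp add: power_mult)
  show ?thesis
  proof (intro exI conjI allI ballI)
    show "Q 0 = \<theta>" using R(1) by (auto simp: Q_def \<Theta>_def fun_eq_iff mult.assoc[symmetric] \<sigma>2)
    show "continuous_on UNIV (Q m)" for m unfolding Q_def[abs_def] by (intro continuous_on_compose2[OF R(2)[of m]] continuous_intros) auto
    show "(Q (Suc m) has_real_derivative Q1 (Suc m) x) (at x)" for m x
      unfolding Q_def[abs_def] Q1_def using DERIV_chain2[OF R(3)[of m "1 + \<sigma> * x"] lin[of x]] by (simp add: mult.commute)
    show "(Q1 (Suc m) has_real_derivative wpot \<gamma> N x * Q (Suc m) x + Q m x) (at x)" for m x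
    proof -
      have "w (1 + \<sigma> * x) = wpot \<gamma> N x" using \<sigma> by (auto simp: w_def wpot_even)
      moreover have "\<sigma> * (A * \<sigma>) = A" for A using \<sigma> by auto
      ultimately show ?thesis
        unfolding Q_def Q1_def[abs_def] using DERIV_cmult[OF DERIV_chain2[OF R(4)[of m "1 + \<sigma> * x"] lin[of x]], of \<sigma>]
        by (simp only:)
    qed
    show "Q (Suc m) (- \<sigma>) = 0" for m using R(5)[of m] \<sigma>2 by (simp add: Q_def)
    fix m and x :: real assume x: "x \<in> {-1..1}"
    have d: "1 + \<sigma> * x \<in> {0..2}" using x \<sigma> by auto
    have b: "L * 2 ^ (2*m+1) / fact (2*m+1) \<le> L * (2 * (4 ^ m / fact (2*m)))"
      using mult_left_mono[OF f[of m] L0] by simp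
    show "\<bar>Q (Suc m) x\<bar> \<le> exp (2 * N) * (\<integral>x. \<bar>\<theta> x\<bar> \<partial>MX) * 2 * (4 ^ m / fact (2*m))"
    proof -
      have "\<bar>Q (Suc m) x\<bar> \<le> exp (2 * N) * (L * 2 ^ (2*m+1) / fact (2*m+1))" using R(6)[OF d, of m] by (simp add: Q_def)
      also have "\<dots> \<le> exp (2 * N) * (L * (2 * (4 ^ m / fact (2*m))))" by (intro mult_left_mono b) auto
      finally show ?thesis by (simp add: Lint mult_ac)
    qed
    show "\<bar>Q1 (Suc m) x\<bar> \<le> exp (2 * N) * (\<integral>x. \<bar>\<theta> x\<bar> \<partial>MX) * (2 * N + 1) * (4 ^ m / fact (2*m))"
    proof -
      have "\<bar>Q1 (Suc m) x\<bar> = \<bar>R1 (Suc m) (1 + \<sigma> * x)\<bar>" using \<sigma> by (auto simp: Q1_def)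
      also have "\<dots> \<le> exp (2 * N) * (N * (L * 2 ^ (2*m+1) / fact (2*m+1)) + L * 2 ^ (2*m) / fact (2*m))" using R(6)[OF d, of m] by simp
      also have "\<dots> \<le> exp (2 * N) * (N * (L * (2 * (4 ^ m / fact (2*m)))) + L * 2 ^ (2*m) / fact (2*m))"
        by (intro mult_left_mono add_right_mono b) (use N in auto)
      also have "\<dots> = exp (2 * N) * L * (2 * N + 1) * (4 ^ m / fact (2*m))" unfolding f2 by (simp add: algebra_simps)
      finally show ?thesis by (simp add: Lint)
    qed
  qed
qed


section \<open>Observability of a single mode\<close>

text \<open>The central binomial coefficient is at least 4^m/(2m+1). This is the exact rate at which
  Gevrey order 2 meets the factorials of the chain.\<close>

lemma fact_power_bound: "4 ^ m * (fact m)\<^sup>2 \<le> (2 * real m + 1) * fact (2 * m)"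
proof (induction m)
  case 0 then show ?case by simp
next
  case (Suc m)
  have "4 ^ Suc m * (fact (Suc m))\<^sup>2 = (4 * (real m + 1)\<^sup>2) * (4 ^ m * (fact m)\<^sup>2)"
    by (simp add: power_mult_distrib algebra_simps power2_eq_square)
  also have "\<dots> \<le> (4 * (real m + 1)\<^sup>2) * ((2 * real m + 1) * fact (2 * m))" by (intro mult_left_mono Suc) auto
  also have "\<dots> \<le> ((2 * real m + 3) * (2 * real m + 2)) * ((2 * real m + 1) * fact (2 * m))"
    by (intro mult_right_mono) (auto simp: power2_eq_square algebra_simps)
  also have "\<dots> = (2 * real (Suc m) + 1) * fact (2 * Suc m)" by (simp add: algebra_simps)
  finally show ?case .
qed

text \<open>Bound for the m-th derivative of a product of two Gevrey functions with ratio 1/32; m +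
  1 counts the terms of the Leibniz rule.\<close>

definition Bd :: "nat \<Rightarrow> real" where "Bd m = (real m + 1) * (fact m)\<^sup>2 * (1 / 32) ^ m"

lemma Bd_nonneg: "0 \<le> Bd m" by (simp add: Bd_def)

text \<open>Here 32 = 2 * 4 * 4: a factor 2^m for m + 1, a factor 4^m for the 2m + 1 of
  \<open>fact_power_bound\<close>, and 4^m left over for convergence.\<close>

lemma Bd_bound: "Bd m * (4 ^ m / fact (2 * m)) \<le> (1 / 4) ^ m"
proof -
  have a: "real m + 1 \<le> 2 ^ m" by (induction m) auto
  have b: "2 * real m + 1 \<le> 4 ^ m" by (induction m) auto
  have "(fact m)\<^sup>2 * (4 ^ m / fact (2 * m)) \<le> 2 * real m + 1"
    using fact_power_bound[of m] by (simp add: divide_le_eq mult_ac)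
  then have "((real m + 1) * (1/32) ^ m) * ((fact m)\<^sup>2 * (4 ^ m / fact (2 * m))) \<le> ((real m + 1) * (1/32) ^ m) * (2 * real m + 1)"
    by (intro mult_left_mono) auto
  also have "\<dots> \<le> (2 ^ m * (1/32) ^ m) * 4 ^ m" by (intro mult_mono a b) auto
  also have "\<dots> = (1/4) ^ m"
    by (simp flip: power_mult_distrib)
  finally show ?thesis by (simp add: Bd_def mult_ac)
qed

lemma time_cutoff:
  assumes T: "T > 0"
  shows "\<exists>D. tower D \<and> (\<forall>m. D m 0 = 0 \<and> D m T = 0) \<and> (\<forall>m t. \<bar>D m t\<bar> \<le> Bd m) \<and> (\<forall>t. 0 \<le> D 0 t) \<and> 0 < integral {0..T} (D 0)"
proof -
  \<comment> \<open>288 = 9 * 32, so the ratio 9/M of \<open>ef_bound\<close> becomes 1/32.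
    Multiplying by the reflected copy makes the cutoff flat at both 0 and T.\<close>
  define A where "A = ef 288"
  define B where "B i t = (-1) ^ i * ef 288 i (T - t)" for i t
  have tA: "tower A" unfolding A_def by (rule tower_ef) simp
  have tB: "tower B" unfolding tower_def
  proof (intro allI)
    fix i t
    have l: "((\<lambda>t. T - t) has_real_derivative -1) (at t)" by (auto intro!: derivative_eq_intros)
    have "(ef 288 i has_real_derivative ef 288 (Suc i) (T - t)) (at (T - t))" using tower_ef[of 288] by (auto simp: tower_def)
    from DERIV_cmult[OF DERIV_chain2[of "ef 288 i" _ "\<lambda>t. T - t", OF this l], of "(-1) ^ i"]
    show "(B i has_real_derivative B (Suc i) t) (at t)" by (simp add: B_def[abs_def])
  qed
  have bA: "\<bar>A i t\<bar> \<le> (fact i)\<^sup>2 * (1 / 32) ^ i" "\<bar>B i t\<bar> \<le> (fact i)\<^sup>2 * (1 / 32) ^ i" for i t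
    using ef_bound[of 288 i t] ef_bound[of 288 i "T - t"] by (auto simp: A_def B_def abs_mult power_abs)
  define D where "D n t = (\<Sum>i\<le>n. real (n choose i) * (A i t * B (n - i) t))" for n t
  have tD: "tower D" unfolding D_def[abs_def] by (rule tower_mult[OF tA tB])
  have "\<bar>D n t\<bar> \<le> Bd n" for n t
  proof -
    have "\<bar>D n t\<bar> \<le> (\<Sum>i\<le>n. \<bar>real (n choose i) * (A i t * B (n - i) t)\<bar>)" unfolding D_def by (rule sum_abs)
    also have "\<dots> \<le> (\<Sum>i\<le>n. (fact n)\<^sup>2 * (1 / 32) ^ n)"
    proof (rule sum_mono)
      fix i assume i: "i \<in> {..n}"
      \<comment> \<open>Of the squares of i! and (n-i)!, one factor of each is absorbed by the
        binomial coefficient and the other by i! (n-i)! <= n!. So every Leibniz term is at most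
        (n!)^2/32^n.\<close>
      have f: "fact i * fact (n - i) * real (n choose i) = fact n"
        using binomial_fact_lemma[of i n] i by (metis atMost_iff of_nat_fact of_nat_mult)
      have c1: "1 \<le> real (n choose i)" using i by (simp add: Suc_leI)
      have fl: "fact i * fact (n - i) \<le> (fact n :: real)" unfolding f[symmetric] using mult_left_mono[OF c1, of "fact i * fact (n - i)"] by simp
      have "\<bar>real (n choose i) * (A i t * B (n - i) t)\<bar> \<le> real (n choose i) * (((fact i)\<^sup>2 * (1 / 32) ^ i) * ((fact (n - i))\<^sup>2 * (1 / 32) ^ (n - i)))"
        unfolding abs_mult by (intro mult_mono bA) auto
      also have "\<dots> = (fact i * fact (n - i) * real (n choose i)) * (fact i * fact (n - i)) * ((1 / 32) ^ i * (1 / 32) ^ (n - i))"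
        by (simp add: power2_eq_square mult_ac)
      also have "(1 / 32 :: real) ^ i * (1 / 32) ^ (n - i) = (1 / 32) ^ n" using i by (simp flip: power_add)
      also have "(fact i * fact (n - i) * real (n choose i)) * (fact i * fact (n - i)) * (1 / 32) ^ n \<le> fact n * fact n * (1 / 32) ^ n"
        unfolding f by (intro mult_right_mono mult_left_mono fl) auto
      finally show "\<bar>real (n choose i) * (A i t * B (n - i) t)\<bar> \<le> (fact n)\<^sup>2 * (1 / 32) ^ n" by (simp add: power2_eq_square)
    qed
    also have "\<dots> = Bd n" by (simp add: Bd_def)
    finally show ?thesis .
  qed
  moreover have "D m 0 = 0 \<and> D m T = 0" for m by (auto simp: D_def A_def B_def ef_def)
  moreover have D0: "D 0 t = ef 288 0 t * ef 288 0 (T - t)" for t by (simp add: D_def A_def B_def)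
  moreover have nn: "0 \<le> D 0 t" for t by (simp add: D0 ef_0)
  moreover have "0 < integral {0..T} (D 0)"
  proof -
    obtain P where P: "P 0 = 0" "\<And>x. (P has_real_derivative D 0 x) (at x)"
      using ex_antiderivative[OF tower_continuous[OF tD]] by blast
    have "P 0 < P T"
    proof (rule DERIV_pos_imp_increasing_open[OF T])
      show "\<exists>y. (P has_real_derivative y) (at x) \<and> 0 < y" if "0 < x" "x < T" for x
        using P(2)[of x] that by (intro exI[of _ "D 0 x"]) (simp add: D0 ef_0)
      show "continuous_on {0..T} P" by (rule DERIV_continuous_on) (use P(2) in \<open>auto intro: has_field_derivative_at_within\<close>)
    qed
    moreover have "(D 0 has_integral P T - P 0) {0..T}"
      by (rule fundamental_theorem_of_calculus)
         (use T P(2) in \<open>auto simp: has_real_derivative_iff_has_vector_derivative intro: has_vector_derivative_at_within\<close>)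
    ultimately show ?thesis by (simp add: integral_unique)
  qed
  ultimately show ?thesis using tD by blast
qed

section \<open>The functionals F_m for one trajectory and one sine mode\<close>

locale mode_setting =
  fixes \<gamma> :: real and n :: nat and g0 :: "real \<times> real \<Rightarrow> real" and g :: "real \<Rightarrow> real \<times> real \<Rightarrow> real"
    and T :: real and D :: "nat \<Rightarrow> real \<Rightarrow> real"
  assumes g: "\<gamma> > 0" and n: "n \<ge> 1" and s: "is_solution \<gamma> g0 g" and T: "T > 0"
    and D: "tower D" "\<And>m. D m 0 = 0" "\<And>m. D m T = 0" "\<And>m t. \<bar>D m t\<bar> \<le> Bd m"
begin

definition cp :: "(real \<Rightarrow> real) \<Rightarrow> real \<Rightarrow> real" where "cp p t = ipS UNIV (g t) (ten p (sn n))"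
definition Fm :: "nat \<Rightarrow> (real \<Rightarrow> real) \<Rightarrow> real" where "Fm m p = integral {0..T} (\<lambda>t. D m t * cp p t)"
text \<open>The part of the mode over S in L^1 of time, as it comes out of the duality pairing;
  \<open>integral_sqrt_sq\<close> turns it into the squared observation at the end.\<close>

definition JS :: "real set \<Rightarrow> real" where "JS S = integral {0..T} (\<lambda>t. sqrt (Qf n S (g t) (g t)))"

lemma biU: "bbil (ipS UNIV)" by (rule bbil_ipS) simp

lemma ten_c: "continuous_on UNIV p \<Longrightarrow> sqi MO (ten p (sn n))"
  by (intro continuous_sqi continuous_ten continuous_intros)

lemma cp_cont: "continuous_on UNIV p \<Longrightarrow> continuous_on {0..T} (cp p)"
  unfolding cp_def[abs_def] by (rule continuous_on_subset[OF solution_bbil_cont(1)[OF biU s ten_c]]) auto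

lemma Dcp_int: "continuous_on UNIV p \<Longrightarrow> (\<lambda>t. D m t * cp p t) integrable_on {0..T}"
  by (intro integrable_continuous_interval continuous_intros cp_cont tower_continuous[OF D(1)])

lemma cp_lin: assumes "continuous_on UNIV p" "continuous_on UNIV q" "t \<ge> 0"
  shows "cp (\<lambda>x. p x + c * q x) t = cp p t + c * cp q t"
proof -
  have gt: "sqi MO (g t)" by (rule solution_sqi[OF s assms(3)])
  have e: "ten (\<lambda>x. p x + c * q x) (sn n) = (\<lambda>z. ten p (sn n) z + c * ten q (sn n) z)" by (auto simp: ten_def algebra_simps)
  have "sqi MO (\<lambda>z. ten p (sn n) z + c * ten q (sn n) z)" by (intro sqi_add sqi_cmult ten_c assms)
  then show ?thesis unfolding cp_def e
    using bbilD(1)[OF biU gt] bbilD(2)[OF biU ten_c[OF assms(1)] ten_c[OF assms(2)] gt] ten_c[OF assms(1)] ten_c[OF assms(2)] by simp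
qed

lemma Fm_lin: assumes "continuous_on UNIV p" "continuous_on UNIV q"
  shows "Fm m (\<lambda>x. p x + c * q x) = Fm m p + c * Fm m q"
proof -
  have "Fm m (\<lambda>x. p x + c * q x) = integral {0..T} (\<lambda>t. D m t * cp p t + c * (D m t * cp q t))"
    unfolding Fm_def by (rule integral_cong) (simp add: cp_lin[OF assms] algebra_simps)
  also have "\<dots> = Fm m p + c * Fm m q" unfolding Fm_def
    by (subst Henstock_Kurzweil_Integration.integral_add) (auto intro!: Dcp_int assms integrable_on_mult_right)
  finally show ?thesis .
qed

lemma Fm_step:
  assumes p: "\<And>x. (p has_real_derivative p1 x) (at x)" "\<And>x. (p1 has_real_derivative p2 x) (at x)" "continuous_on UNIV p2"
     "p (-1) = 0" "p 1 = 0"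
  shows "Fm m (\<lambda>x. p2 x - wpot \<gamma> (real n * pi) x * p x) = - Fm (Suc m) p"
proof -
  let ?q = "\<lambda>x. p2 x - wpot \<gamma> (real n * pi) x * p x"
  have pc: "continuous_on UNIV p" using p by (auto intro!: DERIV_continuous_on intro: has_field_derivative_at_within)
  have qc: "continuous_on UNIV ?q" by (intro continuous_intros p pc wpot_continuous g)
  have cd: "(cp p has_real_derivative cp ?q t) (at t)" if t: "t > 0" for t
  proof -
    obtain h where h: "A_op \<gamma> (g t) h" "sqi MO h" "((\<lambda>s. n2 MO (\<lambda>z. (g s z - g t z) / (s - t) - h z)) \<longlongrightarrow> 0) (at t)"
      using solution_deriv[OF s t] by blast
    have V: "ten p (sn n) \<in> Vspace \<gamma>" "g t \<in> Vspace \<gamma>" using ten_sn_domain(1)[OF g p] h(1) by (auto simp: A_op_def)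
    have "ipS UNIV h (ten p (sn n)) = aV \<gamma> (g t) (ten p (sn n))" using h(1) V(1) by (simp add: A_op_def L2inner_eq ipS_def)
    also have "\<dots> = cp ?q t" using ten_sn_domain(2)[OF g p V(2)] by (simp add: cp_def ipS_def)
    finally show ?thesis using solution_bbil_deriv(1)[OF biU s t ten_c[OF pc] h(2,3)] by (simp add: cp_def[abs_def])
  qed
  \<comment> \<open>The trajectory is continuous at 0 but differentiable only for t > 0, hence the
    interior form of the fundamental theorem. The boundary terms vanish with D.\<close>
  have "((\<lambda>t. D (Suc m) t * cp p t + D m t * cp ?q t) has_integral D m T * cp p T - D m 0 * cp p 0) {0..T}"
  proof (rule fundamental_theorem_of_calculus_interior)
    show "continuous_on {0..T} (\<lambda>t. D m t * cp p t)" by (intro continuous_intros cp_cont pc tower_continuous[OF D(1)])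
    show "((\<lambda>t. D m t * cp p t) has_vector_derivative D (Suc m) t * cp p t + D m t * cp ?q t) (at t)" if "t \<in> {0<..<T}" for t
      unfolding has_real_derivative_iff_has_vector_derivative[symmetric]
      using DERIV_mult[of "D m" "D (Suc m) t" t UNIV, OF _ cd[of t]] D(1) that by (simp add: tower_def algebra_simps)
  qed (use T in simp)
  then have "((\<lambda>t. D (Suc m) t * cp p t + D m t * cp ?q t) has_integral 0) {0..T}" by (simp add: D)
  moreover have "((\<lambda>t. D (Suc m) t * cp p t + D m t * cp ?q t) has_integral Fm (Suc m) p + Fm m ?q) {0..T}"
    unfolding Fm_def by (intro has_integral_add integrable_integral Dcp_int pc qc)
  ultimately have "Fm (Suc m) p + Fm m ?q = 0" using has_integral_unique by blast
  then show ?thesis by simp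
qed

lemma sqrtQ_cont: "S \<in> sets borel \<Longrightarrow> continuous_on {0..T} (\<lambda>t. sqrt (Qf n S (g t) (g t)))"
  by (intro continuous_intros continuous_on_subset[OF solution_bbil_cont(2)[OF bbil_Qf[OF n] s sqi_zero]]) auto

lemma JS_nonneg: "S \<in> sets borel \<Longrightarrow> 0 \<le> JS S"
  unfolding JS_def by (intro integral_nonneg integrable_continuous_interval sqrtQ_cont) 
    (auto intro!: bbilD(3)[OF bbil_Qf[OF n]] solution_sqi[OF s])

lemma n2_MX_bound: assumes "continuous_on UNIV p" "\<And>x. x \<in> {-1<..<1} \<Longrightarrow> \<bar>p x\<bar> \<le> B" "0 \<le> B" shows "n2 MX p \<le> sqrt 2 * B"
proof (rule power2_le_imp_le)
  have c1: "(\<integral>x. B\<^sup>2 \<partial>MX) = 2 * B\<^sup>2" using integral_MX_deriv[of "\<lambda>x. B\<^sup>2 * x" "\<lambda>_. B\<^sup>2"] by (auto intro!: derivative_eq_intros)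
  have "(n2 MX p)\<^sup>2 \<le> (\<integral>x. B\<^sup>2 \<partial>MX)" unfolding n2_sq
  proof (rule integral_mono[OF sqi_integrable_sq[OF continuous_sqi_MX[OF assms(1)]]])
    show "(p x)\<^sup>2 \<le> B\<^sup>2" if "x \<in> space MX" for x using assms(2)[of x] that by (simp add: power2_le_iff_abs_le assms(3))
  qed simp
  then have "(n2 MX p)\<^sup>2 \<le> 2 * B\<^sup>2" unfolding c1 .
  then show "(n2 MX p)\<^sup>2 \<le> (sqrt 2 * B)\<^sup>2" by (simp add: power_mult_distrib)
qed (use assms in simp)

lemma cp_bound:
  assumes S: "S \<in> sets borel" and p: "continuous_on UNIV p" "\<And>x. x \<in> {-1<..<1} \<Longrightarrow> x \<notin> S \<Longrightarrow> p x = 0" and t: "t \<ge> 0"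
  shows "\<bar>cp p t\<bar> \<le> sqrt (Qf n S (g t) (g t)) * n2 MX p"
proof -
  have gt: "sqi MO (g t)" by (rule solution_sqi[OF s t])
  have ms: "sqi MX (mode n (g t))" by (rule mode_sqi[OF gt n])
  have isq: "sqi MX (\<lambda>x. indicator S x * mode n (g t) x)"
  proof -
    have "(\<lambda>x. indicator S x :: real) \<in> borel_measurable MX" using S by (intro measurable_MX) auto
    then have "(\<lambda>x. indicator S x * mode n (g t) x) \<in> borel_measurable MX" using ms by (intro borel_measurable_times) (auto simp: sqi_def)
    moreover have "(\<lambda>x. (indicator S x * mode n (g t) x)\<^sup>2) = (\<lambda>x. indicator S x * (mode n (g t) x)\<^sup>2)" by (auto simp: indicator_def)
    ultimately show ?thesis using integrable_ind_mult[OF S sqi_integrable_sq[OF ms]] by (simp add: sqi_def)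
  qed
  have "cp p t = (\<integral>x. mode n (g t) x * p x \<partial>MX)"
    using integral_mult_ten_sn[OF gt continuous_sqi_MX[OF p(1)]] by (simp add: cp_def ipS_def)
  also have "\<dots> = (\<integral>x. (indicator S x * mode n (g t) x) * p x \<partial>MX)"
    by (rule Bochner_Integration.integral_cong) (use p(2) in \<open>auto simp: indicator_def\<close>)
  also have "\<bar>\<dots>\<bar> \<le> n2 MX (\<lambda>x. indicator S x * mode n (g t) x) * n2 MX p"
    by (rule cauchy_schwarz_integral[OF isq continuous_sqi_MX[OF p(1)]])
  also have "n2 MX (\<lambda>x. indicator S x * mode n (g t) x) = sqrt (Qf n S (g t) (g t))"
  proof -
    have "(\<lambda>x. (indicator S x * mode n (g t) x)\<^sup>2) = (\<lambda>x. indicator S x * (mode n (g t) x * mode n (g t) x))"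
      by (auto simp: indicator_def power2_eq_square)
    then show ?thesis by (simp add: n2_def Qf_def)
  qed
  finally show ?thesis .
qed

lemma Fm_bound:
  assumes S: "S \<in> sets borel" and p: "continuous_on UNIV p" "\<And>x. x \<in> {-1<..<1} \<Longrightarrow> x \<notin> S \<Longrightarrow> p x = 0" 
    "\<And>x. x \<in> {-1<..<1} \<Longrightarrow> \<bar>p x\<bar> \<le> B" "0 \<le> B"
  shows "\<bar>Fm m p\<bar> \<le> Bd m * (sqrt 2 * B) * JS S"
proof -
  have "norm (Fm m p) \<le> integral {0..T} (\<lambda>t. (Bd m * (sqrt 2 * B)) * sqrt (Qf n S (g t) (g t)))" unfolding Fm_def
  proof (rule integral_norm_bound_integral)
    show "(\<lambda>t. D m t * cp p t) integrable_on {0..T}" by (rule Dcp_int[OF p(1)])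
    show "(\<lambda>t. (Bd m * (sqrt 2 * B)) * sqrt (Qf n S (g t) (g t))) integrable_on {0..T}"
      by (intro integrable_continuous_interval continuous_intros sqrtQ_cont S)
    fix t assume "t \<in> {0..T}"
    then have t: "t \<ge> 0" by simp
    have Q0: "0 \<le> Qf n S (g t) (g t)" by (rule bbilD(3)[OF bbil_Qf[OF n S] solution_sqi[OF s t]])
    have "norm (D m t * cp p t) \<le> Bd m * (sqrt (Qf n S (g t) (g t)) * n2 MX p)"
      unfolding real_norm_def abs_mult by (intro mult_mono D(4) cp_bound[OF S p(1,2) t]) (auto simp: Bd_nonneg)
    also have "\<dots> \<le> Bd m * (sqrt (Qf n S (g t) (g t)) * (sqrt 2 * B))"
      by (intro mult_left_mono n2_MX_bound p Bd_nonneg) (auto simp: Q0)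
    finally show "norm (D m t * cp p t) \<le> (Bd m * (sqrt 2 * B)) * sqrt (Qf n S (g t) (g t))" by (simp add: mult_ac)
  qed
  then show ?thesis by (simp add: JS_def)
qed

text \<open>With $p = \zeta Q_{m+1}$ one has $p'' - Wp = \zeta Q_m + (\zeta'' Q_{m+1} + 2 \zeta' Q_{m+1}')$, and the last
  bracket lives in the observation set. Iterating leaves the remainder $F_K(\zeta Q_K) \to 0$.\<close>

lemma one_sided_flatness:
  assumes S: "S \<in> sets borel" and \<zeta>: "\<And>x. (\<zeta> has_real_derivative \<zeta>1 x) (at x)" "\<And>x. (\<zeta>1 has_real_derivative \<zeta>2 x) (at x)" "continuous_on UNIV \<zeta>2"
    and \<zeta>b: "\<And>x. x \<in> {-1..1} \<Longrightarrow> \<bar>\<zeta> x\<bar> \<le> Z \<and> \<bar>\<zeta>1 x\<bar> \<le> Z \<and> \<bar>\<zeta>2 x\<bar> \<le> Z" and \<zeta>s: "\<And>x. x \<notin> S \<Longrightarrow> \<zeta>1 x = 0 \<and> \<zeta>2 x = 0"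
    and \<sigma>: "\<sigma> = 1 \<or> \<sigma> = (-1::real)" "\<zeta> \<sigma> = 0" and \<theta>: "continuous_on UNIV \<theta>"
  shows "\<bar>Fm 0 (\<lambda>x. \<zeta> x * \<theta> x)\<bar> \<le> 16 * Z * (real n * pi + 1) * exp (2 * (real n * pi)) * n2 MX \<theta> * JS S"
proof -
  define N where "N = real n * pi"
  have N: "N > 0" using n by (simp add: N_def)
  have Z: "0 \<le> Z" using \<zeta>b[of 0] by auto
  have \<zeta>c: "continuous_on UNIV \<zeta>" "continuous_on UNIV \<zeta>1"
    using \<zeta>(1,2) by (auto intro!: DERIV_continuous_on intro: has_field_derivative_at_within)
  define L where "L = (\<integral>x. \<bar>\<theta> x\<bar> \<partial>MX)"
  have L0: "0 \<le> L" unfolding L_def by (rule integral_nonneg_AE) simp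
  have LL: "L \<le> sqrt 2 * n2 MX \<theta>"
  proof -
    have "\<bar>\<integral>x. \<bar>\<theta> x\<bar> * 1 \<partial>MX\<bar> \<le> n2 MX (\<lambda>x. \<bar>\<theta> x\<bar>) * n2 MX (\<lambda>x. 1)"
      by (intro cauchy_schwarz_integral continuous_sqi_MX continuous_intros \<theta>)
    moreover have "n2 MX (\<lambda>x. 1) \<le> sqrt 2 * 1" by (rule n2_MX_bound) (auto intro: continuous_intros)
    moreover have "n2 MX (\<lambda>x. \<bar>\<theta> x\<bar>) = n2 MX \<theta>" by (simp add: n2_def)
    ultimately have "L \<le> n2 MX \<theta> * n2 MX (\<lambda>x. 1)" "n2 MX \<theta> * n2 MX (\<lambda>x. 1) \<le> n2 MX \<theta> * sqrt 2"
      by (auto simp: L_def intro!: mult_left_mono)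
    then show ?thesis by (simp add: mult.commute)
  qed
  obtain Q Q1 where Q: "Q 0 = \<theta>" "\<And>m. continuous_on UNIV (Q m)" "\<And>m x. (Q (Suc m) has_real_derivative Q1 (Suc m) x) (at x)"
     "\<And>m x. (Q1 (Suc m) has_real_derivative wpot \<gamma> N x * Q (Suc m) x + Q m x) (at x)" "\<And>m. Q (Suc m) (- \<sigma>) = 0"
     "\<And>m x. x \<in> {-1..1} \<Longrightarrow> \<bar>Q (Suc m) x\<bar> \<le> exp (2 * N) * L * 2 * (4 ^ m / fact (2*m)) \<and>
        \<bar>Q1 (Suc m) x\<bar> \<le> exp (2 * N) * L * (2 * N + 1) * (4 ^ m / fact (2*m))"
    using chain_functions[OF g N \<theta> \<sigma>(1)] unfolding L_def by blast
  have Q1c: "continuous_on UNIV (Q1 (Suc m))" for m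
    using Q(4)[of m] by (auto intro!: DERIV_continuous_on intro: has_field_derivative_at_within)
  define st where "st m x = \<zeta>2 x * Q (Suc m) x + 2 * (\<zeta>1 x * Q1 (Suc m) x)" for m x
  have stc: "continuous_on UNIV (st m)" for m unfolding st_def[abs_def] by (intro continuous_intros \<zeta> \<zeta>c Q Q1c)
  have zc: "continuous_on UNIV (\<lambda>x. \<zeta> x * Q m x)" for m by (intro continuous_intros \<zeta>c Q)
  have step: "Fm m (\<lambda>x. \<zeta> x * Q m x) = - Fm (Suc m) (\<lambda>x. \<zeta> x * Q (Suc m) x) - Fm m (st m)" for m
  proof -
    let ?p = "\<lambda>x. \<zeta> x * Q (Suc m) x"
    let ?p1 = "\<lambda>x. \<zeta>1 x * Q (Suc m) x + \<zeta> x * Q1 (Suc m) x"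
    let ?p2 = "\<lambda>x. (\<zeta>2 x * Q (Suc m) x + \<zeta>1 x * Q1 (Suc m) x) + (\<zeta>1 x * Q1 (Suc m) x + \<zeta> x * (wpot \<gamma> N x * Q (Suc m) x + Q m x))"
    have d1: "(?p has_real_derivative ?p1 x) (at x)" for x
      using DERIV_mult[OF \<zeta>(1)[of x] Q(3)[of m x]] by (simp add: algebra_simps)
    have d2: "(?p1 has_real_derivative ?p2 x) (at x)" for x
      using DERIV_add[OF DERIV_mult[OF \<zeta>(2)[of x] Q(3)[of m x]] DERIV_mult[OF \<zeta>(1)[of x] Q(4)[of m x]]] by (simp add: algebra_simps)
    have c2: "continuous_on UNIV ?p2" by (intro continuous_intros \<zeta> \<zeta>c Q Q1c wpot_continuous g)
    \<comment> \<open>At -sigma the chain vanishes, at sigma the cutoff does.\<close>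
    have ends: "?p (-1) = 0" "?p 1 = 0" using \<sigma> Q(5)[of m] by auto
    have "Fm m (\<lambda>x. ?p2 x - wpot \<gamma> N x * ?p x) = - Fm (Suc m) ?p" using Fm_step[OF d1 d2 c2 ends, of m] by (simp add: N_def)
    moreover have "(\<lambda>x. ?p2 x - wpot \<gamma> N x * ?p x) = (\<lambda>x. \<zeta> x * Q m x + 1 * st m x)" by (auto simp: st_def algebra_simps)
    ultimately show ?thesis using Fm_lin[OF zc[of m] stc[of m], of m 1] by simp
  qed
  \<comment> \<open>A coefficient 2 from \<open>Q\<close> and 2(2N+1) from the doubled
    \<open>Q1\<close> term add up to 4N + 4.\<close>
  define B where "B m = Z * (exp (2 * N) * L * (4 * N + 4) * (4 ^ m / fact (2*m)))" for m
  have stb: "\<bar>st m x\<bar> \<le> B m" if x: "x \<in> {-1<..<1}" for m x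
  proof -
    have x': "x \<in> {-1..1}" using x by auto
    define E where "E = exp (2 * N) * L * (4 ^ m / fact (2*m))"
    have "\<bar>st m x\<bar> \<le> \<bar>\<zeta>2 x\<bar> * \<bar>Q (Suc m) x\<bar> + 2 * (\<bar>\<zeta>1 x\<bar> * \<bar>Q1 (Suc m) x\<bar>)"
      unfolding st_def using abs_triangle_ineq[of "\<zeta>2 x * Q (Suc m) x" "2 * (\<zeta>1 x * Q1 (Suc m) x)"] by (simp add: abs_mult)
    also have "\<dots> \<le> Z * (2 * E) + 2 * (Z * ((2 * N + 1) * E))"
      using \<zeta>b[OF x'] Q(6)[OF x', of m] Z
      by (intro add_mono mult_left_mono mult_mono) (auto simp: E_def mult_ac)
    also have "\<dots> = Z * ((4 * N + 4) * E)" by (simp add: algebra_simps)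
    also have "\<dots> = B m" by (simp add: B_def E_def mult_ac)
    finally show ?thesis .
  qed
  have B0: "0 \<le> B m" for m unfolding B_def using Z L0 N by simp
  define X where "X = 8 * Z * (N + 1) * exp (2 * N) * n2 MX \<theta> * JS S"
  have X0: "0 \<le> X" unfolding X_def using Z N JS_nonneg[OF S] by simp
  have stF: "\<bar>Fm m (st m)\<bar> \<le> X * (1 / 4) ^ m" for m
  proof -
    have "\<bar>Fm m (st m)\<bar> \<le> Bd m * (sqrt 2 * B m) * JS S"
      by (rule Fm_bound[OF S stc _ stb B0]) (use \<zeta>s in \<open>auto simp: st_def\<close>)
    also have "\<dots> = (Bd m * (4 ^ m / fact (2*m))) * (sqrt 2 * L * (Z * exp (2 * N) * (4 * N + 4) * JS S))"
      by (simp add: B_def mult_ac)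
    also have "\<dots> \<le> (1 / 4) ^ m * (sqrt 2 * (sqrt 2 * n2 MX \<theta>) * (Z * exp (2 * N) * (4 * N + 4) * JS S))"
      using Z N JS_nonneg[OF S] L0
      by (intro mult_mono Bd_bound mult_right_mono mult_left_mono LL mult_nonneg_nonneg) auto
    also have "\<dots> = X * (1 / 4) ^ m" unfolding X_def
    proof -
      have "sqrt 2 * (sqrt 2 * n2 MX \<theta>) = 2 * n2 MX \<theta>" by (simp add: mult.assoc[symmetric])
      then show "(1 / 4) ^ m * (sqrt 2 * (sqrt 2 * n2 MX \<theta>) * (Z * exp (2 * N) * (4 * N + 4) * JS S)) = 8 * Z * (N + 1) * exp (2 * N) * n2 MX \<theta> * JS S * (1 / 4) ^ m"
        by (simp only:) (simp add: algebra_simps)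
    qed
    finally show ?thesis .
  qed
  have ind: "\<bar>Fm 0 (\<lambda>x. \<zeta> x * Q 0 x)\<bar> \<le> (\<Sum>m<K. \<bar>Fm m (st m)\<bar>) + \<bar>Fm K (\<lambda>x. \<zeta> x * Q K x)\<bar>" for K
  proof (induction K)
    case 0 then show ?case by simp
  next
    case (Suc K)
    then show ?case using step[of K] by simp
  qed
  \<comment> \<open>The geometric sum is at most 4/3, rounded up to 2; together with the 8 in X this
    gives the 16 of the claim.\<close>
  have geo: "(\<Sum>m<K. \<bar>Fm m (st m)\<bar>) \<le> 2 * X" for K
  proof -
    have "(\<Sum>m<K. \<bar>Fm m (st m)\<bar>) \<le> (\<Sum>m<K. X * (1 / 4) ^ m)" by (intro sum_mono stF)
    also have "\<dots> = X * (\<Sum>m<K. (1 / 4) ^ m)" by (simp add: sum_distrib_left)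
    also have "(\<Sum>m<K. (1 / 4 :: real) ^ m) = (1 - (1/4) ^ K) / (1 - 1/4)" by (subst sum_gp_strict) auto
    also have "X * \<dots> \<le> X * 2" by (intro mult_left_mono X0) (simp add: field_simps)
    finally show ?thesis by simp
  qed
  \<comment> \<open>The remainder lives on the whole interval and not in the observation set, so it
    is measured with S = UNIV; its coefficient tends to 0.\<close>
  define Y where "Y = sqrt 2 * (Z * (exp (2 * N) * L * 2)) * JS UNIV"
  have Y0: "0 \<le> Y" unfolding Y_def using Z L0 JS_nonneg[of UNIV] by simp
  \<comment> \<open>\<open>Q (Suc K)\<close> is controlled by 4^K/(2K)! but weighted with
    \<open>Bd (Suc K)\<close>. The mismatch costs (2K+2)(2K+1)/4 <= (K+1)^2. The bound is written as
    a square so that k/2^k -> 0 applies.\<close>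
  have rem: "\<bar>Fm (Suc K) (\<lambda>x. \<zeta> x * Q (Suc K) x)\<bar> \<le> Y * (real (Suc K) * (1/2) ^ Suc K)\<^sup>2" for K
  proof -
    let ?c = "4 ^ K / (fact (2*K) :: real)"
    have "\<bar>Fm (Suc K) (\<lambda>x. \<zeta> x * Q (Suc K) x)\<bar> \<le> Bd (Suc K) * (sqrt 2 * (Z * (exp (2 * N) * L * 2 * ?c))) * JS UNIV"
    proof (rule Fm_bound[OF _ zc])
      show "\<bar>\<zeta> x * Q (Suc K) x\<bar> \<le> Z * (exp (2 * N) * L * 2 * ?c)" if "x \<in> {-1<..<1}" for x
        unfolding abs_mult using \<zeta>b[of x] Q(6)[of x K] that Z by (intro mult_mono) auto
    qed (use Z L0 in auto)
    also have "\<dots> = (Bd (Suc K) * ?c) * Y" by (simp add: Y_def mult_ac)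
    also have "(Bd (Suc K) * ?c) * Y \<le> (real (Suc K) * (1/2) ^ Suc K)\<^sup>2 * Y"
    proof (rule mult_right_mono[OF _ Y0])
      define F where "F = (fact (2 * K) :: real)"
      have F: "F > 0" by (simp add: F_def)
      have f: "fact (2 * Suc K) = (2 * real K + 2) * (2 * real K + 1) * F" by (simp add: F_def algebra_simps)
      have "?c = (4 ^ Suc K / fact (2 * Suc K)) * ((2 * real K + 2) * (2 * real K + 1) / 4)"
      proof -
        have "(4 ^ Suc K / ((2 * real K + 2) * (2 * real K + 1) * F)) * ((2 * real K + 2) * (2 * real K + 1) / 4) = 4 ^ K / F"
        proof -
          have "(2 * real K + 2) * (2 * real K + 1) > 0" by (simp add: add_nonneg_pos)
          then show ?thesis using F by simp
        qed
        then show ?thesis unfolding f F_def[symmetric] by simp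
      qed
      then have "Bd (Suc K) * ?c = (Bd (Suc K) * (4 ^ Suc K / fact (2 * Suc K))) * ((2 * real K + 2) * (2 * real K + 1) / 4)" by simp
      also have "\<dots> \<le> (1 / 4) ^ Suc K * (real (Suc K))\<^sup>2"
        by (intro mult_mono Bd_bound) (auto simp: power2_eq_square algebra_simps)
      also have "\<dots> = (real (Suc K) * (1/2) ^ Suc K)\<^sup>2"
      proof -
        have "((1/2::real) ^ Suc K)\<^sup>2 = ((1/2)\<^sup>2) ^ Suc K" by (simp only: power_mult[symmetric] mult.commute)
        then show ?thesis by (simp add: power_mult_distrib power_divide del: power_Suc)
      qed
      finally show "Bd (Suc K) * ?c \<le> (real (Suc K) * (1/2) ^ Suc K)\<^sup>2" .
    qed
    finally show ?thesis by (simp only: mult.commute)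
  qed
  have "\<bar>Fm 0 (\<lambda>x. \<zeta> x * Q 0 x)\<bar> \<le> 2 * X + Y * 0\<^sup>2"
  proof (rule tendsto_lowerbound)
    have "(\<lambda>k. real k * (1/2) ^ k) \<longlonglongrightarrow> 0" by (rule powser_times_n_limit_0) simp
    then have "(\<lambda>k. real (Suc k) * (1/2) ^ Suc k) \<longlonglongrightarrow> 0" by (rule LIMSEQ_Suc)
    then show "(\<lambda>k. 2 * X + Y * (real (Suc k) * (1/2) ^ Suc k)\<^sup>2) \<longlonglongrightarrow> 2 * X + Y * 0\<^sup>2" by (intro tendsto_intros)
    show "\<forall>\<^sub>F k in sequentially. \<bar>Fm 0 (\<lambda>x. \<zeta> x * Q 0 x)\<bar> \<le> 2 * X + Y * (real (Suc k) * (1/2) ^ Suc k)\<^sup>2"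
    proof (rule always_eventually, rule allI)
      fix k show "\<bar>Fm 0 (\<lambda>x. \<zeta> x * Q 0 x)\<bar> \<le> 2 * X + Y * (real (Suc k) * (1/2) ^ Suc k)\<^sup>2"
        using ind[of "Suc k"] geo[of "Suc k"] rem[of k] by linarith
    qed
  qed simp
  then show ?thesis using Q(1) by (simp add: X_def N_def)
qed

end

section \<open>The cutoff in x and the cost of observing one mode\<close>

lemma tower_locally_const:
  assumes E: "tower E" and S: "open S" "\<And>x. x \<in> S \<Longrightarrow> E 0 x = c" and x: "x \<in> S"
  shows "E (Suc m) x = 0"
  using x
proof (induction m arbitrary: x)
  case 0
  have "((\<lambda>_. c) has_real_derivative 0) (at x)" by simp
  then have "(E 0 has_real_derivative 0) (at x)"
    by (rule has_field_derivative_transform_within_open[OF _ S(1) 0]) (simp add: S(2))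
  then show ?case using E DERIV_unique unfolding tower_def by blast
next
  case (Suc m)
  have "((\<lambda>_. 0) has_real_derivative 0) (at x)" by simp
  then have "(E (Suc m) has_real_derivative 0) (at x)"
    by (rule has_field_derivative_transform_within_open[OF _ S(1) Suc.prems]) (simp add: Suc.IH)
  then show ?case using E DERIV_unique unfolding tower_def by blast
qed

lemma space_cutoff:
  assumes ab: "0 < a" "a < b" "b < (1::real)"
  shows "\<exists>\<zeta> \<zeta>1 \<zeta>2 Z. (\<forall>x. (\<zeta> has_real_derivative \<zeta>1 x) (at x)) \<and> (\<forall>x. (\<zeta>1 has_real_derivative \<zeta>2 x) (at x)) \<and> continuous_on UNIV \<zeta>2 \<and>
     (\<forall>x\<in>{-1..1}. \<bar>\<zeta> x\<bar> \<le> Z \<and> \<bar>1 - \<zeta> x\<bar> \<le> Z \<and> \<bar>\<zeta>1 x\<bar> \<le> Z \<and> \<bar>\<zeta>2 x\<bar> \<le> Z) \<and> (\<forall>x. x \<notin> {a<..<b} \<longrightarrow> \<zeta>1 x = 0 \<and> \<zeta>2 x = 0) \<and> \<zeta> 1 = 0 \<and> \<zeta> (-1) = (1::real)"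
proof -
  obtain H :: "real \<Rightarrow> real" where H: "smooth1 H" "\<And>x. x \<le> 0 \<Longrightarrow> H x = 0" "\<And>x. x \<ge> 1 \<Longrightarrow> H x = 1" "\<And>x. 0 \<le> H x \<and> H x \<le> 1"
    using ex_smooth_step by blast
  \<comment> \<open>The step occupies the middle third of (a,b). The cutoff is thus constant in open
    neighbourhoods of a and b, and its derivatives vanish at these two points as well.\<close>
  define d where "d = (b - a) / 3"
  have d: "d > 0" "3 * d = b - a" using ab by (auto simp: d_def)
  define \<zeta> where "\<zeta> x = 1 + (-1) * H ((1 / d) * x + (- (a + d) / d))" for x
  have "smooth1 \<zeta>" unfolding \<zeta>_def[abs_def] by (intro smooth1_add smooth1_mult smooth1_const smooth1_affine H(1))
  then obtain E where E: "tower E" "E 0 = \<zeta>" by (auto simp: smooth1_def)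
  have arg: "(1 / d) * x + (- (a + d) / d) = (x - a - d) / d" for x by (simp add: diff_divide_distrib add_divide_distrib)
  have lo: "\<zeta> x = 1" if "x \<in> {..<a + d}" for x
    unfolding \<zeta>_def arg using H(2)[of "(x - a - d) / d"] that d(1) by (simp add: divide_nonpos_pos)
  have hi: "\<zeta> x = 0" if "x \<in> {a + 2 * d<..}" for x
  proof -
    have "(x - a - d) / d \<ge> 1" using that d(1) by (simp add: le_divide_eq)
    then show ?thesis unfolding \<zeta>_def arg using H(3) by simp
  qed
  have zero: "E (Suc m) x = 0" if "x \<notin> {a<..<b}" for m x
  proof (cases "x \<le> a")
    case True
    show ?thesis by (rule tower_locally_const[OF E(1), of "{..<a + d}" 1]) (use lo E(2) True d in auto)
  next
    case False
    show ?thesis by (rule tower_locally_const[OF E(1), of "{a + 2 * d<..}" 0]) (use hi E(2) False that d in auto)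
  qed
  have "\<exists>Z. \<forall>x\<in>{-1..1}. \<bar>E m x\<bar> \<le> Z" for m
  proof -
    have "compact (E m ` {-1..1})" by (intro compact_continuous_image tower_continuous[OF E(1)]) auto
    then obtain K where "\<forall>v \<in> E m ` {-1..1}. norm v \<le> K" using compact_imp_bounded bounded_iff by blast
    then show ?thesis by auto
  qed
  then obtain Zf where Zf: "\<And>m x. x \<in> {-1..1} \<Longrightarrow> \<bar>E m x\<bar> \<le> Zf m" by metis
  define Z where "Z = 1 + \<bar>Zf 1\<bar> + \<bar>Zf 2\<bar>"
  have b1: "\<bar>\<zeta> x\<bar> \<le> 1 \<and> \<bar>1 - \<zeta> x\<bar> \<le> 1" for x unfolding \<zeta>_def using H(4)[of "(1 / d) * x + (- (a + d) / d)"] by auto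
  have "\<forall>x\<in>{-1..1}. \<bar>\<zeta> x\<bar> \<le> Z \<and> \<bar>1 - \<zeta> x\<bar> \<le> Z \<and> \<bar>E 1 x\<bar> \<le> Z \<and> \<bar>E 2 x\<bar> \<le> Z"
  proof
    fix x :: real assume x: "x \<in> {-1..1}"
    show "\<bar>\<zeta> x\<bar> \<le> Z \<and> \<bar>1 - \<zeta> x\<bar> \<le> Z \<and> \<bar>E 1 x\<bar> \<le> Z \<and> \<bar>E 2 x\<bar> \<le> Z"
      using b1[of x] Zf[OF x, of 1] Zf[OF x, of 2] unfolding Z_def by linarith
  qed
  moreover have "(\<zeta> has_real_derivative E 1 x) (at x)" "(E 1 has_real_derivative E 2 x) (at x)" for x
    using E by (auto simp: tower_def numeral_2_eq_2)
  moreover have "E 1 x = 0 \<and> E 2 x = 0" if "x \<notin> {a<..<b}" for x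
    using zero[OF that, of 0] zero[OF that, of 1] by (simp add: numeral_2_eq_2)
  moreover have "\<zeta> 1 = 0" "\<zeta> (-1) = 1" using hi[of 1] lo[of "-1"] d ab by auto
  ultimately show ?thesis using tower_continuous[OF E(1), of UNIV 2] by blast
qed

text \<open>Cauchy-Schwarz in time, obtained from the nonnegative variance of sqrt q about its mean
  c.\<close>

lemma integral_sqrt_sq:
  assumes "continuous_on {0..T} q" "\<And>t. t \<in> {0..T} \<Longrightarrow> 0 \<le> q t" "T > (0::real)"
  shows "(integral {0..T} (\<lambda>t. sqrt (q t)))\<^sup>2 \<le> T * integral {0..T} q"
proof -
  define J where "J = integral {0..T} (\<lambda>t. sqrt (q t))"
  define c where "c = J / T"
  have cs: "continuous_on {0..T} (\<lambda>t. sqrt (q t))" by (intro continuous_intros assms(1))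
  have i: "q integrable_on {0..T}" "(\<lambda>t. sqrt (q t)) integrable_on {0..T}"
    by (intro integrable_continuous_interval assms(1) cs)+
  have "0 \<le> integral {0..T} (\<lambda>t. (sqrt (q t) - c)\<^sup>2)"
    by (intro integral_nonneg integrable_continuous_interval continuous_intros assms(1)) auto
  also have "integral {0..T} (\<lambda>t. (sqrt (q t) - c)\<^sup>2) = integral {0..T} (\<lambda>t. q t + ((- 2 * c) * sqrt (q t) + c\<^sup>2))"
    by (rule integral_cong) (use assms(2) in \<open>auto simp: power2_diff algebra_simps\<close>)
  also have "\<dots> = integral {0..T} q + ((- 2 * c) * J + c\<^sup>2 * T)"
    using has_integral_add[OF integrable_integral[OF i(1)] has_integral_add[OF has_integral_mult_right[OF integrable_integral[OF i(2)], of "- 2 * c"] has_integral_const_real[of "c\<^sup>2" 0 T]]] assms(3)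
    by (intro integral_unique) (simp add: J_def mult.commute)
  also have "(- 2 * c) * J + c\<^sup>2 * T = - J\<^sup>2 / T" using assms(3) by (simp add: c_def power2_eq_square field_simps)
  finally show ?thesis using assms(3) by (simp add: J_def field_simps)
qed

text \<open>\<open>one_sided_flatness\<close> is used twice, with zeta and the chain from -1, and
  with 1 - zeta and the chain from 1; this doubles 16 to 32. With theta close to the mode of u(T)
  the left side is at least about I times the squared norm of that mode, the right side is linear in
  the norm, and one factor cancels. Neither the exponent 2N nor Z depends on T.\<close>

lemma mode_observability:
  assumes ab: "0 < a" "a < b" "b < 1" and g: "\<gamma> > 0" and T: "T > 0"
  shows "\<exists>K>0. \<forall>n\<ge>1. \<forall>g0 g. is_solution \<gamma> g0 g \<longrightarrow> Qf n UNIV (g T) (g T) \<le>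
      K * ((real n * pi + 1) * exp (2 * (real n * pi)))\<^sup>2 * integral {0..T} (\<lambda>t. Qf n {a<..<b} (g t) (g t))"
proof -
  obtain D where D: "tower D" "\<And>m. D m 0 = 0" "\<And>m. D m T = 0" "\<And>m t. \<bar>D m t\<bar> \<le> Bd m" and D_nonneg: "\<And>t. 0 \<le> D 0 t" and D_int: "0 < integral {0..T} (D 0)"
    using time_cutoff[OF T] by blast
  define I where "I = integral {0..T} (D 0)"
  have I: "I > 0" using D_int by (simp add: I_def)
  obtain \<zeta> \<zeta>1 \<zeta>2 Z where \<zeta>: "\<And>x. (\<zeta> has_real_derivative \<zeta>1 x) (at x)" "\<And>x. (\<zeta>1 has_real_derivative \<zeta>2 x) (at x)" "continuous_on UNIV \<zeta>2"
     "\<And>x. x\<in>{-1..1} \<Longrightarrow> \<bar>\<zeta> x\<bar> \<le> Z \<and> \<bar>1 - \<zeta> x\<bar> \<le> Z \<and> \<bar>\<zeta>1 x\<bar> \<le> Z \<and> \<bar>\<zeta>2 x\<bar> \<le> Z" "\<And>x. x \<notin> {a<..<b} \<Longrightarrow> \<zeta>1 x = 0 \<and> \<zeta>2 x = 0" "\<zeta> 1 = 0" "\<zeta> (-1) = 1"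
    using space_cutoff[OF ab] by blast
  have \<zeta>c: "continuous_on UNIV \<zeta>" using \<zeta>(1) by (auto intro!: DERIV_continuous_on intro: has_field_derivative_at_within)
  have Z0: "0 \<le> Z" using \<zeta>(4)[of 0] by auto
  have S: "{a<..<b} \<in> sets borel" by simp
  have "Qf n UNIV (g T) (g T) \<le> ((32 * Z / I)\<^sup>2 * T + 1) * ((real n * pi + 1) * exp (2 * (real n * pi)))\<^sup>2 * integral {0..T} (\<lambda>t. Qf n {a<..<b} (g t) (g t))"
    if n: "n \<ge> 1" and s: "is_solution \<gamma> g0 g" for n g0 g
  proof -
    interpret mode_setting \<gamma> n g0 g T D by unfold_locales (use g n s T D in auto)
    define N where "N = real n * pi"
    have N: "N > 0" using n by (simp add: N_def)
    define A where "A = 32 * Z * ((N + 1) * exp (2 * N))"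
    have A0: "0 \<le> A" using Z0 N by (simp add: A_def)
    define J where "J = JS {a<..<b}"
    have J0: "0 \<le> J" unfolding J_def by (rule JS_nonneg[OF S])
    have F0: "\<bar>Fm 0 \<theta>\<bar> \<le> A * n2 MX \<theta> * J" if \<theta>: "continuous_on UNIV \<theta>" for \<theta>
    proof -
      have 1: "\<bar>Fm 0 (\<lambda>x. \<zeta> x * \<theta> x)\<bar> \<le> 16 * Z * (N + 1) * exp (2 * N) * n2 MX \<theta> * J"
        unfolding N_def J_def by (rule one_sided_flatness[OF S \<zeta>(1,2,3), of Z 1]) (use \<zeta>(4-6) \<theta> in auto)
      have 2: "\<bar>Fm 0 (\<lambda>x. (1 - \<zeta> x) * \<theta> x)\<bar> \<le> 16 * Z * (N + 1) * exp (2 * N) * n2 MX \<theta> * J"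
        unfolding N_def J_def
      proof (rule one_sided_flatness[OF S, of _ "\<lambda>x. - \<zeta>1 x" "\<lambda>x. - \<zeta>2 x" Z "-1"])
        show "((\<lambda>x. 1 - \<zeta> x) has_real_derivative - \<zeta>1 x) (at x)" for x using DERIV_diff[OF DERIV_const \<zeta>(1)] by simp
        show "((\<lambda>x. - \<zeta>1 x) has_real_derivative - \<zeta>2 x) (at x)" for x by (rule DERIV_minus[OF \<zeta>(2)])
        show "continuous_on UNIV (\<lambda>x. - \<zeta>2 x)" by (intro continuous_intros \<zeta>)
      qed (use \<zeta>(4,5,7) \<theta> in auto)
      have "Fm 0 (\<lambda>x. \<zeta> x * \<theta> x + 1 * ((1 - \<zeta> x) * \<theta> x)) = Fm 0 (\<lambda>x. \<zeta> x * \<theta> x) + 1 * Fm 0 (\<lambda>x. (1 - \<zeta> x) * \<theta> x)"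
        by (rule Fm_lin) (intro continuous_intros \<zeta>c \<theta>)+
      moreover have "(\<lambda>x. \<zeta> x * \<theta> x + 1 * ((1 - \<zeta> x) * \<theta> x)) = \<theta>" by (auto simp: algebra_simps)
      ultimately have "Fm 0 \<theta> = Fm 0 (\<lambda>x. \<zeta> x * \<theta> x) + Fm 0 (\<lambda>x. (1 - \<zeta> x) * \<theta> x)" by simp
      then have "\<bar>Fm 0 \<theta>\<bar> \<le> 2 * (16 * Z * (N + 1) * exp (2 * N) * n2 MX \<theta> * J)" using 1 2 by linarith
      then show ?thesis by (simp add: A_def algebra_simps)
    qed
    have bq: "bbil (Qf n UNIV)" by (rule bbil_Qf[OF n]) simp
    have gT: "sqi MO (g T)" using solution_sqi[OF s] T by simp
    obtain h where "A_op \<gamma> (g T) h" using solution_deriv[OF s T] by blast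
    then obtain \<phi> where \<phi>: "approx_seq \<gamma> \<phi> (g T)" by (auto simp: A_op_def Vspace_def)
    have t: "\<And>k. test_fun (\<phi> k)" and \<phi>l: "(\<lambda>k. n2 MO (\<lambda>z. \<phi> k z - g T z)) \<longlonglongrightarrow> 0" using \<phi> by (auto simp: approx_seq_iff)
    have \<phi>s: "\<And>k. sqi MO (\<phi> k)" by (rule test_fun_sqi[OF t])
    define Y where "Y = sqrt (Qf n UNIV (g T) (g T))"
    have Q0: "0 \<le> Qf n UNIV (g T) (g T)" by (rule bbilD(3)[OF bq gT])
    have cq: "continuous_on {0..T} (\<lambda>t. Qf n UNIV (g t) e)" if "sqi MO e" for e
      by (rule continuous_on_subset[OF solution_bbil_cont(1)[OF bq s that]]) auto
    have Dc: "continuous_on {0..T} (D 0)" by (rule tower_continuous[OF D(1)])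
    have Fk: "Fm 0 (mode n (\<phi> k)) = integral {0..T} (\<lambda>t. D 0 t * Qf n UNIV (g t) (\<phi> k))" for k
      unfolding Fm_def
    proof (rule integral_cong)
      fix u assume "u \<in> {0..T}"
      then have gu: "sqi MO (g u)" using solution_sqi[OF s] by simp
      have "cp (mode n (\<phi> k)) u = Qf n UNIV (g u) (\<phi> k)"
        using integral_mult_ten_sn[OF gu continuous_sqi_MX[OF proj_facts(5)[OF t]]] by (simp add: cp_def ipS_def Qf_def)
      then show "D 0 u * cp (mode n (\<phi> k)) u = D 0 u * Qf n UNIV (g u) (\<phi> k)" by simp
    qed
    have cn: "continuous_on {0..T} (\<lambda>t. sqrt (ipS UNIV (g t) (g t)))"
      by (intro continuous_intros continuous_on_subset[OF solution_bbil_cont(2)[OF biU s sqi_zero]]) auto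
    define G where "G = integral {0..T} (\<lambda>t. D 0 t * sqrt (ipS UNIV (g t) (g t)))"
    \<comment> \<open>Since D 0 >= 0, \<open>mode_symmetric\<close> bounds the D-weighted integral
      of the pairing of u(t) with u(T) from below by I Y^2. Replacing u(T) by
      \<open>\<phi> k\<close> turns this integral into \<open>Fm 0\<close> of a continuous function,
      with an error controlled by the L^2 distance.\<close>
    have key: "I * Y\<^sup>2 \<le> A * sqrt (Qf n UNIV (\<phi> k) (\<phi> k)) * J + G * n2 MO (\<lambda>z. \<phi> k z - g T z)" for k
    proof -
      have "integral {0..T} (\<lambda>t. D 0 t * Y\<^sup>2) \<le> integral {0..T} (\<lambda>t. D 0 t * Qf n UNIV (g t) (\<phi> k) + (D 0 t * sqrt (ipS UNIV (g t) (g t))) * n2 MO (\<lambda>z. \<phi> k z - g T z))"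
      proof (rule integral_le)
        show "(\<lambda>t. D 0 t * Y\<^sup>2) integrable_on {0..T}" by (intro integrable_continuous_interval continuous_intros Dc)
        show "(\<lambda>t. D 0 t * Qf n UNIV (g t) (\<phi> k) + (D 0 t * sqrt (ipS UNIV (g t) (g t))) * n2 MO (\<lambda>z. \<phi> k z - g T z)) integrable_on {0..T}"
          by (intro integrable_continuous_interval continuous_intros Dc cq \<phi>s continuous_on_subset[OF solution_bbil_cont(2)[OF biU s sqi_zero]]) auto
        fix u assume u: "u \<in> {0..T}"
        then have gu: "sqi MO (g u)" using solution_sqi[OF s] by simp
        show "D 0 u * Y\<^sup>2 \<le> D 0 u * Qf n UNIV (g u) (\<phi> k) + (D 0 u * sqrt (ipS UNIV (g u) (g u))) * n2 MO (\<lambda>z. \<phi> k z - g T z)"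
        proof (cases "u = 0")
          \<comment> \<open>\<open>mode_symmetric\<close> speaks about positive times; at time 0 the
            cutoff vanishes.\<close>
          case True then show ?thesis by (simp add: D)
        next
          case False
          have "Y\<^sup>2 \<le> Qf n UNIV (g u) (g T)" unfolding Y_def using mode_symmetric[OF g n s, of u T] False u Q0 by simp
          also have "\<dots> = Qf n UNIV (g u) (\<phi> k) - Qf n UNIV (g u) (\<lambda>z. \<phi> k z - g T z)" using bbil_diff(2)[OF bq \<phi>s gT gu] by simp
          also have "\<dots> \<le> Qf n UNIV (g u) (\<phi> k) + n2 MO (g u) * n2 MO (\<lambda>z. \<phi> k z - g T z)"
            using bbil_bound[OF bq gu sqi_diff[OF \<phi>s[of k] gT]] by (simp add: abs_le_iff)
          also have "n2 MO (g u) = sqrt (ipS UNIV (g u) (g u))" by (simp add: n2_def ipS_def power2_eq_square)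
          finally have "D 0 u * Y\<^sup>2 \<le> D 0 u * (Qf n UNIV (g u) (\<phi> k) + sqrt (ipS UNIV (g u) (g u)) * n2 MO (\<lambda>z. \<phi> k z - g T z))"
            by (intro mult_left_mono D_nonneg)
          then show ?thesis by (simp add: algebra_simps)
        qed
      qed
      also have "\<dots> = Fm 0 (mode n (\<phi> k)) + G * n2 MO (\<lambda>z. \<phi> k z - g T z)"
        unfolding Fk G_def
        by (subst Henstock_Kurzweil_Integration.integral_add)
           (auto intro!: integrable_continuous_interval continuous_intros Dc cq \<phi>s continuous_on_subset[OF solution_bbil_cont(2)[OF biU s sqi_zero]])
      also have "integral {0..T} (\<lambda>t. D 0 t * Y\<^sup>2) = I * Y\<^sup>2" by (simp add: I_def)
      also have "Fm 0 (mode n (\<phi> k)) \<le> A * n2 MX (mode n (\<phi> k)) * J" using F0[OF proj_facts(5)[OF t]] by (meson abs_le_D1)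
      also have "n2 MX (mode n (\<phi> k)) = sqrt (Qf n UNIV (\<phi> k) (\<phi> k))" by (simp add: n2_def Qf_def power2_eq_square)
      finally show ?thesis by simp
    qed
    have "I * Y\<^sup>2 \<le> A * Y * J + G * 0"
    proof (rule tendsto_lowerbound)
      have "(\<lambda>k. Qf n UNIV (\<phi> k) (\<phi> k)) \<longlonglongrightarrow> Qf n UNIV (g T) (g T)"
        by (rule bbil_tendsto[OF bq _ gT \<phi>l _ gT \<phi>l]) (auto simp: \<phi>s)
      then show "(\<lambda>k. A * sqrt (Qf n UNIV (\<phi> k) (\<phi> k)) * J + G * n2 MO (\<lambda>z. \<phi> k z - g T z)) \<longlonglongrightarrow> A * Y * J + G * 0"
        unfolding Y_def by (intro tendsto_intros \<phi>l)
      show "\<forall>\<^sub>F k in sequentially. I * Y\<^sup>2 \<le> A * sqrt (Qf n UNIV (\<phi> k) (\<phi> k)) * J + G * n2 MO (\<lambda>z. \<phi> k z - g T z)" using key by simp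
    qed simp
    then have "Y * (I * Y) \<le> Y * (A * J)" by (simp add: power2_eq_square mult_ac)
    moreover have Y0: "0 \<le> Y" using Q0 by (simp add: Y_def)
    ultimately have "I * Y \<le> A * J" using A0 J0 by (cases "Y = 0") auto
    then have "Y \<le> (A / I) * J" using I by (simp add: field_simps)
    then have "Y\<^sup>2 \<le> ((A / I) * J)\<^sup>2" using Y0 by (intro power_mono)
    also have "\<dots> = (A / I)\<^sup>2 * J\<^sup>2" by (rule power_mult_distrib)
    also have "\<dots> \<le> (A / I)\<^sup>2 * (T * integral {0..T} (\<lambda>t. Qf n {a<..<b} (g t) (g t)))"
    proof (rule mult_left_mono)
      show "J\<^sup>2 \<le> T * integral {0..T} (\<lambda>t. Qf n {a<..<b} (g t) (g t))" unfolding J_def JS_def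
      proof (rule integral_sqrt_sq)
        show "continuous_on {0..T} (\<lambda>t. Qf n {a<..<b} (g t) (g t))"
          by (rule continuous_on_subset[OF solution_bbil_cont(2)[OF bbil_Qf[OF n S] s sqi_zero]]) auto
        show "0 \<le> Qf n {a<..<b} (g t) (g t)" if "t \<in> {0..T}" for t
          by (rule bbilD(3)[OF bbil_Qf[OF n S] solution_sqi[OF s]]) (use that in auto)
      qed (rule T)
    qed simp
    also have "\<dots> \<le> ((32 * Z / I)\<^sup>2 * T + 1) * ((N + 1) * exp (2 * N))\<^sup>2 * integral {0..T} (\<lambda>t. Qf n {a<..<b} (g t) (g t))"
    proof -
      define q where "q = integral {0..T} (\<lambda>t. Qf n {a<..<b} (g t) (g t))"
      have "0 \<le> q" unfolding q_def
      proof (rule integral_nonneg)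
        show "(\<lambda>t. Qf n {a<..<b} (g t) (g t)) integrable_on {0..T}"
          by (intro integrable_continuous_interval continuous_on_subset[OF solution_bbil_cont(2)[OF bbil_Qf[OF n S] s sqi_zero]]) auto
        show "0 \<le> Qf n {a<..<b} (g t) (g t)" if "t \<in> {0..T}" for t
          by (rule bbilD(3)[OF bbil_Qf[OF n S] solution_sqi[OF s]]) (use that in auto)
      qed
      define e where "e = ((N + 1) * exp (2 * N))\<^sup>2"
      have "0 \<le> e" by (simp add: e_def)
      have "(A / I)\<^sup>2 * (T * q) = ((32 * Z / I)\<^sup>2 * T) * e * q" by (simp add: A_def e_def power_mult_distrib power_divide mult_ac)
      also have "\<dots> \<le> ((32 * Z / I)\<^sup>2 * T + 1) * e * q" using \<open>0 \<le> e\<close> \<open>0 \<le> q\<close> by (intro mult_right_mono) auto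
      finally show ?thesis by (simp add: q_def e_def)
    qed
    finally show ?thesis using Q0 by (simp add: Y_def N_def)
  qed
  moreover have "0 < (32 * Z / I)\<^sup>2 * T + 1" using T by (simp add: add_nonneg_pos)
  ultimately show ?thesis by blast
qed


section \<open>Summation over the modes\<close>

lemma Qf_bessel:
  assumes S: "S \<in> sets borel" and f: "sqi MO f" and I: "finite I" "\<And>i. i \<in> I \<Longrightarrow> i \<ge> 1"
  shows "(\<Sum>n\<in>I. Qf n S f f) \<le> ipS S f f"
proof -
  have sl: "integrable MX (\<lambda>x. indicator S x * (\<integral>y. (f (x, y))\<^sup>2 \<partial>MY))" by (rule integrable_ind_mult[OF S integral_slices(1)[OF f]])
  have im: "integrable MX (\<lambda>x. indicator S x * (mode n f x * mode n f x))" if "n \<in> I" for n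
    using f I(2)[OF that] by (intro integrable_ind_mult[OF S] sqi_integrable_mult mode_sqi)
  have "(\<Sum>n\<in>I. Qf n S f f) = (\<integral>x. (\<Sum>n\<in>I. indicator S x * (mode n f x * mode n f x)) \<partial>MX)"
    unfolding Qf_def by (rule Bochner_Integration.integral_sum[symmetric]) (rule im)
  also have "\<dots> \<le> (\<integral>x. indicator S x * (\<integral>y. (f (x, y))\<^sup>2 \<partial>MY) \<partial>MX)"
  proof (rule integral_mono_AE)
    show "integrable MX (\<lambda>x. \<Sum>n\<in>I. indicator S x * (mode n f x * mode n f x))" by (intro Bochner_Integration.integrable_sum im)
    show "integrable MX (\<lambda>x. indicator S x * (\<integral>y. (f (x, y))\<^sup>2 \<partial>MY))" by (rule sl)
    have "AE x in MX. (\<Sum>n\<in>I. (mode n f x)\<^sup>2) \<le> (\<integral>y. (f (x, y))\<^sup>2 \<partial>MY)" by (rule mode_bessel[OF f I])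
    then show "AE x in MX. (\<Sum>n\<in>I. indicator S x * (mode n f x * mode n f x)) \<le> indicator S x * (\<integral>y. (f (x, y))\<^sup>2 \<partial>MY)"
      by eventually_elim (auto simp: sum_distrib_left[symmetric] power2_eq_square indicator_def)
  qed
  also have "\<dots> = ipS S f f"
    using integral_MO_xy[OF ipS_integrable[OF S f f]] by (simp add: ipS_def power2_eq_square)
  finally show ?thesis .
qed

section \<open>Density of finite sine sums and Parseval\<close>

inductive_set trig :: "(real \<times> real \<Rightarrow> real) set" where
  single: "continuous_on UNIV \<alpha> \<Longrightarrow> n \<ge> 1 \<Longrightarrow> ten \<alpha> (sn n) \<in> trig"
| add: "f \<in> trig \<Longrightarrow> h \<in> trig \<Longrightarrow> (\<lambda>z. f z + h z) \<in> trig"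

lemma trig_zero: "(\<lambda>z. 0) \<in> trig"
  using trig.single[of "\<lambda>_. 0" 1] by (simp add: ten_def)

lemma trig_mult_x: "f \<in> trig \<Longrightarrow> continuous_on UNIV \<beta> \<Longrightarrow> (\<lambda>z. \<beta> (fst z) * f z) \<in> trig"
proof (induction rule: trig.induct)
  case (single \<alpha> n)
  have "ten (\<lambda>x. \<beta> x * \<alpha> x) (sn n) \<in> trig" using single by (intro trig.single continuous_intros)
  then show ?case by (simp add: ten_def mult.assoc)
next
  case (add f h)
  then show ?case using trig.add[of "\<lambda>z. \<beta> (fst z) * f z" "\<lambda>z. \<beta> (fst z) * h z"] by (simp add: algebra_simps)
qed

text \<open>The product formula splits cos(pi y) sin(n pi y) into the modes n+1 and n-1, so
  multiplication by cos(pi y) stays inside the sine sums.\<close>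

lemma trig_mult_cos: "f \<in> trig \<Longrightarrow> (\<lambda>z. cos (pi * snd z) * f z) \<in> trig"
proof (induction rule: trig.induct)
  case (single \<alpha> n)
  have h: "continuous_on UNIV (\<lambda>x. \<alpha> x / 2)" using single by (intro continuous_intros) auto
  have id: "cos (pi * y) * sn n y = sn (Suc n) y / 2 + sn (n - 1) y / 2" for y
  proof -
    have e: "real (n - 1) * pi * y = real n * pi * y - pi * y" using single by (simp add: of_nat_diff algebra_simps)
    have e': "real (Suc n) * pi * y = real n * pi * y + pi * y" by (simp add: algebra_simps)
    show ?thesis unfolding sn_def e e' sin_add sin_diff by (simp add: algebra_simps add_divide_distrib diff_divide_distrib)
  qed
  have 1: "ten (\<lambda>x. \<alpha> x / 2) (sn (Suc n)) \<in> trig" by (rule trig.single[OF h]) simp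
  \<comment> \<open>For n = 1 the lower neighbour is mode 0, which is the zero function;
    \<open>trig\<close> generates from n >= 1, so it is supplied separately.\<close>
  have 2: "ten (\<lambda>x. \<alpha> x / 2) (sn (n - 1)) \<in> trig"
  proof (cases "n = 1")
    case True then show ?thesis using trig_zero by (simp add: ten_def sn_def)
  next
    case False then show ?thesis using single by (intro trig.single[OF h]) auto
  qed
  have "(\<lambda>z. cos (pi * snd z) * ten \<alpha> (sn n) z) = (\<lambda>z. ten (\<lambda>x. \<alpha> x / 2) (sn (Suc n)) z + ten (\<lambda>x. \<alpha> x / 2) (sn (n - 1)) z)"
  proof
    fix z :: "real \<times> real"
    have "cos (pi * snd z) * ten \<alpha> (sn n) z = \<alpha> (fst z) * (cos (pi * snd z) * sn n (snd z))" by (simp add: ten_def)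
    then show "cos (pi * snd z) * ten \<alpha> (sn n) z = ten (\<lambda>x. \<alpha> x / 2) (sn (Suc n)) z + ten (\<lambda>x. \<alpha> x / 2) (sn (n - 1)) z"
      unfolding id by (simp add: ten_def algebra_simps)
  qed
  then show ?case using trig.add[OF 1 2] by simp
next
  case (add f h)
  then show ?case using trig.add[of "\<lambda>z. cos (pi * snd z) * f z" "\<lambda>z. cos (pi * snd z) * h z"] by (simp add: algebra_simps)
qed

text \<open>By Stone--Weierstrass, polynomials in $x$ and $\cos \pi y$ approximate $\varphi/\sin \pi y$; multiplied by $\sin \pi y$
  they are finite sine sums.\<close>

lemma trig_mult_poly:
  assumes "real_polynomial_function (p :: real \<times> real \<Rightarrow> real)"
  shows "f \<in> trig \<Longrightarrow> (\<lambda>z. p (fst z, cos (pi * snd z)) * f z) \<in> trig"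
  using assms
proof (induction arbitrary: f rule: real_polynomial_function.induct)
  case (linear l)
  have l: "l (x, c) = l (1, 0) * x + l (0, 1) * c" for x c
  proof -
    have "(x, c) = x *\<^sub>R (1, 0) + c *\<^sub>R (0::real, 1::real)" by simp
    then have "l (x, c) = l (x *\<^sub>R (1, 0) + c *\<^sub>R (0, 1))" by simp
    also have "\<dots> = x *\<^sub>R l (1, 0) + c *\<^sub>R l (0, 1)"
      by (simp only: linear_add[OF bounded_linear.linear[OF linear(1)]] linear_scale[OF bounded_linear.linear[OF linear(1)]])
    finally show ?thesis by simp
  qed
  have 1: "(\<lambda>z. (l (1, 0) * fst z) * f z) \<in> trig" by (rule trig_mult_x[OF linear(2), of "\<lambda>x. l (1, 0) * x"]) (intro continuous_intros)
  have "(\<lambda>z. l (0, 1) * f z) \<in> trig" using trig_mult_x[OF linear(2), of "\<lambda>x. l (0, 1)"] by simp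
  from trig.add[OF 1 trig_mult_cos[OF this]] show ?case by (subst l) (simp add: algebra_simps)
next
  case (const c)
  then show ?case using trig_mult_x[of f "\<lambda>_. c"] by simp
next
  case (add p q)
  then show ?case using trig.add[OF add.IH(1)[OF add.prems] add.IH(2)[OF add.prems]] by (simp add: algebra_simps)
next
  case (mult p q)
  then show ?case using mult.IH(1)[OF mult.IH(2)[OF mult.prems]] by (simp add: mult.assoc)
qed

lemma trig_finite_sum:
  "f \<in> trig \<Longrightarrow> \<exists>M \<alpha>. (\<forall>n. continuous_on UNIV (\<alpha> n)) \<and> (\<forall>x y. f (x, y) = (\<Sum>n\<in>{1..M}. \<alpha> n x * sn n y))"
proof (induction rule: trig.induct)
  case (single \<alpha> n)
  show ?case
  proof (intro exI conjI allI)
    show "continuous_on UNIV (if k = n then \<alpha> else (\<lambda>_. 0))" for k using single by simp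
    fix x y
    have "(\<Sum>k\<in>{1..n}. (if k = n then \<alpha> else (\<lambda>_. 0)) x * sn k y) = (\<Sum>k\<in>{1..n}. if n = k then \<alpha> x * sn n y else 0)"
      by (intro sum.cong) auto
    also have "\<dots> = \<alpha> x * sn n y" using single by (subst sum.delta') auto
    finally show "ten \<alpha> (sn n) (x, y) = (\<Sum>k\<in>{1..n}. (if k = n then \<alpha> else (\<lambda>_. 0)) x * sn k y)" by simp
  qed
next
  case (add f h)
  then obtain M \<alpha> M' \<alpha>' where a: "\<And>n. continuous_on UNIV (\<alpha> n)" "\<And>x y. f (x, y) = (\<Sum>n\<in>{1..M}. \<alpha> n x * sn n y)"
    and a': "\<And>n. continuous_on UNIV (\<alpha>' n)" "\<And>x y. h (x, y) = (\<Sum>n\<in>{1..M'}. \<alpha>' n x * sn n y)" by blast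
  define \<beta> where "\<beta> n x = (if n \<le> M then \<alpha> n x else 0) + (if n \<le> M' then \<alpha>' n x else 0)" for n x
  have "continuous_on UNIV (\<beta> n)" for n unfolding \<beta>_def[abs_def] using a(1) a'(1) by (cases "n \<le> M"; cases "n \<le> M'") (auto intro!: continuous_intros)
  moreover have "f (x, y) + h (x, y) = (\<Sum>n\<in>{1..max M M'}. \<beta> n x * sn n y)" for x y
  proof -
    have ext: "(\<Sum>n\<in>{1..K}. c n * sn n y) = (\<Sum>n\<in>{1..max M M'}. (if n \<le> K then c n else 0) * sn n y)" if "K \<le> max M M'" for K c
      by (rule sum.mono_neutral_cong_left) (use that in auto)
    have "f (x, y) = (\<Sum>n\<in>{1..max M M'}. (if n \<le> M then \<alpha> n x else 0) * sn n y)"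
      unfolding a(2) by (rule ext) simp
    moreover have "h (x, y) = (\<Sum>n\<in>{1..max M M'}. (if n \<le> M' then \<alpha>' n x else 0) * sn n y)"
      unfolding a'(2) by (rule ext) simp
    ultimately show ?thesis by (simp only: sum.distrib[symmetric] \<beta>_def distrib_right)
  qed
  ultimately show ?case by blast
qed

text \<open>The quotient phi / sin(pi y) is continuous on the whole plane: on Omega the sine is
  positive, and off the compact support the numerator is 0. Since cos(pi y) is injective on [0,1], x
  and cos(pi y) separate the points of the closed rectangle.\<close>

lemma test_fun_trig_approx:
  assumes t: "test_fun \<phi>" and e: "e > 0"
  shows "\<exists>M \<alpha>. (\<forall>n. continuous_on UNIV (\<alpha> n)) \<and> (\<forall>x\<in>{-1<..<1}. \<forall>y\<in>{0<..<1}. \<bar>\<phi> (x, y) - (\<Sum>n\<in>{1..M}. \<alpha> n x * sn n y)\<bar> \<le> e)"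
proof -
  define S :: "(real \<times> real) set" where "S = {-1..1} \<times> {0..1}"
  obtain K where K: "compact K" "K \<subseteq> Omega" "\<And>z. z \<notin> K \<Longrightarrow> \<phi> z = 0" using t by (auto simp: test_fun_def)
  define \<Phi> where "\<Phi> z = \<phi> z / sn 1 (snd z)" for z
  have \<phi>c: "continuous_on UNIV \<phi>" by (rule Ck_continuous[OF test_fun_Ck[OF t]])
  have snp: "sn 1 y > 0" if "0 < y" "y < 1" for y
    unfolding sn_def using that by (intro mult_pos_pos sin_gt_zero) auto
  have \<Phi>c: "continuous_on UNIV \<Phi>"
  proof -
    have "continuous_on Omega \<Phi>" unfolding \<Phi>_def
    proof (intro continuous_intros continuous_on_subset[OF \<phi>c])
      show "continuous_on Omega (\<lambda>x. sn 1 (snd x))" by (rule continuous_on_compose2[OF sn_continuous[of UNIV 1]]) (auto intro: continuous_intros)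
      show "\<forall>x\<in>Omega. sn 1 (snd x) \<noteq> 0" using snp by (force simp: Omega_def)
    qed auto
    moreover have "continuous_on (- K) \<Phi>"
    proof (rule continuous_on_eq[OF continuous_on_const[of _ 0]])
      fix z assume "z \<in> - K"
      then show "0 = \<Phi> z" using K(3)[of z] by (simp add: \<Phi>_def)
    qed
    moreover have "open Omega" unfolding Omega_def by (intro open_Times) auto
    moreover have "open (- K)" using K(1) by (simp add: compact_imp_closed open_Compl)
    ultimately have "continuous_on (Omega \<union> - K) \<Phi>" by (intro continuous_on_open_Un)
    moreover have "Omega \<union> - K = UNIV" using K(2) by auto
    ultimately show ?thesis by simp
  qed
  define R where "R = {(\<lambda>z. p (fst z, cos (pi * snd z))) | p. real_polynomial_function (p :: real \<times> real \<Rightarrow> real)}"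
  have rc: "continuous_on UNIV (\<lambda>z. p (fst z, cos (pi * snd z)))" if "real_polynomial_function p" for p :: "real \<times> real \<Rightarrow> real"
    by (rule continuous_on_compose2[OF continuous_on_polymonial_function[OF that[unfolded real_polynomial_function_eq], of UNIV]])
       (auto intro!: continuous_intros)
  interpret function_ring_on R S
  proof
    show "compact S" unfolding S_def by (intro compact_Times) auto
    show "continuous_on S f" if "f \<in> R" for f using that rc continuous_on_subset unfolding R_def by blast
    show "(\<lambda>x. f x + h x) \<in> R" if fh: "f \<in> R" "h \<in> R" for f h
    proof -
      obtain p q where pq: "real_polynomial_function p" "real_polynomial_function q"
        "f = (\<lambda>z. p (fst z, cos (pi * snd z)))" "h = (\<lambda>z. q (fst z, cos (pi * snd z)))" using fh unfolding R_def by blast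
      then show ?thesis unfolding R_def by (intro CollectI exI[of _ "\<lambda>z. p z + q z"]) (auto intro: real_polynomial_function.intros)
    qed
    show "(\<lambda>x. f x * h x) \<in> R" if fh: "f \<in> R" "h \<in> R" for f h
    proof -
      obtain p q where pq: "real_polynomial_function p" "real_polynomial_function q"
        "f = (\<lambda>z. p (fst z, cos (pi * snd z)))" "h = (\<lambda>z. q (fst z, cos (pi * snd z)))" using fh unfolding R_def by blast
      then show ?thesis unfolding R_def by (intro CollectI exI[of _ "\<lambda>z. p z * q z"]) (auto intro: real_polynomial_function.intros)
    qed
    show "(\<lambda>_. c) \<in> R" for c unfolding R_def by (intro CollectI exI[of _ "\<lambda>z. c"]) (auto intro: real_polynomial_function.intros)
    show "\<exists>f\<in>R. f z \<noteq> f z'" if z: "z \<in> S" "z' \<in> S" "z \<noteq> z'" for z z'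
    proof (cases "fst z = fst z'")
      case False
      have "(\<lambda>z. fst z) \<in> R" unfolding R_def
        by (intro CollectI exI[of _ "fst"]) (auto intro: real_polynomial_function.intros bounded_linear_fst)
      then show ?thesis using False by (intro bexI[of _ "\<lambda>z. fst z"])
    next
      case True
      have "(\<lambda>z. cos (pi * snd z)) \<in> R" unfolding R_def
        by (intro CollectI exI[of _ "snd"]) (auto intro: real_polynomial_function.intros bounded_linear_snd)
      moreover have "cos (pi * snd z) \<noteq> cos (pi * snd z')"
      proof
        assume c: "cos (pi * snd z) = cos (pi * snd z')"
        have "pi * snd z = pi * snd z'" 
          by (rule cos_inj_pi[OF _ _ _ _ c]) (use z in \<open>auto simp: S_def mult_left_le\<close>)
        then have "snd z = snd z'" by simp
        then show False using True z(3) by (simp add: prod_eq_iff)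
      qed
      ultimately show ?thesis by (intro bexI[of _ "\<lambda>z. cos (pi * snd z)"])
    qed
  qed
  have "e / 2 > 0" using e by simp
  then obtain f where f: "f \<in> R" "\<And>z. z \<in> S \<Longrightarrow> \<bar>\<Phi> z - f z\<bar> < e / 2"
    using Stone_Weierstrass_basic[OF continuous_on_subset[OF \<Phi>c], of "e/2"] by blast
  obtain p where p: "real_polynomial_function p" "f = (\<lambda>z. p (fst z, cos (pi * snd z)))" using f(1) unfolding R_def by blast
  have "ten (\<lambda>_. 1) (sn 1) \<in> trig" by (rule trig.single) auto
  from trig_mult_poly[OF p(1) this] have "(\<lambda>z. f z * ten (\<lambda>_. 1) (sn 1) z) \<in> trig" by (simp add: p(2))
  then obtain M \<alpha> where M: "\<And>n. continuous_on UNIV (\<alpha> n)" "\<And>x y. f (x, y) * ten (\<lambda>_. 1) (sn 1) (x, y) = (\<Sum>n\<in>{1..M}. \<alpha> n x * sn n y)"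
    using trig_finite_sum by blast
  have "\<bar>\<phi> (x, y) - (\<Sum>n\<in>{1..M}. \<alpha> n x * sn n y)\<bar> \<le> e" if xy: "x \<in> {-1<..<1}" "y \<in> {0<..<1}" for x y
  proof -
    have s0: "sn 1 y > 0" using snp xy by simp
    have "\<phi> (x, y) - (\<Sum>n\<in>{1..M}. \<alpha> n x * sn n y) = (\<Phi> (x, y) - f (x, y)) * sn 1 y"
    proof -
      have "(\<Sum>n\<in>{1..M}. \<alpha> n x * sn n y) = f (x, y) * sn 1 y" using M(2)[of x y] by simp
      moreover have "\<phi> (x, y) = \<Phi> (x, y) * sn 1 y" using s0 by (simp add: \<Phi>_def)
      ultimately show ?thesis by (simp only: left_diff_distrib)
    qed
    also have "\<bar>\<dots>\<bar> \<le> (e / 2) * 2"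
    proof -
      have "\<bar>sn 1 y\<bar> \<le> 2" using sn_bound[of 1 y] sqrt2_less_2 by linarith
      moreover have "\<bar>\<Phi> (x, y) - f (x, y)\<bar> \<le> e / 2" using f(2)[of "(x, y)"] xy by (force simp: S_def)
      ultimately show ?thesis unfolding abs_mult using e by (intro mult_mono) auto
    qed
    finally show ?thesis by simp
  qed
  then show ?thesis using M(1) by blast
qed

text \<open>On almost every slice, completing the square shows that sine coefficients beat any other
  coefficients. So any finite sine sum close to f bounds the energy that the first M modes
  miss.\<close>

lemma best_approx:
  assumes f: "sqi MO f" and \<alpha>: "\<And>n. continuous_on UNIV (\<alpha> n)"
  shows "(\<integral>z. (f z)\<^sup>2 \<partial>MO) - (\<Sum>n\<in>{1..M}. Qf n UNIV f f) \<le> (\<integral>z. (f z - (\<Sum>n\<in>{1..M}. ten (\<alpha> n) (sn n) z))\<^sup>2 \<partial>MO)"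
proof -
  let ?h = "\<lambda>z. f z - (\<Sum>n\<in>{1..M}. ten (\<alpha> n) (sn n) z)"
  have h: "sqi MO ?h" by (intro sqi_diff f sqi_sum continuous_sqi continuous_ten \<alpha> continuous_intros) simp
  have im: "integrable MX (\<lambda>x. (mode n f x)\<^sup>2)" if "n \<in> {1..M}" for n
    using f that by (intro sqi_integrable_sq mode_sqi) auto
  have "(\<integral>z. (f z)\<^sup>2 \<partial>MO) - (\<Sum>n\<in>{1..M}. Qf n UNIV f f) = (\<integral>x. (\<integral>y. (f (x, y))\<^sup>2 \<partial>MY) - (\<Sum>n\<in>{1..M}. (mode n f x)\<^sup>2) \<partial>MX)"
  proof -
    have "(\<Sum>n\<in>{1..M}. Qf n UNIV f f) = (\<integral>x. (\<Sum>n\<in>{1..M}. (mode n f x)\<^sup>2) \<partial>MX)"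
      using Bochner_Integration.integral_sum[of "{1..M}" MX "\<lambda>n x. (mode n f x)\<^sup>2"] im by (simp add: Qf_def power2_eq_square)
    moreover have "integrable MX (\<lambda>x. \<Sum>n\<in>{1..M}. (mode n f x)\<^sup>2)" by (intro Bochner_Integration.integrable_sum im)
    ultimately show ?thesis
      using Bochner_Integration.integral_diff[OF integral_slices(1)[OF f]] integral_slices(2)[OF f] by (simp only:)
  qed
  also have "\<dots> \<le> (\<integral>x. (\<integral>y. (?h (x, y))\<^sup>2 \<partial>MY) \<partial>MX)"
  proof (rule integral_mono_AE)
    show "integrable MX (\<lambda>x. (\<integral>y. (f (x, y))\<^sup>2 \<partial>MY) - (\<Sum>n\<in>{1..M}. (mode n f x)\<^sup>2))"
      by (intro Bochner_Integration.integrable_diff Bochner_Integration.integrable_sum integral_slices(1)[OF f] im)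
    show "integrable MX (\<lambda>x. \<integral>y. (?h (x, y))\<^sup>2 \<partial>MY)" by (rule integral_slices(1)[OF h])
    show "AE x in MX. (\<integral>y. (f (x, y))\<^sup>2 \<partial>MY) - (\<Sum>n\<in>{1..M}. (mode n f x)\<^sup>2) \<le> (\<integral>y. (?h (x, y))\<^sup>2 \<partial>MY)"
      using AE_slice[OF f]
    proof eventually_elim
      case (elim x)
      have "(\<integral>y. (?h (x, y))\<^sup>2 \<partial>MY) = (\<integral>y. (f (x, y) - (\<Sum>n\<in>{1..M}. \<alpha> n x * sn n y))\<^sup>2 \<partial>MY)" by simp
      also have "\<dots> = (\<integral>y. (f (x, y))\<^sup>2 \<partial>MY) - 2 * (\<Sum>n\<in>{1..M}. \<alpha> n x * mode n f x) + (\<Sum>n\<in>{1..M}. (\<alpha> n x)\<^sup>2)"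
        unfolding mode_def by (rule slice_expand[OF elim]) auto
      moreover have "2 * (\<Sum>n\<in>{1..M}. \<alpha> n x * mode n f x) \<le> (\<Sum>n\<in>{1..M}. (\<alpha> n x)\<^sup>2) + (\<Sum>n\<in>{1..M}. (mode n f x)\<^sup>2)"
        unfolding sum_distrib_left sum.distrib[symmetric]
        by (rule sum_mono) (use sum_squares_bound in \<open>simp add: mult.assoc[symmetric]\<close>)
      ultimately show ?case by linarith
    qed
  qed
  also have "\<dots> = (\<integral>z. (?h z)\<^sup>2 \<partial>MO)" by (rule integral_slices(2)[OF h])
  finally show ?thesis .
qed

text \<open>Completeness of the sines: a function of V is an L^2 limit of test functions, these are
  uniformly close to finite sine sums, and \<open>best_approx\<close> bounds what the modes
  miss.\<close>

lemma parseval_le: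
  assumes f: "f \<in> Vspace \<gamma>" and C: "\<And>M. (\<Sum>n\<in>{1..M}. Qf n UNIV f f) \<le> C"
  shows "(\<integral>z. (f z)\<^sup>2 \<partial>MO) \<le> C"
proof (rule field_le_epsilon)
  fix e :: real assume e: "e > 0"
  obtain \<phi> where \<phi>: "approx_seq \<gamma> \<phi> f" and fs: "sqi MO f" using f by (auto simp: Vspace_def L2_iff)
  have t: "\<And>k. test_fun (\<phi> k)" and l: "(\<lambda>k. n2 MO (\<lambda>z. \<phi> k z - f z)) \<longlonglongrightarrow> 0" using \<phi> by (auto simp: approx_seq_iff)
  \<comment> \<open>The distance from f to the sine sum will be at most d + 2d, as a uniform error d
    on a set of measure 2 has L^2 norm at most 2d. Then (3d)^2 = 9e/16 <= e.\<close>
  define d where "d = sqrt e / 4"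
  have d: "d > 0" using e by (simp add: d_def)
  obtain k where k: "n2 MO (\<lambda>z. \<phi> k z - f z) < d"
    using order_tendstoD(2)[OF l d] by (auto simp: eventually_sequentially)
  obtain M \<alpha> where \<alpha>: "\<And>n. continuous_on UNIV (\<alpha> n)" "\<And>x y. x\<in>{-1<..<1} \<Longrightarrow> y\<in>{0<..<1} \<Longrightarrow> \<bar>\<phi> k (x, y) - (\<Sum>n\<in>{1..M}. \<alpha> n x * sn n y)\<bar> \<le> d"
    using test_fun_trig_approx[OF t d, of k] by blast
  let ?S = "\<lambda>z. \<Sum>n\<in>{1..M}. ten (\<alpha> n) (sn n) z"
  have Ss: "sqi MO ?S" by (intro sqi_sum continuous_sqi continuous_ten \<alpha> continuous_intros) simp
  have ps: "sqi MO (\<phi> k)" by (rule test_fun_sqi[OF t])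
  have m: "(\<integral>z. d\<^sup>2 \<partial>MO) = 2 * d\<^sup>2"
  proof -
    have "(\<integral>z. ten (\<lambda>_. d\<^sup>2) (\<lambda>_. 1) z \<partial>MO) = (\<integral>x. d\<^sup>2 \<partial>MX) * (\<integral>y. 1 \<partial>MY)" by (rule integral_ten) auto
    moreover have "(\<integral>x. d\<^sup>2 \<partial>MX) = 2 * d\<^sup>2" using integral_MX_deriv[of "\<lambda>x. d\<^sup>2 * x" "\<lambda>_. d\<^sup>2"] by (auto intro!: derivative_eq_intros)
    moreover have "(\<integral>y. (1::real) \<partial>MY) = 1" using integral_MY_deriv[of "\<lambda>x. x" "\<lambda>_. 1"] by (auto intro!: derivative_eq_intros)
    ultimately show ?thesis by (simp only: ten_def mult_1_right)
  qed
  have "(n2 MO (\<lambda>z. \<phi> k z - ?S z))\<^sup>2 \<le> (\<integral>z. d\<^sup>2 \<partial>MO)" unfolding n2_sq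
  proof (rule integral_mono[OF sqi_integrable_sq[OF sqi_diff[OF ps Ss]]])
    show "integrable MO (\<lambda>z. d\<^sup>2)" by simp
    show "(\<phi> k z - ?S z)\<^sup>2 \<le> d\<^sup>2" if zO: "z \<in> space MO" for z
    proof -
      obtain x y where z: "z = (x,y)" "x \<in> {-1<..<1}" "y \<in> {0<..<1}" using zO by (auto simp: Omega_def)
      then show ?thesis using \<alpha>(2)[OF z(2,3)] d by (simp add: power2_le_iff_abs_le)
    qed
  qed
  also have "\<dots> \<le> (2 * d)\<^sup>2" unfolding m by (simp add: power_mult_distrib)
  finally have n1: "n2 MO (\<lambda>z. \<phi> k z - ?S z) \<le> 2 * d" by (rule power2_le_imp_le) (use d in simp)
  have "n2 MO (\<lambda>z. f z - ?S z) \<le> n2 MO (\<lambda>z. (-1) * (\<phi> k z - f z)) + n2 MO (\<lambda>z. \<phi> k z - ?S z)"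
    using n2_triangle[OF sqi_cmult[OF sqi_diff[OF ps fs], of "-1"] sqi_diff[OF ps Ss]] by simp
  also have "n2 MO (\<lambda>z. (-1) * (\<phi> k z - f z)) = n2 MO (\<lambda>z. \<phi> k z - f z)" unfolding n2_cmult by simp
  finally have "n2 MO (\<lambda>z. f z - ?S z) \<le> 3 * d" using n1 k by linarith
  then have "(n2 MO (\<lambda>z. f z - ?S z))\<^sup>2 \<le> (3 * d)\<^sup>2" by (intro power_mono) auto
  also have "\<dots> \<le> e" using e by (simp add: d_def power_mult_distrib power_divide)
  finally have "(\<integral>z. (f z - ?S z)\<^sup>2 \<partial>MO) \<le> e" by (simp add: n2_sq)
  then show "(\<integral>z. (f z)\<^sup>2 \<partial>MO) \<le> C + e" using best_approx[of f \<alpha> M, OF fs \<alpha>(1)] C[of M] by linarith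
qed

section \<open>From single modes to the full observation\<close>

lemma time_observation:
  assumes ab: "0 < a" "a < b" "b < 1" and s: "is_solution \<gamma> g0 g"
  shows "(LINT t:{0..T}|lborel. (LINT z:omega a b|lborel. (g t z)\<^sup>2)) = integral {0..T} (\<lambda>t. ipS {a<..<b} (g t) (g t))"
proof -
  have "(LINT z:omega a b|lborel. (g t z)\<^sup>2) = ipS {a<..<b} (g t) (g t)" for t
    using ab omega_integral[of a b "\<lambda>z. (g t z)\<^sup>2"] by (simp add: ipS_def power2_eq_square)
  moreover have "set_integrable lborel {0..T} (\<lambda>t. ipS {a<..<b} (g t) (g t))"
    by (intro borel_integrable_atLeastAtMost' continuous_on_subset[OF solution_bbil_cont(2)[OF bbil_ipS s sqi_zero]]) auto
  ultimately show ?thesis by (simp add: set_borel_integral_eq_integral(2))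
qed

lemma observation_cont:
  assumes s: "is_solution \<gamma> g0 g"
  shows "(\<lambda>t. ipS {a<..<b} (g t) (g t)) integrable_on {0..T}"
  by (intro integrable_continuous_interval continuous_on_subset[OF solution_bbil_cont(2)[OF bbil_ipS s sqi_zero]]) auto

lemma observation_mono:
  assumes s: "is_solution \<gamma> g0 g" and T: "0 \<le> T" "T \<le> T'"
  shows "integral {0..T} (\<lambda>t. ipS {a<..<b} (g t) (g t)) \<le> integral {0..T'} (\<lambda>t. ipS {a<..<b} (g t) (g t))"
proof (rule integral_subset_le)
  show "\<forall>t\<in>{0..T'}. 0 \<le> ipS {a<..<b} (g t) (g t)"
    by (auto intro!: bbilD(3)[OF bbil_ipS] solution_sqi[OF s])
qed (use T in \<open>auto intro!: observation_cont[OF s]\<close>)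

text \<open>The left side decreases in T by contraction, the right side increases because its
  integrand is nonnegative. Needed to define the critical time as an infimum.\<close>

lemma observable_mono:
  assumes g: "\<gamma> > 0" and ab: "0 < a" "a < b" "b < 1" and T: "0 < T" "T \<le> T'" and o: "observable \<gamma> a b T"
  shows "observable \<gamma> a b T'"
proof -
  obtain C where C: "C > 0" "\<And>g0 g. L2 g0 \<Longrightarrow> is_solution \<gamma> g0 g \<Longrightarrow> (LINT z:Omega|lborel. (g T z)\<^sup>2) \<le>
        C * (LINT t:{0..T}|lborel. (LINT z:omega a b|lborel. (g t z)\<^sup>2))" using o unfolding observable_def by blast
  have "(LINT z:Omega|lborel. (g T' z)\<^sup>2) \<le> C * (LINT t:{0..T'}|lborel. (LINT z:omega a b|lborel. (g t z)\<^sup>2))"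
    if g0: "L2 g0" and s: "is_solution \<gamma> g0 g" for g0 g
  proof -
    have "(LINT z:Omega|lborel. (g T' z)\<^sup>2) \<le> (LINT z:Omega|lborel. (g T z)\<^sup>2)"
      unfolding set_integral_Omega by (rule solution_contraction[OF g s T])
    also have "\<dots> \<le> C * (LINT t:{0..T}|lborel. (LINT z:omega a b|lborel. (g t z)\<^sup>2))" by (rule C(2)[OF g0 s])
    also have "\<dots> \<le> C * (LINT t:{0..T'}|lborel. (LINT z:omega a b|lborel. (g t z)\<^sup>2))"
      unfolding time_observation[OF ab s] using C(1) T by (intro mult_left_mono observation_mono[OF s]) auto
    finally show ?thesis .
  qed
  then show ?thesis unfolding observable_def using C(1) by blast
qed

text \<open>Observe on [0,T0] at the cost ((N+1) e^(2N))^2 <= e^(6N), by N + 1 <= e^N, then let the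
  mode decay on [T0,T] at the rate 2 \<open>muN\<close>. The bound E makes the combined constant
  uniform in n, so that Bessel over (a,b) and Parseval can sum the modes.\<close>

lemma observable_of_dissipation:
  assumes g: "\<gamma> > 0" and ab: "0 < a" "a < b" "b < 1" and T: "0 < T0" "T0 \<le> T"
    and E: "\<And>n. n \<ge> 1 \<Longrightarrow> 6 * (real n * pi) - 2 * muN \<gamma> (real n * pi) * (T - T0) \<le> E"
  shows "observable \<gamma> a b T"
proof -
  obtain K where K: "K > 0" "\<And>n g0 g. n \<ge> 1 \<Longrightarrow> is_solution \<gamma> g0 g \<Longrightarrow> Qf n UNIV (g T0) (g T0) \<le>
      K * ((real n * pi + 1) * exp (2 * (real n * pi)))\<^sup>2 * integral {0..T0} (\<lambda>t. Qf n {a<..<b} (g t) (g t))"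
    using mode_observability[OF ab g T(1)] by blast
  define C where "C = K * exp E"
  have C: "C > 0" using K by (simp add: C_def)
  have S: "{a<..<b} \<in> sets borel" by simp
  have "(LINT z:Omega|lborel. (g T z)\<^sup>2) \<le> C * (LINT t:{0..T}|lborel. (LINT z:omega a b|lborel. (g t z)\<^sup>2))"
    if s: "is_solution \<gamma> g0 g" for g0 g
  proof -
    let ?q = "\<lambda>n t. Qf n {a<..<b} (g t) (g t)"
    have T0: "T > 0" using T by simp
    have qi: "?q n integrable_on {0..T0}" if "n \<ge> 1" for n
      by (intro integrable_continuous_interval continuous_on_subset[OF solution_bbil_cont(2)[OF bbil_Qf[OF that S] s sqi_zero]]) auto
    have md: "Qf n UNIV (g T) (g T) \<le> C * integral {0..T0} (?q n)" if n: "n \<ge> 1" for n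
    proof -
      define N where "N = real n * pi"
      have N: "N > 0" using n by (simp add: N_def)
      define m where "m = muN \<gamma> N"
      have q0: "0 \<le> integral {0..T0} (?q n)"
        by (intro integral_nonneg qi n) (auto intro!: bbilD(3)[OF bbil_Qf[OF n S]] solution_sqi[OF s])
      have "Qf n UNIV (g T) (g T) \<le> exp (- 2 * m * (T - T0)) * Qf n UNIV (g T0) (g T0)"
        unfolding m_def N_def by (rule mode_decay[OF g n s T])
      also have "\<dots> \<le> exp (- 2 * m * (T - T0)) * (K * ((N + 1) * exp (2 * N))\<^sup>2 * integral {0..T0} (?q n))"
        unfolding N_def by (intro mult_left_mono K(2)[OF n s]) auto
      also have "\<dots> = (K * integral {0..T0} (?q n)) * (exp (- 2 * m * (T - T0)) * ((N + 1) * exp (2 * N))\<^sup>2)" by (simp add: mult_ac)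
      also have "\<dots> \<le> (K * integral {0..T0} (?q n)) * exp E"
      proof (rule mult_left_mono)
        have "N + 1 \<le> exp N" using exp_ge_add_one_self[of N] by linarith
        then have "(N + 1) * exp (2 * N) \<le> exp N * exp (2 * N)" by (intro mult_right_mono) auto
        also have "\<dots> = exp (3 * N)" by (simp flip: exp_add)
        finally have "((N + 1) * exp (2 * N))\<^sup>2 \<le> (exp (3 * N))\<^sup>2" using N by (intro power_mono) auto
        also have "\<dots> = exp (6 * N)" by (simp add: power2_eq_square flip: exp_add)
        finally have "exp (- 2 * m * (T - T0)) * ((N + 1) * exp (2 * N))\<^sup>2 \<le> exp (- 2 * m * (T - T0)) * exp (6 * N)" by (intro mult_left_mono) auto
        also have "\<dots> = exp (6 * N - 2 * m * (T - T0))" by (simp flip: exp_add)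
        also have "\<dots> \<le> exp E" using E[OF n] by (simp add: m_def N_def)
        finally show "exp (- 2 * m * (T - T0)) * ((N + 1) * exp (2 * N))\<^sup>2 \<le> exp E" .
      qed (use K q0 in simp)
      finally show ?thesis by (simp add: C_def mult_ac)
    qed
    have "(\<integral>z. (g T z)\<^sup>2 \<partial>MO) \<le> C * integral {0..T} (\<lambda>t. ipS {a<..<b} (g t) (g t))"
    proof (rule parseval_le)
      obtain h where "A_op \<gamma> (g T) h" using solution_deriv[OF s T0] by blast
      then show "g T \<in> Vspace \<gamma>" by (simp add: A_op_def)
      fix M
      have "(\<Sum>n\<in>{1..M}. Qf n UNIV (g T) (g T)) \<le> (\<Sum>n\<in>{1..M}. C * integral {0..T0} (?q n))" by (intro sum_mono md) simp
      also have "\<dots> = C * integral {0..T0} (\<lambda>t. \<Sum>n\<in>{1..M}. ?q n t)"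
        by (subst Henstock_Kurzweil_Integration.integral_sum) (auto intro!: qi simp: sum_distrib_left)
      also have "\<dots> \<le> C * integral {0..T0} (\<lambda>t. ipS {a<..<b} (g t) (g t))"
      proof (rule mult_left_mono[OF integral_le])
        show "(\<lambda>t. \<Sum>n\<in>{1..M}. ?q n t) integrable_on {0..T0}" by (intro integrable_sum qi) auto
        show "(\<lambda>t. ipS {a<..<b} (g t) (g t)) integrable_on {0..T0}" by (rule observation_cont[OF s])
        show "(\<Sum>n\<in>{1..M}. ?q n t) \<le> ipS {a<..<b} (g t) (g t)" if "t \<in> {0..T0}" for t
          by (rule Qf_bessel[OF S solution_sqi[OF s]]) (use that in auto)
      qed (use C in simp)
      also have "\<dots> \<le> C * integral {0..T} (\<lambda>t. ipS {a<..<b} (g t) (g t))"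
        using C T by (intro mult_left_mono observation_mono[OF s]) auto
      finally show "(\<Sum>n\<in>{1..M}. Qf n UNIV (g T) (g T)) \<le> C * integral {0..T} (\<lambda>t. ipS {a<..<b} (g t) (g t))" .
    qed
    then show ?thesis unfolding time_observation[OF ab s] set_integral_Omega .
  qed
  then show ?thesis unfolding observable_def using C by blast
qed

text \<open>For gamma < 1 the dissipation rate is of order N^(1+theta) with theta =
  (1-gamma)/(1+gamma) > 0, so it beats 6N for large N however short the remaining time T/2
  is.\<close>

lemma observable_subcritical:
  assumes g: "0 < \<gamma>" "\<gamma> < 1" and ab: "0 < a" "a < b" "b < 1" and T: "T > 0"
  shows "observable \<gamma> a b T"
proof -
  define c where "c = (1 / 2 powr \<gamma>) powr (2 / (1 + \<gamma>)) / 4"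
  have c: "c > 0" by (simp add: c_def)
  define \<theta> where "\<theta> = (1 - \<gamma>) / (1 + \<gamma>)"
  have \<theta>: "\<theta> > 0" using g by (simp add: \<theta>_def)
  have mu: "muN \<gamma> N = c * N powr \<theta> * N" if "N > 0" for N
  proof -
    have "muN \<gamma> N = c * N powr (2 / (1 + \<gamma>))" unfolding muN_def c_def using that by (simp add: powr_mult powr_divide field_simps)
    also have "2 / (1 + \<gamma>) = \<theta> + 1" using g by (simp add: \<theta>_def field_simps)
    finally show ?thesis using that by (simp add: powr_add)
  qed
  \<comment> \<open>The point where c T N^theta = 6. Beyond it the exponent is nonpositive, below it
    the crude bound 6N <= 6 N0 suffices.\<close>
  define N0 where "N0 = (6 / (c * T)) powr (1 / \<theta>)"
  have N0: "N0 > 0" using c T by (simp add: N0_def)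
  have p0: "N0 powr \<theta> = 6 / (c * T)" using \<theta> c T by (simp add: N0_def powr_powr)
  have "6 * (real n * pi) - 2 * muN \<gamma> (real n * pi) * (T - T/2) \<le> 6 * N0" if n: "n \<ge> 1" for n :: nat
  proof -
    define N where "N = real n * pi"
    have N: "N > 0" using n by (simp add: N_def)
    have "6 * N - 2 * muN \<gamma> N * (T - T/2) = N * (6 - c * T * N powr \<theta>)" using mu[OF N] by (simp add: algebra_simps)
    also have "\<dots> \<le> 6 * N0"
    proof (cases "N \<le> N0")
      case True
      have "N * (6 - c * T * N powr \<theta>) \<le> N * 6" using N c T by (intro mult_left_mono) auto
      then show ?thesis using True by simp
    next
      case False
      have "N0 powr \<theta> \<le> N powr \<theta>" using False N0 \<theta> by (intro powr_mono2) auto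
      then have "c * T * (6 / (c * T)) \<le> c * T * N powr \<theta>" unfolding p0 using c T by (intro mult_left_mono) auto
      then have "6 - c * T * N powr \<theta> \<le> 0" using c T by simp
      then have "N * (6 - c * T * N powr \<theta>) \<le> 0" using N by (intro mult_nonneg_nonpos) auto
      then show ?thesis using N0 by linarith
    qed
    finally show ?thesis by (simp add: N_def)
  qed
  then show ?thesis by (intro observable_of_dissipation[of \<gamma> a b "T/2" T "6 * N0"]) (use g ab T in auto)
qed

text \<open>At gamma = 1 cost and dissipation are both linear: with \<open>muN\<close> = N/8 and T0
  = 1, the inequality 6N <= (N/4)(T - 1) holds from T = 25 on.\<close>

lemma observable_critical_large:
  assumes ab: "0 < a" "a < b" "b < 1" shows "observable 1 a b 25"
proof (rule observable_of_dissipation[of 1 a b 1 25 0])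
  fix n :: nat assume n: "n \<ge> 1"
  have m: "muN 1 (real n * pi) = real n * pi / 8" unfolding muN_def using n by simp
  show "6 * (real n * pi) - 2 * muN 1 (real n * pi) * (25 - 1) \<le> 0" unfolding m by simp
qed (use ab in auto)

theorem theorem1p2:
  fixes \<gamma> a b :: real
  assumes "\<gamma> > 0" and "0 < a" and "a < b" and "b < 1"
  shows "(\<gamma> < 1 \<longrightarrow> (\<forall>T>0. observable \<gamma> a b T))
       \<and> (\<gamma> = 1 \<longrightarrow> (\<exists>Tstar>0. (\<forall>T>Tstar. observable \<gamma> a b T) \<and>
                                 (\<forall>T. 0 < T \<and> T < Tstar \<longrightarrow> \<not> observable \<gamma> a b T)))
       \<and> (\<gamma> > 1 \<longrightarrow> (\<forall>T>0. \<not> observable \<gamma> a b T))"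
proof (intro conjI impI)
  show "\<forall>T>0. observable \<gamma> a b T" if "\<gamma> < 1" using observable_subcritical assms that by blast
  show "\<forall>T>0. \<not> observable \<gamma> a b T" if "\<gamma> > 1" using not_observable_supercritical assms that by blast
  assume g1: "\<gamma> = 1"
  \<comment> \<open>The critical time is the infimum of X. \<open>not_observable_critical\<close>
    keeps it positive, T = 25 makes X nonempty, and \<open>observable_mono\<close> gives
    observability at every time above it.\<close>
  define X where "X = {T. 0 < T \<and> observable 1 a b T}"
  obtain T0 where T0: "T0 > 0" "\<And>T. 0 < T \<Longrightarrow> T < T0 \<Longrightarrow> \<not> observable 1 a b T"
    using not_observable_critical[OF assms(2-4)] by blast
  have lb: "T0 \<le> T" if "T \<in> X" for T using T0(2)[of T] that by (force simp: X_def)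
  have ne: "X \<noteq> {}" using observable_critical_large[OF assms(2-4)] by (auto simp: X_def intro!: exI[of _ 25])
  have bd: "bdd_below X" using lb by (auto simp: bdd_below_def)
  have "T0 \<le> Inf X" by (rule cInf_greatest[OF ne lb])
  moreover have "observable 1 a b T" if TX: "T > Inf X" for T
  proof -
    obtain T1 where "T1 \<in> X" "T1 < T" using TX cInf_lessD[OF ne] by blast
    then show ?thesis using observable_mono[OF _ assms(2-4), of 1 T1 T] by (auto simp: X_def)
  qed
  moreover have "\<not> observable 1 a b T" if "0 < T" "T < Inf X" for T
    using cInf_lower[OF _ bd, of T] that by (auto simp: X_def)
  ultimately show "\<exists>Tstar>0. (\<forall>T>Tstar. observable \<gamma> a b T) \<and> (\<forall>T. 0 < T \<and> T < Tstar \<longrightarrow> \<not> observable \<gamma> a b T)"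
    using T0(1) g1 by (intro exI[of _ "Inf X"]) auto
qed

end
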